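(* Let $M$ be a four-dimensional manifold with Lorentzian metric $g_{\mu\nu}$ and let $\Sigma_\star\subset M$ be a smooth embedded spacelike hypersurface. Let $\tau_{\mu\nu}$ be a symmetric tensor field on $\Sigma_\star$, tangential to $\Sigma_\star$, let $\lambda$ and $G$ be real constants, and let $T_{\mu\nu}$ be the matter stress-energy tensor. Assume: (i) $g_{\mu\nu}\in C^0(M)\cap C^2(M\setminus\Sigma_\star)$; (ii) the first derivatives of $g_{\mu\nu}$ are piecewise locally bounded (locally bounded on each side of $\Sigma_\star$); (iii) the induced metric on $\Sigma_\star$ is nondegenerate; (iv) $\tau_{\mu\nu}\in L^\infty(\Sigma_\star)$. Then: (a) the Einstein tensor $G_{\mu\nu}$ of $g$ defines a tensor-valued distribution in $\mathcal D'(M)$; (b) the localized term $\delta(\Sigma_\star)\tau_{\mu\nu}$ defines a tensor-valued distribution; (c) the equation $$G_{\mu\nu}+\lambda\,\delta(\Sigma_\star)\tau_{\mu\nu}=8\pi G\,T_{\mu\nu}$$ is well defined in weak form, i.e. as an equation between tensor-valued distributions on $M$.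
   Context: $\delta(\Sigma_\star)$ is the Dirac distribution on $\Sigma_\star$ defined by $\int_M d^4x\,\sqrt{-g}\,\delta(\Sigma_\star)\,\varphi=\int_{\Sigma_\star}d^3y\,\sqrt h\,\varphi(X(y))$ for every smooth compactly supported test function $\varphi$, where $X$ is the embedding of $\Sigma_\star$ and $h$ the induced metric. Derivatives of the metric and of the Christoffel symbols entering the curvature are understood as weak (distributional) derivatives. $T_{\mu\nu}$ is interpreted as a tensor-valued distribution on $M$.
   Formalization: The embedded hypersurface Σ⋆ is assumed to be a closed subset of M, so that M∖Σ⋆ is open; without this (b) fails, e.g. for a spacelike spiral in a flat Lorentzian torus with infinite volume in a compact set. *)

theory Defs
  imports "HOL-Analysis.Analysis"
begin

section \<open>Functions of class $C^k$ on open subsets of Euclidean space\<close>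

definition pd :: "'n::finite \<Rightarrow> (real^'n \<Rightarrow> real) \<Rightarrow> real^'n \<Rightarrow> real" where
  "pd i f x = frechet_derivative f (at x) (axis i 1)"

text \<open>The following two notions are only used for open sets.\<close>

primrec Ck_on :: "nat \<Rightarrow> (real^'n::finite) set \<Rightarrow> (real^'n \<Rightarrow> real) \<Rightarrow> bool" where
  "Ck_on 0 S f \<longleftrightarrow> continuous_on S f"
| "Ck_on (Suc k) S f \<longleftrightarrow> (\<forall>x\<in>S. f differentiable (at x)) \<and> (\<forall>i. Ck_on k S (pd i f))"

definition smooth_on :: "(real^'n::finite) set \<Rightarrow> (real^'n \<Rightarrow> real) \<Rightarrow> bool" where
  "smooth_on S f \<longleftrightarrow> (\<forall>k. Ck_on k S f)"

text \<open>The list \<open>[i1, \<dots>, ik]\<close> stands for the multi-index of the derivative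
  $\partial_{i1} \cdots \partial_{ik}$.\<close>

primrec pds :: "'n::finite list \<Rightarrow> (real^'n \<Rightarrow> real) \<Rightarrow> real^'n \<Rightarrow> real" where
  "pds [] f = f"
| "pds (i # is) f = pd i (pds is f)"


section \<open>Smooth manifolds\<close>

text \<open>A manifold is a whole type \<open>'a\<close>, Hausdorff and second countable by its sorts, together with
  a smooth atlas. The atlas need not be maximal. A chart is its domain with its coordinate map;
  the values of the map outside the domain are irrelevant.\<close>

type_synonym ('a, 'n) chart = "'a set \<times> ('a \<Rightarrow> real^'n)"

abbreviation cdom :: "('a, 'n) chart \<Rightarrow> 'a set" where "cdom c \<equiv> fst c"
abbreviation crd :: "('a, 'n) chart \<Rightarrow> 'a \<Rightarrow> real^'n" where "crd c \<equiv> snd c"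

definition cimg :: "('a, 'n) chart \<Rightarrow> (real^'n) set" where
  "cimg c = crd c ` cdom c"

definition cinv :: "('a, 'n) chart \<Rightarrow> real^'n \<Rightarrow> 'a" where
  "cinv c = inv_into (cdom c) (crd c)"

definition is_chart :: "('a::topological_space, 'n::finite) chart \<Rightarrow> bool" where
  "is_chart c \<longleftrightarrow> open (cdom c) \<and> open (cimg c)
     \<and> homeomorphism (cdom c) (cimg c) (crd c) (cinv c)"

definition smooth_atlas :: "('a::topological_space, 'n::finite) chart set \<Rightarrow> bool" where
  "smooth_atlas A \<longleftrightarrow> (\<forall>c\<in>A. is_chart c) \<and> (\<Union>c\<in>A. cdom c) = UNIV
     \<and> (\<forall>c\<in>A. \<forall>c'\<in>A. \<forall>i.
          smooth_on (crd c ` (cdom c \<inter> cdom c')) (\<lambda>x. crd c' (cinv c x) $ i))"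

text \<open>The matrix $\partial x'^i / \partial x^j$ at a point, where $x$ are the coordinates of \<open>c\<close>
  and $x'$ those of \<open>c'\<close>.\<close>

definition jac :: "('a, 'n::finite) chart \<Rightarrow> ('a, 'n) chart \<Rightarrow> 'a \<Rightarrow> real^'n^'n" where
  "jac c c' p = (\<chi> i j. pd j (\<lambda>x. crd c' (cinv c x) $ i) (crd c p))"

text \<open>A covariant 2-tensor field along \<open>S\<close> is given by its matrix of components \<open>t c p\<close> in each
  chart \<open>c\<close>. On overlaps, $t_{\mu\nu} =
  \partial_\mu x'^\alpha\, \partial_\nu x'^\beta\, t'_{\alpha\beta}$.\<close>

definition cov2_tensor_field ::
    "('a, 'n::finite) chart set \<Rightarrow> 'a set \<Rightarrow> (('a, 'n) chart \<Rightarrow> 'a \<Rightarrow> real^'n^'n) \<Rightarrow> bool" where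
  "cov2_tensor_field A S t \<longleftrightarrow> (\<forall>c\<in>A. \<forall>c'\<in>A. \<forall>p \<in> S \<inter> cdom c \<inter> cdom c'.
      t c p = transpose (jac c c' p) ** t c' p ** jac c c' p)"


section \<open>Test functions and tensor-valued distributions on a manifold\<close>

definition supp :: "('a::topological_space \<Rightarrow> real) \<Rightarrow> 'a set" where
  "supp \<phi> = closure {p. \<phi> p \<noteq> 0}"

definition tests :: "('a::topological_space, 'n::finite) chart set \<Rightarrow> 'a set \<Rightarrow> ('a \<Rightarrow> real) set" where
  "tests A U = {\<phi>. (\<forall>c\<in>A. smooth_on (cimg c) (\<lambda>x. \<phi> (cinv c x))) \<and> compact (supp \<phi>) \<and> supp \<phi> \<subseteq> U}"

text \<open>Distributions on the domain of one chart: linear functionals on the test functions supported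
  there, with the usual seminorm estimates on every compact set. Values of the functional on other
  functions are irrelevant.\<close>

definition chart_distribution ::
    "('a::topological_space, 'n::finite) chart set \<Rightarrow> ('a, 'n) chart \<Rightarrow> (('a \<Rightarrow> real) \<Rightarrow> real) \<Rightarrow> bool" where
  "chart_distribution A c u \<longleftrightarrow>
     (\<forall>\<phi>\<in>tests A (cdom c). \<forall>\<psi>\<in>tests A (cdom c). \<forall>a b.
        u (\<lambda>p. a * \<phi> p + b * \<psi> p) = a * u \<phi> + b * u \<psi>) \<and>
     (\<forall>K. compact K \<and> K \<subseteq> cdom c \<longrightarrow>
        (\<exists>C N. \<forall>\<phi>\<in>tests A K.
           \<bar>u \<phi>\<bar> \<le> C * (\<Sum>is | length is \<le> N. SUP x\<in>cimg c. \<bar>pds is (\<lambda>x. \<phi> (cinv c x)) x\<bar>)))"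

text \<open>A tensor-valued distribution $T_{\mu\nu}$ on the manifold is a family of component
  distributions, one for each chart, which transform as the components of a covariant 2-tensor
  on overlaps. As in the defining formula of the Dirac distribution of a hypersurface, the pairing
  with test functions is the invariant one, formally
  $T_{\mu\nu}[\varphi] = \int d^4x\,\sqrt{-g}\,T_{\mu\nu}\,\varphi$; so the transformation law
  contains no Jacobian determinant.\<close>

type_synonym ('a, 'n) tensor_functional =
  "('a, 'n) chart \<Rightarrow> 'n \<Rightarrow> 'n \<Rightarrow> ('a \<Rightarrow> real) \<Rightarrow> real"

definition tensor_distribution ::
    "('a::topological_space, 'n::finite) chart set \<Rightarrow> ('a, 'n) tensor_functional \<Rightarrow> bool" where
  "tensor_distribution A T \<longleftrightarrow>
     (\<forall>c\<in>A. \<forall>\<mu> \<nu>. chart_distribution A c (T c \<mu> \<nu>)) \<and>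
     (\<forall>c\<in>A. \<forall>c'\<in>A. \<forall>\<phi>\<in>tests A (cdom c \<inter> cdom c'). \<forall>\<mu> \<nu>.
        T c \<mu> \<nu> \<phi> =
          (\<Sum>\<alpha>\<in>UNIV. \<Sum>\<beta>\<in>UNIV. T c' \<alpha> \<beta> (\<lambda>p. jac c c' p $ \<alpha> $ \<mu> * jac c c' p $ \<beta> $ \<nu> * \<phi> p)))"


section \<open>Weak derivatives in coordinates\<close>

definition locally_integrable :: "(real^'n::finite) set \<Rightarrow> (real^'n \<Rightarrow> real) \<Rightarrow> bool" where
  "locally_integrable \<Omega> f \<longleftrightarrow> (\<forall>K. compact K \<and> K \<subseteq> \<Omega> \<longrightarrow> set_integrable lebesgue K f)"

definition has_weak_pd ::
    "(real^'n::finite) set \<Rightarrow> 'n \<Rightarrow> (real^'n \<Rightarrow> real) \<Rightarrow> (real^'n \<Rightarrow> real) \<Rightarrow> bool" where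
  "has_weak_pd \<Omega> i f f' \<longleftrightarrow> locally_integrable \<Omega> f \<and> locally_integrable \<Omega> f' \<and>
     (\<forall>\<phi>. smooth_on UNIV \<phi> \<and> compact (supp \<phi>) \<and> supp \<phi> \<subseteq> \<Omega> \<longrightarrow>
        (LINT x:\<Omega>|lebesgue. f x * pd i \<phi> x) = - (LINT x:\<Omega>|lebesgue. f' x * \<phi> x))"

text \<open>A representative of the weak derivative, which is unique up to null sets.\<close>

definition weak_pd :: "(real^'n::finite) set \<Rightarrow> 'n \<Rightarrow> (real^'n \<Rightarrow> real) \<Rightarrow> real^'n \<Rightarrow> real" where
  "weak_pd \<Omega> i f = (SOME f'. has_weak_pd \<Omega> i f f')"

text \<open>Functionals on an open set of coordinates, with pairing $\int d^nx$: the one given by a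
  function, the distributional derivative $\partial_i u$ of a function $u$, and the product with a
  function. The functional $\partial_i u$ is evaluated also on weakly differentiable $\psi$. This
  is what gives sense to the product of $\partial_i u$, for locally bounded $u$, with a function
  that is not smooth but has locally bounded weak derivatives.\<close>

definition fn_dist ::
    "(real^'n::finite) set \<Rightarrow> (real^'n \<Rightarrow> real) \<Rightarrow> (real^'n \<Rightarrow> real) \<Rightarrow> real" where
  "fn_dist \<Omega> u \<psi> = (LINT x:\<Omega>|lebesgue. u x * \<psi> x)"

definition pd_dist ::
    "(real^'n::finite) set \<Rightarrow> 'n \<Rightarrow> (real^'n \<Rightarrow> real) \<Rightarrow> (real^'n \<Rightarrow> real) \<Rightarrow> real" where
  "pd_dist \<Omega> i u \<psi> = - (LINT x:\<Omega>|lebesgue. u x * weak_pd \<Omega> i \<psi> x)"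

definition mult_dist :: "('b \<Rightarrow> real) \<Rightarrow> (('b \<Rightarrow> real) \<Rightarrow> real) \<Rightarrow> ('b \<Rightarrow> real) \<Rightarrow> real" where
  "mult_dist a u \<psi> = u (\<lambda>x. a x * \<psi> x)"


section \<open>Distributional curvature in coordinates\<close>

context
  fixes \<Omega> :: "(real^4) set" and G :: "real^4 \<Rightarrow> real^4^4"
begin

definition christoffel :: "4 \<Rightarrow> 4 \<Rightarrow> 4 \<Rightarrow> real^4 \<Rightarrow> real" where
  "christoffel \<alpha> \<mu> \<nu> x = (1/2) * (\<Sum>\<beta>\<in>UNIV. matrix_inv (G x) $ \<alpha> $ \<beta> *
     (weak_pd \<Omega> \<mu> (\<lambda>x. G x $ \<beta> $ \<nu>) x + weak_pd \<Omega> \<nu> (\<lambda>x. G x $ \<beta> $ \<mu>) x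
      - weak_pd \<Omega> \<beta> (\<lambda>x. G x $ \<mu> $ \<nu>) x))"

text \<open>$R^\rho{}_{\sigma\mu\nu} = \partial_\mu \Gamma^\rho_{\nu\sigma}
  - \partial_\nu \Gamma^\rho_{\mu\sigma} + \Gamma^\rho_{\mu\lambda} \Gamma^\lambda_{\nu\sigma}
  - \Gamma^\rho_{\nu\lambda} \Gamma^\lambda_{\mu\sigma}$ and
  $R_{\mu\nu} = R^\rho{}_{\mu\rho\nu}$.\<close>

definition riemann_dist :: "4 \<Rightarrow> 4 \<Rightarrow> 4 \<Rightarrow> 4 \<Rightarrow> (real^4 \<Rightarrow> real) \<Rightarrow> real" where
  "riemann_dist \<rho> \<sigma> \<mu> \<nu> \<psi> =
     pd_dist \<Omega> \<mu> (christoffel \<rho> \<nu> \<sigma>) \<psi> - pd_dist \<Omega> \<nu> (christoffel \<rho> \<mu> \<sigma>) \<psi>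
     + fn_dist \<Omega> (\<lambda>x. \<Sum>l\<in>UNIV. christoffel \<rho> \<mu> l x * christoffel l \<nu> \<sigma> x
                          - christoffel \<rho> \<nu> l x * christoffel l \<mu> \<sigma> x) \<psi>"

definition ricci_dist :: "4 \<Rightarrow> 4 \<Rightarrow> (real^4 \<Rightarrow> real) \<Rightarrow> real" where
  "ricci_dist \<mu> \<nu> \<psi> = (\<Sum>\<rho>\<in>UNIV. riemann_dist \<rho> \<mu> \<rho> \<nu> \<psi>)"

definition scalar_curvature_dist :: "(real^4 \<Rightarrow> real) \<Rightarrow> real" where
  "scalar_curvature_dist \<psi> = (\<Sum>\<alpha>\<in>UNIV. \<Sum>\<beta>\<in>UNIV.
     mult_dist (\<lambda>x. matrix_inv (G x) $ \<alpha> $ \<beta>) (ricci_dist \<alpha> \<beta>) \<psi>)"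

definition einstein_dist :: "4 \<Rightarrow> 4 \<Rightarrow> (real^4 \<Rightarrow> real) \<Rightarrow> real" where
  "einstein_dist \<mu> \<nu> \<psi> =
     ricci_dist \<mu> \<nu> \<psi> - (1/2) * mult_dist (\<lambda>x. G x $ \<mu> $ \<nu>) scalar_curvature_dist \<psi>"

text \<open>Weak derivatives and Lebesgue integrals are total in HOL. The next two predicates say that
  those which occur in \<open>riemann_dist\<close> and \<open>einstein_dist\<close> on the argument \<open>\<psi>\<close> really exist.\<close>

definition curvature_defined_on :: "(real^4 \<Rightarrow> real) \<Rightarrow> bool" where
  "curvature_defined_on \<psi> \<longleftrightarrow>
     (\<forall>i. \<exists>\<psi>'. has_weak_pd \<Omega> i \<psi> \<psi>') \<and>
     (\<forall>i \<rho> \<mu> \<nu>. set_integrable lebesgue \<Omega> (\<lambda>x. christoffel \<rho> \<mu> \<nu> x * weak_pd \<Omega> i \<psi> x)) \<and>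
     (\<forall>\<rho> \<mu> \<nu> \<rho>' \<mu>' \<nu>'. set_integrable lebesgue \<Omega>
        (\<lambda>x. christoffel \<rho> \<mu> \<nu> x * christoffel \<rho>' \<mu>' \<nu>' x * \<psi> x))"

definition einstein_defined_on :: "(real^4 \<Rightarrow> real) \<Rightarrow> bool" where
  "einstein_defined_on \<psi> \<longleftrightarrow>
     (\<forall>i \<mu> \<nu>. \<exists>d. has_weak_pd \<Omega> i (\<lambda>x. G x $ \<mu> $ \<nu>) d) \<and>
     curvature_defined_on \<psi> \<and>
     (\<forall>\<alpha> \<beta> \<mu> \<nu>. curvature_defined_on (\<lambda>x. matrix_inv (G x) $ \<alpha> $ \<beta> * (G x $ \<mu> $ \<nu> * \<psi> x)))"

end


section \<open>Lorentzian metrics and the Einstein tensor on a manifold\<close>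

definition minkowski :: "real^4^4" where
  "minkowski = (\<chi> i j. if i \<noteq> j then 0 else if i = 0 then -1 else 1)"

definition lorentzian :: "real^4^4 \<Rightarrow> bool" where
  "lorentzian g \<longleftrightarrow> (\<exists>P. invertible P \<and> transpose P ** g ** P = minkowski)"

definition lorentzian_metric ::
    "('a, 4) chart set \<Rightarrow> (('a, 4) chart \<Rightarrow> 'a \<Rightarrow> real^4^4) \<Rightarrow> bool" where
  "lorentzian_metric A g \<longleftrightarrow> cov2_tensor_field A UNIV g \<and> (\<forall>c\<in>A. \<forall>p\<in>cdom c. lorentzian (g c p))"

definition metric_coords ::
    "(('a, 4) chart \<Rightarrow> 'a \<Rightarrow> real^4^4) \<Rightarrow> ('a, 4) chart \<Rightarrow> real^4 \<Rightarrow> real^4^4" where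
  "metric_coords g c x = g c (cinv c x)"

text \<open>The coordinate expression of $\sqrt{-g}\,\varphi$, which turns the pairing $\int d^4x$ into
  the invariant one.\<close>

definition density_test ::
    "(('a, 4) chart \<Rightarrow> 'a \<Rightarrow> real^4^4) \<Rightarrow> ('a, 4) chart \<Rightarrow> ('a \<Rightarrow> real) \<Rightarrow> real^4 \<Rightarrow> real" where
  "density_test g c \<phi> x = sqrt (- det (metric_coords g c x)) * \<phi> (cinv c x)"

definition einstein_tensor ::
    "(('a, 4) chart \<Rightarrow> 'a \<Rightarrow> real^4^4) \<Rightarrow> ('a, 4) tensor_functional" where
  "einstein_tensor g c \<mu> \<nu> \<phi> =
     einstein_dist (cimg c) (metric_coords g c) \<mu> \<nu> (density_test g c \<phi>)"

definition metric_C0_C2_off ::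
    "('a, 4) chart set \<Rightarrow> 'a set \<Rightarrow> (('a, 4) chart \<Rightarrow> 'a \<Rightarrow> real^4^4) \<Rightarrow> bool" where
  "metric_C0_C2_off A S g \<longleftrightarrow> (\<forall>c\<in>A. \<forall>\<mu> \<nu>.
     Ck_on 0 (cimg c) (\<lambda>x. metric_coords g c x $ \<mu> $ \<nu>) \<and>
     Ck_on 2 (crd c ` (cdom c - S)) (\<lambda>x. metric_coords g c x $ \<mu> $ \<nu>))"

text \<open>Near a point of a hypersurface \<open>S\<close>, the set \<open>V - S\<close> is the union of the two sides, so a bound
  on \<open>V - S\<close> is the same as one bound on each side.\<close>

definition metric_derivs_locally_bounded_off ::
    "('a::topological_space, 4) chart set \<Rightarrow> 'a set \<Rightarrow> (('a, 4) chart \<Rightarrow> 'a \<Rightarrow> real^4^4) \<Rightarrow> bool" where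
  "metric_derivs_locally_bounded_off A S g \<longleftrightarrow> (\<forall>c\<in>A. \<forall>p\<in>cdom c.
     \<exists>V C. open V \<and> p \<in> V \<and> V \<subseteq> cdom c \<and>
       (\<forall>q\<in>V - S. \<forall>i \<mu> \<nu>. \<bar>pd i (\<lambda>x. metric_coords g c x $ \<mu> $ \<nu>) (crd c q)\<bar> \<le> C))"


section \<open>Embedded hypersurfaces\<close>

text \<open>The matrix $\partial X^\mu / \partial y^i$ of a map \<open>X\<close> in the coordinates \<open>d\<close> of its source
  and \<open>c\<close> of its target.\<close>

definition dmap ::
    "('b \<Rightarrow> 'a) \<Rightarrow> ('a, 'm) chart \<Rightarrow> ('b, 'n::finite) chart \<Rightarrow> 'b \<Rightarrow> real^'n^'m::finite" where
  "dmap X c d y = (\<chi> \<mu> i. pd i (\<lambda>u. crd c (X (cinv d u)) $ \<mu>) (crd d y))"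

text \<open>The image of the embedding is required to be closed, so that its complement is an open
  submanifold and compact subsets of the target meet it in compact sets.\<close>

definition embedded_hypersurface ::
    "('a::topological_space, 4) chart set \<Rightarrow> ('b::topological_space, 3) chart set \<Rightarrow> ('b \<Rightarrow> 'a) \<Rightarrow> bool" where
  "embedded_hypersurface A B X \<longleftrightarrow>
     homeomorphism UNIV (range X) X (inv X) \<and> closed (range X) \<and>
     (\<forall>c\<in>A. \<forall>d\<in>B. \<forall>\<mu>.
        smooth_on (crd d ` (cdom d \<inter> X -` cdom c)) (\<lambda>u. crd c (X (cinv d u)) $ \<mu>)) \<and>
     (\<forall>c\<in>A. \<forall>d\<in>B. \<forall>y \<in> cdom d \<inter> X -` cdom c. inj (\<lambda>w. dmap X c d y *v w))"

definition bform :: "real^'n^'n \<Rightarrow> real^'n \<Rightarrow> real^'n \<Rightarrow> real" where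
  "bform M u v = u \<bullet> (M *v v)"

text \<open>Any chart of the ambient manifold around \<open>X y\<close> gives the same induced metric.\<close>

definition induced_metric ::
    "('a, 4) chart set \<Rightarrow> (('a, 4) chart \<Rightarrow> 'a \<Rightarrow> real^4^4) \<Rightarrow> ('b \<Rightarrow> 'a) \<Rightarrow>
     ('b, 3) chart \<Rightarrow> 'b \<Rightarrow> real^3^3" where
  "induced_metric A g X d y =
     (let c = (SOME c. c \<in> A \<and> X y \<in> cdom c)
      in transpose (dmap X c d y) ** g c (X y) ** dmap X c d y)"

definition spacelike ::
    "('a, 4) chart set \<Rightarrow> ('b, 3) chart set \<Rightarrow> (('a, 4) chart \<Rightarrow> 'a \<Rightarrow> real^4^4) \<Rightarrow> ('b \<Rightarrow> 'a) \<Rightarrow> bool" where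
  "spacelike A B g X \<longleftrightarrow>
     (\<forall>d\<in>B. \<forall>y\<in>cdom d. \<forall>w. w \<noteq> 0 \<longrightarrow> bform (induced_metric A g X d y) w w > 0)"

definition induced_metric_nondegenerate ::
    "('a, 4) chart set \<Rightarrow> ('b, 3) chart set \<Rightarrow> (('a, 4) chart \<Rightarrow> 'a \<Rightarrow> real^4^4) \<Rightarrow> ('b \<Rightarrow> 'a) \<Rightarrow> bool" where
  "induced_metric_nondegenerate A B g X \<longleftrightarrow>
     (\<forall>d\<in>B. \<forall>y\<in>cdom d. det (induced_metric A g X d y) \<noteq> 0)"

text \<open>The measure $d^3y\,\sqrt h$ on the hypersurface: the unique Borel measure with the usual
  coordinate expression in every chart.\<close>

definition induced_volume ::
    "('a, 4) chart set \<Rightarrow> ('b::topological_space, 3) chart set \<Rightarrow>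
     (('a, 4) chart \<Rightarrow> 'a \<Rightarrow> real^4^4) \<Rightarrow> ('b \<Rightarrow> 'a) \<Rightarrow> 'b measure" where
  "induced_volume A B g X = (THE m. sets m = sets borel \<and>
     (\<forall>d\<in>B. \<forall>S\<in>sets borel. S \<subseteq> cdom d \<longrightarrow>
        emeasure m S =
          (\<integral>\<^sup>+ u \<in> crd d ` S. ennreal (sqrt (det (induced_metric A g X d (cinv d u)))) \<partial>lborel)))"

definition delta_dist ::
    "('a, 4) chart set \<Rightarrow> ('b::topological_space, 3) chart set \<Rightarrow>
     (('a, 4) chart \<Rightarrow> 'a \<Rightarrow> real^4^4) \<Rightarrow> ('b \<Rightarrow> 'a) \<Rightarrow> ('a \<Rightarrow> real) \<Rightarrow> real" where
  "delta_dist A B g X \<phi> = (LINT y|induced_volume A B g X. \<phi> (X y))"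

definition delta_tensor ::
    "('a, 4) chart set \<Rightarrow> ('b::topological_space, 3) chart set \<Rightarrow>
     (('a, 4) chart \<Rightarrow> 'a \<Rightarrow> real^4^4) \<Rightarrow> ('b \<Rightarrow> 'a) \<Rightarrow>
     (('a, 4) chart \<Rightarrow> 'a \<Rightarrow> real^4^4) \<Rightarrow> ('a, 4) tensor_functional" where
  "delta_tensor A B g X \<tau> c \<mu> \<nu> \<phi> = mult_dist (\<lambda>p. \<tau> c p $ \<mu> $ \<nu>) (delta_dist A B g X) \<phi>"

text \<open>A covariant tensor along the hypersurface is tangential if it annihilates the normal
  vectors.\<close>

definition tangential ::
    "('a, 4) chart set \<Rightarrow> ('b, 3) chart set \<Rightarrow> (('a, 4) chart \<Rightarrow> 'a \<Rightarrow> real^4^4) \<Rightarrow> ('b \<Rightarrow> 'a) \<Rightarrow>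
     (('a, 4) chart \<Rightarrow> 'a \<Rightarrow> real^4^4) \<Rightarrow> bool" where
  "tangential A B g X \<tau> \<longleftrightarrow> (\<forall>c\<in>A. \<forall>d\<in>B. \<forall>y \<in> cdom d \<inter> X -` cdom c. \<forall>n.
     (\<forall>w. bform (g c (X y)) n (dmap X c d y *v w) = 0) \<longrightarrow>
     \<tau> c (X y) *v n = 0 \<and> n v* \<tau> c (X y) = 0)"

text \<open>$\tau \in L^\infty$: measurable, and essentially bounded in the pointwise norm given by the
  induced metric $h$, i.e. $|\tau(u,v)| \le C\,|u|_h\,|v|_h$ for tangent vectors $u$, $v$. For a
  tangential tensor these values determine all components.\<close>

definition Linfty_tensor ::
    "('a, 4) chart set \<Rightarrow> ('b::topological_space, 3) chart set \<Rightarrow>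
     (('a, 4) chart \<Rightarrow> 'a \<Rightarrow> real^4^4) \<Rightarrow> ('b \<Rightarrow> 'a) \<Rightarrow>
     (('a, 4) chart \<Rightarrow> 'a \<Rightarrow> real^4^4) \<Rightarrow> bool" where
  "Linfty_tensor A B g X \<tau> \<longleftrightarrow>
     (\<forall>c\<in>A. \<forall>\<mu> \<nu>. set_borel_measurable borel (X -` cdom c) (\<lambda>y. \<tau> c (X y) $ \<mu> $ \<nu>)) \<and>
     (\<exists>C. \<forall>c\<in>A. \<forall>d\<in>B. AE y in induced_volume A B g X. y \<in> cdom d \<inter> X -` cdom c \<longrightarrow>
        (\<forall>u v. \<bar>bform (\<tau> c (X y)) (dmap X c d y *v u) (dmap X c d y *v v)\<bar>
           \<le> C * sqrt (bform (induced_metric A g X d y) u u)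
               * sqrt (bform (induced_metric A g X d y) v v)))"


section \<open>The field equation $G_{\mu\nu} + \lambda\,\delta(\Sigma)\,\tau_{\mu\nu} = 8\pi G\,T_{\mu\nu}$ in weak form\<close>

definition field_lhs ::
    "('a, 4) chart set \<Rightarrow> ('b::topological_space, 3) chart set \<Rightarrow>
     (('a, 4) chart \<Rightarrow> 'a \<Rightarrow> real^4^4) \<Rightarrow> ('b \<Rightarrow> 'a) \<Rightarrow>
     (('a, 4) chart \<Rightarrow> 'a \<Rightarrow> real^4^4) \<Rightarrow> real \<Rightarrow> ('a, 4) tensor_functional" where
  "field_lhs A B g X \<tau> lam c \<mu> \<nu> \<phi> =
     einstein_tensor g c \<mu> \<nu> \<phi> + lam * delta_tensor A B g X \<tau> c \<mu> \<nu> \<phi>"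

definition field_rhs :: "real \<Rightarrow> ('a, 4) tensor_functional \<Rightarrow> ('a, 4) tensor_functional" where
  "field_rhs GN T c \<mu> \<nu> \<phi> = 8 * pi * GN * T c \<mu> \<nu> \<phi>"

text \<open>Equality of two tensor-valued distributions on an open part \<open>W\<close> of the domain of \<open>c\<close>, tested
  against the components in \<open>c\<close>.\<close>

definition weak_equation_on ::
    "('a::topological_space, 'n::finite) chart set \<Rightarrow> ('a, 'n) tensor_functional \<Rightarrow>
     ('a, 'n) tensor_functional \<Rightarrow> ('a, 'n) chart \<Rightarrow> 'a set \<Rightarrow> bool" where
  "weak_equation_on A S T c W \<longleftrightarrow> (\<forall>\<phi>\<in>tests A W. \<forall>\<mu> \<nu>. S c \<mu> \<nu> \<phi> = T c \<mu> \<nu> \<phi>)"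

end

theory Submission
  imports Defs
begin

text \<open>In a chart, the hypersurface is near each of its points contained in a Lipschitz graph over a
  hyperplane, so every segment whose direction is close to the normal of this hyperplane crosses it
  at most once. As two nearby points are joined by two such segments of comparable length, a
  continuous function with bounded derivatives off the hypersurface is locally Lipschitz. Hence the
  metric and its inverse are locally Lipschitz, their weak derivatives are the classical ones almost
  everywhere, and the Christoffel symbols are locally bounded. The Einstein functional then has
  the form $\int (a \psi + b^i \partial_i \psi)$ with locally bounded $a$, $b^i$ for all
  compactly supported Lipschitz $\psi$, which gives existence, linearity and the seminorm estimates.

  For the transformation law, contract the Riemann functional with the Jacobian matrix $J$ and
  change variables. By the almost everywhere transformation law of the Christoffel symbols and the
  Piola identity, the integrands of the two sides differ by
  $\partial_m J^a_s \partial_n \psi - \partial_n J^a_s \partial_m \psi$, whose integral vanishes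
  because the partial derivatives of $J$ commute. Contracting gives the Ricci, scalar and Einstein
  functionals.

  For the Dirac term, the densities $\sqrt h$ of the charts of the hypersurface glue to a locally
  finite Borel measure, and a tangential tensor has components which are bounded, locally, in terms
  of its pointwise norm.\<close>

section \<open>Partial derivatives and functions of class $C^k$\<close>

text \<open>The curvature contains derivatives of Christoffel symbols that are only bounded, and it
  is multiplied by the inverse metric, by the metric and by the density sqrt(-det g), which are only
  Lipschitz across the hypersurface. Such a product makes sense only if the functional can be
  evaluated on Lipschitz arguments, so every functional is studied on compactly supported Lipschitz
  functions, and smooth test functions are a special case. All functions of one chart are
  differentiable off one common null set, the coordinate image of the hypersurface, so product and
  chain rules hold at the same points for all of them, without an appeal to Rademacher's theorem.
  These null sets correspond to each other under coordinate changes. As the curvature is not a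
  function, its transformation law and its contractions cannot be read off pointwise: the Jacobian
  and its inverse have to be moved through the argument of the functional, and a contraction becomes
  linearity in that argument. The density in the argument absorbs the determinant which the change
  of variables produces.\<close>

lemma pd_eq:
  assumes "(f has_derivative f') (at x)"
  shows "pd i f x = f' (axis i 1)"
  unfolding pd_def using frechet_derivative_at[OF assms] by simp

lemma sum_axis: "(\<Sum>i\<in>UNIV. axis k 1 $ i * c i) = (c k :: real)"
proof -
  have "(\<Sum>i\<in>UNIV. axis k 1 $ i * c i) = (\<Sum>i\<in>UNIV. if i = k then c i else 0)"
    by (intro sum.cong) (auto simp: axis_def)
  then show ?thesis by simp
qed

lemma has_derivative_pd:
  fixes f :: "real^'n::finite \<Rightarrow> real"
  assumes "f differentiable (at x)"
  shows "(f has_derivative (\<lambda>v. \<Sum>i\<in>UNIV. v $ i * pd i f x)) (at x)"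
proof -
  let ?D = "frechet_derivative f (at x)"
  have d: "(f has_derivative ?D) (at x)"
    using assms frechet_derivative_works by blast
  then have lin: "linear ?D" using has_derivative_linear by blast
  have "?D v = (\<Sum>i\<in>UNIV. v $ i * pd i f x)" for v
  proof -
    have "?D v = ?D (\<Sum>i\<in>UNIV. v $ i *s axis i 1)" by (simp add: basis_expansion)
    also have "\<dots> = (\<Sum>i\<in>UNIV. v $ i * pd i f x)"
      by (simp add: linear_sum[OF lin] linear_cmul[OF lin] scalar_mult_eq_scaleR pd_def)
    finally show ?thesis .
  qed
  then have "?D = (\<lambda>v. \<Sum>i\<in>UNIV. v $ i * pd i f x)" by blast
  then show ?thesis using d by simp
qed

text \<open>\<open>frechet_derivative\<close> is a choice among the derivatives at the point.
  Functions that agree near the point have the same candidates, so the equality also covers points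
  where no derivative exists.\<close>

lemma pd_cong:
  assumes "open U" "x \<in> U" "\<And>y. y \<in> U \<Longrightarrow> f y = g y"
  shows "pd i f x = pd i g x"
proof -
  have e: "(f has_derivative D) (at x) \<longleftrightarrow> (g has_derivative D) (at x)" for D
    using has_derivative_transform_within_open[of f D x UNIV U g]
      has_derivative_transform_within_open[of g D x UNIV U f] assms by auto
  show ?thesis unfolding pd_def frechet_derivative_def by (simp only: e)
qed

lemma differentiable_cong:
  assumes "open U" "x \<in> U" "\<And>y. y \<in> U \<Longrightarrow> f y = g y" "f differentiable (at x)"
  shows "g differentiable (at x)"
  using assms has_derivative_transform_within_open[of f _ x UNIV U g]
  unfolding differentiable_def by metis

lemma pd_const [simp]: "pd i (\<lambda>_. c) x = 0"
  by (subst pd_eq[where f' = "\<lambda>_. 0"]) auto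

lemma pd_coord: "pd i (\<lambda>x. x $ j) x = (if i = j then 1 else 0)"
  by (subst pd_eq[where f' = "\<lambda>v. v $ j"])
     (auto intro!: bounded_linear_imp_has_derivative bounded_linear_vec_nth simp: axis_def)

lemma pd_add:
  assumes "f differentiable (at x)" "g differentiable (at x)"
  shows "pd i (\<lambda>x. f x + g x) x = pd i f x + pd i g x"
  by (subst pd_eq[OF has_derivative_add[OF has_derivative_pd[OF assms(1)] has_derivative_pd[OF assms(2)]]])
     (simp add: sum_axis)

lemma pd_diff:
  assumes "f differentiable (at x)" "g differentiable (at x)"
  shows "pd i (\<lambda>x. f x - g x) x = pd i f x - pd i g x"
  by (subst pd_eq[OF has_derivative_diff[OF has_derivative_pd[OF assms(1)] has_derivative_pd[OF assms(2)]]])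
     (simp add: sum_axis)

lemma pd_mult:
  fixes f g :: "real^'n::finite \<Rightarrow> real"
  assumes "f differentiable (at x)" "g differentiable (at x)"
  shows "pd i (\<lambda>x. f x * g x) x = pd i f x * g x + f x * pd i g x"
  by (subst pd_eq[OF has_derivative_mult[OF has_derivative_pd[OF assms(1)] has_derivative_pd[OF assms(2)]]])
     (simp add: sum_axis)

lemma pd_cmult:
  fixes f :: "real^'n::finite \<Rightarrow> real"
  assumes "f differentiable (at x)"
  shows "pd i (\<lambda>x. c * f x) x = c * pd i f x"
  using pd_mult[of "\<lambda>_. c", OF _ assms] by simp

lemma pd_sum:
  assumes "\<And>a. a \<in> I \<Longrightarrow> f a differentiable (at x)"
  shows "pd i (\<lambda>x. \<Sum>a\<in>I. f a x) x = (\<Sum>a\<in>I. pd i (f a) x)"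
  by (subst pd_eq[OF has_derivative_sum[OF has_derivative_pd[OF assms]]])
     (auto simp: sum_axis)

lemma differentiable_vec:
  fixes h :: "real^'n::finite \<Rightarrow> real^'m::finite"
  assumes "\<And>j. (\<lambda>x. h x $ j) differentiable (at x)"
  shows "(h has_derivative (\<lambda>v. \<chi> j. \<Sum>i\<in>UNIV. v $ i * pd i (\<lambda>x. h x $ j) x)) (at x)"
proof -
  have "\<forall>b\<in>Basis. ((\<lambda>x. h x \<bullet> b) has_derivative
      (\<lambda>v. (\<chi> j. \<Sum>i\<in>UNIV. v $ i * pd i (\<lambda>x. h x $ j) x) \<bullet> b)) (at x)"
    using has_derivative_pd[OF assms] by (auto simp: Basis_vec_def inner_axis)
  then show ?thesis
    using has_derivative_componentwise_within[of h _ x UNIV] by blast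
qed

lemma has_derivative_compose_pd:
  fixes h :: "real^'n::finite \<Rightarrow> real^'m::finite" and f :: "real^'m \<Rightarrow> real"
  assumes "\<And>j. (\<lambda>x. h x $ j) differentiable (at x)" "f differentiable (at (h x))"
  shows "((\<lambda>x. f (h x)) has_derivative (\<lambda>v. \<Sum>j\<in>UNIV. (\<Sum>i\<in>UNIV. v $ i * pd i (\<lambda>x. h x $ j) x) * pd j f (h x))) (at x)"
  using has_derivative_compose[OF differentiable_vec[OF assms(1)] has_derivative_pd[OF assms(2)]]
  by simp

lemma differentiable_compose_pd:
  fixes h :: "real^'n::finite \<Rightarrow> real^'m::finite" and f :: "real^'m \<Rightarrow> real"
  assumes "\<And>j. (\<lambda>x. h x $ j) differentiable (at x)" "f differentiable (at (h x))"
  shows "(\<lambda>x. f (h x)) differentiable (at x)"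
  using has_derivative_compose_pd[OF assms] unfolding differentiable_def by blast

lemma pd_compose:
  fixes h :: "real^'n::finite \<Rightarrow> real^'m::finite" and f :: "real^'m \<Rightarrow> real"
  assumes "\<And>j. (\<lambda>x. h x $ j) differentiable (at x)" "f differentiable (at (h x))"
  shows "pd i (\<lambda>x. f (h x)) x = (\<Sum>j\<in>UNIV. pd i (\<lambda>x. h x $ j) x * pd j f (h x))"
  by (subst pd_eq[OF has_derivative_compose_pd[OF assms]])
     (auto simp: sum_axis)

lemma pd_compose_real:
  fixes f :: "real^'n::finite \<Rightarrow> real"
  assumes "f differentiable (at x)" "(F has_real_derivative F') (at (f x))"
  shows "pd i (\<lambda>x. F (f x)) x = F' * pd i f x" "(\<lambda>x. F (f x)) differentiable (at x)"
proof -
  have d: "((\<lambda>x. F (f x)) has_derivative (\<lambda>v. F' * (\<Sum>i\<in>UNIV. v $ i * pd i f x))) (at x)"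
    using has_derivative_compose[OF has_derivative_pd[OF assms(1)]] assms(2)
    unfolding has_field_derivative_def by blast
  show "pd i (\<lambda>x. F (f x)) x = F' * pd i f x"
    by (subst pd_eq[OF d]) (auto simp: sum_axis)
  show "(\<lambda>x. F (f x)) differentiable (at x)"
    using d unfolding differentiable_def by blast
qed

section \<open>Closure properties of the classes C^k\<close>

lemma Ck_on_subset: "Ck_on k S f \<Longrightarrow> T \<subseteq> S \<Longrightarrow> Ck_on k T f"
  by (induction k arbitrary: f) (auto intro: continuous_on_subset)

lemma Ck_on_SucD: "Ck_on (Suc k) S f \<Longrightarrow> Ck_on k S f"
proof (induction k arbitrary: f)
  case 0
  then have "\<And>x. x \<in> S \<Longrightarrow> isCont f x" by (auto intro: differentiable_imp_continuous_within)
  then show ?case by (simp add: continuous_at_imp_continuous_on)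
next
  case (Suc k)
  have "\<And>i. Ck_on (Suc k) S (pd i f)" using Suc.prems by simp
  then have "\<And>i. Ck_on k S (pd i f)" by (rule Suc.IH)
  then show ?case using Suc.prems by simp
qed

lemma Ck_on_cong:
  assumes "open S" "\<And>x. x \<in> S \<Longrightarrow> f x = g x" "Ck_on k S f"
  shows "Ck_on k S g"
  using assms(2,3)
proof (induction k arbitrary: f g)
  case 0
  then show ?case by (simp cong: continuous_on_cong)
next
  case (Suc k)
  have "g differentiable (at x)" if "x \<in> S" for x
    using differentiable_cong[OF assms(1) that Suc.prems(1)] Suc.prems(2) that by auto
  moreover have "Ck_on k S (pd i g)" for i
    using Suc.IH[of "pd i f" "pd i g"] pd_cong[OF assms(1) _ Suc.prems(1)] Suc.prems(2) by auto
  ultimately show ?case by simp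
qed

lemma Ck_on_local:
  assumes "\<And>x. x \<in> S \<Longrightarrow> \<exists>U. open U \<and> x \<in> U \<and> Ck_on k U f"
  shows "Ck_on k S f"
  using assms
proof (induction k arbitrary: f)
  case 0
  have "isCont f x" if "x \<in> S" for x
    using 0[OF that] by (auto simp: continuous_on_eq_continuous_at)
  then show ?case by (simp add: continuous_at_imp_continuous_on)
next
  case (Suc k)
  then have "f differentiable (at x)" if "x \<in> S" for x
    using that by fastforce
  moreover have "Ck_on k S (pd i f)" for i
    by (rule Suc.IH) (use Suc.prems in fastforce)
  ultimately show ?case by simp
qed

lemma Ck_on_const [simp]: "Ck_on k S (\<lambda>_. c)"
proof (induction k arbitrary: c)
  case (Suc k)
  have "pd i (\<lambda>_. c) = (\<lambda>_. 0)" for i :: 'a by auto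
  then show ?case using Suc by simp
qed simp

lemma Ck_on_add:
  assumes "open S" "Ck_on k S f" "Ck_on k S g"
  shows "Ck_on k S (\<lambda>x. f x + g x)"
  using assms(2,3)
proof (induction k arbitrary: f g)
  case (Suc k)
  have "Ck_on k S (pd i (\<lambda>x. f x + g x))" for i
    by (rule Ck_on_cong[OF assms(1) _ Suc.IH[of "pd i f" "pd i g"]])
       (use Suc.prems in \<open>auto simp: pd_add\<close>)
  then show ?case using Suc.prems by auto
qed (auto intro: continuous_intros)

lemma Ck_on_mult:
  assumes "open S" "Ck_on k S f" "Ck_on k S g"
  shows "Ck_on k S (\<lambda>x. f x * g x)"
  using assms(2,3)
proof (induction k arbitrary: f g)
  case (Suc k)
  have f: "Ck_on k S f" and g: "Ck_on k S g"
    by (rule Ck_on_SucD[OF Suc.prems(1)], rule Ck_on_SucD[OF Suc.prems(2)])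
  have "Ck_on k S (pd i (\<lambda>x. f x * g x))" for i
    by (rule Ck_on_cong[OF assms(1) _ Ck_on_add[OF assms(1) Suc.IH[OF _ g, of "pd i f"] Suc.IH[OF f, of "pd i g"]]])
       (use Suc.prems in \<open>auto simp: pd_mult\<close>)
  then show ?case using Suc.prems by auto
qed (auto intro: continuous_intros)

lemma Ck_on_sum:
  assumes "open S" "\<And>a. a \<in> I \<Longrightarrow> Ck_on k S (f a)"
  shows "Ck_on k S (\<lambda>x. \<Sum>a\<in>I. f a x)"
  using assms(2) by (induction I rule: infinite_finite_induct) (auto intro: Ck_on_add[OF assms(1)])

lemma Ck_on_prod:
  assumes "open S" "\<And>a. a \<in> I \<Longrightarrow> Ck_on k S (f a)"
  shows "Ck_on k S (\<lambda>x. \<Prod>a\<in>I. f a x)"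
  using assms(2) by (induction I rule: infinite_finite_induct) (auto intro: Ck_on_mult[OF assms(1)])

text \<open>Induction on k for all outer functions at once: the chain rule leaves
  \<open>pd j f\<close> composed with h, to which the induction hypothesis applies.\<close>

lemma Ck_on_compose:
  fixes h :: "real^'n::finite \<Rightarrow> real^'m::finite" and f :: "real^'m \<Rightarrow> real"
  assumes "open S" "Ck_on k T f" "\<And>j. Ck_on k S (\<lambda>x. h x $ j)" "h ` S \<subseteq> T"
  shows "Ck_on k S (\<lambda>x. f (h x))"
  using assms(2,3)
proof (induction k arbitrary: f)
  case 0
  have "continuous_on S (\<lambda>x. \<chi> j. h x $ j)"
    by (rule continuous_on_vec_lambda) (use 0(2) in simp)
  then have "continuous_on S h" by simp
  from continuous_on_compose2[OF _ this assms(4), of f] 0(1) show ?case by simp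
next
  case (Suc k)
  have h: "Ck_on k S (\<lambda>x. h x $ j)" for j by (rule Ck_on_SucD[OF Suc.prems(2)])
  have d: "(\<lambda>x. h x $ j) differentiable (at x)" "f differentiable (at (h x))" if "x \<in> S" for x j
    using Suc.prems that assms(4) by auto
  have IH: "Ck_on k S (\<lambda>x. pd j f (h x))" for j
    by (rule Suc.IH[OF _ h]) (use Suc.prems in simp)
  have hd: "Ck_on k S (pd i (\<lambda>x. h x $ j))" for i j
    using Suc.prems(2)[of j] by simp
  have "Ck_on k S (\<lambda>x. \<Sum>j\<in>UNIV. pd i (\<lambda>x. h x $ j) x * pd j f (h x))" for i
    by (rule Ck_on_sum[OF assms(1) Ck_on_mult[OF assms(1) hd IH]])
  then have "Ck_on k S (pd i (\<lambda>x. f (h x)))" for i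
    by (rule Ck_on_cong[OF assms(1), rotated]) (rule pd_compose[OF d, symmetric])
  moreover have "(\<lambda>x. f (h x)) differentiable (at x)" if "x \<in> S" for x
    by (rule differentiable_compose_pd[OF d[OF that]])
  ultimately show ?case by simp
qed

lemma smooth_on_CkD: "smooth_on S f \<Longrightarrow> Ck_on k S f"
  by (simp add: smooth_on_def)

lemma smooth_on_pd: "smooth_on S f \<Longrightarrow> smooth_on S (pd i f)"
  unfolding smooth_on_def by (metis Ck_on.simps(2))

lemma smooth_on_differentiable: "smooth_on S f \<Longrightarrow> x \<in> S \<Longrightarrow> f differentiable (at x)"
  unfolding smooth_on_def by (metis Ck_on.simps(2))

lemma smooth_on_continuous: "smooth_on S f \<Longrightarrow> continuous_on S f"
  unfolding smooth_on_def by (metis Ck_on.simps(1))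

lemma smooth_on_pds: "smooth_on S f \<Longrightarrow> smooth_on S (pds is f)"
  by (induction "is") (auto intro: smooth_on_pd)

text \<open>The mean value theorem is applied twice, in direction i to the difference along j and
  then in direction j to \<open>pd i f\<close>. The second difference is symmetric in i and j while
  the right side is not, and \<open>pd_commute\<close> exploits this.\<close>

lemma second_difference_MVT:
  fixes f :: "real^'n::finite \<Rightarrow> real"
  assumes h: "h > 0" and sub: "cball x (2 * h) \<subseteq> S" and f: "Ck_on 2 S f"
  shows "\<exists>\<xi>\<in>cball x (2*h). f (x + h *\<^sub>R axis i 1 + h *\<^sub>R axis j 1) - f (x + h *\<^sub>R axis i 1)
     - f (x + h *\<^sub>R axis j 1) + f x = h^2 * pd j (pd i f) \<xi>"
proof -
  have C: "Ck_on (Suc (Suc 0)) S f" using f by (simp add: numeral_2_eq_2 del: Ck_on.simps)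
  have in_S: "x + s *\<^sub>R axis i 1 + t *\<^sub>R axis j 1 \<in> cball x (2*h)" if "0 \<le> s" "s \<le> h" "0 \<le> t" "t \<le> h" for s t
  proof -
    have "norm (s *\<^sub>R axis i (1::real) + t *\<^sub>R axis j 1) \<le> norm (s *\<^sub>R axis i (1::real)) + norm (t *\<^sub>R axis j (1::real))"
      by (rule norm_triangle_ineq)
    also have "\<dots> \<le> 2 * h" using that by (simp add: norm_axis_1)
    finally have "norm (s *\<^sub>R axis i (1::real) + t *\<^sub>R axis j 1) \<le> 2 * h" .
    moreover have "x - (x + s *\<^sub>R axis i 1 + t *\<^sub>R axis j 1) = - (s *\<^sub>R axis i 1 + t *\<^sub>R axis j 1)" by simp
    ultimately show ?thesis unfolding mem_cball dist_norm by (simp only: norm_minus_cancel)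
  qed
  have line: "((\<lambda>s. u (a + s *\<^sub>R axis l 1)) has_real_derivative pd l u (a + s *\<^sub>R axis l 1)) (at s)"
    if "u differentiable (at (a + s *\<^sub>R axis l 1))" for u :: "real^'n \<Rightarrow> real" and a l s
  proof -
    have "((\<lambda>s. a + s *\<^sub>R axis l 1) has_derivative (\<lambda>s. s *\<^sub>R axis l (1::real))) (at s)"
      by (auto intro!: derivative_eq_intros)
    from has_derivative_compose[OF this has_derivative_pd[OF that]]
    show ?thesis unfolding has_field_derivative_def
      by (rule has_derivative_eq_rhs) (auto simp: sum_axis sum_distrib_left[symmetric] mult.assoc mult.commute)
  qed
  define F where "F s = f (x + h *\<^sub>R axis j 1 + s *\<^sub>R axis i 1) - f (x + s *\<^sub>R axis i 1)" for s
  define F' where "F' s = pd i f (x + h *\<^sub>R axis j 1 + s *\<^sub>R axis i 1) - pd i f (x + s *\<^sub>R axis i 1)" for s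
  have dF: "(F has_real_derivative F' s) (at s)" if "0 \<le> s" "s \<le> h" for s
    unfolding F_def F'_def
  proof (intro DERIV_diff line)
    have "x + h *\<^sub>R axis j 1 + s *\<^sub>R axis i 1 \<in> S" "x + s *\<^sub>R axis i 1 \<in> S"
      using in_S[of s h] in_S[of s 0] that h sub by (auto simp: algebra_simps)
    then show "f differentiable at (x + h *\<^sub>R axis j 1 + s *\<^sub>R axis i 1)" "f differentiable at (x + s *\<^sub>R axis i 1)"
      using C by auto
  qed
  obtain s where s: "0 < s" "s < h" "F h - F 0 = (h - 0) * F' s"
    using MVT2[OF h, of F F'] dF by auto
  define q where "q t = pd i f (x + s *\<^sub>R axis i 1 + t *\<^sub>R axis j 1)" for t
  define q' where "q' t = pd j (pd i f) (x + s *\<^sub>R axis i 1 + t *\<^sub>R axis j 1)" for t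
  have dq: "(q has_real_derivative q' t) (at t)" if "0 \<le> t" "t \<le> h" for t
    unfolding q_def q'_def
  proof (rule line)
    have "x + s *\<^sub>R axis i 1 + t *\<^sub>R axis j 1 \<in> S" using in_S[of s t] s that sub by auto
    then show "pd i f differentiable at (x + s *\<^sub>R axis i 1 + t *\<^sub>R axis j 1)" using C by auto
  qed
  obtain t where t: "0 < t" "t < h" "q h - q 0 = (h - 0) * q' t"
    using MVT2[OF h, of q q'] dq by auto
  have "F' s = q h - q 0" unfolding F'_def q_def by (simp add: algebra_simps)
  then have "F h - F 0 = h^2 * q' t" using s(3) t(3) by (simp add: power2_eq_square)
  moreover have "F h - F 0 = f (x + h *\<^sub>R axis i 1 + h *\<^sub>R axis j 1) - f (x + h *\<^sub>R axis i 1)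
     - f (x + h *\<^sub>R axis j 1) + f x" unfolding F_def by (simp add: algebra_simps)
  ultimately show ?thesis
    using in_S[of s t] s t unfolding q'_def by (intro bexI[of _ "x + s *\<^sub>R axis i 1 + t *\<^sub>R axis j 1"]) auto
qed

text \<open>Both iterated derivatives are values of the same second difference divided by h^2, taken
  at points within distance 2h of x; continuity at x then forces them together.\<close>

lemma pd_commute:
  fixes f :: "real^'n::finite \<Rightarrow> real"
  assumes "open S" "x \<in> S" and f: "Ck_on 2 S f"
  shows "pd i (pd j f) x = pd j (pd i f) x"
proof (rule ccontr)
  let ?a = "pd i (pd j f)" and ?b = "pd j (pd i f)"
  assume ne: "?a x \<noteq> ?b x"
  \<comment> \<open>Half the gap: two errors below e cannot bridge a gap of 2e.\<close>
  define e where "e = \<bar>?a x - ?b x\<bar> / 2"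
  have e: "e > 0" using ne by (simp add: e_def)
  have C: "Ck_on (Suc (Suc 0)) S f" using f by (simp add: numeral_2_eq_2 del: Ck_on.simps)
  have "continuous_on S ?a" "continuous_on S ?b" using C by auto
  then have "isCont ?a x" "isCont ?b x" using assms by (auto simp: continuous_on_eq_continuous_at)
  then obtain d1 d2 where d: "d1 > 0" "d2 > 0" "\<And>y. dist y x < d1 \<Longrightarrow> dist (?a y) (?a x) < e"
    "\<And>y. dist y x < d2 \<Longrightarrow> dist (?b y) (?b x) < e"
    using e unfolding continuous_at_eps_delta by metis
  obtain r where r: "r > 0" "cball x r \<subseteq> S" using assms open_contains_cball by blast
  define h where "h = min r (min d1 d2) / 4"
  have h: "h > 0" "2 * h < d1" "2 * h < d2" "cball x (2*h) \<subseteq> S"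
  proof -
    have "cball x (2*h) \<subseteq> cball x r" using r d by (intro subset_cball) (auto simp: h_def min_def)
    then show "cball x (2*h) \<subseteq> S" using r by blast
  qed (use r d in \<open>auto simp: h_def min_def\<close>)
  obtain \<xi> where xi: "\<xi>\<in>cball x (2*h)" "f (x + h *\<^sub>R axis i 1 + h *\<^sub>R axis j 1) - f (x + h *\<^sub>R axis i 1)
     - f (x + h *\<^sub>R axis j 1) + f x = h^2 * ?b \<xi>"
    using second_difference_MVT[OF h(1,4) f, of i j] by blast
  obtain \<eta> where eta: "\<eta>\<in>cball x (2*h)" "f (x + h *\<^sub>R axis j 1 + h *\<^sub>R axis i 1) - f (x + h *\<^sub>R axis j 1)
     - f (x + h *\<^sub>R axis i 1) + f x = h^2 * ?a \<eta>"
    using second_difference_MVT[OF h(1,4) f, of j i] by blast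
  have "x + h *\<^sub>R axis j 1 + h *\<^sub>R axis i 1 = x + h *\<^sub>R axis i 1 + h *\<^sub>R axis j 1" by simp
  then have "f (x + h *\<^sub>R axis j 1 + h *\<^sub>R axis i 1) = f (x + h *\<^sub>R axis i 1 + h *\<^sub>R axis j 1)"
    by (rule arg_cong)
  then have "h^2 * ?a \<eta> = h^2 * ?b \<xi>" using xi(2) eta(2) by linarith
  then have "?a \<eta> = ?b \<xi>" using h by simp
  moreover have "\<bar>?a \<eta> - ?a x\<bar> < e" using d(3)[of \<eta>] eta(1) h by (simp add: dist_commute dist_real_def)
  moreover have "\<bar>?b \<xi> - ?b x\<bar> < e" using d(4)[of \<xi>] xi(1) h by (simp add: dist_commute dist_real_def)
  moreover have "\<bar>?a x - ?b x\<bar> = 2 * e" by (simp add: e_def)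
  ultimately show False by (smt (verit))
qed

section \<open>Test functions and the fundamental lemma of the calculus of variations\<close>

text \<open>exp(-1/t) t^(-k), extended by 0. The derivative of a member of the family is a
  combination of the members of index k+1 and k+2, so smoothness of the case k = 0 follows by an
  induction that treats all k at once.\<close>

definition flat :: "nat \<Rightarrow> real \<Rightarrow> real" where
  "flat k t = (if t \<le> 0 then 0 else exp (- (1 / t)) / t ^ k)"

lemma flat_tendsto_0: "(flat k \<longlongrightarrow> 0) (at_right 0)"
proof -
  have "((\<lambda>s. s ^ k / exp s) \<longlongrightarrow> 0) (at_top :: real filter)"
    by (rule tendsto_power_div_exp_0)
  then have "((\<lambda>t::real. inverse t ^ k / exp (inverse t)) \<longlongrightarrow> 0) (at_right 0)"
    by (rule filterlim_compose[OF _ filterlim_inverse_at_top_right])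
  moreover have "\<forall>\<^sub>F t in at_right (0::real). inverse t ^ k / exp (inverse t) = flat k t"
    by (rule eventually_mono[OF eventually_at_right_less])
       (simp add: flat_def exp_minus power_inverse divide_inverse mult.commute)
  ultimately show ?thesis by (rule Lim_transform_eventually)
qed

text \<open>At 0 the right difference quotient of \<open>flat k\<close> is
  \<open>flat (Suc k)\<close>, which tends to 0 because the exponential beats every power; the left
  one vanishes.\<close>

lemma DERIV_flat: "(flat k has_real_derivative (flat (k+2) t - real k * flat (k+1) t)) (at t)"
proof (cases t "0::real" rule: linorder_cases)
  case less
  have "((\<lambda>_. 0) has_real_derivative 0) (at t)" by simp
  then have "(flat k has_real_derivative 0) (at t)"
    by (rule has_field_derivative_transform_within_open[of _ _ _ "{..<0}"])
       (use less in \<open>auto simp: flat_def\<close>)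
  then show ?thesis using less by (simp add: flat_def)
next
  case greater
  have "((\<lambda>t. exp (- (1 / t)) / t ^ k) has_real_derivative (flat (k+2) t - real k * flat (k+1) t)) (at t)"
  proof (cases k)
    case 0
    then show ?thesis using greater
      by (auto intro!: derivative_eq_intros simp: flat_def field_simps power2_eq_square)
  next
    case (Suc m)
    then show ?thesis using greater
      by (cases m; auto intro!: derivative_eq_intros simp: flat_def field_simps power2_eq_square power_add; metis One_nat_def power_eq_if)
  qed
  then show ?thesis
    by (rule has_field_derivative_transform_within_open[of _ _ _ "{0<..}"])
       (use greater in \<open>auto simp: flat_def\<close>)
next
  case equal
  have "((\<lambda>h. (flat k h - flat k 0) / h) \<longlongrightarrow> 0) (at_right 0)"
    by (rule Lim_transform_eventually[OF flat_tendsto_0[of "Suc k"] eventually_mono[OF eventually_at_right_less]])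
       (simp add: flat_def)
  moreover have "((\<lambda>h. (flat k h - flat k 0) / h) \<longlongrightarrow> 0) (at_left 0)"
    by (rule Lim_transform_eventually[OF tendsto_const eventually_mono[OF eventually_at_left_real[of "-1"]]])
       (auto simp: flat_def)
  ultimately have "(flat k has_real_derivative 0) (at 0)"
    unfolding DERIV_def by (simp add: filterlim_split_at)
  then show ?thesis using equal by (simp add: flat_def)
qed

text \<open>The affine argument covers the two faces of a box in direction j, with slopes of either
  sign.\<close>

lemma Ck_on_flat: "Ck_on l UNIV (\<lambda>x. flat k (c * x $ j + d))"
proof (induction l arbitrary: k)
  case 0
  have "isCont (flat k) t" for t using DERIV_flat DERIV_isCont by blast
  then have "continuous_on UNIV (flat k)" by (simp add: continuous_at_imp_continuous_on)
  then show ?case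
    by (auto intro!: continuous_on_compose2[where f = "\<lambda>x. c * x $ j + d"] continuous_intros)
next
  case (Suc l)
  let ?a = "\<lambda>x::real^'a. c * x $ j + d"
  have c: "(\<lambda>x::real^'a. x $ j) differentiable (at x)" for x
    by (auto intro!: bounded_linear_imp_differentiable bounded_linear_vec_nth)
  have da: "?a differentiable (at x)" for x
    by (intro differentiable_add differentiable_mult differentiable_const c)
  have pa: "pd i ?a x = (if i = j then c else 0)" for i x
    by (simp add: pd_add pd_cmult c pd_coord)
  have "Ck_on l UNIV (\<lambda>x::real^'a. (if i = j then c else 0) * (flat (k+2) (?a x) + (- real k) * flat (k+1) (?a x)))" for i
    by (intro Ck_on_mult Ck_on_add Ck_on_const Suc.IH open_UNIV)
  then have "Ck_on l UNIV (pd i (\<lambda>x::real^'a. flat k (?a x)))" for i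
    by (rule Ck_on_cong[OF open_UNIV, rotated])
       (simp only: pd_compose_real(1)[OF da DERIV_flat] pa, simp add: algebra_simps)
  then show ?case by (simp add: pd_compose_real(2)[OF da DERIV_flat])
qed

text \<open>The factor \<open>Suc n\<close> steepens the sides: exp(-1/((n+1) t)) tends to 1 for t >
  0, so the bumps converge to the indicator of the open box while staying between 0 and 1.\<close>

definition box_bump :: "nat \<Rightarrow> real^'n \<Rightarrow> real^'n \<Rightarrow> real^'n::finite \<Rightarrow> real" where
  "box_bump n a b x = (\<Prod>j\<in>UNIV. flat 0 (real (Suc n) * (x $ j - a $ j)) * flat 0 (real (Suc n) * (b $ j - x $ j)))"

lemma smooth_box_bump: "smooth_on UNIV (box_bump n a b)"
proof -
  have "Ck_on k UNIV (box_bump n a b)" for k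
  proof -
    have "Ck_on k UNIV (\<lambda>x. \<Prod>j\<in>UNIV. flat 0 (real (Suc n) * x $ j + (- real (Suc n) * a $ j))
        * flat 0 ((- real (Suc n)) * x $ j + real (Suc n) * b $ j))"
      by (intro Ck_on_prod Ck_on_mult Ck_on_flat open_UNIV)
    moreover have "(\<lambda>x. \<Prod>j\<in>UNIV. flat 0 (real (Suc n) * x $ j + (- real (Suc n) * a $ j))
        * flat 0 ((- real (Suc n)) * x $ j + real (Suc n) * b $ j)) = box_bump n a b"
      unfolding box_bump_def by (intro ext prod.cong refl) (simp add: algebra_simps)
    ultimately show ?thesis by simp
  qed
  then show ?thesis by (simp add: smooth_on_def)
qed

lemma flat_0_bounds: "0 \<le> flat 0 t" "flat 0 t \<le> 1" by (auto simp: flat_def)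

lemma box_bump_bounds: "0 \<le> box_bump n a b x" "box_bump n a b x \<le> 1"
  unfolding box_bump_def
  by (auto intro!: prod_nonneg prod_le_1 mult_nonneg_nonneg mult_le_one flat_0_bounds)

lemma box_bump_eq_0: "x \<notin> box a b \<Longrightarrow> box_bump n a b x = 0"
proof -
  assume "x \<notin> box a b"
  then obtain j where "x $ j \<le> a $ j \<or> b $ j \<le> x $ j" by (auto simp: mem_box_cart not_less)
  then have "flat 0 (real (Suc n) * (x $ j - a $ j)) * flat 0 (real (Suc n) * (b $ j - x $ j)) = 0"
    by (auto simp: flat_def mult_le_0_iff)
  then show ?thesis unfolding box_bump_def by (meson finite UNIV_I prod_zero)
qed

lemma supp_box_bump: "supp (box_bump n a b) \<subseteq> cbox a b"
proof -
  have "{x. box_bump n a b x \<noteq> 0} \<subseteq> cbox a b"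
    using box_bump_eq_0 box_subset_cbox by blast
  then show ?thesis unfolding supp_def by (rule closure_minimal[OF _ closed_cbox])
qed

lemma compact_supp_box_bump: "compact (supp (box_bump n a b))"
  using supp_box_bump by (metis compact_cbox closed_closure compact_Int_closed inf.absorb_iff2 supp_def)

lemma box_bump_tendsto: "(\<lambda>n. box_bump n a b x) \<longlonglongrightarrow> indicator (box a b) x"
proof (cases "x \<in> box a b")
  case True
  have *: "(\<lambda>n. flat 0 (real (Suc n) * t)) \<longlonglongrightarrow> 1" if "t > 0" for t
  proof -
    have "(\<lambda>n. exp (- (inverse (real (Suc n)) / t))) \<longlonglongrightarrow> exp (- (0 / t))"
      by (intro tendsto_intros LIMSEQ_inverse_real_of_nat) (use that in auto)
    moreover have "flat 0 (real (Suc n) * t) = exp (- (inverse (real (Suc n)) / t))" for n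
      using that mult_pos_pos[of "real (Suc n)" t] by (simp add: flat_def field_simps not_le[symmetric] del: of_nat_Suc)
    ultimately show ?thesis by simp
  qed
  have "(\<lambda>n. box_bump n a b x) \<longlonglongrightarrow> (\<Prod>j\<in>(UNIV::'a set). 1 * 1)"
    unfolding box_bump_def by (intro tendsto_prod tendsto_mult *) (use True in \<open>auto simp: mem_box_cart\<close>)
  then show ?thesis using True by simp
qed (simp add: box_bump_eq_0)

text \<open>Boxes are stable under intersection and generate the Borel sets, so the integral
  vanishes over every Borel set; \<open>tot\<close> serves the passage to complements. The densities
  f and 0 then define the same set function.\<close>

lemma AE_zero_of_boxes:
  fixes f :: "'a::euclidean_space \<Rightarrow> real"
  assumes f: "integrable lborel f" and z: "\<And>a b. (LINT x:box a b|lborel. f x) = 0"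
    and tot: "(LINT x|lborel. f x) = 0"
  shows "AE x in lborel. f x = 0"
proof -
  have si: "set_integrable lborel A f" if "A \<in> sets borel" for A
    unfolding set_integrable_def by (rule integrable_mult_indicator[OF _ f]) (use that in simp)
  have "(LINT x:A|lborel. f x) = 0" if "A \<in> sets borel" for A
  proof -
    let ?G = "range (\<lambda>(a, b). box a b :: 'a set)"
    have "Int_stable ?G"
    proof (rule Int_stableI)
      fix U V assume "U \<in> ?G" "V \<in> ?G"
      then obtain a b c d where "U = box a b" "V = box c d" by auto
      then have "U \<inter> V = (\<lambda>(a, b). box a b) (\<Sum>i\<in>Basis. max (a \<bullet> i) (c \<bullet> i) *\<^sub>R i, \<Sum>i\<in>Basis. min (b \<bullet> i) (d \<bullet> i) *\<^sub>R i)"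
        by (simp add: box_Int_box)
      then show "U \<inter> V \<in> ?G" by (rule range_eqI)
    qed
    moreover have "?G \<subseteq> Pow UNIV" by simp
    moreover have "A \<in> sigma_sets UNIV ?G" using that by (simp add: borel_eq_box)
    ultimately show ?thesis
    proof (induction rule: sigma_sets_induct_disjoint)
      case (basic A)
      then show ?case using z by auto
    next
      case empty
      then show ?case by (simp add: set_lebesgue_integral_def)
    next
      case (compl A)
      then have A: "A \<in> sets borel" by (simp add: borel_eq_box)
      have "(LINT x:(UNIV - A) \<union> A|lborel. f x) = (LINT x:UNIV - A|lborel. f x) + (LINT x:A|lborel. f x)"
        by (rule set_integral_Un) (use A in \<open>auto intro!: si\<close>)
      moreover have "(LINT x:(UNIV - A) \<union> A|lborel. f x) = 0"
        using tot by (simp add: set_lebesgue_integral_def)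
      ultimately show ?case using compl by simp
    next
      case (union A)
      then have A: "A i \<in> sets borel" for i by (auto simp: borel_eq_box)
      have "(LINT x:(\<Union>i. A i)|lborel. f x) = (\<Sum>i. LINT x:A i|lborel. f x)"
        by (rule lebesgue_integral_countable_add)
           (use A union in \<open>auto intro!: si simp: disjoint_family_on_def\<close>)
      then show ?case using union by simp
    qed
  qed
  then show ?thesis
    using density_unique_real[of lborel f "\<lambda>_. 0"] f by (simp add: set_lebesgue_integral_def)
qed

text \<open>Smooth bumps converge boundedly to indicators of boxes, so f integrates to 0 over every
  box inside \<Omega>; countably many closed boxes exhaust \<Omega>.\<close>

lemma AE_zero_of_tests:
  fixes f :: "real^'n::finite \<Rightarrow> real"
  assumes "open \<Omega>" and f: "locally_integrable \<Omega> f"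
    and z: "\<And>\<phi>. smooth_on UNIV \<phi> \<Longrightarrow> compact (supp \<phi>) \<Longrightarrow> supp \<phi> \<subseteq> \<Omega> \<Longrightarrow> (LINT x:\<Omega>|lebesgue. f x * \<phi> x) = 0"
  shows "AE x in lebesgue. x \<in> \<Omega> \<longrightarrow> f x = 0"
proof -
  have zb: "(LINT x:box a b|lebesgue. f x) = 0" if ab: "cbox a b \<subseteq> \<Omega>" for a b
  proof -
    have si: "set_integrable lebesgue (cbox a b) f" using f ab by (simp add: locally_integrable_def)
    have m: "box_bump n a b \<in> borel_measurable lebesgue" for n
      using smooth_on_continuous[OF smooth_box_bump, of n a b]
      by (simp add: borel_measurable_continuous_onI measurable_completion)
    have m2: "(\<lambda>x. indicator (cbox a b) x *\<^sub>R f x) \<in> borel_measurable lebesgue"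
      using si unfolding set_integrable_def by auto
    have lim: "(\<lambda>n. LINT x|lebesgue. box_bump n a b x * (indicator (cbox a b) x *\<^sub>R f x)) \<longlonglongrightarrow>
       (LINT x|lebesgue. indicator (box a b) x * (indicator (cbox a b) x *\<^sub>R f x))"
    proof (rule integral_dominated_convergence[where w = "\<lambda>x. \<bar>indicator (cbox a b) x *\<^sub>R f x\<bar>"])
      show "integrable lebesgue (\<lambda>x. \<bar>indicator (cbox a b) x *\<^sub>R f x\<bar>)"
        using si unfolding set_integrable_def by (rule integrable_abs)
      show "AE x in lebesgue. (\<lambda>n. box_bump n a b x * (indicator (cbox a b) x *\<^sub>R f x)) \<longlonglongrightarrow>
           indicator (box a b) x * (indicator (cbox a b) x *\<^sub>R f x)"
        by (intro AE_I2 tendsto_mult box_bump_tendsto tendsto_const)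
      show "AE x in lebesgue. norm (box_bump n a b x * (indicator (cbox a b) x *\<^sub>R f x)) \<le> \<bar>indicator (cbox a b) x *\<^sub>R f x\<bar>" for n
        by (intro AE_I2) (use box_bump_bounds[of n a b] in \<open>auto simp: abs_mult mult_left_le_one_le\<close>)
    qed (intro borel_measurable_times m m2 borel_measurable_indicator; simp)+
    have "(LINT x|lebesgue. box_bump n a b x * (indicator (cbox a b) x *\<^sub>R f x)) = (LINT x:\<Omega>|lebesgue. f x * box_bump n a b x)" for n
      unfolding set_lebesgue_integral_def
    proof (rule Bochner_Integration.integral_cong[OF refl])
      fix x
      show "box_bump n a b x * (indicator (cbox a b) x *\<^sub>R f x) = indicator \<Omega> x *\<^sub>R (f x * box_bump n a b x)"
        using box_bump_eq_0[of x a b n] ab box_subset_cbox[of a b] by (auto simp: indicator_def split: if_splits)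
    qed
    moreover have "(LINT x:\<Omega>|lebesgue. f x * box_bump n a b x) = 0" for n
      by (rule z[OF smooth_box_bump compact_supp_box_bump subset_trans[OF supp_box_bump ab]])
    ultimately have "(LINT x|lebesgue. indicator (box a b) x * (indicator (cbox a b) x *\<^sub>R f x)) = 0"
      using lim by (simp add: LIMSEQ_const_iff)
    moreover have "indicator (box a b) x * (indicator (cbox a b) x *\<^sub>R f x) = indicator (box a b) x *\<^sub>R f x" for x
      using box_subset_cbox[of a b] by (auto simp: indicator_def)
    ultimately show ?thesis by (simp only: set_lebesgue_integral_def)
  qed
  have AEc: "AE x in lebesgue. x \<in> cbox a b \<longrightarrow> f x = 0" if ab: "cbox a b \<subseteq> \<Omega>" for a b
  proof -
    have si: "set_integrable lebesgue (box a b) f"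
      using set_integrable_subset[of lebesgue "cbox a b" f "box a b"] f ab by (auto simp: locally_integrable_def box_subset_cbox)
    \<comment> \<open>The argument with boxes is for Borel functions on the whole space, so f is cut
      off to one box and then replaced by a Borel version.\<close>
    define d where "d x = indicator (box a b) x *\<^sub>R f x" for x
    have d: "integrable lebesgue d" using si by (simp add: d_def[abs_def] set_integrable_def)
    obtain d' where d': "d' \<in> borel_measurable lborel" "AE x in lborel. d x = d' x"
      using completion_ex_borel_measurable_real[of d lborel] d by auto
    have eq: "AE x in lebesgue. d x = d' x" using d'(2) AE_completion_iff by (simp add: AE_completion)
    have m': "d' \<in> borel_measurable lebesgue" using d'(1) by (simp add: measurable_completion)
    have "integrable lebesgue d'" using d eq m' integrable_cong_AE_imp by (metis AE_cong)
    then have i': "integrable lborel d'" using d'(1) by (simp add: integrable_completion)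
    have zz: "(LINT x:A|lborel. d' x) = (LINT x:A|lebesgue. d x)" if "A \<in> sets borel" for A
    proof -
      have "(LINT x:A|lborel. d' x) = (LINT x:A|lebesgue. d' x)" unfolding set_lebesgue_integral_def
        by (rule integral_completion[symmetric]) (use d' that in measurable)
      also have "\<dots> = (LINT x:A|lebesgue. d x)" unfolding set_lebesgue_integral_def
      proof (rule integral_cong_AE)
        have A: "A \<in> sets lebesgue" using that by simp
        show "(\<lambda>x. indicat_real A x *\<^sub>R d' x) \<in> borel_measurable lebesgue"
          by (rule borel_measurable_scaleR[OF borel_measurable_indicator[OF A] m'])
        show "(\<lambda>x. indicat_real A x *\<^sub>R d x) \<in> borel_measurable lebesgue"
          by (rule borel_measurable_scaleR[OF borel_measurable_indicator[OF A] borel_measurable_integrable[OF d]])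
      qed (use eq in auto)
      finally show ?thesis .
    qed
    have "AE x in lborel. d' x = 0"
    proof (rule AE_zero_of_boxes[OF i'])
      fix u v :: "real^'n"
      obtain s t where st: "box u v \<inter> box a b = box s t" using box_Int_box by blast
      have "(LINT x:box u v|lborel. d' x) = (LINT x:box u v|lebesgue. d x)" by (rule zz) simp
      also have "\<dots> = (LINT x:box s t|lebesgue. f x)"
        unfolding set_lebesgue_integral_def d_def st[symmetric]
        by (intro Bochner_Integration.integral_cong) (auto simp: indicator_def)
      also have "\<dots> = 0"
      proof (cases "box s t = {}")
        case False
        \<comment> \<open>The closed box of a nonempty intersection stays inside
          \<open>cbox a b\<close>, hence inside \<Omega>, as \<open>zb\<close> requires.\<close>
        have "cbox s t = closure (box s t)" using False by simp
        also have "\<dots> \<subseteq> cbox a b" using st box_subset_cbox[of a b] by (intro closure_minimal) auto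
        finally show ?thesis using zb ab by auto
      qed (simp add: set_lebesgue_integral_def)
      finally show "(LINT x:box u v|lborel. d' x) = 0" .
    next
      have "(LINT x|lborel. d' x) = (LINT x:UNIV|lborel. d' x)" by (simp add: set_lebesgue_integral_def)
      also have "\<dots> = (LINT x|lebesgue. d x)" using zz[of UNIV] by (simp add: set_lebesgue_integral_def)
      also have "\<dots> = 0" using zb[OF ab] by (simp add: d_def set_lebesgue_integral_def)
      finally show "(LINT x|lborel. d' x) = 0" .
    qed
    then have "AE x in lebesgue. d' x = 0" by (simp add: AE_completion)
    moreover have "AE x in lebesgue. x \<notin> cbox a b - box a b"
      by (rule AE_not_in) (use negligible_frontier_interval[of a b] in \<open>simp add: negligible_iff_null_sets\<close>)
    ultimately show ?thesis using eq by eventually_elim (auto simp: d_def)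
  qed
  obtain D where D: "countable D" "D \<subseteq> Pow \<Omega>" "\<And>X. X \<in> D \<Longrightarrow> \<exists>a b. X = cbox a b" "\<Union>D = \<Omega>"
    using open_countable_Union_open_cbox[OF assms(1)] by metis
  have "AE x in lebesgue. \<forall>X\<in>D. x \<in> X \<longrightarrow> f x = 0"
    unfolding AE_ball_countable[OF D(1)] using D(2,3) AEc by (metis Pow_iff subset_iff)
  then show ?thesis by eventually_elim (use D(4) in auto)
qed

section \<open>Locally bounded measurable functions\<close>

text \<open>Completeness: every subset of a Lebesgue null set is measurable.\<close>

lemma borel_measurable_lebesgue_AE:
  fixes f g :: "'a::euclidean_space \<Rightarrow> 'b::topological_space"
  assumes g: "g \<in> borel_measurable lebesgue" and eq: "AE x in lebesgue. f x = g x"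
  shows "f \<in> borel_measurable lebesgue"
proof -
  obtain N where N: "N \<in> null_sets lebesgue" "\<And>x. x \<notin> N \<Longrightarrow> f x = g x"
    using eq by (auto simp: eventually_ae_filter)
  have sub: "S \<in> sets lebesgue" if "S \<subseteq> N" for S
    using N(1) that by (meson negligible_iff_null_sets negligible_imp_sets negligible_subset)
  show ?thesis
  proof (rule measurableI)
    fix A :: "'b set" assume A: "A \<in> sets borel"
    have "f -` A = (g -` A - N) \<union> (f -` A \<inter> N)" using N(2) by auto
    moreover have "g -` A \<in> sets lebesgue" using measurable_sets[OF g A] by simp
    moreover have "N \<in> sets lebesgue" using N(1) by (rule null_setsD2)
    moreover have "f -` A \<inter> N \<in> sets lebesgue" by (rule sub) simp
    ultimately have "f -` A \<in> sets lebesgue" by (metis sets.Diff sets.Un)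
    then show "f -` A \<inter> space lebesgue \<in> sets lebesgue" by simp
  qed simp
qed

text \<open>The class L^\<infinity>_loc, an algebra of coefficients. The bound is only essential
  because \<open>weak_pd\<close> is a choice that is determined up to null sets.\<close>

definition loc_bdd :: "(real^'n::finite) set \<Rightarrow> (real^'n \<Rightarrow> real) \<Rightarrow> bool" where
  "loc_bdd \<Omega> f \<longleftrightarrow> set_borel_measurable lebesgue \<Omega> f \<and>
     (\<forall>K. compact K \<and> K \<subseteq> \<Omega> \<longrightarrow> (\<exists>C. AE x in lebesgue. x \<in> K \<longrightarrow> \<bar>f x\<bar> \<le> C))"

lemma loc_bddI:
  assumes "set_borel_measurable lebesgue \<Omega> f"
    "\<And>K. compact K \<Longrightarrow> K \<subseteq> \<Omega> \<Longrightarrow> \<exists>C. AE x in lebesgue. x \<in> K \<longrightarrow> \<bar>f x\<bar> \<le> C"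
  shows "loc_bdd \<Omega> f"
  using assms by (simp add: loc_bdd_def)

lemma loc_bdd_bound:
  assumes "loc_bdd \<Omega> f" "compact K" "K \<subseteq> \<Omega>"
  obtains C where "C \<ge> 0" "AE x in lebesgue. x \<in> K \<longrightarrow> \<bar>f x\<bar> \<le> C"
proof -
  obtain C where C: "AE x in lebesgue. x \<in> K \<longrightarrow> \<bar>f x\<bar> \<le> C" using assms unfolding loc_bdd_def by blast
  have "AE x in lebesgue. x \<in> K \<longrightarrow> \<bar>f x\<bar> \<le> max C 0" using C by eventually_elim auto
  then show ?thesis using that[of "max C 0"] by simp
qed

lemma loc_bdd_meas: "loc_bdd \<Omega> f \<Longrightarrow> (\<lambda>x. indicator \<Omega> x *\<^sub>R f x) \<in> borel_measurable lebesgue"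
  by (simp add: loc_bdd_def set_borel_measurable_def)

lemma loc_bdd_cong_AE:
  assumes f: "loc_bdd \<Omega> f" and eq: "AE x in lebesgue. x \<in> \<Omega> \<longrightarrow> g x = f x"
  shows "loc_bdd \<Omega> g"
proof (rule loc_bddI)
  have "AE x in lebesgue. indicator \<Omega> x *\<^sub>R g x = indicator \<Omega> x *\<^sub>R f x"
    using eq by eventually_elim (auto simp: indicator_def)
  then show "set_borel_measurable lebesgue \<Omega> g"
    unfolding set_borel_measurable_def by (rule borel_measurable_lebesgue_AE[OF loc_bdd_meas[OF f]])
  fix K :: "(real^'a) set" assume K: "compact K" "K \<subseteq> \<Omega>"
  obtain C where "AE x in lebesgue. x \<in> K \<longrightarrow> \<bar>f x\<bar> \<le> C" using loc_bdd_bound[OF f K] by blast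
  then have "AE x in lebesgue. x \<in> K \<longrightarrow> \<bar>g x\<bar> \<le> C" using eq by eventually_elim (use K in auto)
  then show "\<exists>C. AE x in lebesgue. x \<in> K \<longrightarrow> \<bar>g x\<bar> \<le> C" by blast
qed

lemma loc_bdd_add:
  assumes f: "loc_bdd \<Omega> f" and g: "loc_bdd \<Omega> g"
  shows "loc_bdd \<Omega> (\<lambda>x. f x + g x)"
proof (rule loc_bddI)
  show "set_borel_measurable lebesgue \<Omega> (\<lambda>x. f x + g x)"
    using borel_measurable_add[OF loc_bdd_meas[OF f] loc_bdd_meas[OF g]]
    by (simp add: set_borel_measurable_def algebra_simps)
  fix K :: "(real^'a) set" assume K: "compact K" "K \<subseteq> \<Omega>"
  obtain C where "AE x in lebesgue. x \<in> K \<longrightarrow> \<bar>f x\<bar> \<le> C" using loc_bdd_bound[OF f K] by blast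
  moreover obtain D where "AE x in lebesgue. x \<in> K \<longrightarrow> \<bar>g x\<bar> \<le> D" using loc_bdd_bound[OF g K] by blast
  ultimately have "AE x in lebesgue. x \<in> K \<longrightarrow> \<bar>f x + g x\<bar> \<le> C + D" by eventually_elim auto
  then show "\<exists>C. AE x in lebesgue. x \<in> K \<longrightarrow> \<bar>f x + g x\<bar> \<le> C" by blast
qed

lemma loc_bdd_mult:
  assumes f: "loc_bdd \<Omega> f" and g: "loc_bdd \<Omega> g"
  shows "loc_bdd \<Omega> (\<lambda>x. f x * g x)"
proof (rule loc_bddI)
  have "(\<lambda>x. (indicator \<Omega> x *\<^sub>R f x) * (indicator \<Omega> x *\<^sub>R g x)) = (\<lambda>x. indicator \<Omega> x *\<^sub>R (f x * g x))"
    by (auto simp: indicator_def)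
  then show "set_borel_measurable lebesgue \<Omega> (\<lambda>x. f x * g x)"
    using borel_measurable_times[OF loc_bdd_meas[OF f] loc_bdd_meas[OF g]]
    by (simp add: set_borel_measurable_def)
  fix K :: "(real^'a) set" assume K: "compact K" "K \<subseteq> \<Omega>"
  obtain C where C: "C \<ge> 0" "AE x in lebesgue. x \<in> K \<longrightarrow> \<bar>f x\<bar> \<le> C" using loc_bdd_bound[OF f K] by blast
  obtain D where "AE x in lebesgue. x \<in> K \<longrightarrow> \<bar>g x\<bar> \<le> D" using loc_bdd_bound[OF g K] by blast
  with C(2) have "AE x in lebesgue. x \<in> K \<longrightarrow> \<bar>f x * g x\<bar> \<le> C * D"
    by eventually_elim (auto simp: abs_mult C(1) intro!: mult_mono)
  then show "\<exists>C. AE x in lebesgue. x \<in> K \<longrightarrow> \<bar>f x * g x\<bar> \<le> C" by blast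
qed

lemma loc_bdd_const:
  assumes "open \<Omega>" shows "loc_bdd \<Omega> (\<lambda>_. c)"
  by (rule loc_bddI) (use assms in \<open>auto simp: set_borel_measurable_def simp del: real_scaleR_def
      intro!: borel_measurable_scaleR borel_measurable_indicator\<close>)

lemma loc_bdd_cmult: "open \<Omega> \<Longrightarrow> loc_bdd \<Omega> f \<Longrightarrow> loc_bdd \<Omega> (\<lambda>x. c * f x)"
  by (rule loc_bdd_mult[OF loc_bdd_const])

lemma loc_bdd_diff:
  assumes "open \<Omega>" "loc_bdd \<Omega> f" "loc_bdd \<Omega> g" shows "loc_bdd \<Omega> (\<lambda>x. f x - g x)"
  using loc_bdd_add[OF assms(2) loc_bdd_cmult[OF assms(1,3), of "-1"]] by simp

lemma loc_bdd_sum: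
  assumes "open \<Omega>" "\<And>a. a \<in> I \<Longrightarrow> loc_bdd \<Omega> (f a)"
  shows "loc_bdd \<Omega> (\<lambda>x. \<Sum>a\<in>I. f a x)"
  using assms(2) by (induction I rule: infinite_finite_induct) (auto intro: loc_bdd_add loc_bdd_const[OF assms(1)])

lemma loc_bdd_continuous:
  assumes "open \<Omega>" "continuous_on \<Omega> f" shows "loc_bdd \<Omega> f"
proof (rule loc_bddI)
  have "set_borel_measurable borel \<Omega> f"
    using borel_measurable_continuous_on_indicator[OF _ assms(2)] assms(1)
    by (simp add: set_borel_measurable_def)
  then show "set_borel_measurable lebesgue \<Omega> f"
    by (simp add: set_borel_measurable_def measurable_completion)
  fix K :: "(real^'a) set" assume K: "compact K" "K \<subseteq> \<Omega>"
  have "compact (f ` K)" using K assms(2) by (meson compact_continuous_image continuous_on_subset)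
  then obtain C where "\<And>x. x \<in> K \<Longrightarrow> \<bar>f x\<bar> \<le> C"
    by (metis bounded_real compact_imp_bounded imageI)
  then show "\<exists>C. AE x in lebesgue. x \<in> K \<longrightarrow> \<bar>f x\<bar> \<le> C" by blast
qed

lemma set_integrable_loc_bdd:
  assumes f: "loc_bdd \<Omega> f" and K: "compact K" "K \<subseteq> \<Omega>"
    and z: "AE x in lebesgue. x \<in> \<Omega> - K \<longrightarrow> f x = 0"
  shows "set_integrable lebesgue \<Omega> f"
proof -
  obtain C where C: "C \<ge> 0" "AE x in lebesgue. x \<in> K \<longrightarrow> \<bar>f x\<bar> \<le> C" using loc_bdd_bound[OF f K] by blast
  have KL: "K \<in> lmeasurable" using K by (simp add: lmeasurable_compact)
  have "integrable lebesgue (\<lambda>x. C * indicator K x)"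
    using KL by (intro integrable_mult_right) (auto simp: lmeasurable_iff_integrable)
  then show ?thesis unfolding set_integrable_def
  proof (rule Bochner_Integration.integrable_bound)
    show "(\<lambda>x. indicator \<Omega> x *\<^sub>R f x) \<in> borel_measurable lebesgue" by (rule loc_bdd_meas[OF f])
    show "AE x in lebesgue. norm (indicator \<Omega> x *\<^sub>R f x) \<le> norm (C * indicator K x)"
      using C(2) z by eventually_elim (use C(1) in \<open>auto simp: indicator_def\<close>)
  qed
qed

lemma locally_integrable_loc_bdd:
  assumes f: "loc_bdd \<Omega> f" shows "locally_integrable \<Omega> f"
  unfolding locally_integrable_def
proof (intro allI impI)
  fix K :: "(real^'a) set" assume K: "compact K \<and> K \<subseteq> \<Omega>"
  have "loc_bdd K f"
  proof (rule loc_bddI)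
    have "(\<lambda>x. indicator K x *\<^sub>R (indicator \<Omega> x *\<^sub>R f x)) = (\<lambda>x. indicator K x *\<^sub>R f x)"
      using K by (intro ext) (auto simp: indicator_def)
    moreover have "(\<lambda>x. indicator K x *\<^sub>R (indicator \<Omega> x *\<^sub>R f x)) \<in> borel_measurable lebesgue"
      using K by (intro borel_measurable_scaleR borel_measurable_indicator loc_bdd_meas f) (simp add: borel_compact)
    ultimately show "set_borel_measurable lebesgue K f" by (simp add: set_borel_measurable_def)
  qed (use f K in \<open>auto simp: loc_bdd_def\<close>)
  then show "set_integrable lebesgue K f"
    by (rule set_integrable_loc_bdd[of K f K]) (use K in auto)
qed

section \<open>Locally Lipschitz functions, differentiable off a closed null set\<close>

text \<open>N is a parameter and not quantified inside: the functions of one chart share it, and the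
  class is closed under algebra and composition without bookkeeping of null sets.\<close>

definition lipd :: "(real^'n::finite) set \<Rightarrow> (real^'n) set \<Rightarrow> (real^'n \<Rightarrow> real) \<Rightarrow> bool" where
  "lipd \<Omega> N u \<longleftrightarrow> (\<forall>x\<in>\<Omega>. \<exists>r>0. \<exists>L. cball x r \<subseteq> \<Omega> \<and> L-lipschitz_on (cball x r) u) \<and>
     (\<forall>x\<in>\<Omega>-N. u differentiable (at x))"

lemma lipd_differentiable: "lipd \<Omega> N u \<Longrightarrow> x \<in> \<Omega> \<Longrightarrow> x \<notin> N \<Longrightarrow> u differentiable (at x)"
  by (simp add: lipd_def)

lemma lipd_continuous:
  assumes "lipd \<Omega> N u" shows "continuous_on \<Omega> u"
proof (rule continuous_at_imp_continuous_on, rule ballI)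
  fix x assume "x \<in> \<Omega>"
  then obtain r L where r: "r > 0" "L-lipschitz_on (cball x r) u" using assms unfolding lipd_def by blast
  have "continuous_on (cball x r) u" using r(2) by (rule lipschitz_on_continuous_on)
  then have "continuous_on (ball x r) u" by (rule continuous_on_subset) auto
  then show "isCont u x" using r(1) by (simp add: continuous_on_eq_continuous_at)
qed

lemma lipd_loc_bdd: "open \<Omega> \<Longrightarrow> lipd \<Omega> N u \<Longrightarrow> loc_bdd \<Omega> u"
  by (rule loc_bdd_continuous[OF _ lipd_continuous])

lemma lipd_common:
  assumes "lipd \<Omega> N u" "lipd \<Omega> N v" "x \<in> \<Omega>"
  obtains r L M where "r > 0" "cball x r \<subseteq> \<Omega>" "L-lipschitz_on (cball x r) u" "M-lipschitz_on (cball x r) v"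
proof -
  obtain r L where r: "r > 0" "cball x r \<subseteq> \<Omega>" "L-lipschitz_on (cball x r) u" using assms unfolding lipd_def by blast
  obtain s M where s: "s > 0" "cball x s \<subseteq> \<Omega>" "M-lipschitz_on (cball x s) v" using assms unfolding lipd_def by blast
  have "cball x (min r s) \<subseteq> cball x r" "cball x (min r s) \<subseteq> cball x s" by auto
  then show ?thesis using that[of "min r s" L M] r s lipschitz_on_subset by (metis min_less_iff_conj subset_trans)
qed

lemma lipd_add:
  assumes u: "lipd \<Omega> N u" and v: "lipd \<Omega> N v" shows "lipd \<Omega> N (\<lambda>x. u x + v x)"
  unfolding lipd_def
proof (intro conjI ballI)
  fix x assume "x \<in> \<Omega>"
  then obtain r L M where "r > 0" "cball x r \<subseteq> \<Omega>" "L-lipschitz_on (cball x r) u" "M-lipschitz_on (cball x r) v"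
    using lipd_common[OF u v] by blast
  then show "\<exists>r>0. \<exists>L. cball x r \<subseteq> \<Omega> \<and> L-lipschitz_on (cball x r) (\<lambda>x. u x + v x)"
    using lipschitz_on_add by blast
qed (use u v in \<open>auto simp: lipd_def\<close>)

lemma lipschitz_on_mult_cball:
  fixes u v :: "'a::{real_normed_vector,heine_borel} \<Rightarrow> real"
  assumes u: "L-lipschitz_on (cball x r) u" and v: "M-lipschitz_on (cball x r) v" and r: "r > 0"
  shows "((\<bar>u x\<bar> + L * r) * M + (\<bar>v x\<bar> + M * r) * L)-lipschitz_on (cball x r) (\<lambda>y. u y * v y)"
proof (rule lipschitz_onI)
  have L: "L \<ge> 0" and M: "M \<ge> 0" using u v lipschitz_on_nonneg by blast+
  show "0 \<le> (\<bar>u x\<bar> + L * r) * M + (\<bar>v x\<bar> + M * r) * L" using L M r by simp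
  have bu: "\<bar>u y\<bar> \<le> \<bar>u x\<bar> + L * r" if "y \<in> cball x r" for y
  proof -
    have "dist (u y) (u x) \<le> L * dist y x" using lipschitz_onD[OF u that] r by auto
    also have "\<dots> \<le> L * r" using that L by (intro mult_left_mono) (auto simp: dist_commute)
    finally show ?thesis by (simp add: dist_real_def)
  qed
  have bv: "\<bar>v y\<bar> \<le> \<bar>v x\<bar> + M * r" if "y \<in> cball x r" for y
  proof -
    have "dist (v y) (v x) \<le> M * dist y x" using lipschitz_onD[OF v that] r by auto
    also have "\<dots> \<le> M * r" using that M by (intro mult_left_mono) (auto simp: dist_commute)
    finally show ?thesis by (simp add: dist_real_def)
  qed
  fix y z assume yz: "y \<in> cball x r" "z \<in> cball x r"
  have "dist (u y * v y) (u z * v z) = \<bar>u y * (v y - v z) + v z * (u y - u z)\<bar>"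
    by (simp add: dist_real_def algebra_simps)
  also have "\<dots> \<le> \<bar>u y\<bar> * \<bar>v y - v z\<bar> + \<bar>v z\<bar> * \<bar>u y - u z\<bar>"
    by (metis abs_mult abs_triangle_ineq)
  also have "\<dots> \<le> (\<bar>u x\<bar> + L * r) * (M * dist y z) + (\<bar>v x\<bar> + M * r) * (L * dist y z)"
    using lipschitz_onD[OF u yz] lipschitz_onD[OF v yz] bu[OF yz(1)] bv[OF yz(2)] L M r
    by (intro add_mono mult_mono) (auto simp: dist_real_def)
  finally show "dist (u y * v y) (u z * v z) \<le> ((\<bar>u x\<bar> + L * r) * M + (\<bar>v x\<bar> + M * r) * L) * dist y z"
    by (simp add: algebra_simps)
qed

lemma lipd_mult:
  assumes u: "lipd \<Omega> N u" and v: "lipd \<Omega> N v" shows "lipd \<Omega> N (\<lambda>x. u x * v x)"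
  unfolding lipd_def
proof (intro conjI ballI)
  fix x assume "x \<in> \<Omega>"
  then obtain r L M where r: "r > 0" "cball x r \<subseteq> \<Omega>" "L-lipschitz_on (cball x r) u" "M-lipschitz_on (cball x r) v"
    using lipd_common[OF u v] by blast
  then show "\<exists>r>0. \<exists>L. cball x r \<subseteq> \<Omega> \<and> L-lipschitz_on (cball x r) (\<lambda>x. u x * v x)"
    using lipschitz_on_mult_cball[OF r(3,4,1)] by blast
qed (use u v in \<open>auto simp: lipd_def\<close>)

lemma lipd_const: "open \<Omega> \<Longrightarrow> lipd \<Omega> N (\<lambda>_. c)"
  unfolding lipd_def open_contains_cball by (metis differentiable_const lipschitz_on_constant)

lemma lipd_cmult: "open \<Omega> \<Longrightarrow> lipd \<Omega> N u \<Longrightarrow> lipd \<Omega> N (\<lambda>x. c * u x)"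
  by (rule lipd_mult[OF lipd_const])

lemma lipd_sum:
  assumes "open \<Omega>" "\<And>a. a \<in> I \<Longrightarrow> lipd \<Omega> N (f a)" shows "lipd \<Omega> N (\<lambda>x. \<Sum>a\<in>I. f a x)"
  using assms(2) by (induction I rule: infinite_finite_induct) (auto intro: lipd_add lipd_const[OF assms(1)])

lemma lipd_prod:
  assumes "open \<Omega>" "\<And>a. a \<in> I \<Longrightarrow> lipd \<Omega> N (f a)" shows "lipd \<Omega> N (\<lambda>x. \<Prod>a\<in>I. f a x)"
  using assms(2) by (induction I rule: infinite_finite_induct) (auto intro: lipd_mult lipd_const[OF assms(1)])

lemma lipd_cong:
  assumes u: "lipd \<Omega> N u" and "open \<Omega>" and eq: "\<And>x. x \<in> \<Omega> \<Longrightarrow> u x = v x" shows "lipd \<Omega> N v"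
  unfolding lipd_def
proof (intro conjI ballI)
  fix x assume "x \<in> \<Omega>"
  then obtain r L where r: "r > 0" "cball x r \<subseteq> \<Omega>" "L-lipschitz_on (cball x r) u" using u unfolding lipd_def by blast
  have "L-lipschitz_on (cball x r) v" by (rule lipschitz_on_transform[OF r(3)]) (use eq r(2) in auto)
  then show "\<exists>r>0. \<exists>L. cball x r \<subseteq> \<Omega> \<and> L-lipschitz_on (cball x r) v" using r by blast
next
  fix x assume "x \<in> \<Omega> - N"
  then show "v differentiable (at x)"
    by (intro differentiable_cong[OF assms(2), of x u v]) (use eq lipd_differentiable[OF u] in auto)
qed

lemma lipd_subset:
  assumes u: "lipd \<Omega> N u" and "open T" "T \<subseteq> \<Omega>" shows "lipd T N u"
  unfolding lipd_def
proof (intro conjI ballI)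
  fix x assume x: "x \<in> T"
  then obtain r L where r: "r > 0" "cball x r \<subseteq> \<Omega>" "L-lipschitz_on (cball x r) u" using u assms(3) unfolding lipd_def by blast
  obtain s where s: "s > 0" "cball x s \<subseteq> T" using x assms(2) open_contains_cball by blast
  have "cball x (min r s) \<subseteq> cball x r" "cball x (min r s) \<subseteq> cball x s" by auto
  then show "\<exists>r>0. \<exists>L. cball x r \<subseteq> T \<and> L-lipschitz_on (cball x r) u"
    using r s lipschitz_on_subset by (metis min_less_iff_conj subset_trans)
qed (use u assms(3) in \<open>auto simp: lipd_def\<close>)

lemma has_derivative_onorm_le:
  fixes u :: "real^'n::finite \<Rightarrow> real"
  assumes "u differentiable (at x)" "\<And>i. \<bar>pd i u x\<bar> \<le> C"
  shows "onorm (\<lambda>v. \<Sum>i\<in>UNIV. v $ i * pd i u x) \<le> real CARD('n) * C"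
proof (rule onorm_le)
  fix v :: "real^'n"
  have "\<bar>\<Sum>i\<in>UNIV. v $ i * pd i u x\<bar> \<le> (\<Sum>i\<in>(UNIV::'n set). norm v * C)"
    by (rule order_trans[OF sum_abs], rule sum_mono)
       (auto simp: abs_mult component_le_norm_cart assms intro!: mult_mono)
  then show "norm (\<Sum>i\<in>UNIV. v $ i * pd i u x) \<le> real CARD('n) * C * norm v" by (simp add: mult_ac)
qed

lemma lipschitz_on_pd_bound:
  fixes u :: "real^'n::finite \<Rightarrow> real"
  assumes "convex S" "\<And>x. x \<in> S \<Longrightarrow> u differentiable (at x)" "\<And>x i. x \<in> S \<Longrightarrow> \<bar>pd i u x\<bar> \<le> C" "C \<ge> 0"
  shows "(real CARD('n) * C)-lipschitz_on S u"
proof (rule bounded_derivative_imp_lipschitz[OF _ assms(1)])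
  show "(u has_derivative (\<lambda>v. \<Sum>i\<in>UNIV. v $ i * pd i u x)) (at x within S)" if "x \<in> S" for x
    using has_derivative_pd[OF assms(2)[OF that]] by (rule has_derivative_at_withinI)
  show "onorm (\<lambda>v. \<Sum>i\<in>UNIV. v $ i * pd i u x) \<le> real CARD('n) * C" if "x \<in> S" for x
    by (rule has_derivative_onorm_le) (use assms that in auto)
qed (use assms(4) in simp)

text \<open>The partial derivatives are continuous, hence bounded on a closed ball, which is
  convex.\<close>

lemma Ck_on_lipd:
  fixes u :: "real^'n::finite \<Rightarrow> real"
  assumes "open \<Omega>" and u: "Ck_on 1 \<Omega> u" shows "lipd \<Omega> N u"
  unfolding lipd_def
proof (intro conjI ballI)
  fix x assume "x \<in> \<Omega>"
  then obtain r where r: "r > 0" "cball x r \<subseteq> \<Omega>" using assms(1) open_contains_cball by blast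
  have c: "continuous_on \<Omega> (pd i u)" for i using u by simp
  have "\<exists>C. \<forall>y\<in>cball x r. \<bar>pd i u y\<bar> \<le> C" for i
    using compact_imp_bounded[OF compact_continuous_image[OF continuous_on_subset[OF c r(2)] compact_cball]]
    by (metis bounded_real imageI)
  then obtain C where C: "\<And>i y. y \<in> cball x r \<Longrightarrow> \<bar>pd i u y\<bar> \<le> C i" by metis
  have "\<bar>pd i u y\<bar> \<le> (\<Sum>i\<in>UNIV. \<bar>C i\<bar>)" if "y \<in> cball x r" for i y
    using C[OF that, of i] member_le_sum[of i UNIV "\<lambda>i. \<bar>C i\<bar>"] by auto
  then have "(real CARD('n) * (\<Sum>i\<in>UNIV. \<bar>C i\<bar>))-lipschitz_on (cball x r) u"
    using u r(2) by (intro lipschitz_on_pd_bound) (auto intro: sum_nonneg)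
  then show "\<exists>r>0. \<exists>L. cball x r \<subseteq> \<Omega> \<and> L-lipschitz_on (cball x r) u" using r by blast
qed (use u in auto)

lemma smooth_on_lipd: "open \<Omega> \<Longrightarrow> smooth_on \<Omega> u \<Longrightarrow> lipd \<Omega> N u"
  by (rule Ck_on_lipd[OF _ smooth_on_CkD])

lemma lipd_vec:
  fixes h :: "real^'n::finite \<Rightarrow> real^'m::finite"
  assumes "\<And>j. lipd \<Omega> N (\<lambda>x. h x $ j)" "x \<in> \<Omega>"
  obtains r L where "r > 0" "cball x r \<subseteq> \<Omega>" "L-lipschitz_on (cball x r) h"
proof -
  have "\<forall>j. \<exists>r L. r > 0 \<and> cball x r \<subseteq> \<Omega> \<and> L-lipschitz_on (cball x r) (\<lambda>x. h x $ j)"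
    using assms unfolding lipd_def by blast
  then obtain r L where r: "\<And>j. r j > 0" "\<And>j. cball x (r j) \<subseteq> \<Omega>" "\<And>j. (L j)-lipschitz_on (cball x (r j)) (\<lambda>x. h x $ j)"
    by metis
  define s where "s = Min (range r)"
  have s: "s > 0" "\<And>j. s \<le> r j" using r(1) by (auto simp: s_def)
  have sub: "cball x s \<subseteq> cball x (r j)" for j using s(2)[of j] by (rule subset_cball)
  have "(\<Sum>j\<in>UNIV. L j)-lipschitz_on (cball x s) h"
  proof (rule lipschitz_onI)
    fix y z assume yz: "y \<in> cball x s" "z \<in> cball x s"
    have "dist (h y) (h z) \<le> (\<Sum>j\<in>UNIV. \<bar>(h y - h z) $ j\<bar>)"
      unfolding dist_norm by (rule norm_le_l1_cart)
    also have "\<dots> \<le> (\<Sum>j\<in>UNIV. L j * dist y z)"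
    proof (rule sum_mono)
      fix j show "\<bar>(h y - h z) $ j\<bar> \<le> L j * dist y z"
        using lipschitz_onD[OF r(3)[of j] subsetD[OF sub yz(1)] subsetD[OF sub yz(2)]] by (simp add: dist_real_def)
    qed
    finally show "dist (h y) (h z) \<le> (\<Sum>j\<in>UNIV. L j) * dist y z" by (simp add: sum_distrib_right)
  qed (use r(3) lipschitz_on_nonneg in \<open>blast intro: sum_nonneg\<close>)
  then show ?thesis using that[OF s(1)] sub r(2) by blast
qed

lemma lipd_compose:
  fixes h :: "real^'n::finite \<Rightarrow> real^'m::finite"
  assumes h: "\<And>j. lipd \<Omega> N (\<lambda>x. h x $ j)" and u: "lipd \<Omega>' N' u"
    and im: "\<And>x. x \<in> \<Omega> \<Longrightarrow> h x \<in> \<Omega>'" and N: "\<And>x. x \<in> \<Omega> - N \<Longrightarrow> h x \<notin> N'"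
  shows "lipd \<Omega> N (\<lambda>x. u (h x))"
  unfolding lipd_def
proof (intro conjI ballI)
  fix x assume x: "x \<in> \<Omega>"
  obtain s M where s: "s > 0" "M-lipschitz_on (cball (h x) s) u"
    using u im[OF x] unfolding lipd_def by blast
  obtain r L where r: "r > 0" "cball x r \<subseteq> \<Omega>" "L-lipschitz_on (cball x r) h"
    using lipd_vec[OF h x] by blast
  have L: "L \<ge> 0" using r(3) lipschitz_on_nonneg by blast
  \<comment> \<open>Dividing by L + 1 covers the case L = 0; then L t <= s, so h maps the small ball
    into the ball on which u is Lipschitz.\<close>
  define t where "t = min r (s / (L + 1))"
  have t: "t > 0" "t \<le> r" "t \<le> s / (L + 1)" using r s L by (auto simp: t_def)
  have "L * t \<le> (L + 1) * (s / (L + 1))" using t L by (intro mult_mono) auto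
  moreover have "(L + 1) * (s / (L + 1)) = s" using L by simp
  ultimately have Lt: "L * t \<le> s" by simp
  have sub: "cball x t \<subseteq> cball x r" using t(2) by (rule subset_cball)
  have hs: "h ` cball x t \<subseteq> cball (h x) s"
  proof safe
    fix y assume y: "y \<in> cball x t"
    have "dist (h x) (h y) \<le> L * dist x y" using lipschitz_onD[OF r(3), of x y] y sub r(1) by auto
    also have "\<dots> \<le> L * t" using y L by (intro mult_left_mono) auto
    finally show "h y \<in> cball (h x) s" using Lt by simp
  qed
  have "(M * L)-lipschitz_on (cball x t) (u \<circ> h)"
    by (rule lipschitz_on_compose[OF lipschitz_on_subset[OF r(3) sub] lipschitz_on_subset[OF s(2) hs]])
  then show "\<exists>r>0. \<exists>L. cball x r \<subseteq> \<Omega> \<and> L-lipschitz_on (cball x r) (\<lambda>x. u (h x))"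
    using t(1) sub r(2) unfolding comp_def by blast
next
  fix x assume x: "x \<in> \<Omega> - N"
  have "(\<lambda>x. h x $ j) differentiable (at x)" for j by (rule lipd_differentiable[OF h]) (use x in auto)
  moreover have "u differentiable (at (h x))"
    by (rule lipd_differentiable[OF u]) (use x im N in auto)
  ultimately show "(\<lambda>x. u (h x)) differentiable (at x)" by (rule differentiable_compose_pd)
qed

lemma lipd_compose_real:
  assumes u: "lipd \<Omega> N u" and F: "\<And>s. s \<in> D \<Longrightarrow> (F has_real_derivative F' s) (at s)"
    and F': "continuous_on D F'" and D: "open D" "\<And>x. x \<in> \<Omega> \<Longrightarrow> u x \<in> D"
  shows "lipd \<Omega> N (\<lambda>x. F (u x))"
  unfolding lipd_def
proof (intro conjI ballI)
  fix x assume x: "x \<in> \<Omega>"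
  obtain s where s: "s > 0" "cball (u x) s \<subseteq> D" using D x open_contains_cball by metis
  obtain C where C: "\<And>t. t \<in> cball (u x) s \<Longrightarrow> \<bar>F' t\<bar> \<le> C"
    using compact_imp_bounded[OF compact_continuous_image[OF continuous_on_subset[OF F' s(2)] compact_cball]]
    by (metis bounded_real imageI)
  have "\<bar>F' (u x)\<bar> \<le> C" using C[of "u x"] s(1) by simp
  then have "C \<ge> 0" by linarith
  have FL: "C-lipschitz_on (cball (u x) s) F"
  proof (rule bounded_derivative_imp_lipschitz[where f' = "\<lambda>t. (*) (F' t)"])
    show "(F has_derivative (*) (F' t)) (at t within cball (u x) s)" if "t \<in> cball (u x) s" for t
      using F[of t] that s(2) unfolding has_field_derivative_def by (blast intro: has_derivative_at_withinI)
    show "onorm ((*) (F' t)) \<le> C" if "t \<in> cball (u x) s" for t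
      by (rule onorm_le) (use C[OF that] in \<open>auto simp: abs_mult intro!: mult_right_mono\<close>)
  qed (use \<open>C \<ge> 0\<close> in auto)
  obtain r L where r: "r > 0" "cball x r \<subseteq> \<Omega>" "L-lipschitz_on (cball x r) u" using u x unfolding lipd_def by blast
  have L: "L \<ge> 0" using r(3) lipschitz_on_nonneg by blast
  define t where "t = min r (s / (L + 1))"
  have t: "t > 0" "t \<le> r" "t \<le> s / (L + 1)" using r s L by (auto simp: t_def)
  have "L * t \<le> (L + 1) * (s / (L + 1))" using t L by (intro mult_mono) auto
  moreover have "(L + 1) * (s / (L + 1)) = s" using L by simp
  ultimately have Lt: "L * t \<le> s" by simp
  have sub: "cball x t \<subseteq> cball x r" using t(2) by (rule subset_cball)
  have hs: "u ` cball x t \<subseteq> cball (u x) s"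
  proof safe
    fix y assume y: "y \<in> cball x t"
    have "dist (u x) (u y) \<le> L * dist x y" using lipschitz_onD[OF r(3), of x y] y sub r(1) by auto
    also have "\<dots> \<le> L * t" using y L by (intro mult_left_mono) auto
    finally show "u y \<in> cball (u x) s" using Lt by simp
  qed
  have "(C * L)-lipschitz_on (cball x t) (F \<circ> u)"
    by (rule lipschitz_on_compose[OF lipschitz_on_subset[OF r(3) sub] lipschitz_on_subset[OF FL hs]])
  then show "\<exists>r>0. \<exists>L. cball x r \<subseteq> \<Omega> \<and> L-lipschitz_on (cball x r) (\<lambda>x. F (u x))"
    using t(1) sub r(2) unfolding comp_def by blast
next
  fix x assume x: "x \<in> \<Omega> - N"
  show "(\<lambda>x. F (u x)) differentiable (at x)"
    by (rule pd_compose_real(2)[OF _ F]) (use x u D in \<open>auto simp: lipd_def\<close>)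
qed

lemma lipd_inverse:
  assumes "lipd \<Omega> N u" "\<And>x. x \<in> \<Omega> \<Longrightarrow> u x \<noteq> 0"
  shows "lipd \<Omega> N (\<lambda>x. inverse (u x))"
proof (rule lipd_compose_real[OF assms(1), where D = "- {0}" and F' = "\<lambda>s. - inverse (s^2)"])
  show "continuous_on (- {0}) (\<lambda>s::real. - inverse (s\<^sup>2))" by (auto intro!: continuous_intros)
qed (use assms(2) in \<open>auto intro!: derivative_eq_intros simp: power2_eq_square divide_inverse\<close>)

lemma lipd_sqrt:
  assumes "lipd \<Omega> N u" "\<And>x. x \<in> \<Omega> \<Longrightarrow> u x > 0"
  shows "lipd \<Omega> N (\<lambda>x. sqrt (u x))"
  by (rule lipd_compose_real[OF assms(1), where D = "{0<..}" and F' = "\<lambda>s. inverse (sqrt s) / 2"])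
     (use assms(2) in \<open>auto intro!: continuous_intros DERIV_real_sqrt\<close>)

text \<open>Away from zeros |u| is the square root of u^2, so no new points without derivative
  appear.\<close>

lemma lipd_abs:
  assumes "lipd \<Omega> N u" "\<And>x. x \<in> \<Omega> \<Longrightarrow> u x \<noteq> 0"
  shows "lipd \<Omega> N (\<lambda>x. \<bar>u x\<bar>)"
proof -
  have "lipd \<Omega> N (\<lambda>x. sqrt (u x * u x))"
    by (rule lipd_sqrt[OF lipd_mult[OF assms(1,1)]]) (use assms(2) in \<open>simp add: zero_less_mult_iff linorder_neq_iff\<close>, blast)
  then show ?thesis by simp
qed

section \<open>Difference quotients and partial derivatives of locally Lipschitz functions\<close>

lemma pd_line:
  fixes u :: "real^'n::finite \<Rightarrow> real"
  assumes "u differentiable (at x)"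
  shows "((\<lambda>s. u (x + s *\<^sub>R axis i 1)) has_real_derivative pd i u x) (at 0)"
proof -
  have "((\<lambda>s. x + s *\<^sub>R axis i 1) has_derivative (\<lambda>s. s *\<^sub>R axis i (1::real))) (at 0)"
    by (auto intro!: derivative_eq_intros)
  moreover have "(u has_derivative (\<lambda>v. \<Sum>j\<in>UNIV. v $ j * pd j u x)) (at (x + 0 *\<^sub>R axis i (1::real)))"
    using has_derivative_pd[OF assms] by simp
  ultimately have "((\<lambda>s. u (x + s *\<^sub>R axis i 1)) has_derivative (\<lambda>s. \<Sum>j\<in>UNIV. (s *\<^sub>R axis i (1::real)) $ j * pd j u x)) (at 0)"
    by (rule has_derivative_compose)
  moreover have "(\<Sum>j\<in>UNIV. (s *\<^sub>R axis i (1::real)) $ j * pd j u x) = pd i u x * s" for s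
  proof -
    have "(\<Sum>j\<in>UNIV. (s *\<^sub>R axis i (1::real)) $ j * pd j u x) = s * (\<Sum>j\<in>UNIV. axis i 1 $ j * pd j u x)"
      by (simp add: sum_distrib_left mult.assoc)
    then show ?thesis unfolding sum_axis by (simp add: mult.commute)
  qed
  ultimately show ?thesis unfolding has_field_derivative_def by simp
qed

lemma pd_difference_quotient:
  fixes u :: "real^'n::finite \<Rightarrow> real"
  assumes "u differentiable (at x)"
  shows "(\<lambda>n. (u (x + inverse (real (Suc n)) *\<^sub>R axis i 1) - u x) / inverse (real (Suc n))) \<longlonglongrightarrow> pd i u x"
proof -
  have "((\<lambda>h. (u (x + h *\<^sub>R axis i 1) - u x) / h) \<longlongrightarrow> pd i u x) (at 0)"
    using pd_line[OF assms, of i] by (simp add: DERIV_def)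
  moreover have "filterlim (\<lambda>n. inverse (real (Suc n))) (at 0) sequentially"
    by (intro filterlim_atI LIMSEQ_inverse_real_of_nat) auto
  ultimately show ?thesis by (rule filterlim_compose)
qed

lemma pd_lipschitz_bound:
  fixes u :: "real^'n::finite \<Rightarrow> real"
  assumes V: "open V" "x \<in> V" "L-lipschitz_on V u" and u: "u differentiable (at x)"
  shows "\<bar>pd i u x\<bar> \<le> L"
proof (rule LIMSEQ_le_const2[OF tendsto_rabs[OF pd_difference_quotient[OF u, of i]]])
  have "(\<lambda>n. x + inverse (real (Suc n)) *\<^sub>R axis i 1) \<longlonglongrightarrow> x + 0 *\<^sub>R axis i 1"
    by (intro tendsto_intros LIMSEQ_inverse_real_of_nat)
  then have "eventually (\<lambda>n. x + inverse (real (Suc n)) *\<^sub>R axis i 1 \<in> V) sequentially"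
    using V(1,2) by (auto simp: tendsto_def)
  then obtain M where M: "\<And>n. n \<ge> M \<Longrightarrow> x + inverse (real (Suc n)) *\<^sub>R axis i 1 \<in> V"
    by (auto simp: eventually_sequentially)
  have "\<bar>(u (x + inverse (real (Suc n)) *\<^sub>R axis i 1) - u x) / inverse (real (Suc n))\<bar> \<le> L" if "n \<ge> M" for n
  proof -
    have h: "inverse (real (Suc n)) > 0" by simp
    have "\<bar>u (x + inverse (real (Suc n)) *\<^sub>R axis i 1) - u x\<bar> \<le> L * inverse (real (Suc n))"
      using lipschitz_onD[OF V(3) M[OF that] V(2)] by (simp add: dist_real_def dist_norm norm_axis_1)
    then show ?thesis unfolding abs_divide abs_of_pos[OF h] pos_divide_le_eq[OF h] .
  qed
  then show "\<exists>M. \<forall>n\<ge>M. \<bar>(u (x + inverse (real (Suc n)) *\<^sub>R axis i 1) - u x) / inverse (real (Suc n))\<bar> \<le> L" by blast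
qed

lemma lipd_pd_bound:
  fixes u :: "real^'n::finite \<Rightarrow> real"
  assumes u: "lipd \<Omega> N u" and K: "compact K" "K \<subseteq> \<Omega>"
  obtains C where "C \<ge> 0" "\<And>x i. x \<in> K \<Longrightarrow> x \<notin> N \<Longrightarrow> \<bar>pd i u x\<bar> \<le> C"
proof -
  have "\<forall>x\<in>K. \<exists>r L. r > 0 \<and> cball x r \<subseteq> \<Omega> \<and> L-lipschitz_on (cball x r) u" using u K(2) unfolding lipd_def by blast
  then obtain r L where r: "\<And>x. x \<in> K \<Longrightarrow> r x > 0" "\<And>x. x \<in> K \<Longrightarrow> (L x)-lipschitz_on (cball x (r x)) u" by metis
  have "K \<subseteq> (\<Union>x\<in>K. ball x (r x))" using r(1) by auto
  then obtain F where F: "F \<subseteq> K" "finite F" "K \<subseteq> (\<Union>x\<in>F. ball x (r x))"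
    using compactE_image[OF K(1), of K "\<lambda>x. ball x (r x)"] by auto
  have "\<bar>pd i u y\<bar> \<le> (\<Sum>x\<in>F. \<bar>L x\<bar>)" if y: "y \<in> K" "y \<notin> N" for y i
  proof -
    obtain x where x: "x \<in> F" "y \<in> ball x (r x)" using F(3) y by auto
    have "(L x)-lipschitz_on (ball x (r x)) u"
      by (rule lipschitz_on_subset[OF r(2)]) (use x F ball_subset_cball in auto)
    then have "\<bar>pd i u y\<bar> \<le> L x"
      by (intro pd_lipschitz_bound[of "ball x (r x)"]) (use x y K lipd_differentiable[OF u] in auto)
    also have "\<dots> \<le> (\<Sum>x\<in>F. \<bar>L x\<bar>)" using member_le_sum[of x F "\<lambda>x. \<bar>L x\<bar>"] x F by auto
    finally show ?thesis .
  qed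
  then show ?thesis using that[of "\<Sum>x\<in>F. \<bar>L x\<bar>"] by (auto intro: sum_nonneg)
qed

lemma AE_notin_negligible: "negligible N \<Longrightarrow> AE x in lebesgue. x \<notin> N"
  by (rule AE_not_in) (simp add: negligible_iff_null_sets)

text \<open>Measurability comes from writing the derivative off N as a limit of difference quotients
  of a Borel function, the essential bound from the local Lipschitz constants.\<close>

lemma lipd_pd_loc_bdd:
  fixes u :: "real^'n::finite \<Rightarrow> real"
  assumes "open \<Omega>" "negligible N" and u: "lipd \<Omega> N u"
  shows "loc_bdd \<Omega> (pd i u)"
proof (rule loc_bddI)
  \<comment> \<open>The extension by 0 is Borel on the whole space, so its shifts are defined; at a
    point of the open set \<Omega> its quotients are those of u once the step is small.\<close>
  define w where "w x = indicator \<Omega> x *\<^sub>R u x" for x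
  have w: "w \<in> borel_measurable borel"
    unfolding w_def by (rule borel_measurable_continuous_on_indicator) (use assms lipd_continuous in auto)
  define h where "h n = inverse (real (Suc n))" for n
  define q where "q n x = indicator (\<Omega> - N) x * ((w (x + h n *\<^sub>R axis i 1) - w x) / h n)" for n x
  have m: "\<Omega> - N \<in> sets lebesgue"
    using assms by (intro sets.Diff) (auto simp: negligible_imp_sets)
  have "(\<lambda>x. w (x + h n *\<^sub>R axis i 1)) \<in> borel_measurable borel" for n
    by (rule measurable_compose[OF _ w]) simp
  then have "(\<lambda>x. (w (x + h n *\<^sub>R axis i 1) - w x) / h n) \<in> borel_measurable borel" for n
    using w by simp
  then have qm: "q n \<in> borel_measurable lebesgue" for n
    unfolding q_def[abs_def]
    by (intro borel_measurable_times borel_measurable_indicator m) (auto intro: measurable_completion)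
  have "(\<lambda>n. q n x) \<longlonglongrightarrow> indicator (\<Omega> - N) x *\<^sub>R pd i u x" for x
  proof (cases "x \<in> \<Omega> - N")
    case True
    have "(\<lambda>n. x + h n *\<^sub>R axis i 1) \<longlonglongrightarrow> x + 0 *\<^sub>R axis i 1"
      unfolding h_def by (intro tendsto_intros LIMSEQ_inverse_real_of_nat)
    then have "eventually (\<lambda>n. x + h n *\<^sub>R axis i 1 \<in> \<Omega>) sequentially"
      using assms(1) True by (auto simp: tendsto_def)
    then have ev: "eventually (\<lambda>n. (u (x + h n *\<^sub>R axis i 1) - u x) / h n = q n x) sequentially"
      by eventually_elim (use True in \<open>auto simp: q_def w_def\<close>)
    have "(\<lambda>n. (u (x + h n *\<^sub>R axis i 1) - u x) / h n) \<longlonglongrightarrow> pd i u x"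
      unfolding h_def by (rule pd_difference_quotient) (use True u in \<open>auto simp: lipd_def\<close>)
    then have "(\<lambda>n. q n x) \<longlonglongrightarrow> pd i u x" using ev by (rule Lim_transform_eventually)
    then show ?thesis using True by simp
  qed (simp add: q_def)
  then have "(\<lambda>x. indicator (\<Omega> - N) x *\<^sub>R pd i u x) \<in> borel_measurable lebesgue"
    by (rule borel_measurable_LIMSEQ_real[OF _ qm])
  moreover have "AE x in lebesgue. indicator \<Omega> x *\<^sub>R pd i u x = indicator (\<Omega> - N) x *\<^sub>R pd i u x"
    using AE_notin_negligible[OF assms(2)] by eventually_elim (auto simp: indicator_def)
  ultimately show "set_borel_measurable lebesgue \<Omega> (pd i u)"
    unfolding set_borel_measurable_def by (rule borel_measurable_lebesgue_AE)
next
  fix K :: "(real^'n) set" assume K: "compact K" "K \<subseteq> \<Omega>"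
  obtain C where C: "\<And>x i. x \<in> K \<Longrightarrow> x \<notin> N \<Longrightarrow> \<bar>pd i u x\<bar> \<le> C" using lipd_pd_bound[OF u K] by metis
  have "AE x in lebesgue. x \<in> K \<longrightarrow> \<bar>pd i u x\<bar> \<le> C"
    using AE_notin_negligible[OF assms(2)] by eventually_elim (use C in auto)
  then show "\<exists>C. AE x in lebesgue. x \<in> K \<longrightarrow> \<bar>pd i u x\<bar> \<le> C" by blast
qed

text \<open>Vanishing is required on \<Omega> only: coordinate expressions such as
  \<open>\<phi> (cinv c x)\<close> have arbitrary values outside the image of the chart.\<close>

definition lipc :: "(real^'n::finite) set \<Rightarrow> (real^'n) set \<Rightarrow> (real^'n \<Rightarrow> real) \<Rightarrow> bool" where
  "lipc \<Omega> N \<psi> \<longleftrightarrow> lipd \<Omega> N \<psi> \<and> (\<exists>K. compact K \<and> K \<subseteq> \<Omega> \<and> (\<forall>x\<in>\<Omega>-K. \<psi> x = 0))"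

lemma lipc_lipd: "lipc \<Omega> N \<psi> \<Longrightarrow> lipd \<Omega> N \<psi>"
  by (simp add: lipc_def)

lemma lipc_mult:
  assumes "lipd \<Omega> N u" "lipc \<Omega> N \<psi>" shows "lipc \<Omega> N (\<lambda>x. u x * \<psi> x)"
  using assms lipd_mult unfolding lipc_def by fastforce

lemma lipc_add:
  assumes u: "lipc \<Omega> N u" and v: "lipc \<Omega> N v" shows "lipc \<Omega> N (\<lambda>x. u x + v x)"
proof -
  obtain K L where "compact K" "K \<subseteq> \<Omega>" "\<forall>x\<in>\<Omega>-K. u x = 0" "compact L" "L \<subseteq> \<Omega>" "\<forall>x\<in>\<Omega>-L. v x = 0"
    using assms unfolding lipc_def by blast
  then have "compact (K \<union> L) \<and> K \<union> L \<subseteq> \<Omega> \<and> (\<forall>x\<in>\<Omega>-(K \<union> L). u x + v x = 0)" by auto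
  then show ?thesis unfolding lipc_def using lipd_add[OF lipc_lipd[OF u] lipc_lipd[OF v]] by blast
qed

lemma lipc_0: "open \<Omega> \<Longrightarrow> lipc \<Omega> N (\<lambda>_. 0)"
  unfolding lipc_def using lipd_const compact_empty by blast

lemma lipc_sum:
  assumes "open \<Omega>" "\<And>a. a \<in> I \<Longrightarrow> lipc \<Omega> N (f a)" shows "lipc \<Omega> N (\<lambda>x. \<Sum>a\<in>I. f a x)"
  using assms(2) by (induction I rule: infinite_finite_induct) (auto intro: lipc_add lipc_0[OF assms(1)])

lemma lipc_pd_vanish:
  assumes "open \<Omega>" "lipc \<Omega> N \<psi>"
  obtains K where "compact K" "K \<subseteq> \<Omega>" "\<And>x. x \<in> \<Omega> - K \<Longrightarrow> \<psi> x = 0" "\<And>x i. x \<in> \<Omega> - K \<Longrightarrow> pd i \<psi> x = 0"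
proof -
  obtain K where K: "compact K" "K \<subseteq> \<Omega>" "\<forall>x\<in>\<Omega>-K. \<psi> x = 0" using assms unfolding lipc_def by blast
  have "pd i \<psi> x = 0" if "x \<in> \<Omega> - K" for x i
  proof -
    have "pd i \<psi> x = pd i (\<lambda>_. 0) x"
      by (rule pd_cong[of "\<Omega> - K"]) (use that K assms(1) compact_imp_closed open_Diff in auto)
    then show ?thesis by simp
  qed
  then show ?thesis using that K by auto
qed

lemma lipc_integrable:
  assumes "open \<Omega>" "loc_bdd \<Omega> f" "lipc \<Omega> N \<psi>"
  shows "set_integrable lebesgue \<Omega> (\<lambda>x. f x * \<psi> x)"
proof -
  obtain K where K: "compact K" "K \<subseteq> \<Omega>" "\<And>x. x \<in> \<Omega> - K \<Longrightarrow> \<psi> x = 0" using lipc_pd_vanish[OF assms(1,3)] by metis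
  show ?thesis
    by (rule set_integrable_loc_bdd[OF loc_bdd_mult[OF assms(2) lipd_loc_bdd[OF assms(1) lipc_lipd[OF assms(3)]]] K(1,2)])
       (use K(3) in auto)
qed

lemma lipc_pd_integrable:
  assumes "open \<Omega>" "negligible N" "loc_bdd \<Omega> f" "lipc \<Omega> N \<psi>"
  shows "set_integrable lebesgue \<Omega> (\<lambda>x. f x * pd i \<psi> x)"
proof -
  obtain K where K: "compact K" "K \<subseteq> \<Omega>" "\<And>x. x \<in> \<Omega> - K \<Longrightarrow> pd i \<psi> x = 0" using lipc_pd_vanish[OF assms(1,4)] by metis
  show ?thesis
    by (rule set_integrable_loc_bdd[OF loc_bdd_mult[OF assms(3) lipd_pd_loc_bdd[OF assms(1,2) lipc_lipd[OF assms(4)]]] K(1,2)])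
       (use K(3) in auto)
qed

text \<open>The extension by 0 is locally Lipschitz everywhere, because a point outside \<Omega> has
  a neighbourhood that misses the compact set K; compactness of the ball makes the constant
  uniform.\<close>

lemma lipc_extend_lipschitz:
  fixes \<psi> :: "real^'n::finite \<Rightarrow> real"
  assumes "lipd \<Omega> N \<psi>" and K: "compact K" "K \<subseteq> \<Omega>" "\<forall>x\<in>\<Omega>-K. \<psi> x = 0"
  shows "\<exists>L. L-lipschitz_on (cball 0 R) (\<lambda>x. indicator \<Omega> x *\<^sub>R \<psi> x)"
proof -
  let ?w = "\<lambda>x. indicator \<Omega> x *\<^sub>R \<psi> x"
  \<comment> \<open>\<open>local_lipschitz\<close> speaks of functions of time and space; a single
    time turns it into a statement about \<open>?w\<close>.\<close>
  have "local_lipschitz {0::real} (cball 0 R) (\<lambda>_. ?w)"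
  proof (rule local_lipschitzI)
    fix t :: real and x :: "real^'n"
    have "\<exists>r>0. \<exists>L. L-lipschitz_on (cball x r) ?w"
    proof (cases "x \<in> \<Omega>")
      case True
      then obtain r L where r: "r > 0" "cball x r \<subseteq> \<Omega>" "L-lipschitz_on (cball x r) \<psi>" using assms(1) unfolding lipd_def by blast
      have "L-lipschitz_on (cball x r) ?w" by (rule lipschitz_on_transform[OF r(3)]) (use r(2) in auto)
      then show ?thesis using r by blast
    next
      case False
      then have "x \<in> - K" "open (- K)" using K compact_imp_closed by auto
      then obtain r where r: "r > 0" "cball x r \<subseteq> - K" using open_contains_cball by blast
      have "0-lipschitz_on (cball x r) ?w"
        by (rule lipschitz_on_transform[OF lipschitz_on_constant[of _ 0]]) (use r(2) K(3) in \<open>auto simp: indicator_def\<close>)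
      then show ?thesis using r by blast
    qed
    then obtain r L where r: "r > 0" "L-lipschitz_on (cball x r) ?w" by blast
    have "L-lipschitz_on (cball x r \<inter> cball 0 R) ?w" by (rule lipschitz_on_subset[OF r(2)]) auto
    then show "\<exists>u>0. \<exists>L. \<forall>t\<in>cball t u \<inter> {0}. L-lipschitz_on (cball x u \<inter> cball 0 R) ?w"
      using r(1) by blast
  qed
  from local_lipschitz_compact_implies_lipschitz[OF this, of thesis for thesis] show ?thesis
    by (metis compact_cball compact_sing continuous_on_const insertI1)
qed

text \<open>The difference quotients of a compactly supported Lipschitz function have integral zero and
  are dominated, so the almost everywhere derivative has integral zero as well.\<close>

lemma lipc_pd_integral:
  fixes \<psi> :: "real^'n::finite \<Rightarrow> real"
  assumes "open \<Omega>" "negligible N" "lipc \<Omega> N \<psi>"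
  shows "(LINT x:\<Omega>|lebesgue. pd i \<psi> x) = 0"
proof -
  have li: "lipd \<Omega> N \<psi>" using assms(3) by (rule lipc_lipd)
  obtain K where K: "compact K" "K \<subseteq> \<Omega>" "\<forall>x\<in>\<Omega>-K. \<psi> x = 0" using assms unfolding lipc_def by blast
  define w where "w x = indicator \<Omega> x *\<^sub>R \<psi> x" for x
  have w0: "w x = 0" if "x \<notin> K" for x using that K(3) by (auto simp: w_def indicator_def)
  obtain R where R: "\<And>x. x \<in> K \<Longrightarrow> norm x \<le> R" using compact_imp_bounded[OF K(1)] by (auto simp: bounded_iff)
  \<comment> \<open>The support lies in the ball of radius R and the steps are at most 1, so the
    quotients live on radius R+1 and compare values on radius R+2.\<close>
  obtain L where L: "L-lipschitz_on (cball 0 (R+2)) w"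
    using lipc_extend_lipschitz[OF li K, of "R+2"] unfolding w_def by blast
  have L0: "L \<ge> 0" using L lipschitz_on_nonneg by blast
  have wm: "w \<in> borel_measurable borel"
    unfolding w_def by (rule borel_measurable_continuous_on_indicator) (use assms li lipd_continuous in auto)
  have wi: "integrable lborel w"
  proof -
    have "integrable lborel (\<lambda>x. indicator (cball 0 (R+2)) x *\<^sub>R w x)"
      by (rule borel_integrable_compact) (use lipschitz_on_continuous_on[OF L] in auto)
    moreover have "(\<lambda>x. indicator (cball 0 (R+2)) x *\<^sub>R w x) = w"
      using w0 R by (force simp: indicator_def)
    ultimately show ?thesis by simp
  qed
  define h where "h n = inverse (real (Suc n))" for n
  have h: "h n > 0" "h n \<le> 1" for n by (auto simp: h_def inverse_le_1_iff)
  define q where "q n x = (w (x + h n *\<^sub>R axis i 1) - w x) / h n" for n x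
  have ti: "integrable lborel (\<lambda>x. w (x + c))" "(LINT x|lborel. w (x + c)) = (LINT x|lborel. w x)" for c
  proof -
    have e: "lborel = distr lborel borel (\<lambda>x. x + c)"
    proof -
      have "(\<lambda>x. x + c) = (+) c" by (auto simp: add.commute)
      then show ?thesis using lborel_distr_plus[of c] by simp
    qed
    have "integrable (distr lborel borel (\<lambda>x. x + c)) w" using wi e by simp
    then show "integrable lborel (\<lambda>x. w (x + c))" by (subst (asm) integrable_distr_eq) (use wm in auto)
    have "(LINT x|lborel. w x) = (LINT x|distr lborel borel (\<lambda>x. x + c). w x)" using e by simp
    also have "\<dots> = (LINT x|lborel. w (x + c))" by (subst integral_distr) (use wm in auto)
    finally show "(LINT x|lborel. w (x + c)) = (LINT x|lborel. w x)" by simp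
  qed
  have qm: "q n \<in> borel_measurable lborel" for n
  proof -
    have "(\<lambda>x. w (x + h n *\<^sub>R axis i 1)) \<in> borel_measurable borel"
      by (rule measurable_compose[OF _ wm]) simp
    then show ?thesis unfolding q_def[abs_def] using wm by simp
  qed
  have q0: "(LINT x|lebesgue. q n x) = 0" for n
  proof -
    have "(LINT x|lebesgue. q n x) = (LINT x|lborel. q n x)" by (rule integral_completion[OF qm])
    also have "\<dots> = 0" unfolding q_def using ti wi by simp
    finally show ?thesis .
  qed
  have qb: "\<bar>q n x\<bar> \<le> L * indicator (cball 0 (R+1)) x" for n x
  proof (cases "x \<in> cball 0 (R+1)")
    case True
    have "norm (x + h n *\<^sub>R axis i 1) \<le> norm x + norm (h n *\<^sub>R axis i (1::real))" by (rule norm_triangle_ineq)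
    also have "\<dots> \<le> R + 2" using True h[of n] by (simp add: norm_axis_1)
    finally have "x + h n *\<^sub>R axis i 1 \<in> cball 0 (R+2)" by (simp only: mem_cball_0)
    moreover have "x \<in> cball 0 (R+2)" using True by simp
    ultimately have "\<bar>w (x + h n *\<^sub>R axis i 1) - w x\<bar> \<le> L * h n"
      using lipschitz_onD[OF L, of "x + h n *\<^sub>R axis i 1" x] h[of n]
      by (simp add: dist_real_def dist_norm norm_axis_1)
    then show ?thesis using True h[of n] by (simp add: q_def field_simps)
  next
    case False
    have "norm x \<le> norm (x + h n *\<^sub>R axis i 1) + norm (h n *\<^sub>R axis i (1::real))" 
      using norm_triangle_ineq4[of "x + h n *\<^sub>R axis i 1" "h n *\<^sub>R axis i (1::real)"] by simp
    then have "norm (x + h n *\<^sub>R axis i 1) > R" using False h[of n] by (simp add: norm_axis_1)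
    then have "x + h n *\<^sub>R axis i 1 \<notin> K" "x \<notin> K" using R False by force+
    then show ?thesis using False by (simp add: q_def w0)
  qed
  have lim: "(\<lambda>n. q n x) \<longlonglongrightarrow> indicator \<Omega> x *\<^sub>R pd i \<psi> x" if "x \<notin> N" for x
  proof (cases "x \<in> \<Omega>")
    case True
    have "w differentiable (at x)"
      by (rule differentiable_cong[OF assms(1) True, of \<psi>]) (use True that li in \<open>auto simp: w_def lipd_def\<close>)
    then have "(\<lambda>n. q n x) \<longlonglongrightarrow> pd i w x" unfolding q_def h_def by (rule pd_difference_quotient)
    moreover have "pd i w x = pd i \<psi> x" by (rule pd_cong[OF assms(1) True]) (simp add: w_def)
    ultimately show ?thesis using True by simp
  next
    case False
    then have x: "x \<in> - K" and o: "open (- K)" using K compact_imp_closed by auto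
    have "w differentiable (at x)"
      by (rule differentiable_cong[OF o x, of "\<lambda>_. 0"]) (auto simp: w0)
    then have "(\<lambda>n. q n x) \<longlonglongrightarrow> pd i w x" unfolding q_def h_def by (rule pd_difference_quotient)
    moreover have "pd i w x = pd i (\<lambda>_. 0) x" by (rule pd_cong[OF o x]) (simp add: w0)
    ultimately show ?thesis using False by simp
  qed
  have "(\<lambda>n. LINT x|lebesgue. q n x) \<longlonglongrightarrow> (LINT x|lebesgue. indicator \<Omega> x *\<^sub>R pd i \<psi> x)"
  proof (rule integral_dominated_convergence[where w = "\<lambda>x. L * indicator (cball 0 (R+1)) x"])
    show "(\<lambda>x. indicator \<Omega> x *\<^sub>R pd i \<psi> x) \<in> borel_measurable lebesgue"
      using lipd_pd_loc_bdd[OF assms(1,2) li] by (rule loc_bdd_meas)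
    show "q n \<in> borel_measurable lebesgue" for n using qm by (rule measurable_completion)
    show "integrable lebesgue (\<lambda>x::real^'n. L * indicator (cball 0 (R+1)) x)"
      by (intro integrable_mult_right) (simp add: lmeasurable_iff_integrable[symmetric] lmeasurable_compact)
    show "AE x in lebesgue. (\<lambda>n. q n x) \<longlonglongrightarrow> indicator \<Omega> x *\<^sub>R pd i \<psi> x"
      using AE_notin_negligible[OF assms(2)] by eventually_elim (rule lim)
    show "AE x in lebesgue. norm (q n x) \<le> L * indicator (cball 0 (R+1)) x" for n
      using qb by simp
  qed
  then show ?thesis using q0 by (simp add: set_lebesgue_integral_def LIMSEQ_const_iff)
qed

text \<open>The product u \<psi> is again locally Lipschitz with compact support, so its derivative
  has integral 0; the product rule holds off N.\<close>

lemma lipc_by_parts: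
  fixes u \<psi> :: "real^'n::finite \<Rightarrow> real"
  assumes "open \<Omega>" "negligible N" "lipd \<Omega> N u" "lipc \<Omega> N \<psi>"
  shows "(LINT x:\<Omega>|lebesgue. u x * pd i \<psi> x) = - (LINT x:\<Omega>|lebesgue. pd i u x * \<psi> x)"
proof -
  have i1: "set_integrable lebesgue \<Omega> (\<lambda>x. u x * pd i \<psi> x)"
    by (rule lipc_pd_integrable[OF assms(1,2) lipd_loc_bdd[OF assms(1,3)] assms(4)])
  have i2: "set_integrable lebesgue \<Omega> (\<lambda>x. pd i u x * \<psi> x)"
    by (rule lipc_integrable[OF assms(1) lipd_pd_loc_bdd[OF assms(1,2,3)] assms(4)])
  have "0 = (LINT x:\<Omega>|lebesgue. pd i (\<lambda>x. u x * \<psi> x) x)"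
    using lipc_pd_integral[OF assms(1,2) lipc_mult[OF assms(3,4)]] by simp
  also have "\<dots> = (LINT x:\<Omega>|lebesgue. pd i u x * \<psi> x + u x * pd i \<psi> x)"
  unfolding set_lebesgue_integral_def
  proof (rule integral_cong_AE)
    show "AE x in lebesgue. indicator \<Omega> x *\<^sub>R pd i (\<lambda>x. u x * \<psi> x) x = indicator \<Omega> x *\<^sub>R (pd i u x * \<psi> x + u x * pd i \<psi> x)"
      using AE_notin_negligible[OF assms(2)]
      by eventually_elim (use assms(3) lipc_lipd[OF assms(4)] in \<open>auto simp: lipd_def indicator_def pd_mult\<close>)
    show "(\<lambda>x. indicator \<Omega> x *\<^sub>R pd i (\<lambda>x. u x * \<psi> x) x) \<in> borel_measurable lebesgue"
      by (rule loc_bdd_meas[OF lipd_pd_loc_bdd[OF assms(1,2) lipc_lipd[OF lipc_mult[OF assms(3,4)]]]])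
    show "(\<lambda>x. indicator \<Omega> x *\<^sub>R (pd i u x * \<psi> x + u x * pd i \<psi> x)) \<in> borel_measurable lebesgue"
      using set_integral_add(1)[OF i2 i1] unfolding set_integrable_def
      by (rule borel_measurable_integrable)
  qed
  also have "\<dots> = (LINT x:\<Omega>|lebesgue. pd i u x * \<psi> x) + (LINT x:\<Omega>|lebesgue. u x * pd i \<psi> x)"
    by (rule set_integral_add(2)[OF i2 i1])
  finally show ?thesis by simp
qed

section \<open>Weak derivatives of locally Lipschitz functions\<close>

lemma notin_supp: "x \<notin> supp \<phi> \<Longrightarrow> \<phi> x = 0"
  unfolding supp_def using closure_subset[of "{p. \<phi> p \<noteq> 0}"] by auto

lemma smooth_test_lipc:
  assumes "open \<Omega>" "smooth_on UNIV \<phi>" "compact (supp \<phi>)" "supp \<phi> \<subseteq> \<Omega>"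
  shows "lipc \<Omega> N \<phi>"
proof -
  have "lipd \<Omega> N \<phi>" by (rule lipd_subset[OF smooth_on_lipd[OF open_UNIV assms(2)] assms(1)]) simp
  moreover have "\<forall>x\<in>\<Omega> - supp \<phi>. \<phi> x = 0" using notin_supp by auto
  ultimately show ?thesis unfolding lipc_def using assms by blast
qed

lemma lipd_has_weak_pd:
  assumes "open \<Omega>" "negligible N" "lipd \<Omega> N u"
  shows "has_weak_pd \<Omega> i u (pd i u)"
  unfolding has_weak_pd_def
  using locally_integrable_loc_bdd[OF lipd_loc_bdd[OF assms(1,3)]]
    locally_integrable_loc_bdd[OF lipd_pd_loc_bdd[OF assms]]
    lipc_by_parts[OF assms smooth_test_lipc[OF assms(1)]] by simp

lemma locally_integrable_test:
  assumes f: "locally_integrable \<Omega> f" and "smooth_on UNIV \<phi>" "compact (supp \<phi>)" "supp \<phi> \<subseteq> \<Omega>"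
  shows "set_integrable lebesgue \<Omega> (\<lambda>x. f x * \<phi> x)"
proof -
  have c: "continuous_on UNIV \<phi>" using assms(2) by (rule smooth_on_continuous)
  obtain C where C: "\<And>x. x \<in> supp \<phi> \<Longrightarrow> \<bar>\<phi> x\<bar> \<le> C"
    using compact_imp_bounded[OF compact_continuous_image[OF continuous_on_subset[OF c] assms(3)]]
    by (metis bounded_real imageI subset_UNIV)
  have z: "\<phi> x = 0" if "x \<notin> supp \<phi>" for x using that by (rule notin_supp)
  have i: "integrable lebesgue (\<lambda>x. indicator (supp \<phi>) x *\<^sub>R f x)"
    using f assms(3,4) unfolding locally_integrable_def set_integrable_def by blast
  have "integrable lebesgue (\<lambda>x. \<phi> x * (indicator (supp \<phi>) x *\<^sub>R f x))"
  proof (rule Bochner_Integration.integrable_bound[OF integrable_mult_right[OF integrable_abs[OF i], of C]])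
    show "(\<lambda>x. \<phi> x * (indicator (supp \<phi>) x *\<^sub>R f x)) \<in> borel_measurable lebesgue"
      by (intro borel_measurable_times borel_measurable_integrable[OF i])
         (rule measurable_completion, simp add: borel_measurable_continuous_onI c)
    show "AE x in lebesgue. norm (\<phi> x * (indicator (supp \<phi>) x *\<^sub>R f x)) \<le> norm (C * \<bar>indicator (supp \<phi>) x *\<^sub>R f x\<bar>)"
      by (intro AE_I2) (use C in \<open>force simp: indicator_def abs_mult intro!: mult_right_mono\<close>)
  qed
  moreover have "\<phi> x * (indicator (supp \<phi>) x *\<^sub>R f x) = indicator \<Omega> x *\<^sub>R (f x * \<phi> x)" for x
    using z[of x] assms(4) by (auto simp: indicator_def)
  ultimately show ?thesis by (simp only: set_integrable_def)
qed

text \<open>Both candidates give the same functional on test functions, so the fundamental lemma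
  applies to their difference.\<close>

lemma has_weak_pd_unique:
  assumes "open \<Omega>" and d: "has_weak_pd \<Omega> i u d" and e: "has_weak_pd \<Omega> i u e"
  shows "AE x in lebesgue. x \<in> \<Omega> \<longrightarrow> d x = e x"
proof -
  have di: "locally_integrable \<Omega> d" and ei: "locally_integrable \<Omega> e" using d e by (auto simp: has_weak_pd_def)
  have "AE x in lebesgue. x \<in> \<Omega> \<longrightarrow> d x - e x = 0"
  proof (rule AE_zero_of_tests[OF assms(1)])
    show "locally_integrable \<Omega> (\<lambda>x. d x - e x)"
      using di ei unfolding locally_integrable_def by (intro allI impI set_integral_diff(1)) auto
    fix \<phi> :: "real^'a \<Rightarrow> real" assume p: "smooth_on UNIV \<phi>" "compact (supp \<phi>)" "supp \<phi> \<subseteq> \<Omega>"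
    have "(LINT x:\<Omega>|lebesgue. (d x - e x) * \<phi> x) = (LINT x:\<Omega>|lebesgue. d x * \<phi> x) - (LINT x:\<Omega>|lebesgue. e x * \<phi> x)"
      using set_integral_diff(2)[OF locally_integrable_test[OF di p] locally_integrable_test[OF ei p]]
      by (simp add: left_diff_distrib)
    also have "\<dots> = 0"
    proof -
      have "(LINT x:\<Omega>|lebesgue. u x * pd i \<phi> x) = - (LINT x:\<Omega>|lebesgue. d x * \<phi> x)"
        using d p unfolding has_weak_pd_def by blast
      moreover have "(LINT x:\<Omega>|lebesgue. u x * pd i \<phi> x) = - (LINT x:\<Omega>|lebesgue. e x * \<phi> x)"
        using e p unfolding has_weak_pd_def by blast
      ultimately show ?thesis by simp
    qed
    finally show "(LINT x:\<Omega>|lebesgue. (d x - e x) * \<phi> x) = 0" .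
  qed
  then show ?thesis by eventually_elim auto
qed

text \<open>\<open>weak_pd\<close> is a choice; existence and almost everywhere uniqueness are what
  tie it to the classical derivative.\<close>

lemma lipd_weak_pd_AE:
  assumes "open \<Omega>" "negligible N" "lipd \<Omega> N u"
  shows "AE x in lebesgue. x \<in> \<Omega> \<longrightarrow> weak_pd \<Omega> i u x = pd i u x"
proof -
  have "has_weak_pd \<Omega> i u (weak_pd \<Omega> i u)"
    unfolding weak_pd_def by (rule someI[of "has_weak_pd \<Omega> i u", OF lipd_has_weak_pd[OF assms]])
  then show ?thesis using has_weak_pd_unique[OF assms(1)] lipd_has_weak_pd[OF assms] by blast
qed

section \<open>Functions with bounded derivatives off a hypersurface\<close>

text \<open>Derivatives are taken on the open segment only; the endpoints, which may lie on the
  hypersurface, are covered by continuity. The factor \<open>CARD('n)\<close> comes from bounding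
  the directional derivative coordinate by coordinate.\<close>

lemma segment_bound:
  fixes u :: "real^'n::finite \<Rightarrow> real"
  assumes c: "continuous_on (closed_segment p q) u"
    and d: "\<And>x. x \<in> open_segment p q \<Longrightarrow> u differentiable (at x)"
    and b: "\<And>x i. x \<in> open_segment p q \<Longrightarrow> \<bar>pd i u x\<bar> \<le> C"
  shows "\<bar>u q - u p\<bar> \<le> real CARD('n) * C * norm (q - p)"
proof (cases "p = q")
  case False
  define f where "f t = u (p + t *\<^sub>R (q - p))" for t
  define f' where "f' t s = (\<Sum>i\<in>UNIV. (s *\<^sub>R (q - p)) $ i * pd i u (p + t *\<^sub>R (q - p)))" for t s
  have e: "p + t *\<^sub>R (q - p) = (1 - t) *\<^sub>R p + t *\<^sub>R q" for t by (simp add: algebra_simps)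
  have os: "p + t *\<^sub>R (q - p) \<in> open_segment p q" if "0 < t" "t < 1" for t
    using that False unfolding e in_segment by blast
  have "continuous_on {0..1} f" unfolding f_def
  proof (rule continuous_on_compose2[OF c])
    show "(\<lambda>t. p + t *\<^sub>R (q - p)) ` {0..1} \<subseteq> closed_segment p q"
      unfolding e closed_segment_def by auto
  qed (auto intro!: continuous_intros)
  moreover have "(f has_derivative f' t) (at t)" if "0 < t" "t < 1" for t
  proof -
    have "((\<lambda>t. p + t *\<^sub>R (q - p)) has_derivative (\<lambda>s. s *\<^sub>R (q - p))) (at t)"
      by (auto intro!: derivative_eq_intros)
    from has_derivative_compose[OF this has_derivative_pd[OF d[OF os[OF that]]]]
    show ?thesis by (simp add: f_def[abs_def] f'_def[abs_def])
  qed
  ultimately obtain t where t: "0 < t" "t < 1" "f 1 - f 0 = f' t (1 - 0)"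
    using mvt[of 0 1 f f'] by auto
  have "\<bar>f' t 1\<bar> \<le> (\<Sum>i\<in>(UNIV::'n set). norm (q - p) * C)" unfolding f'_def
    by (rule order_trans[OF sum_abs], rule sum_mono)
       (auto simp: abs_mult b[OF os[OF t(1,2)]] component_le_norm_cart[of "q - p", simplified] intro!: mult_mono)
  then show ?thesis using t(3) by (simp add: f_def mult_ac)
qed simp

text \<open>The opening 1/4 leaves room for a detour: from the midpoint of p and q one moves by |q -
  p| along n, which gives two segments of length at most 3/2 |q - p| and of n-component at least 1/2
  |q - p|. Their slope, at least 1/3, exceeds 1/4, and their lengths add up to the factor 3.\<close>

lemma cone_lipschitz:
  fixes u :: "real^'n::finite \<Rightarrow> real"
  assumes r: "r > 0" and n: "norm n = 1"
    and cone: "\<And>s t. s \<in> S \<inter> ball p0 r \<Longrightarrow> t \<in> S \<inter> ball p0 r \<Longrightarrow> \<bar>n \<bullet> (s - t)\<bar> \<le> norm (s - t) / 4"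
    and c: "continuous_on (ball p0 r) u"
    and d: "\<And>x. x \<in> ball p0 r - S \<Longrightarrow> u differentiable (at x)"
    and b: "\<And>x i. x \<in> ball p0 r - S \<Longrightarrow> \<bar>pd i u x\<bar> \<le> C" and C: "C \<ge> 0"
  shows "(3 * (real CARD('n) * C))-lipschitz_on (cball p0 (r/4)) u"
proof -
  define M where "M = real CARD('n) * C"
  have M: "M \<ge> 0" using C by (simp add: M_def)
  have sub: "closed_segment p q \<subseteq> ball p0 r" if "p \<in> ball p0 r" "q \<in> ball p0 r" for p q
    using that by (simp add: closed_segment_subset)
  have clear: "\<bar>u q - u p\<bar> \<le> M * norm (q - p)"
    if pq: "p \<in> ball p0 r" "q \<in> ball p0 r" and S: "open_segment p q \<inter> S = {}" for p q
    unfolding M_def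
  proof (rule segment_bound)
    show "continuous_on (closed_segment p q) u" using c sub[OF pq] by (rule continuous_on_subset)
    fix x assume "x \<in> open_segment p q"
    then have "x \<in> ball p0 r - S" using S sub[OF pq] segment_open_subset_closed by blast
    then show "u differentiable (at x)" "\<And>i. \<bar>pd i u x\<bar> \<le> C" using d b by auto
  qed
  have steep: "\<bar>u q - u p\<bar> \<le> M * norm (q - p)"
    if pq: "p \<in> ball p0 r" "q \<in> ball p0 r" and st: "\<bar>n \<bullet> (q - p)\<bar> > norm (q - p) / 4" for p q
  proof (cases "open_segment p q \<inter> S = {}")
    case True
    then show ?thesis by (rule clear[OF pq])
  next
    case False
    then obtain z where z: "z \<in> open_segment p q" "z \<in> S" by blast
    have zb: "z \<in> ball p0 r" using z(1) sub[OF pq] segment_open_subset_closed by blast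
    \<comment> \<open>Two points of S on the segment differ by a multiple of q - p, which is steeper
      than the cone condition allows.\<close>
    have uniq: "x = z" if x: "x \<in> closed_segment p q" "x \<in> S" for x
    proof (rule ccontr)
      assume ne: "x \<noteq> z"
      obtain a where a: "x = (1 - a) *\<^sub>R p + a *\<^sub>R q" using x(1) unfolding closed_segment_def by blast
      obtain b where b: "z = (1 - b) *\<^sub>R p + b *\<^sub>R q" using z(1) unfolding in_segment by blast
      have e: "x - z = (a - b) *\<^sub>R (q - p)" unfolding a b by (simp add: algebra_simps)
      then have ab: "a \<noteq> b" using ne by auto
      have "\<bar>n \<bullet> (x - z)\<bar> \<le> norm (x - z) / 4"
        by (rule cone) (use x z zb sub[OF pq] in auto)
      then have "\<bar>a - b\<bar> * \<bar>n \<bullet> (q - p)\<bar> \<le> \<bar>a - b\<bar> * (norm (q - p) / 4)"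
        unfolding e by (simp add: abs_mult)
      then show False using ab st by (simp add: mult_le_cancel_left)
    qed
    have zc: "z \<in> closed_segment p q" using z(1) segment_open_subset_closed by blast
    have "open_segment p z \<inter> S = {}"
    proof (rule ccontr)
      assume "open_segment p z \<inter> S \<noteq> {}"
      then obtain x where x: "x \<in> open_segment p z" "x \<in> S" by blast
      have "x \<in> closed_segment p z" using x(1) segment_open_subset_closed by blast
      then have "x \<in> closed_segment p q" using zc subset_closed_segment[of p z p q] by auto
      then show False using uniq[of x] x by (simp add: open_segment_def)
    qed
    moreover have "open_segment z q \<inter> S = {}"
    proof (rule ccontr)
      assume "open_segment z q \<inter> S \<noteq> {}"
      then obtain x where x: "x \<in> open_segment z q" "x \<in> S" by blast
      have "x \<in> closed_segment z q" using x(1) segment_open_subset_closed by blast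
      then have "x \<in> closed_segment p q" using zc subset_closed_segment[of z q p q] by auto
      then show False using uniq[of x] x by (simp add: open_segment_def)
    qed
    ultimately have "\<bar>u z - u p\<bar> \<le> M * norm (z - p)" "\<bar>u q - u z\<bar> \<le> M * norm (q - z)"
      using clear pq zb by auto
    then have "\<bar>u q - u p\<bar> \<le> M * (norm (z - p) + norm (q - z))" by (simp add: distrib_left)
    also have "norm (z - p) + norm (q - z) = norm (q - p)"
      using zc between[of p q z] unfolding between_mem_segment[symmetric] by (simp add: dist_norm norm_minus_commute)
    finally show ?thesis .
  qed
  have "\<bar>u p - u q\<bar> \<le> 3 * M * dist p q" if pq: "p \<in> cball p0 (r/4)" "q \<in> cball p0 (r/4)" for p q
  proof (cases "p = q")
    case False
    define e where "e = norm (q - p)"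
    have e: "e > 0" using False by (simp add: e_def)
    have er: "e \<le> r / 2"
    proof -
      have "dist p q \<le> dist p p0 + dist p0 q" by (rule dist_triangle)
      then show ?thesis using pq by (simp add: e_def dist_norm norm_minus_commute)
    qed
    define z where "z = (1/2) *\<^sub>R (p + q) + e *\<^sub>R n"
    have z1: "z - p = (1/2) *\<^sub>R (q - p) + e *\<^sub>R n" and z2: "z - q = - (1/2) *\<^sub>R (q - p) + e *\<^sub>R n"
      unfolding z_def by (simp_all add: vec_eq_iff field_simps)
    have nn: "n \<bullet> n = 1" using n by (simp add: norm_eq_1)
    have nq: "\<bar>n \<bullet> (q - p)\<bar> \<le> e" using Cauchy_Schwarz_ineq2[of n "q - p"] n by (simp add: e_def)
    have len: "norm (z - p) \<le> 3/2 * e" "norm (z - q) \<le> 3/2 * e"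
      unfolding z1 z2 using norm_triangle_ineq[of "(1/2) *\<^sub>R (q - p)" "e *\<^sub>R n"]
        norm_triangle_ineq[of "- (1/2) *\<^sub>R (q - p)" "e *\<^sub>R n"] e n by (auto simp: e_def)
    have ip: "n \<bullet> (z - p) \<ge> e / 2" "n \<bullet> (z - q) \<ge> e / 2"
      unfolding z1 z2 inner_add_right inner_scaleR_right nn using nq by auto
    have p: "p \<in> ball p0 r" and q: "q \<in> ball p0 r" using pq r by auto
    \<comment> \<open>The radius r/4 is made for this: the three terms are at most r/8, r/8 and
      r/2.\<close>
    have zb: "z \<in> ball p0 r"
    proof -
      have "z - p0 = (1/2) *\<^sub>R (p - p0) + ((1/2) *\<^sub>R (q - p0) + e *\<^sub>R n)"
        unfolding z_def by (simp add: vec_eq_iff field_simps)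
      then have "norm (z - p0) \<le> norm ((1/2) *\<^sub>R (p - p0)) + (norm ((1/2) *\<^sub>R (q - p0)) + norm (e *\<^sub>R n))"
        by (metis norm_triangle_le norm_triangle_ineq add_left_mono)
      also have "\<dots> \<le> r/8 + (r/8 + r/2)"
        using pq er e n by (intro add_mono) (auto simp: dist_norm norm_minus_commute)
      also have "\<dots> < r" using r by simp
      finally show ?thesis by (simp add: dist_norm norm_minus_commute)
    qed
    have "\<bar>u z - u p\<bar> \<le> M * norm (z - p)" "\<bar>u z - u q\<bar> \<le> M * norm (z - q)"
      using len ip e by (intro steep p q zb; linarith)+
    then have "\<bar>u p - u q\<bar> \<le> M * norm (z - p) + M * norm (z - q)" by linarith
    also have "\<dots> \<le> M * (3/2 * e) + M * (3/2 * e)" using len M by (intro add_mono mult_left_mono) auto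
    finally show ?thesis by (simp add: e_def dist_norm norm_minus_commute)
  qed simp
  then show ?thesis using M unfolding M_def by (intro lipschitz_onI) (auto simp: dist_real_def mult.assoc)
qed

text \<open>\<open>S\<close> is near every point of \<open>\<Omega>\<close> a Lipschitz graph over a hyperplane with normal \<open>n\<close>; a
  segment whose direction is close to \<open>n\<close> then meets \<open>S\<close> at most once.\<close>

definition flat_set :: "(real^'n::finite) set \<Rightarrow> (real^'n) set \<Rightarrow> bool" where
  "flat_set \<Omega> S \<longleftrightarrow> (\<forall>p\<in>\<Omega>. \<exists>r>0. \<exists>n. norm n = 1 \<and> ball p r \<subseteq> \<Omega> \<and>
     (\<forall>s\<in>S \<inter> ball p r. \<forall>t\<in>S \<inter> ball p r. \<bar>n \<bullet> (s - t)\<bar> \<le> norm (s - t) / 4))"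

lemma lipd_flat_set:
  fixes u :: "real^'n::finite \<Rightarrow> real"
  assumes S: "flat_set \<Omega> S" and c: "continuous_on \<Omega> u"
    and d: "\<And>x. x \<in> \<Omega> - S \<Longrightarrow> u differentiable (at x)"
    and b: "\<And>p. p \<in> \<Omega> \<Longrightarrow> \<exists>r>0. \<exists>C. \<forall>x\<in>ball p r - S. \<forall>i. \<bar>pd i u x\<bar> \<le> C"
  shows "lipd \<Omega> S u"
  unfolding lipd_def
proof (intro conjI ballI)
  fix p assume p: "p \<in> \<Omega>"
  obtain r n where r: "r > 0" "norm n = 1" "ball p r \<subseteq> \<Omega>"
    "\<forall>s\<in>S \<inter> ball p r. \<forall>t\<in>S \<inter> ball p r. \<bar>n \<bullet> (s - t)\<bar> \<le> norm (s - t) / 4"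
    using bspec[OF S[unfolded flat_set_def] p] by (elim exE conjE)
  obtain r' C where r': "r' > 0" "\<forall>x\<in>ball p r' - S. \<forall>i. \<bar>pd i u x\<bar> \<le> C" using b[OF p] by blast
  define \<rho> where "\<rho> = min r r'"
  have rho: "\<rho> > 0" "ball p \<rho> \<subseteq> ball p r" "ball p \<rho> \<subseteq> ball p r'" using r r' by (auto simp: \<rho>_def)
  \<comment> \<open>C may be negative if no point of the ball lies off S, while the cone lemma asks
    for a nonnegative bound.\<close>
  have "(3 * (real CARD('n) * max C 0))-lipschitz_on (cball p (\<rho>/4)) u"
  proof (rule cone_lipschitz[OF rho(1) r(2)])
    show "\<bar>n \<bullet> (s - t)\<bar> \<le> norm (s - t) / 4" if "s \<in> S \<inter> ball p \<rho>" "t \<in> S \<inter> ball p \<rho>" for s t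
      using r(4) that rho(2) by (meson IntD1 IntD2 IntI subsetD)
    show "continuous_on (ball p \<rho>) u" using c rho(2) r(3) by (meson continuous_on_subset order_trans)
    show "u differentiable (at x)" if "x \<in> ball p \<rho> - S" for x by (rule d) (use that rho(2) r(3) in auto)
    show "\<bar>pd i u x\<bar> \<le> max C 0" if "x \<in> ball p \<rho> - S" for x i
      using r'(2) that rho(3) by (meson DiffD1 DiffD2 DiffI le_max_iff_disj subsetD)
  qed simp
  moreover have "cball p (\<rho>/4) \<subseteq> \<Omega>"
  proof -
    have "cball p (\<rho>/4) \<subseteq> ball p \<rho>" using rho(1) by auto
    then show ?thesis using rho(2) r(3) by blast
  qed
  ultimately show "\<exists>r>0. \<exists>L. cball p r \<subseteq> \<Omega> \<and> L-lipschitz_on (cball p r) u"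
    using rho(1) by (intro exI[of _ "\<rho>/4"]) auto
qed (use d in auto)

text \<open>The derivative A at y0 is injective and its range is a proper subspace of the target, so
  a unit normal n exists. Near y0 the remainder Z = Y - A has Lipschitz constant m/8, where m bounds
  A from below. Hence |n . (Y y - Y z)| is at most |Z y - Z z|, and 8 |Z y - Z z| <= m |y - z| <= |Y
  y - Y z| + |Z y - Z z| gives even the ratio 1/7.\<close>

lemma immersion_flat:
  fixes Y :: "real^'m::finite \<Rightarrow> real^'n::finite"
  assumes "open D" "y0 \<in> D" and Y: "\<And>\<mu>. Ck_on 1 D (\<lambda>y. Y y $ \<mu>)"
    and inj: "inj (\<lambda>w. (\<chi> \<mu> i. pd i (\<lambda>y. Y y $ \<mu>) y0) *v w)" and card: "CARD('m) < CARD('n)"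
  shows "\<exists>\<rho>>0. \<exists>n. norm n = 1 \<and> ball y0 \<rho> \<subseteq> D \<and>
     (\<forall>y\<in>ball y0 \<rho>. \<forall>z\<in>ball y0 \<rho>. \<bar>n \<bullet> (Y y - Y z)\<bar> \<le> norm (Y y - Y z) / 4)"
proof -
  define A where "A = (\<chi> \<mu> i. pd i (\<lambda>y. Y y $ \<mu>) y0)"
  have lin: "linear ((*v) A)" by (rule matrix_vector_mul_linear)
  obtain m where m: "m > 0" "\<And>w. m * norm w \<le> norm (A *v w)"
    using linear_inj_bounded_below_pos[OF lin] inj unfolding A_def by (metis mult.commute)
  have "dim (range ((*v) A)) \<le> dim (UNIV :: (real^'m) set)" by (rule dim_image_le[OF lin])
  then have "dim (range ((*v) A)) < DIM(real^'n)" using card by (simp add: dim_UNIV)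
  then obtain v where v: "v \<noteq> 0" "\<And>w. orthogonal v (A *v w)"
    using orthogonal_to_subspace_exists[of "range ((*v) A)"] by (metis rangeI span_base)
  define n where "n = v /\<^sub>R norm v"
  have n: "norm n = 1" "\<And>w. n \<bullet> (A *v w) = 0" using v by (auto simp: n_def orthogonal_def)
  \<comment> \<open>Chosen so that summing over \<open>CARD('n)\<close> components, each with
    Lipschitz constant \<open>CARD('m) * \<eta>\<close>, gives m/8.\<close>
  define \<eta> where "\<eta> = m / (8 * real CARD('n) * real CARD('m))"
  have eta: "\<eta> > 0" using m by (simp add: \<eta>_def)
  define Z where "Z y = Y y - A *v y" for y
  have ev: "eventually (\<lambda>y. \<bar>pd i (\<lambda>y. Y y $ \<mu>) y - A $ \<mu> $ i\<bar> < \<eta>) (nhds y0)" for \<mu> i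
  proof -
    have "continuous_on D (pd i (\<lambda>y. Y y $ \<mu>))" using Y[of \<mu>] by simp
    then have "isCont (pd i (\<lambda>y. Y y $ \<mu>)) y0" using assms(1,2) by (simp add: continuous_on_eq_continuous_at)
    then have "(pd i (\<lambda>y. Y y $ \<mu>) \<longlongrightarrow> pd i (\<lambda>y. Y y $ \<mu>) y0) (nhds y0)"
      by (simp only: isCont_def tendsto_at_iff_tendsto_nhds)
    from tendstoD[OF this eta] show ?thesis by (simp add: dist_real_def A_def)
  qed
  have "eventually (\<lambda>y. \<forall>\<mu> i. \<bar>pd i (\<lambda>y. Y y $ \<mu>) y - A $ \<mu> $ i\<bar> < \<eta>) (nhds y0)"
    using ev by (simp add: eventually_all_finite)
  moreover have "eventually (\<lambda>y. y \<in> D) (nhds y0)" using assms(1,2) by (rule eventually_nhds_in_open)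
  ultimately have "eventually (\<lambda>y. y \<in> D \<and> (\<forall>\<mu> i. \<bar>pd i (\<lambda>y. Y y $ \<mu>) y - A $ \<mu> $ i\<bar> < \<eta>)) (nhds y0)"
    by eventually_elim auto
  then obtain \<rho> where rho: "\<rho> > 0" "\<And>y. y \<in> ball y0 \<rho> \<Longrightarrow> y \<in> D \<and> (\<forall>\<mu> i. \<bar>pd i (\<lambda>y. Y y $ \<mu>) y - A $ \<mu> $ i\<bar> < \<eta>)"
    unfolding eventually_nhds_metric by (auto simp: dist_commute)
  have Zlip: "(real CARD('m) * \<eta>)-lipschitz_on (ball y0 \<rho>) (\<lambda>y. Z y $ \<mu>)" for \<mu>
  proof (rule lipschitz_on_pd_bound)
    fix y assume y: "y \<in> ball y0 \<rho>"
    have dY: "(\<lambda>y. Y y $ \<mu>) differentiable (at y)" using Y[of \<mu>] rho(2)[OF y] by simp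
    have dc: "(\<lambda>y::real^'m. y $ j) differentiable (at y)" for j
      by (simp add: bounded_linear_imp_differentiable bounded_linear_vec_nth)
    have dA: "(\<lambda>y. \<Sum>j\<in>UNIV. A $ \<mu> $ j * y $ j) differentiable (at y)"
      by (rule differentiable_sum) (auto intro!: differentiable_mult differentiable_const dc)
    have e: "(\<lambda>y. Z y $ \<mu>) = (\<lambda>y. Y y $ \<mu> - (\<Sum>j\<in>UNIV. A $ \<mu> $ j * y $ j))"
      by (simp add: Z_def matrix_vector_mult_def)
    show "(\<lambda>y. Z y $ \<mu>) differentiable (at y)" unfolding e by (intro differentiable_diff dY dA)
    have "pd i (\<lambda>y. \<Sum>j\<in>UNIV. A $ \<mu> $ j * y $ j) y = (\<Sum>j\<in>UNIV. A $ \<mu> $ j * (if i = j then 1 else 0))" for i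
      by (subst pd_sum) (auto intro!: differentiable_mult differentiable_const dc sum.cong simp: pd_cmult[OF dc] pd_coord)
    then have "pd i (\<lambda>y. \<Sum>j\<in>UNIV. A $ \<mu> $ j * y $ j) y = A $ \<mu> $ i" for i by (simp add: if_distrib cong: if_cong)
    then show "\<bar>pd i (\<lambda>y. Z y $ \<mu>) y\<bar> \<le> \<eta>" for i
      unfolding e pd_diff[OF dY dA] using rho(2)[OF y] by (simp add: less_imp_le)
  qed (use eta in auto)
  have Zb: "norm (Z y - Z z) \<le> m / 8 * norm (y - z)" if yz: "y \<in> ball y0 \<rho>" "z \<in> ball y0 \<rho>" for y z
  proof -
    have "norm (Z y - Z z) \<le> (\<Sum>\<mu>\<in>UNIV. \<bar>(Z y - Z z) $ \<mu>\<bar>)" by (rule norm_le_l1_cart)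
    also have "\<dots> \<le> (\<Sum>\<mu>\<in>(UNIV::'n set). real CARD('m) * \<eta> * norm (y - z))"
      by (rule sum_mono) (use lipschitz_onD[OF Zlip yz] in \<open>simp add: dist_real_def dist_norm\<close>)
    also have "\<dots> = m / 8 * norm (y - z)" by (simp add: \<eta>_def)
    finally show ?thesis .
  qed
  have "\<bar>n \<bullet> (Y y - Y z)\<bar> \<le> norm (Y y - Y z) / 4" if yz: "y \<in> ball y0 \<rho>" "z \<in> ball y0 \<rho>" for y z
  proof -
    have e: "Y y - Y z = (Z y - Z z) + A *v (y - z)" by (simp add: Z_def matrix_vector_mult_diff_distrib)
    have "\<bar>n \<bullet> (Y y - Y z)\<bar> = \<bar>n \<bullet> (Z y - Z z)\<bar>" unfolding e inner_add_right n(2) by simp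
    also have "\<dots> \<le> norm (Z y - Z z)" using Cauchy_Schwarz_ineq2[of n "Z y - Z z"] n(1) by simp
    finally have 1: "\<bar>n \<bullet> (Y y - Y z)\<bar> \<le> norm (Z y - Z z)" .
    have "A *v (y - z) = (Y y - Y z) - (Z y - Z z)" unfolding e by simp
    then have "norm (A *v (y - z)) \<le> norm (Y y - Y z) + norm (Z y - Z z)" by (metis norm_triangle_ineq4)
    then have "m * norm (y - z) \<le> norm (Y y - Y z) + norm (Z y - Z z)" using m(2)[of "y - z"] by linarith
    then show ?thesis using 1 Zb[OF yz] by simp
  qed
  moreover have "ball y0 \<rho> \<subseteq> D" using rho(2) by blast
  ultimately show ?thesis using rho(1) n(1) by blast
qed

section \<open>Curvature of locally Lipschitz Lorentzian metrics\<close>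

lemma lorentzian_det_neg:
  fixes g :: "real^4^4"
  assumes "lorentzian g" shows "det g < 0"
proof -
  obtain P where P: "invertible P" "transpose P ** g ** P = minkowski" using assms by (auto simp: lorentzian_def)
  have "det minkowski = (\<Prod>i\<in>UNIV. minkowski $ i $ i)"
    by (rule det_diagonal) (simp add: minkowski_def)
  also have "\<dots> = (\<Prod>i\<in>UNIV. if i = (0::4) then -1 else 1)" by (simp add: minkowski_def)
  also have "\<dots> = -1" by simp
  finally have "det P * det g * det P = -1" unfolding P(2)[symmetric] by (simp add: det_mul)
  then have "det g * (det P)^2 < 0" by (simp add: power2_eq_square mult_ac)
  then show ?thesis by (simp add: mult_less_0_iff)
qed

text \<open>Congruence to \<open>minkowski\<close> carries its symmetry over: with the inverse Q of
  P, g is Q^T \<open>minkowski\<close> Q.\<close>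

lemma lorentzian_symmetric:
  fixes g :: "real^4^4"
  assumes "lorentzian g" shows "transpose g = g"
proof -
  obtain P where P: "invertible P" "transpose P ** g ** P = minkowski" using assms by (auto simp: lorentzian_def)
  obtain Q where Q: "P ** Q = mat 1" "Q ** P = mat 1" using P(1) by (auto simp: invertible_def)
  have TQ: "transpose Q ** transpose P = mat 1" using Q(1) by (metis matrix_transpose_mul transpose_mat)
  have "transpose Q ** (transpose P ** g ** P) ** Q = (transpose Q ** transpose P) ** g ** (P ** Q)"
    by (simp add: matrix_mul_assoc)
  then have g: "g = transpose Q ** minkowski ** Q" using P(2) Q(1) TQ by simp
  have "transpose minkowski = minkowski" by (simp add: minkowski_def transpose_def vec_eq_iff)
  then show ?thesis unfolding g by (simp add: matrix_transpose_mul matrix_mul_assoc)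
qed

section \<open>Regularity of determinants and inverse matrices\<close>

lemma matrix_inv_mult:
  fixes A :: "real^'n::finite^'n"
  assumes "det A \<noteq> 0"
  shows "A ** matrix_inv A = mat 1" "matrix_inv A ** A = mat 1"
proof -
  have "\<exists>B. A ** B = mat 1 \<and> B ** A = mat 1"
    using assms unfolding invertible_det_nz[symmetric] invertible_def .
  from someI_ex[OF this] show "A ** matrix_inv A = mat 1" "matrix_inv A ** A = mat 1"
    unfolding matrix_inv_def by auto
qed

text \<open>Cramer's rule exhibits the entries of the inverse as rational functions of the entries,
  through which Lipschitz continuity and continuity pass to inverse metrics.\<close>

lemma matrix_inv_cramer:
  fixes A :: "real^'n::finite^'n"
  assumes "det A \<noteq> 0"
  shows "matrix_inv A $ a $ b = det (\<chi> i j. if j = a then axis b 1 $ i else A $ i $ j) / det A"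
proof -
  have "A *v (matrix_inv A *v axis b 1) = axis b 1"
    by (simp add: matrix_vector_mul_assoc matrix_inv_mult[OF assms])
  then have "matrix_inv A *v axis b 1 = (\<chi> k. det (\<chi> i j. if j = k then axis b 1 $ i else A $ i $ j) / det A)"
    using cramer[OF assms] by blast
  moreover have "(matrix_inv A *v axis b 1) $ a = matrix_inv A $ a $ b"
    by (simp add: matrix_vector_mult_basis column_def)
  ultimately show ?thesis by simp
qed

lemma lipd_det:
  fixes A :: "real^'n::finite \<Rightarrow> real^'m::finite^'m"
  assumes "open \<Omega>" "\<And>i j. lipd \<Omega> N (\<lambda>x. A x $ i $ j)"
  shows "lipd \<Omega> N (\<lambda>x. det (A x))"
  unfolding det_def by (intro lipd_sum lipd_cmult lipd_prod assms)

lemma lipd_matrix_inv: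
  fixes A :: "real^'n::finite \<Rightarrow> real^'m::finite^'m"
  assumes "open \<Omega>" "\<And>i j. lipd \<Omega> N (\<lambda>x. A x $ i $ j)" "\<And>x. x \<in> \<Omega> \<Longrightarrow> det (A x) \<noteq> 0"
  shows "lipd \<Omega> N (\<lambda>x. matrix_inv (A x) $ a $ b)"
proof (rule lipd_cong[OF _ assms(1)])
  show "lipd \<Omega> N (\<lambda>x. det (\<chi> i j. if j = a then axis b 1 $ i else A x $ i $ j) * inverse (det (A x)))"
  proof (intro lipd_mult lipd_inverse lipd_det assms)
    show "lipd \<Omega> N (\<lambda>x. (\<chi> i j. if j = a then axis b 1 $ i else A x $ i $ j) $ i $ j)" for i j
      by (cases "j = a") (simp_all add: assms(2) lipd_const[OF assms(1)])
  qed
  show "det (\<chi> i j. if j = a then axis b 1 $ i else A x $ i $ j) * inverse (det (A x)) = matrix_inv (A x) $ a $ b"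
    if "x \<in> \<Omega>" for x
    using matrix_inv_cramer[OF assms(3)[OF that]] by (simp add: divide_inverse)
qed

text \<open>The Christoffel symbols with classical in place of weak derivatives; where the metric
  has no derivative the value is arbitrary. Unlike \<open>christoffel\<close> it does not refer to a
  domain, so it can be restricted to an overlap of charts.\<close>

definition chr :: "(real^4 \<Rightarrow> real^4^4) \<Rightarrow> 4 \<Rightarrow> 4 \<Rightarrow> 4 \<Rightarrow> real^4 \<Rightarrow> real" where
  "chr G a m n x = (1/2) * (\<Sum>b\<in>UNIV. matrix_inv (G x) $ a $ b *
     (pd m (\<lambda>x. G x $ b $ n) x + pd n (\<lambda>x. G x $ b $ m) x - pd b (\<lambda>x. G x $ m $ n) x))"

text \<open>The integrand of the Riemann functional, after the derivatives have been moved to the test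
  function.\<close>

definition rint :: "(real^4 \<Rightarrow> real^4^4) \<Rightarrow> 4 \<Rightarrow> 4 \<Rightarrow> 4 \<Rightarrow> 4 \<Rightarrow> (real^4 \<Rightarrow> real) \<Rightarrow> real^4 \<Rightarrow> real" where
  "rint G r s m n \<psi> x = chr G r m s x * pd n \<psi> x - chr G r n s x * pd m \<psi> x
     + (\<Sum>l\<in>UNIV. chr G r m l x * chr G l n s x - chr G r n l x * chr G l m s x) * \<psi> x"

definition ric_on :: "(real^4) set \<Rightarrow> (real^4 \<Rightarrow> real^4^4) \<Rightarrow> 4 \<Rightarrow> 4 \<Rightarrow> (real^4 \<Rightarrow> real) \<Rightarrow> real" where
  "ric_on W G m n \<psi> = (\<Sum>r\<in>UNIV. LINT x:W|lebesgue. rint G r m r n \<psi> x)"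

definition scal_on :: "(real^4) set \<Rightarrow> (real^4 \<Rightarrow> real^4^4) \<Rightarrow> (real^4 \<Rightarrow> real) \<Rightarrow> real" where
  "scal_on W G \<psi> = (\<Sum>a\<in>UNIV. \<Sum>b\<in>UNIV. ric_on W G a b (\<lambda>x. matrix_inv (G x) $ a $ b * \<psi> x))"

definition ein_on :: "(real^4) set \<Rightarrow> (real^4 \<Rightarrow> real^4^4) \<Rightarrow> 4 \<Rightarrow> 4 \<Rightarrow> (real^4 \<Rightarrow> real) \<Rightarrow> real" where
  "ein_on W G m n \<psi> = ric_on W G m n \<psi> - (1/2) * scal_on W G (\<lambda>x. G x $ m $ n * \<psi> x)"

section \<open>Functionals of order one with locally bounded coefficients\<close>

lemma set_integral_sum:
  fixes f :: "'k \<Rightarrow> 'b \<Rightarrow> real"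
  assumes "\<And>k. k \<in> I \<Longrightarrow> set_integrable M A (f k)"
  shows "set_integrable M A (\<lambda>x. \<Sum>k\<in>I. f k x)" "(LINT x:A|M. \<Sum>k\<in>I. f k x) = (\<Sum>k\<in>I. LINT x:A|M. f k x)"
proof -
  have "set_integrable M A (\<lambda>x. \<Sum>k\<in>I. f k x) \<and> (LINT x:A|M. \<Sum>k\<in>I. f k x) = (\<Sum>k\<in>I. LINT x:A|M. f k x)"
    using assms
  proof (induction I rule: infinite_finite_induct)
    case (insert k I)
    then show ?case using set_integral_add[of M A "f k" "\<lambda>x. \<Sum>k\<in>I. f k x"] by simp
  qed (simp_all add: set_integrable_def)
  then show "set_integrable M A (\<lambda>x. \<Sum>k\<in>I. f k x)" "(LINT x:A|M. \<Sum>k\<in>I. f k x) = (\<Sum>k\<in>I. LINT x:A|M. f k x)" by auto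
qed

text \<open>Distributions of order one with coefficients in L^\<infinity>_loc, in duality with
  compactly supported Lipschitz functions. Multiplication by Lipschitz functions preserves the
  class, which gives a meaning to contractions with the inverse metric and to the product of scalar
  curvature and metric.\<close>

definition first_order ::
    "(real^'n::finite) set \<Rightarrow> (real^'n) set \<Rightarrow> ((real^'n \<Rightarrow> real) \<Rightarrow> real) \<Rightarrow> bool" where
  "first_order \<Omega> N u \<longleftrightarrow> (\<exists>a b. loc_bdd \<Omega> a \<and> (\<forall>i. loc_bdd \<Omega> (b i)) \<and>
     (\<forall>\<psi>. lipc \<Omega> N \<psi> \<longrightarrow> u \<psi> = (LINT x:\<Omega>|lebesgue. a x * \<psi> x) + (\<Sum>i\<in>UNIV. LINT x:\<Omega>|lebesgue. b i x * pd i \<psi> x)))"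

lemma first_orderE:
  assumes "first_order \<Omega> N u"
  obtains a b where "loc_bdd \<Omega> a" "\<forall>i. loc_bdd \<Omega> (b i)"
    "\<forall>\<psi>. lipc \<Omega> N \<psi> \<longrightarrow> u \<psi> = (LINT x:\<Omega>|lebesgue. a x * \<psi> x) + (\<Sum>i\<in>UNIV. LINT x:\<Omega>|lebesgue. b i x * pd i \<psi> x)"
  using assms unfolding first_order_def by (elim exE conjE)

lemma first_order_add:
  assumes o: "open \<Omega>" "negligible N" and u: "first_order \<Omega> N u" and v: "first_order \<Omega> N v"
  shows "first_order \<Omega> N (\<lambda>\<psi>. u \<psi> + v \<psi>)"
proof -
  obtain a b where ab0: "loc_bdd \<Omega> a" "\<forall>i. loc_bdd \<Omega> (b i)"
    "\<forall>\<psi>. lipc \<Omega> N \<psi> \<longrightarrow> u \<psi> = (LINT x:\<Omega>|lebesgue. a x * \<psi> x) + (\<Sum>i\<in>UNIV. LINT x:\<Omega>|lebesgue. b i x * pd i \<psi> x)"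
    using u by (rule first_orderE)
  note ab = ab0(1) ab0(2)[rule_format] ab0(3)[rule_format]
  obtain c d where cd0: "loc_bdd \<Omega> c" "\<forall>i. loc_bdd \<Omega> (d i)"
    "\<forall>\<psi>. lipc \<Omega> N \<psi> \<longrightarrow> v \<psi> = (LINT x:\<Omega>|lebesgue. c x * \<psi> x) + (\<Sum>i\<in>UNIV. LINT x:\<Omega>|lebesgue. d i x * pd i \<psi> x)"
    using v by (rule first_orderE)
  note cd = cd0(1) cd0(2)[rule_format] cd0(3)[rule_format]
  show ?thesis unfolding first_order_def
  proof (intro exI conjI allI impI)
    show "loc_bdd \<Omega> (\<lambda>x. a x + c x)" by (rule loc_bdd_add[OF ab(1) cd(1)])
    show "loc_bdd \<Omega> (\<lambda>x. b i x + d i x)" for i by (rule loc_bdd_add[OF ab(2) cd(2)])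
    fix \<psi> assume p: "lipc \<Omega> N \<psi>"
    have 1: "(LINT x:\<Omega>|lebesgue. (a x + c x) * \<psi> x) = (LINT x:\<Omega>|lebesgue. a x * \<psi> x) + (LINT x:\<Omega>|lebesgue. c x * \<psi> x)"
      unfolding distrib_right by (rule set_integral_add(2)[OF lipc_integrable[OF o(1) ab(1) p] lipc_integrable[OF o(1) cd(1) p]])
    have 2: "(LINT x:\<Omega>|lebesgue. (b i x + d i x) * pd i \<psi> x) = (LINT x:\<Omega>|lebesgue. b i x * pd i \<psi> x) + (LINT x:\<Omega>|lebesgue. d i x * pd i \<psi> x)" for i
      unfolding distrib_right by (rule set_integral_add(2)[OF lipc_pd_integrable[OF o ab(2) p] lipc_pd_integrable[OF o cd(2) p]])
    show "u \<psi> + v \<psi> = (LINT x:\<Omega>|lebesgue. (a x + c x) * \<psi> x) + (\<Sum>i\<in>UNIV. LINT x:\<Omega>|lebesgue. (b i x + d i x) * pd i \<psi> x)"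
      unfolding 1 2 sum.distrib ab(3)[OF p] cd(3)[OF p] by simp
  qed
qed

lemma first_order_cmult:
  assumes o: "open \<Omega>" and u: "first_order \<Omega> N u"
  shows "first_order \<Omega> N (\<lambda>\<psi>. k * u \<psi>)"
proof -
  obtain a b where ab0: "loc_bdd \<Omega> a" "\<forall>i. loc_bdd \<Omega> (b i)"
    "\<forall>\<psi>. lipc \<Omega> N \<psi> \<longrightarrow> u \<psi> = (LINT x:\<Omega>|lebesgue. a x * \<psi> x) + (\<Sum>i\<in>UNIV. LINT x:\<Omega>|lebesgue. b i x * pd i \<psi> x)"
    using u by (rule first_orderE)
  note ab = ab0(1) ab0(2)[rule_format] ab0(3)[rule_format]
  show ?thesis unfolding first_order_def
  proof (intro exI conjI allI impI)
    show "loc_bdd \<Omega> (\<lambda>x. k * a x)" by (rule loc_bdd_cmult[OF o ab(1)])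
    show "loc_bdd \<Omega> (\<lambda>x. k * b i x)" for i by (rule loc_bdd_cmult[OF o ab(2)])
    fix \<psi> assume p: "lipc \<Omega> N \<psi>"
    show "k * u \<psi> = (LINT x:\<Omega>|lebesgue. k * a x * \<psi> x) + (\<Sum>i\<in>UNIV. LINT x:\<Omega>|lebesgue. k * b i x * pd i \<psi> x)"
      unfolding ab(3)[OF p] mult.assoc set_integral_mult_right sum_distrib_left[symmetric] distrib_left[symmetric] ..
  qed
qed

lemma first_order_0: "open \<Omega> \<Longrightarrow> first_order \<Omega> N (\<lambda>_. 0)"
  unfolding first_order_def by (intro exI[of _ "\<lambda>_. 0"] exI[of _ "\<lambda>_ _. 0"]) (simp add: loc_bdd_const)

lemma first_order_sum:
  assumes "open \<Omega>" "negligible N" "\<And>k. k \<in> I \<Longrightarrow> first_order \<Omega> N (u k)"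
  shows "first_order \<Omega> N (\<lambda>\<psi>. \<Sum>k\<in>I. u k \<psi>)"
  using assms(3) by (induction I rule: infinite_finite_induct) (auto intro: first_order_add[OF assms(1,2)] first_order_0[OF assms(1)])

text \<open>b \<partial>(f \<psi>) = (b \<partial>f) \<psi> + (b f) \<partial>\<psi>: the derivative
  of f joins the coefficient of order zero.\<close>

lemma first_order_mult:
  assumes o: "open \<Omega>" "negligible N" and u: "first_order \<Omega> N u" and f: "lipd \<Omega> N f"
  shows "first_order \<Omega> N (\<lambda>\<psi>. u (\<lambda>x. f x * \<psi> x))"
proof -
  obtain a b where ab0: "loc_bdd \<Omega> a" "\<forall>i. loc_bdd \<Omega> (b i)"
    "\<forall>\<psi>. lipc \<Omega> N \<psi> \<longrightarrow> u \<psi> = (LINT x:\<Omega>|lebesgue. a x * \<psi> x) + (\<Sum>i\<in>UNIV. LINT x:\<Omega>|lebesgue. b i x * pd i \<psi> x)"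
    using u by (rule first_orderE)
  note ab = ab0(1) ab0(2)[rule_format] ab0(3)[rule_format]
  have fb: "loc_bdd \<Omega> f" by (rule lipd_loc_bdd[OF o(1) f])
  have A1: "loc_bdd \<Omega> (\<lambda>x. b i x * pd i f x)" for i
    by (rule loc_bdd_mult[OF ab(2) lipd_pd_loc_bdd[OF o f]])
  have A2: "loc_bdd \<Omega> (\<lambda>x. \<Sum>i\<in>UNIV. b i x * pd i f x)" by (rule loc_bdd_sum[OF o(1) A1])
  have B: "loc_bdd \<Omega> (\<lambda>x. b i x * f x)" for i by (rule loc_bdd_mult[OF ab(2) fb])
  have A3: "loc_bdd \<Omega> (\<lambda>x. a x * f x)" by (rule loc_bdd_mult[OF ab(1) fb])
  show ?thesis unfolding first_order_def
  proof (intro exI conjI allI impI)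
    show "loc_bdd \<Omega> (\<lambda>x. a x * f x + (\<Sum>i\<in>UNIV. b i x * pd i f x))" by (rule loc_bdd_add[OF A3 A2])
    show "loc_bdd \<Omega> (\<lambda>x. b i x * f x)" for i by (rule B)
    fix \<psi> assume p: "lipc \<Omega> N \<psi>"
    have e: "(LINT x:\<Omega>|lebesgue. b i x * pd i (\<lambda>x. f x * \<psi> x) x) =
       (LINT x:\<Omega>|lebesgue. (b i x * pd i f x) * \<psi> x) + (LINT x:\<Omega>|lebesgue. (b i x * f x) * pd i \<psi> x)" for i
    proof -
      have i1: "set_integrable lebesgue \<Omega> (\<lambda>x. (b i x * pd i f x) * \<psi> x)" by (rule lipc_integrable[OF o(1) A1 p])
      have i2: "set_integrable lebesgue \<Omega> (\<lambda>x. (b i x * f x) * pd i \<psi> x)" by (rule lipc_pd_integrable[OF o B p])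
      have i3: "set_integrable lebesgue \<Omega> (\<lambda>x. b i x * pd i (\<lambda>x. f x * \<psi> x) x)" by (rule lipc_pd_integrable[OF o ab(2) lipc_mult[OF f p]])
      have "(LINT x:\<Omega>|lebesgue. b i x * pd i (\<lambda>x. f x * \<psi> x) x) =
        (LINT x:\<Omega>|lebesgue. (b i x * pd i f x) * \<psi> x + (b i x * f x) * pd i \<psi> x)"
        unfolding set_lebesgue_integral_def
      proof (rule integral_cong_AE)
        show "AE x in lebesgue. indicator \<Omega> x *\<^sub>R (b i x * pd i (\<lambda>x. f x * \<psi> x) x) =
           indicator \<Omega> x *\<^sub>R ((b i x * pd i f x) * \<psi> x + (b i x * f x) * pd i \<psi> x)"
          using AE_notin_negligible[OF o(2)]
          by eventually_elim (use f lipc_lipd[OF p] in \<open>auto simp: lipd_def indicator_def pd_mult algebra_simps\<close>)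
      qed (use i3 set_integral_add(1)[OF i1 i2] in \<open>auto simp only: set_integrable_def dest: borel_measurable_integrable\<close>)
      also have "\<dots> = (LINT x:\<Omega>|lebesgue. (b i x * pd i f x) * \<psi> x) + (LINT x:\<Omega>|lebesgue. (b i x * f x) * pd i \<psi> x)"
        by (rule set_integral_add(2)[OF i1 i2])
      finally show ?thesis .
    qed
    have "(LINT x:\<Omega>|lebesgue. (a x * f x + (\<Sum>i\<in>UNIV. b i x * pd i f x)) * \<psi> x) =
       (LINT x:\<Omega>|lebesgue. (a x * f x) * \<psi> x) + (LINT x:\<Omega>|lebesgue. (\<Sum>i\<in>UNIV. b i x * pd i f x) * \<psi> x)"
      unfolding distrib_right by (rule set_integral_add(2)[OF lipc_integrable[OF o(1) A3 p] lipc_integrable[OF o(1) A2 p]])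
    also have "(LINT x:\<Omega>|lebesgue. (\<Sum>i\<in>UNIV. b i x * pd i f x) * \<psi> x) = (\<Sum>i\<in>UNIV. LINT x:\<Omega>|lebesgue. (b i x * pd i f x) * \<psi> x)"
      unfolding sum_distrib_right by (rule set_integral_sum(2)) (auto intro: lipc_integrable[OF o(1) A1 p])
    finally show "u (\<lambda>x. f x * \<psi> x) = (LINT x:\<Omega>|lebesgue. (a x * f x + (\<Sum>i\<in>UNIV. b i x * pd i f x)) * \<psi> x)
       + (\<Sum>i\<in>UNIV. LINT x:\<Omega>|lebesgue. b i x * f x * pd i \<psi> x)"
      unfolding ab(3)[OF lipc_mult[OF f p]] e sum.distrib by (simp add: mult.assoc)
  qed
qed

lemma first_order_linear:
  assumes o: "open \<Omega>" "negligible N" and u: "first_order \<Omega> N u" and p: "lipc \<Omega> N p" and q: "lipc \<Omega> N q"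
  shows "u (\<lambda>x. k * p x + l * q x) = k * u p + l * u q"
proof -
  obtain a b where ab0: "loc_bdd \<Omega> a" "\<forall>i. loc_bdd \<Omega> (b i)"
    "\<forall>\<psi>. lipc \<Omega> N \<psi> \<longrightarrow> u \<psi> = (LINT x:\<Omega>|lebesgue. a x * \<psi> x) + (\<Sum>i\<in>UNIV. LINT x:\<Omega>|lebesgue. b i x * pd i \<psi> x)"
    using u by (rule first_orderE)
  note ab = ab0(1) ab0(2)[rule_format] ab0(3)[rule_format]
  have kp: "lipc \<Omega> N (\<lambda>x. k * p x)" and lq: "lipc \<Omega> N (\<lambda>x. l * q x)"
    by (rule lipc_mult[OF lipd_const[OF o(1)] p], rule lipc_mult[OF lipd_const[OF o(1)] q])
  have kl: "lipc \<Omega> N (\<lambda>x. k * p x + l * q x)" by (rule lipc_add[OF kp lq])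
  have 1: "(LINT x:\<Omega>|lebesgue. a x * (k * p x + l * q x)) = k * (LINT x:\<Omega>|lebesgue. a x * p x) + l * (LINT x:\<Omega>|lebesgue. a x * q x)"
    unfolding distrib_left set_integral_add(2)[OF lipc_integrable[OF o(1) ab(1) kp] lipc_integrable[OF o(1) ab(1) lq]]
    by (simp only: mult.left_commute[of "a _"] set_integral_mult_right)
  have 2: "(LINT x:\<Omega>|lebesgue. b i x * pd i (\<lambda>x. k * p x + l * q x) x) =
     k * (LINT x:\<Omega>|lebesgue. b i x * pd i p x) + l * (LINT x:\<Omega>|lebesgue. b i x * pd i q x)" for i
  proof -
    have i1: "set_integrable lebesgue \<Omega> (\<lambda>x. k * (b i x * pd i p x))"
      by (intro set_integrable_mult_right lipc_pd_integrable[OF o ab(2) p])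
    have i2: "set_integrable lebesgue \<Omega> (\<lambda>x. l * (b i x * pd i q x))"
      by (intro set_integrable_mult_right lipc_pd_integrable[OF o ab(2) q])
    have i3: "set_integrable lebesgue \<Omega> (\<lambda>x. b i x * pd i (\<lambda>x. k * p x + l * q x) x)"
      by (rule lipc_pd_integrable[OF o ab(2) kl])
    have "(LINT x:\<Omega>|lebesgue. b i x * pd i (\<lambda>x. k * p x + l * q x) x) =
        (LINT x:\<Omega>|lebesgue. k * (b i x * pd i p x) + l * (b i x * pd i q x))"
      unfolding set_lebesgue_integral_def
    proof (rule integral_cong_AE)
      show "AE x in lebesgue. indicator \<Omega> x *\<^sub>R (b i x * pd i (\<lambda>x. k * p x + l * q x) x) =
           indicator \<Omega> x *\<^sub>R (k * (b i x * pd i p x) + l * (b i x * pd i q x))"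
        using AE_notin_negligible[OF o(2)]
      proof eventually_elim
        fix x assume x: "x \<notin> N"
        show "indicator \<Omega> x *\<^sub>R (b i x * pd i (\<lambda>x. k * p x + l * q x) x) =
           indicator \<Omega> x *\<^sub>R (k * (b i x * pd i p x) + l * (b i x * pd i q x))"
        proof (cases "x \<in> \<Omega>")
          case True
          have d: "p differentiable (at x)" "q differentiable (at x)"
            "(\<lambda>x. k * p x) differentiable (at x)" "(\<lambda>x. l * q x) differentiable (at x)"
            using lipd_differentiable[OF lipc_lipd[OF p] True x] lipd_differentiable[OF lipc_lipd[OF q] True x]
              lipd_differentiable[OF lipc_lipd[OF kp] True x] lipd_differentiable[OF lipc_lipd[OF lq] True x] by auto
          show ?thesis by (simp add: pd_add[OF d(3,4)] pd_cmult[OF d(1)] pd_cmult[OF d(2)] algebra_simps)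
        qed simp
      qed
    qed (use i3 set_integral_add(1)[OF i1 i2] in \<open>auto simp only: set_integrable_def dest: borel_measurable_integrable\<close>)
    also have "\<dots> = k * (LINT x:\<Omega>|lebesgue. b i x * pd i p x) + l * (LINT x:\<Omega>|lebesgue. b i x * pd i q x)"
      unfolding set_integral_add(2)[OF i1 i2] set_integral_mult_right ..
    finally show ?thesis .
  qed
  show ?thesis unfolding ab(3)[OF kl] ab(3)[OF p] ab(3)[OF q] 1 2 sum.distrib sum_distrib_left[symmetric]
    by (simp add: algebra_simps)
qed

text \<open>Used to contract indices: a sum of values with different multipliers becomes one value
  at the summed argument, which can then be simplified pointwise.\<close>

lemma first_order_sum_arg:
  assumes o: "open \<Omega>" "negligible N" and u: "first_order \<Omega> N u" and p: "\<And>k. k \<in> I \<Longrightarrow> lipc \<Omega> N (p k)"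
  shows "u (\<lambda>x. \<Sum>k\<in>I. p k x) = (\<Sum>k\<in>I. u (p k))"
proof -
  have z: "u (\<lambda>_. 0) = 0" using first_order_linear[OF o u lipc_0[OF o(1)] lipc_0[OF o(1)], of 0 0] by simp
  show ?thesis using p
  proof (induction I rule: infinite_finite_induct)
    case (insert k I)
    have "u (\<lambda>x. 1 * p k x + 1 * (\<Sum>k\<in>I. p k x)) = 1 * u (p k) + 1 * u (\<lambda>x. \<Sum>k\<in>I. p k x)"
      by (rule first_order_linear[OF o u]) (auto intro!: lipc_sum[OF o(1)] insert.prems)
    then show ?case using insert by simp
  qed (auto simp: z)
qed

lemma set_integral_bound:
  fixes f :: "real^'n::finite \<Rightarrow> real"
  assumes f: "loc_bdd \<Omega> f" and K: "compact K" "K \<subseteq> \<Omega>"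
  shows "\<exists>C. C \<ge> 0 \<and> (\<forall>h S. (AE x in lebesgue. x \<in> \<Omega> \<longrightarrow> \<bar>h x\<bar> \<le> S * indicator K x) \<longrightarrow> S \<ge> 0 \<longrightarrow>
     \<bar>LINT x:\<Omega>|lebesgue. f x * h x\<bar> \<le> C * S)"
proof -
  obtain B where B: "B \<ge> 0" "AE x in lebesgue. x \<in> K \<longrightarrow> \<bar>f x\<bar> \<le> B" using loc_bdd_bound[OF f K] by blast
  have Ki: "integrable lebesgue (\<lambda>x. indicator K x :: real)"
    using K by (simp add: lmeasurable_compact flip: lmeasurable_iff_integrable)
  have "\<bar>LINT x:\<Omega>|lebesgue. f x * h x\<bar> \<le> (B * measure lebesgue K) * S"
    if h: "AE x in lebesgue. x \<in> \<Omega> \<longrightarrow> \<bar>h x\<bar> \<le> S * indicator K x" and S: "S \<ge> 0" for h S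
  proof -
    have "\<bar>LINT x:\<Omega>|lebesgue. f x * h x\<bar> \<le> (LINT x|lebesgue. (B * S) * indicator K x)"
      unfolding set_lebesgue_integral_def real_norm_def[symmetric]
    proof (rule order_trans[OF integral_norm_bound integral_mono_AE'])
      show "AE x in lebesgue. norm (indicator \<Omega> x *\<^sub>R (f x * h x)) \<le> (B * S) * indicator K x"
        using B(2) h
      proof eventually_elim
        fix x assume x: "x \<in> K \<longrightarrow> \<bar>f x\<bar> \<le> B" "x \<in> \<Omega> \<longrightarrow> \<bar>h x\<bar> \<le> S * indicator K x"
        show "norm (indicator \<Omega> x *\<^sub>R (f x * h x)) \<le> (B * S) * indicator K x"
          using x B(1) S K(2) by (cases "x \<in> \<Omega>"; cases "x \<in> K") (auto simp: abs_mult intro!: mult_mono)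
      qed
    qed (use Ki B(1) S in \<open>auto intro!: AE_I2 mult_nonneg_nonneg\<close>)
    also have "\<dots> = (B * measure lebesgue K) * S" using K by (simp add: lmeasurable_compact mult_ac)
    finally show ?thesis .
  qed
  then show ?thesis using B(1) by (intro exI[of _ "B * measure lebesgue K"] conjI allI impI) simp_all
qed

text \<open>One constant serves all arguments supported in K. The bound S is asked for off N, where
  the derivatives exist.\<close>

lemma first_order_bound:
  fixes u :: "(real^'n::finite \<Rightarrow> real) \<Rightarrow> real"
  assumes o: "open \<Omega>" "negligible N" and u: "first_order \<Omega> N u" and K: "compact K" "K \<subseteq> \<Omega>"
  shows "\<exists>C. C \<ge> 0 \<and> (\<forall>\<psi> S. lipc \<Omega> N \<psi> \<longrightarrow> (\<forall>x\<in>\<Omega> - K. \<psi> x = 0) \<longrightarrow>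
     (\<forall>x\<in>\<Omega> - N. \<bar>\<psi> x\<bar> \<le> S \<and> (\<forall>i. \<bar>pd i \<psi> x\<bar> \<le> S)) \<longrightarrow> S \<ge> 0 \<longrightarrow> \<bar>u \<psi>\<bar> \<le> C * S)"
proof -
  obtain a b where ab0: "loc_bdd \<Omega> a" "\<forall>i. loc_bdd \<Omega> (b i)"
    "\<forall>\<psi>. lipc \<Omega> N \<psi> \<longrightarrow> u \<psi> = (LINT x:\<Omega>|lebesgue. a x * \<psi> x) + (\<Sum>i\<in>UNIV. LINT x:\<Omega>|lebesgue. b i x * pd i \<psi> x)"
    using u by (rule first_orderE)
  note ab = ab0(1) ab0(2)[rule_format] ab0(3)[rule_format]
  obtain C where C0: "C \<ge> 0 \<and> (\<forall>h S. (AE x in lebesgue. x \<in> \<Omega> \<longrightarrow> \<bar>h x\<bar> \<le> S * indicator K x) \<longrightarrow> S \<ge> 0 \<longrightarrow>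
     \<bar>LINT x:\<Omega>|lebesgue. a x * h x\<bar> \<le> C * S)" using set_integral_bound[OF ab(1) K] by (rule exE)
  note C = C0[THEN conjunct1] C0[THEN conjunct2, rule_format]
  have "\<forall>i. \<exists>D. D \<ge> 0 \<and> (\<forall>h S. (AE x in lebesgue. x \<in> \<Omega> \<longrightarrow> \<bar>h x\<bar> \<le> S * indicator K x) \<longrightarrow> S \<ge> 0 \<longrightarrow>
     \<bar>LINT x:\<Omega>|lebesgue. b i x * h x\<bar> \<le> D * S)"
    by (rule allI, rule set_integral_bound[OF ab(2) K])
  from choice[OF this] obtain D where D0: "\<forall>i. D i \<ge> 0 \<and> (\<forall>h S. (AE x in lebesgue. x \<in> \<Omega> \<longrightarrow> \<bar>h x\<bar> \<le> S * indicator K x) \<longrightarrow> S \<ge> 0 \<longrightarrow>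
     \<bar>LINT x:\<Omega>|lebesgue. b i x * h x\<bar> \<le> D i * S)" by (rule exE)
  note D = D0[rule_format, THEN conjunct1] D0[rule_format, THEN conjunct2, rule_format]
  have "\<bar>u \<psi>\<bar> \<le> (C + (\<Sum>i\<in>UNIV. D i)) * S"
    if p: "lipc \<Omega> N \<psi>" and z: "\<And>x. x \<in> \<Omega> - K \<Longrightarrow> \<psi> x = 0" and S: "\<And>x. x \<in> \<Omega> - N \<Longrightarrow> \<bar>\<psi> x\<bar> \<le> S"
      "\<And>x i. x \<in> \<Omega> - N \<Longrightarrow> \<bar>pd i \<psi> x\<bar> \<le> S" "S \<ge> 0" for \<psi> S
  proof -
    have oK: "open (\<Omega> - K)" using o(1) K(1) by (simp add: compact_imp_closed open_Diff)
    have z': "pd i \<psi> x = 0" if "x \<in> \<Omega> - K" for x i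
    proof -
      have "pd i \<psi> x = pd i (\<lambda>_. 0) x" by (rule pd_cong[OF oK that z])
      then show ?thesis by simp
    qed
    have 1: "\<bar>LINT x:\<Omega>|lebesgue. a x * \<psi> x\<bar> \<le> C * S"
    proof (rule C(2)[OF _ S(3)])
      show "AE x in lebesgue. x \<in> \<Omega> \<longrightarrow> \<bar>\<psi> x\<bar> \<le> S * indicator K x"
        using AE_notin_negligible[OF o(2)] by eventually_elim (use z S in \<open>auto simp: indicator_def\<close>)
    qed
    have 2: "\<bar>LINT x:\<Omega>|lebesgue. b i x * pd i \<psi> x\<bar> \<le> D i * S" for i
    proof (rule D(2)[OF _ S(3)])
      show "AE x in lebesgue. x \<in> \<Omega> \<longrightarrow> \<bar>pd i \<psi> x\<bar> \<le> S * indicator K x"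
        using AE_notin_negligible[OF o(2)] by eventually_elim (use z' S in \<open>auto simp: indicator_def\<close>)
    qed
    have "\<bar>u \<psi>\<bar> \<le> \<bar>LINT x:\<Omega>|lebesgue. a x * \<psi> x\<bar> + (\<Sum>i\<in>UNIV. \<bar>LINT x:\<Omega>|lebesgue. b i x * pd i \<psi> x\<bar>)"
      unfolding ab(3)[OF p] by (rule order_trans[OF abs_triangle_ineq add_left_mono[OF sum_abs]])
    also have "\<dots> \<le> C * S + (\<Sum>i\<in>UNIV. D i * S)" by (intro add_mono sum_mono 1 2)
    finally show ?thesis by (simp add: distrib_right sum_distrib_right)
  qed
  then show ?thesis using C(1) D(1)
    by (intro exI[of _ "C + (\<Sum>i\<in>UNIV. D i)"] conjI allI impI) (simp_all add: sum_nonneg)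
qed

lemma first_order_cong:
  assumes "first_order \<Omega> N v" "\<And>\<psi>. lipc \<Omega> N \<psi> \<Longrightarrow> u \<psi> = v \<psi>"
  shows "first_order \<Omega> N u"
proof -
  obtain a b where ab: "loc_bdd \<Omega> a" "\<forall>i. loc_bdd \<Omega> (b i)"
    "\<forall>\<psi>. lipc \<Omega> N \<psi> \<longrightarrow> v \<psi> = (LINT x:\<Omega>|lebesgue. a x * \<psi> x) + (\<Sum>i\<in>UNIV. LINT x:\<Omega>|lebesgue. b i x * pd i \<psi> x)"
    using assms(1) by (rule first_orderE)
  show ?thesis unfolding first_order_def
    by (rule exI[of _ a], rule exI[of _ b]) (use ab assms(2) in auto)
qed

lemma first_order_fn:
  assumes "open \<Omega>" "loc_bdd \<Omega> f"
  shows "first_order \<Omega> N (\<lambda>\<psi>. LINT x:\<Omega>|lebesgue. f x * \<psi> x)"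
  unfolding first_order_def
  by (rule exI[of _ f], rule exI[of _ "\<lambda>_ _. 0"]) (simp add: assms loc_bdd_const)

lemma first_order_pd:
  assumes "open \<Omega>" "loc_bdd \<Omega> f"
  shows "first_order \<Omega> N (\<lambda>\<psi>. LINT x:\<Omega>|lebesgue. f x * pd i \<psi> x)"
proof -
  have e: "(\<Sum>j\<in>UNIV. LINT x:\<Omega>|lebesgue. (if j = i then f x else 0) * pd j \<psi> x) = (LINT x:\<Omega>|lebesgue. f x * pd i \<psi> x)" for \<psi>
  proof -
    have "(LINT x:\<Omega>|lebesgue. (if j = i then f x else 0) * pd j \<psi> x) = (if j = i then LINT x:\<Omega>|lebesgue. f x * pd i \<psi> x else 0)" for j
      by simp
    then show ?thesis by simp
  qed
  have "loc_bdd \<Omega> (\<lambda>x. if j = i then f x else 0)" for j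
    by (cases "j = i") (simp_all add: assms loc_bdd_const)
  then show ?thesis unfolding first_order_def
    by (intro exI[of _ "\<lambda>_. 0"] exI[of _ "\<lambda>j x. if j = i then f x else 0"]) (simp add: e loc_bdd_const[OF assms(1)])
qed

text \<open>A Lorentzian metric in coordinates, with the regularity that the jump conditions yield.
  W is the image of a chart or of an overlap of charts.\<close>

locale lip_metric =
  fixes W N :: "(real^4) set" and G :: "real^4 \<Rightarrow> real^4^4"
  assumes open_W: "open W" and null_N: "negligible N"
    and lip_G: "lipd W N (\<lambda>x. G x $ m $ n)"
    and lor: "x \<in> W \<Longrightarrow> lorentzian (G x)"
begin

lemma det_G: "x \<in> W \<Longrightarrow> det (G x) \<noteq> 0"
  using lorentzian_det_neg[OF lor] by fastforce

lemma lip_inv: "lipd W N (\<lambda>x. matrix_inv (G x) $ a $ b)"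
  by (rule lipd_matrix_inv[OF open_W lip_G det_G])

lemma loc_bdd_pd: "lipd W N u \<Longrightarrow> loc_bdd W (pd i u)"
  by (rule lipd_pd_loc_bdd[OF open_W null_N])

lemma loc_bdd_lip: "lipd W N u \<Longrightarrow> loc_bdd W u"
  by (rule lipd_loc_bdd[OF open_W])

lemma loc_bdd_chr: "loc_bdd W (chr G a m n)"
proof -
  have "loc_bdd W (\<lambda>x. (1/2) * (\<Sum>b\<in>UNIV. matrix_inv (G x) $ a $ b *
     (pd m (\<lambda>x. G x $ b $ n) x + pd n (\<lambda>x. G x $ b $ m) x - pd b (\<lambda>x. G x $ m $ n) x)))"
    by (intro loc_bdd_cmult loc_bdd_sum loc_bdd_mult loc_bdd_diff loc_bdd_add loc_bdd_pd[OF lip_G] loc_bdd_lip[OF lip_inv] open_W)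
  then show ?thesis by (simp add: chr_def[abs_def])
qed

lemma christoffel_AE: "AE x in lebesgue. x \<in> W \<longrightarrow> christoffel W G a m n x = chr G a m n x"
proof -
  have w: "AE x in lebesgue. \<forall>i m n. x \<in> W \<longrightarrow> weak_pd W i (\<lambda>x. G x $ m $ n) x = pd i (\<lambda>x. G x $ m $ n) x"
    unfolding AE_all_countable by (intro allI lipd_weak_pd_AE[OF open_W null_N lip_G])
  then show ?thesis
  proof eventually_elim
    fix x assume "\<forall>i m n. x \<in> W \<longrightarrow> weak_pd W i (\<lambda>x. G x $ m $ n) x = pd i (\<lambda>x. G x $ m $ n) x"
    then show "x \<in> W \<longrightarrow> christoffel W G a m n x = chr G a m n x"
      unfolding christoffel_def chr_def by simp
  qed
qed

lemma loc_bdd_christoffel: "loc_bdd W (christoffel W G a m n)"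
  by (rule loc_bdd_cong_AE[OF loc_bdd_chr christoffel_AE])

definition quad :: "4 \<Rightarrow> 4 \<Rightarrow> 4 \<Rightarrow> 4 \<Rightarrow> real^4 \<Rightarrow> real" where
  "quad r s m n x = (\<Sum>l\<in>UNIV. chr G r m l x * chr G l n s x - chr G r n l x * chr G l m s x)"

lemma loc_bdd_quad: "loc_bdd W (quad r s m n)"
  unfolding quad_def[abs_def]
  by (intro loc_bdd_sum loc_bdd_diff loc_bdd_mult loc_bdd_chr open_W)

lemma rint_integrals:
  assumes p: "lipc W N \<psi>"
  shows "set_integrable lebesgue W (rint G r s m n \<psi>)"
    "(LINT x:W|lebesgue. rint G r s m n \<psi> x) = (LINT x:W|lebesgue. chr G r m s x * pd n \<psi> x)
      + (- 1) * (LINT x:W|lebesgue. chr G r n s x * pd m \<psi> x) + (LINT x:W|lebesgue. quad r s m n x * \<psi> x)"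
proof -
  have 1: "set_integrable lebesgue W (\<lambda>x. chr G r m s x * pd n \<psi> x)" for r m s n
    by (rule lipc_pd_integrable[OF open_W null_N loc_bdd_chr p])
  have 2: "set_integrable lebesgue W (\<lambda>x. quad r s m n x * \<psi> x)"
    by (rule lipc_integrable[OF open_W loc_bdd_quad p])
  have e: "rint G r s m n \<psi> = (\<lambda>x. chr G r m s x * pd n \<psi> x - chr G r n s x * pd m \<psi> x + quad r s m n x * \<psi> x)"
    by (simp add: rint_def quad_def fun_eq_iff)
  show "set_integrable lebesgue W (rint G r s m n \<psi>)"
    unfolding e by (rule set_integral_add(1)[OF set_integral_diff(1)[OF 1 1] 2])
  show "(LINT x:W|lebesgue. rint G r s m n \<psi> x) = (LINT x:W|lebesgue. chr G r m s x * pd n \<psi> x)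
      + (- 1) * (LINT x:W|lebesgue. chr G r n s x * pd m \<psi> x) + (LINT x:W|lebesgue. quad r s m n x * \<psi> x)"
    unfolding e set_integral_add(2)[OF set_integral_diff(1)[OF 1 1] 2] set_integral_diff(2)[OF 1 1] by simp
qed

lemma first_order_rint: "first_order W N (\<lambda>\<psi>. LINT x:W|lebesgue. rint G r s m n \<psi> x)"
  by (rule first_order_cong[OF _ rint_integrals(2)])
     (intro first_order_add first_order_cmult first_order_pd first_order_fn open_W null_N loc_bdd_chr loc_bdd_quad)

lemma first_order_ric: "first_order W N (ric_on W G m n)"
  unfolding ric_on_def[abs_def] by (intro first_order_sum first_order_rint open_W null_N)

lemma first_order_scal: "first_order W N (scal_on W G)"
  unfolding scal_on_def[abs_def]
  by (intro first_order_sum first_order_mult[OF open_W null_N first_order_ric lip_inv] open_W null_N)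

lemma first_order_ein: "first_order W N (ein_on W G m n)"
proof -
  have "first_order W N (\<lambda>\<psi>. ric_on W G m n \<psi> + (- (1/2)) * scal_on W G (\<lambda>x. G x $ m $ n * \<psi> x))"
    by (intro first_order_add first_order_cmult first_order_ric first_order_mult[OF open_W null_N first_order_scal lip_G] open_W null_N)
  then show ?thesis by (simp add: ein_on_def[abs_def])
qed

text \<open>The weak derivatives of the metric and of \<psi> agree with the classical ones off a
  null set, so the integrals do not change. The minus sign in \<open>pd_dist\<close> explains the
  order of the first two terms of \<open>rint\<close>.\<close>

lemma riemann_dist_eq:
  assumes p: "lipc W N \<psi>"
  shows "riemann_dist W G r s m n \<psi> = (LINT x:W|lebesgue. rint G r s m n \<psi> x)"
proof -
  have m1: "(\<lambda>x. indicator W x *\<^sub>R (f x * g x)) \<in> borel_measurable lebesgue" if "loc_bdd W f" "loc_bdd W g" for f g :: "real^4 \<Rightarrow> real"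
    by (rule loc_bdd_meas[OF loc_bdd_mult[OF that]])
  have wp: "AE x in lebesgue. x \<in> W \<longrightarrow> weak_pd W i \<psi> x = pd i \<psi> x" for i
    by (rule lipd_weak_pd_AE[OF open_W null_N lipc_lipd[OF p]])
  have wb: "loc_bdd W (weak_pd W i \<psi>)" for i
    by (rule loc_bdd_cong_AE[OF loc_bdd_pd[OF lipc_lipd[OF p]] wp])
  have 1: "pd_dist W i (christoffel W G a b c) \<psi> = - (LINT x:W|lebesgue. chr G a b c x * pd i \<psi> x)" for i a b c
  proof -
    have "(LINT x:W|lebesgue. christoffel W G a b c x * weak_pd W i \<psi> x) = (LINT x:W|lebesgue. chr G a b c x * pd i \<psi> x)"
      unfolding set_lebesgue_integral_def
    proof (rule integral_cong_AE[OF m1[OF loc_bdd_christoffel wb] m1[OF loc_bdd_chr loc_bdd_pd[OF lipc_lipd[OF p]]]])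
      show "AE x in lebesgue. indicator W x *\<^sub>R (christoffel W G a b c x * weak_pd W i \<psi> x) = indicator W x *\<^sub>R (chr G a b c x * pd i \<psi> x)"
        using wp[of i] christoffel_AE[of a b c] by eventually_elim (auto simp: indicator_def)
    qed
    then show ?thesis by (simp add: pd_dist_def)
  qed
  have 2: "fn_dist W (\<lambda>x. \<Sum>l\<in>UNIV. christoffel W G r m l x * christoffel W G l n s x
                          - christoffel W G r n l x * christoffel W G l m s x) \<psi> = (LINT x:W|lebesgue. quad r s m n x * \<psi> x)"
    unfolding fn_dist_def set_lebesgue_integral_def
  proof (rule integral_cong_AE)
    have "AE x in lebesgue. \<forall>a b c. x \<in> W \<longrightarrow> christoffel W G a b c x = chr G a b c x"
      unfolding AE_all_countable by (intro allI christoffel_AE)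
    then show "AE x in lebesgue. indicator W x *\<^sub>R ((\<Sum>l\<in>UNIV. christoffel W G r m l x * christoffel W G l n s x
                          - christoffel W G r n l x * christoffel W G l m s x) * \<psi> x) = indicator W x *\<^sub>R (quad r s m n x * \<psi> x)"
    proof eventually_elim
      fix x assume "\<forall>a b c. x \<in> W \<longrightarrow> christoffel W G a b c x = chr G a b c x"
      then show "indicator W x *\<^sub>R ((\<Sum>l\<in>UNIV. christoffel W G r m l x * christoffel W G l n s x
                          - christoffel W G r n l x * christoffel W G l m s x) * \<psi> x) = indicator W x *\<^sub>R (quad r s m n x * \<psi> x)"
        by (cases "x \<in> W") (simp_all add: quad_def)
    qed
    show "(\<lambda>x. indicator W x *\<^sub>R ((\<Sum>l\<in>UNIV. christoffel W G r m l x * christoffel W G l n s x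
                          - christoffel W G r n l x * christoffel W G l m s x) * \<psi> x)) \<in> borel_measurable lebesgue"
      by (intro m1 loc_bdd_sum loc_bdd_diff loc_bdd_mult loc_bdd_christoffel open_W loc_bdd_lip[OF lipc_lipd[OF p]])
  qed (intro m1 loc_bdd_quad loc_bdd_lip[OF lipc_lipd[OF p]])
  show ?thesis unfolding riemann_dist_def 1 2 rint_integrals(2)[OF p] by simp
qed

lemma ricci_dist_eq: "lipc W N \<psi> \<Longrightarrow> ricci_dist W G m n \<psi> = ric_on W G m n \<psi>"
  unfolding ricci_dist_def ric_on_def by (simp add: riemann_dist_eq)

lemma einstein_dist_eq:
  assumes p: "lipc W N \<psi>"
  shows "einstein_dist W G m n \<psi> = ein_on W G m n \<psi>"
proof -
  have q: "lipc W N (\<lambda>x. G x $ m $ n * \<psi> x)" by (rule lipc_mult[OF lip_G p])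
  have "scalar_curvature_dist W G (\<lambda>x. G x $ m $ n * \<psi> x) = scal_on W G (\<lambda>x. G x $ m $ n * \<psi> x)"
    unfolding scalar_curvature_dist_def scal_on_def mult_dist_def
    by (intro sum.cong refl ricci_dist_eq lipc_mult[OF lip_inv q])
  then show ?thesis unfolding einstein_dist_def ein_on_def mult_dist_def ricci_dist_eq[OF p] by simp
qed

text \<open>The weak derivative of \<psi> vanishes almost everywhere off the support, so its
  products with locally bounded factors are integrable.\<close>

lemma curvature_defined:
  assumes p: "lipc W N \<psi>"
  shows "curvature_defined_on W G \<psi>"
  unfolding curvature_defined_on_def
proof (intro conjI allI)
  show "\<exists>\<psi>'. has_weak_pd W i \<psi> \<psi>'" for i
    by (rule exI[of _ "pd i \<psi>"], rule lipd_has_weak_pd[OF open_W null_N lipc_lipd[OF p]])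
  obtain K where K: "compact K" "K \<subseteq> W" "\<And>x. x \<in> W - K \<Longrightarrow> \<psi> x = 0" "\<And>x i. x \<in> W - K \<Longrightarrow> pd i \<psi> x = 0"
    using lipc_pd_vanish[OF open_W p] by metis
  have wp: "AE x in lebesgue. x \<in> W \<longrightarrow> weak_pd W i \<psi> x = pd i \<psi> x" for i
    by (rule lipd_weak_pd_AE[OF open_W null_N lipc_lipd[OF p]])
  have wb: "loc_bdd W (weak_pd W i \<psi>)" for i
    by (rule loc_bdd_cong_AE[OF loc_bdd_pd[OF lipc_lipd[OF p]] wp])
  show "set_integrable lebesgue W (\<lambda>x. christoffel W G a b c x * weak_pd W i \<psi> x)" for i a b c
  proof (rule set_integrable_loc_bdd[OF loc_bdd_mult[OF loc_bdd_christoffel wb] K(1,2)])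
    show "AE x in lebesgue. x \<in> W - K \<longrightarrow> christoffel W G a b c x * weak_pd W i \<psi> x = 0"
      using wp[of i] by eventually_elim (use K(4) in auto)
  qed
  show "set_integrable lebesgue W (\<lambda>x. christoffel W G a b c x * christoffel W G d e f x * \<psi> x)" for a b c d e f
    by (rule lipc_integrable[OF open_W loc_bdd_mult[OF loc_bdd_christoffel loc_bdd_christoffel] p])
qed

lemma einstein_defined:
  assumes p: "lipc W N \<psi>"
  shows "einstein_defined_on W G \<psi>"
  unfolding einstein_defined_on_def
proof (intro conjI allI)
  show "\<exists>d. has_weak_pd W i (\<lambda>x. G x $ m $ n) d" for i m n
    by (rule exI[of _ "pd i (\<lambda>x. G x $ m $ n)"], rule lipd_has_weak_pd[OF open_W null_N lip_G])
qed (intro curvature_defined p lipc_mult[OF lip_inv] lipc_mult[OF lip_G])+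

lemma restrict:
  assumes "open V" "V \<subseteq> W"
  shows "lip_metric V N G"
  by unfold_locales (use assms null_N lor lipd_subset[OF lip_G] in auto)

end

section \<open>Locality of the curvature functionals\<close>

lemma rint_vanish:
  assumes "open W" "closed K" "\<And>x. x \<in> W - K \<Longrightarrow> \<psi> x = 0" "x \<in> W - K"
  shows "rint G r s m n \<psi> x = 0"
proof -
  have o: "open (W - K)" using assms by auto
  have "pd i \<psi> x = pd i (\<lambda>_. 0) x" for i
    by (rule pd_cong[OF o assms(4)]) (rule assms(3))
  then have "pd i \<psi> x = 0" for i by simp
  moreover have "\<psi> x = 0" by (rule assms(3)[OF assms(4)])
  ultimately show ?thesis by (simp add: rint_def)
qed

lemma ric_on_restrict:
  assumes "open W" "closed K" "\<And>x. x \<in> W - K \<Longrightarrow> \<psi> x = 0" "K \<subseteq> V" "V \<subseteq> W"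
  shows "ric_on W G m n \<psi> = ric_on V G m n \<psi>"
  unfolding ric_on_def set_lebesgue_integral_def
proof (intro sum.cong refl Bochner_Integration.integral_cong)
  fix r x
  have "rint G r m r n \<psi> x = 0" if "x \<in> W - K"
    by (rule rint_vanish[OF assms(1,2) _ that]) (rule assms(3))
  then show "indicator W x *\<^sub>R rint G r m r n \<psi> x = indicator V x *\<^sub>R rint G r m r n \<psi> x"
    using assms(4,5) by (auto simp: indicator_def)
qed

text \<open>Used to pass from the image of a chart to an overlap that contains the support.\<close>

lemma ein_on_restrict:
  assumes "open W" "closed K" "\<And>x. x \<in> W - K \<Longrightarrow> \<psi> x = 0" "K \<subseteq> V" "V \<subseteq> W"
  shows "ein_on W G m n \<psi> = ein_on V G m n \<psi>"
proof -
  have "ric_on W G m n \<psi> = ric_on V G m n \<psi>" for m n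
    by (rule ric_on_restrict[OF assms(1,2) _ assms(4,5)]) (use assms(3) in auto)
  moreover have "ric_on W G a b (\<lambda>x. matrix_inv (G x) $ a $ b * (G x $ m $ n * \<psi> x)) = ric_on V G a b (\<lambda>x. matrix_inv (G x) $ a $ b * (G x $ m $ n * \<psi> x))" for a b
    by (rule ric_on_restrict[OF assms(1,2) _ assms(4,5)]) (use assms(3) in auto)
  ultimately show ?thesis by (simp add: ein_on_def scal_on_def)
qed

section \<open>Change of coordinates\<close>

lemma sum_swap3: "(\<Sum>a\<in>A. \<Sum>b\<in>B. \<Sum>c\<in>C. F a b c) = (\<Sum>c\<in>C. \<Sum>a\<in>A. \<Sum>b\<in>B. F a b c)"
proof -
  have "(\<Sum>a\<in>A. \<Sum>b\<in>B. \<Sum>c\<in>C. F a b c) = (\<Sum>a\<in>A. \<Sum>c\<in>C. \<Sum>b\<in>B. F a b c)"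
    by (rule sum.cong[OF refl sum.swap])
  also have "\<dots> = (\<Sum>c\<in>C. \<Sum>a\<in>A. \<Sum>b\<in>B. F a b c)" by (rule sum.swap)
  finally show ?thesis .
qed

lemma sum_swap4: "(\<Sum>a\<in>A. \<Sum>b\<in>B. \<Sum>c\<in>C. \<Sum>d\<in>D. F a b c d) = (\<Sum>d\<in>D. \<Sum>a\<in>A. \<Sum>b\<in>B. \<Sum>c\<in>C. F a b c d)"
proof -
  have "(\<Sum>a\<in>A. \<Sum>b\<in>B. \<Sum>c\<in>C. \<Sum>d\<in>D. F a b c d) = (\<Sum>a\<in>A. \<Sum>d\<in>D. \<Sum>b\<in>B. \<Sum>c\<in>C. F a b c d)"
    by (rule sum.cong[OF refl sum_swap3])
  also have "\<dots> = (\<Sum>d\<in>D. \<Sum>a\<in>A. \<Sum>b\<in>B. \<Sum>c\<in>C. F a b c d)" by (rule sum.swap)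
  finally show ?thesis .
qed

lemma sum_delta_mult:
  fixes f :: "'n::finite \<Rightarrow> real"
  shows "(\<Sum>b\<in>UNIV. (if a = b then 1 else 0) * f b) = f a" "(\<Sum>b\<in>UNIV. (if b = a then 1 else 0) * f b) = f a"
    "(\<Sum>b\<in>UNIV. f b * (if b = a then 1 else 0)) = f a" "(\<Sum>b\<in>UNIV. f b * (if a = b then 1 else 0)) = f a"
  by (simp_all add: if_distrib if_distribR sum.delta cong: if_cong)

text \<open>The transformation of the Riemann tensor at a point where all first derivatives exist; the
  last two terms are a divergence, up to terms which cancel by the symmetry of \<open>D\<close>.\<close>

lemma riemann_algebra:
  fixes J :: "'n::finite \<Rightarrow> 'n \<Rightarrow> real"
  assumes sym: "\<And>m b n. D m b n = D n b m"
    and law: "\<And>b m n. (\<Sum>r\<in>UNIV. J b r * C r m n) = (\<Sum>c\<in>UNIV. \<Sum>d\<in>UNIV. C' b c d * J c m * J d n) + D m b n"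
  shows "(\<Sum>r\<in>UNIV. C r m s * (D n a r * P + J a r * p n) - C r n s * (D m a r * P + J a r * p m)
       + (\<Sum>l\<in>UNIV. C r m l * C l n s - C r n l * C l m s) * (J a r * P))
    = (\<Sum>b\<in>UNIV. \<Sum>c\<in>UNIV. C' a c b * (D n b s * J c m * P + J b s * D n c m * P + J b s * J c m * p n))
      - (\<Sum>b\<in>UNIV. \<Sum>c\<in>UNIV. C' a c b * (D m b s * J c n * P + J b s * D m c n * P + J b s * J c n * p m))
      + (\<Sum>b\<in>UNIV. \<Sum>c\<in>UNIV. \<Sum>d\<in>UNIV. (\<Sum>l\<in>UNIV. C' a c l * C' l d b - C' a d l * C' l c b) * (J b s * J c m * J d n * P))
      + (D m a s * p n - D n a s * p m)"
proof -
  \<comment> \<open>In matrix form the law reads M = \<alpha> J + D, where M is the symbol with its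
    upper index contracted with J. The terms X that arise on the left when J is differentiated
    cancel against those of the quadratic part, the terms V on the right cancel by the symmetry of
    D, and the D that is left in M multiplies the derivatives p.\<close>
  define M where "M m b s = (\<Sum>r\<in>UNIV. J b r * C r m s)" for m b s
  define \<alpha> where "\<alpha> m a b = (\<Sum>c\<in>UNIV. C' a c b * J c m)" for m a b
  define X where "X n m = (\<Sum>r\<in>UNIV. D n a r * C r m s)" for n m
  define Y where "Y m n = (\<Sum>l\<in>UNIV. \<alpha> m a l * (\<Sum>b\<in>UNIV. \<alpha> n l b * J b s))" for m n
  define Z where "Z m n = (\<Sum>b\<in>UNIV. \<alpha> m a b * D n b s)" for m n
  define U where "U m = (\<Sum>b\<in>UNIV. \<alpha> m a b * J b s)" for m
  define V where "V n m = (\<Sum>b\<in>UNIV. \<Sum>c\<in>UNIV. C' a c b * J b s * D n c m)" for n m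
  have M: "M m b s = (\<Sum>e\<in>UNIV. \<alpha> m b e * J e s) + D m b s" for m b s
  proof -
    have "(\<Sum>c\<in>UNIV. \<Sum>d\<in>UNIV. C' b c d * J c m * J d s) = (\<Sum>d\<in>UNIV. \<Sum>c\<in>UNIV. C' b c d * J c m * J d s)" by (rule sum.swap)
    also have "\<dots> = (\<Sum>e\<in>UNIV. \<alpha> m b e * J e s)" by (simp add: \<alpha>_def sum_distrib_right)
    finally show ?thesis by (simp add: M_def law)
  qed
  have A1: "(\<Sum>r\<in>UNIV. C r m s * (D n a r * P + J a r * p n)) = P * X n m + p n * M m a s" for m n
    unfolding X_def M_def sum_distrib_left sum.distrib[symmetric] by (intro sum.cong) (auto simp: algebra_simps)
  have A2: "(\<Sum>r\<in>UNIV. (\<Sum>l\<in>UNIV. C r m l * C l n s) * (J a r * P)) = P * (Y m n + Z m n + X m n)" for m n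
  proof -
    have "(\<Sum>r\<in>UNIV. (\<Sum>l\<in>UNIV. C r m l * C l n s) * (J a r * P)) = (\<Sum>r\<in>UNIV. \<Sum>l\<in>UNIV. (J a r * C r m l) * (P * C l n s))"
      unfolding sum_distrib_right by (intro sum.cong) auto
    also have "\<dots> = (\<Sum>l\<in>UNIV. M m a l * (P * C l n s))"
      unfolding M_def sum_distrib_right by (rule sum.swap)
    also have "\<dots> = (\<Sum>l\<in>UNIV. \<Sum>e\<in>UNIV. P * (\<alpha> m a e * (J e l * C l n s))) + (\<Sum>l\<in>UNIV. P * (D m a l * C l n s))"
      unfolding M[of m a] distrib_right sum.distrib sum_distrib_right by (simp add: mult_ac)
    also have "(\<Sum>l\<in>UNIV. \<Sum>e\<in>UNIV. P * (\<alpha> m a e * (J e l * C l n s))) = (\<Sum>e\<in>UNIV. P * (\<alpha> m a e * M n e s))"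
      unfolding M_def sum_distrib_left by (rule sum.swap)
    also have "\<dots> = P * (Y m n + Z m n)"
      unfolding M[of n _ s] Y_def Z_def sum_distrib_left[symmetric] by (simp add: distrib_left sum.distrib)
    also have "(\<Sum>l\<in>UNIV. P * (D m a l * C l n s)) = P * X m n" by (simp add: X_def sum_distrib_left)
    finally show ?thesis by (simp add: distrib_left)
  qed
  have L: "(\<Sum>r\<in>UNIV. C r m s * (D n a r * P + J a r * p n) - C r n s * (D m a r * P + J a r * p m)
       + (\<Sum>l\<in>UNIV. C r m l * C l n s - C r n l * C l m s) * (J a r * P))
     = P * X n m + p n * M m a s - (P * X m n + p m * M n a s) + (P * (Y m n + Z m n + X m n) - P * (Y n m + Z n m + X n m))"
    unfolding sum.distrib sum_subtractf left_diff_distrib A1 A2 by simp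
  have R1: "(\<Sum>b\<in>UNIV. \<Sum>c\<in>UNIV. C' a c b * (D n b s * J c m * P + J b s * D n c m * P + J b s * J c m * p n))
     = P * Z m n + P * V n m + p n * U m" for m n
    unfolding Z_def V_def U_def \<alpha>_def sum_distrib_left sum_distrib_right sum.distrib[symmetric]
    by (intro sum.cong) (auto simp: algebra_simps)
  have R3: "(\<Sum>b\<in>UNIV. \<Sum>c\<in>UNIV. \<Sum>d\<in>UNIV. (\<Sum>l\<in>UNIV. C' a c l * C' l d b) * (J b s * J c m * J d n * P)) = P * Y m n" for m n
  proof -
    have "(\<Sum>b\<in>UNIV. \<Sum>c\<in>UNIV. \<Sum>d\<in>UNIV. (\<Sum>l\<in>UNIV. C' a c l * C' l d b) * (J b s * J c m * J d n * P))
      = (\<Sum>b\<in>UNIV. \<Sum>c\<in>UNIV. \<Sum>d\<in>UNIV. \<Sum>l\<in>UNIV. C' a c l * C' l d b * (J b s * J c m * J d n * P))"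
      by (simp only: sum_distrib_right)
    also have "\<dots> = (\<Sum>l\<in>UNIV. \<Sum>b\<in>UNIV. \<Sum>c\<in>UNIV. \<Sum>d\<in>UNIV. C' a c l * C' l d b * (J b s * J c m * J d n * P))"
      by (rule sum_swap4)
    also have "\<dots> = (\<Sum>l\<in>UNIV. \<Sum>b\<in>UNIV. P * (\<alpha> m a l * (\<alpha> n l b * J b s)))"
    proof (intro sum.cong refl)
      fix l b
      have "P * (\<alpha> m a l * (\<alpha> n l b * J b s)) = (\<Sum>c\<in>UNIV. C' a c l * J c m * (\<Sum>d\<in>UNIV. C' l d b * J d n * (J b s * P)))"
        unfolding \<alpha>_def sum_distrib_right[symmetric] by (simp add: mult_ac)
      then show "(\<Sum>c\<in>UNIV. \<Sum>d\<in>UNIV. C' a c l * C' l d b * (J b s * J c m * J d n * P)) = P * (\<alpha> m a l * (\<alpha> n l b * J b s))"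
        by (simp add: sum_distrib_left mult_ac)
    qed
    also have "\<dots> = P * Y m n" unfolding Y_def sum_distrib_left ..
    finally show ?thesis .
  qed
  have R3': "(\<Sum>b\<in>UNIV. \<Sum>c\<in>UNIV. \<Sum>d\<in>UNIV. (\<Sum>l\<in>UNIV. C' a d l * C' l c b) * (J b s * J c m * J d n * P)) = P * Y n m"
  proof -
    have "(\<Sum>b\<in>UNIV. \<Sum>c\<in>UNIV. \<Sum>d\<in>UNIV. (\<Sum>l\<in>UNIV. C' a d l * C' l c b) * (J b s * J c m * J d n * P))
      = (\<Sum>b\<in>UNIV. \<Sum>d\<in>UNIV. \<Sum>c\<in>UNIV. (\<Sum>l\<in>UNIV. C' a d l * C' l c b) * (J b s * J c m * J d n * P))"
      by (rule sum.cong[OF refl sum.swap])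
    also have "\<dots> = P * Y n m" using R3[of n m] by (simp only: mult_ac)
    finally show ?thesis .
  qed
  have R: "(\<Sum>b\<in>UNIV. \<Sum>c\<in>UNIV. \<Sum>d\<in>UNIV. (\<Sum>l\<in>UNIV. C' a c l * C' l d b - C' a d l * C' l c b) * (J b s * J c m * J d n * P))
     = P * Y m n - P * Y n m"
    unfolding sum_subtractf left_diff_distrib R3 R3' ..
  have "V n m = V m n" unfolding V_def by (simp add: sym[of n _ m])
  moreover have "M m a s = U m + D m a s" "M n a s = U n + D n a s" unfolding M U_def by auto
  ultimately show ?thesis unfolding L R1 R by (simp add: algebra_simps)
qed

text \<open>The law of the Christoffel symbols, from the differentiated tensor law
  \<open>dg\<close>. In the combination of first kind the terms in which D carries the index b
  cancel, and those in which D carries both m and n double. \<open>T\<close> is twice the symbol of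
  first kind of g', pulled back in two indices, and \<open>E\<close> is D with its upper index
  lowered; raising the index with the inverse of g' turns \<open>E\<close> back into D.\<close>

lemma christoffel_algebra:
  fixes J K :: "'n::finite \<Rightarrow> 'n \<Rightarrow> real"
  assumes sym: "\<And>m b n. D m b n = D n b m" and gsym: "\<And>a b. g' a b = g' b a" 
    and dg: "\<And>l m n. dg l m n = (\<Sum>a\<in>UNIV. \<Sum>c\<in>UNIV. D l a m * g' a c * J c n
        + J a m * (\<Sum>p\<in>UNIV. J p l * dg' p a c) * J c n + J a m * g' a c * D l c n)"
    and inv': "\<And>a c. (\<Sum>e\<in>UNIV. i' a e * g' e c) = (if a = c then 1 else 0)"
    and inv: "\<And>a b. (\<Sum>r\<in>UNIV. J a r * i r b) = (\<Sum>e\<in>UNIV. i' a e * K b e)"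
    and KJ: "\<And>e c. (\<Sum>b\<in>UNIV. K b e * J c b) = (if c = e then 1 else 0)"
  shows "(\<Sum>r\<in>UNIV. J a r * ((1/2) * (\<Sum>b\<in>UNIV. i r b * (dg m b n + dg n b m - dg b m n))))
    = (\<Sum>p\<in>UNIV. \<Sum>q\<in>UNIV. ((1/2) * (\<Sum>e\<in>UNIV. i' a e * (dg' p e q + dg' q e p - dg' e p q))) * J p m * J q n) + D m a n"
proof -
  define T where "T e = (\<Sum>p\<in>UNIV. \<Sum>q\<in>UNIV. J p m * J q n * (dg' p e q + dg' q e p - dg' e p q))" for e
  define E where "E e = (\<Sum>q\<in>UNIV. g' e q * D m q n)" for e
  have L: "dg m b n + dg n b m - dg b m n = (\<Sum>e\<in>UNIV. J e b * (T e + 2 * E e))" for b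
  proof -
    define F1 where "F1 m n = (\<Sum>a\<in>UNIV. \<Sum>c\<in>UNIV. D m a b * g' a c * J c n)" for m n
    define F2 where "F2 = (\<Sum>e\<in>UNIV. \<Sum>p\<in>UNIV. \<Sum>q\<in>UNIV. J e b * (J p m * J q n * dg' p e q))"
    define F3 where "F3 = (\<Sum>e\<in>UNIV. \<Sum>p\<in>UNIV. \<Sum>q\<in>UNIV. J e b * (J p m * J q n * dg' q e p))"
    define F4 where "F4 = (\<Sum>e\<in>UNIV. \<Sum>p\<in>UNIV. \<Sum>q\<in>UNIV. J e b * (J p m * J q n * dg' e p q))"
    define F5 where "F5 = (\<Sum>e\<in>UNIV. J e b * E e)"
    have 1: "dg m b n = F1 m n + F2 + F5"
    proof -
      have "(\<Sum>a\<in>UNIV. \<Sum>c\<in>UNIV. J a b * (\<Sum>p\<in>UNIV. J p m * dg' p a c) * J c n) = F2"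
        unfolding F2_def sum_distrib_left sum_distrib_right
        by (rule sum.cong[OF refl], subst sum.swap) (simp add: mult_ac)
      moreover have "(\<Sum>a\<in>UNIV. \<Sum>c\<in>UNIV. J a b * g' a c * D m c n) = F5"
        unfolding F5_def E_def sum_distrib_left by (simp add: mult_ac)
      ultimately show ?thesis unfolding dg F1_def sum.distrib by simp
    qed
    have 2: "dg n b m = F1 n m + F3 + F5"
    proof -
      have "(\<Sum>a\<in>UNIV. \<Sum>c\<in>UNIV. J a b * (\<Sum>p\<in>UNIV. J p n * dg' p a c) * J c m) = F3"
        unfolding F3_def sum_distrib_left sum_distrib_right by (simp add: mult_ac)
      moreover have "(\<Sum>a\<in>UNIV. \<Sum>c\<in>UNIV. J a b * g' a c * D n c m) = F5"
        unfolding F5_def E_def sum_distrib_left by (simp add: mult_ac sym[of n])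
      ultimately show ?thesis unfolding dg F1_def sum.distrib by simp
    qed
    have 3: "dg b m n = F1 m n + F4 + F1 n m"
    proof -
      have "(\<Sum>a\<in>UNIV. \<Sum>c\<in>UNIV. J a m * (\<Sum>p\<in>UNIV. J p b * dg' p a c) * J c n)
         = (\<Sum>a\<in>UNIV. \<Sum>c\<in>UNIV. \<Sum>p\<in>UNIV. J p b * (J a m * J c n * dg' p a c))"
        unfolding sum_distrib_left sum_distrib_right by (simp add: mult_ac)
      also have "\<dots> = F4" unfolding F4_def by (rule sum_swap3)
      finally have "(\<Sum>a\<in>UNIV. \<Sum>c\<in>UNIV. J a m * (\<Sum>p\<in>UNIV. J p b * dg' p a c) * J c n) = F4" .
      moreover have "(\<Sum>a\<in>UNIV. \<Sum>c\<in>UNIV. J a m * g' a c * D b c n) = F1 n m"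
      proof -
        have "(\<Sum>a\<in>UNIV. \<Sum>c\<in>UNIV. J a m * g' a c * D b c n) = (\<Sum>c\<in>UNIV. \<Sum>a\<in>UNIV. J a m * g' a c * D b c n)" by (rule sum.swap)
        also have "\<dots> = F1 n m" unfolding F1_def by (intro sum.cong refl) (use gsym sym in \<open>simp add: mult_ac\<close>)
        finally show ?thesis .
      qed
      moreover have "(\<Sum>a\<in>UNIV. \<Sum>c\<in>UNIV. D b a m * g' a c * J c n) = F1 m n" unfolding F1_def by (simp add: sym[of b])
      ultimately show ?thesis unfolding dg sum.distrib by simp
    qed
    have "(\<Sum>e\<in>UNIV. J e b * (T e + 2 * E e)) = F2 + F3 - F4 + 2 * F5"
      unfolding T_def F2_def F3_def F4_def F5_def
      by (simp add: sum_distrib_left sum.distrib sum_subtractf algebra_simps)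
    then show ?thesis unfolding 1 2 3 by simp
  qed
  have "(\<Sum>r\<in>UNIV. J a r * ((1/2) * (\<Sum>b\<in>UNIV. i r b * (dg m b n + dg n b m - dg b m n))))
     = (\<Sum>r\<in>UNIV. \<Sum>b\<in>UNIV. J a r * i r b * ((1/2) * (dg m b n + dg n b m - dg b m n)))"
    by (simp add: sum_distrib_left mult_ac)
  also have "\<dots> = (\<Sum>b\<in>UNIV. (\<Sum>r\<in>UNIV. J a r * i r b) * ((1/2) * (dg m b n + dg n b m - dg b m n)))"
    unfolding sum_distrib_right by (rule sum.swap)
  also have "\<dots> = (\<Sum>b\<in>UNIV. (\<Sum>e\<in>UNIV. i' a e * K b e) * ((1/2) * (\<Sum>c\<in>UNIV. J c b * (T c + 2 * E c))))"
    unfolding inv L ..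
  also have "\<dots> = (\<Sum>b\<in>UNIV. \<Sum>e\<in>UNIV. \<Sum>c\<in>UNIV. i' a e * ((1/2) * (T c + 2 * E c)) * (K b e * J c b))"
    unfolding sum_distrib_left sum_distrib_right by (rule sum.cong[OF refl], subst sum.swap) (simp add: mult_ac)
  also have "\<dots> = (\<Sum>e\<in>UNIV. \<Sum>c\<in>UNIV. \<Sum>b\<in>UNIV. i' a e * ((1/2) * (T c + 2 * E c)) * (K b e * J c b))"
    by (rule sum_swap3[symmetric])
  also have "\<dots> = (\<Sum>e\<in>UNIV. \<Sum>c\<in>UNIV. i' a e * ((1/2) * (T c + 2 * E c)) * (if c = e then 1 else 0))"
    unfolding sum_distrib_left[symmetric] KJ ..
  also have "\<dots> = (\<Sum>e\<in>UNIV. i' a e * ((1/2) * (T e + 2 * E e)))" unfolding sum_delta_mult ..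
  also have "\<dots> = (\<Sum>e\<in>UNIV. i' a e * ((1/2) * T e)) + (\<Sum>e\<in>UNIV. i' a e * E e)"
    by (simp add: sum.distrib algebra_simps)
  also have "(\<Sum>e\<in>UNIV. i' a e * E e) = D m a n"
  proof -
    have "(\<Sum>e\<in>UNIV. i' a e * E e) = (\<Sum>e\<in>UNIV. \<Sum>q\<in>UNIV. (i' a e * g' e q) * D m q n)"
      unfolding E_def sum_distrib_left by (simp add: mult_ac)
    also have "\<dots> = (\<Sum>q\<in>UNIV. (\<Sum>e\<in>UNIV. i' a e * g' e q) * D m q n)"
      unfolding sum_distrib_right by (rule sum.swap)
    finally show ?thesis unfolding inv' sum_delta_mult .
  qed
  also have "(\<Sum>e\<in>UNIV. i' a e * ((1/2) * T e)) =
     (\<Sum>p\<in>UNIV. \<Sum>q\<in>UNIV. ((1/2) * (\<Sum>e\<in>UNIV. i' a e * (dg' p e q + dg' q e p - dg' e p q))) * J p m * J q n)"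
  proof -
    have "(\<Sum>e\<in>UNIV. i' a e * ((1/2) * T e)) = (\<Sum>e\<in>UNIV. \<Sum>p\<in>UNIV. \<Sum>q\<in>UNIV. (1/2) * (i' a e * (dg' p e q + dg' q e p - dg' e p q)) * J p m * J q n)"
      unfolding T_def sum_distrib_left by (intro sum.cong refl) (simp only: mult_ac)
    also have "\<dots> = (\<Sum>p\<in>UNIV. \<Sum>q\<in>UNIV. \<Sum>e\<in>UNIV. (1/2) * (i' a e * (dg' p e q + dg' q e p - dg' e p q)) * J p m * J q n)"
      by (rule sum_swap3[symmetric])
    also have "\<dots> = (\<Sum>p\<in>UNIV. \<Sum>q\<in>UNIV. ((1/2) * (\<Sum>e\<in>UNIV. i' a e * (dg' p e q + dg' q e p - dg' e p q))) * J p m * J q n)"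
      by (simp only: sum_distrib_left sum_distrib_right)
    finally show ?thesis .
  qed
  finally show ?thesis .
qed

section \<open>Derivatives of determinants and the change of variables\<close>

lemma pd_prod:
  fixes f :: "'k \<Rightarrow> real^'n::finite \<Rightarrow> real"
  assumes "\<And>a. a \<in> I \<Longrightarrow> f a differentiable (at x)"
  shows "pd i (\<lambda>x. \<Prod>a\<in>I. f a x) x = (\<Sum>a\<in>I. pd i (f a) x * (\<Prod>b\<in>I - {a}. f b x))"
proof -
  have "((\<lambda>x. \<Prod>a\<in>I. f a x) has_derivative (\<lambda>v. \<Sum>a\<in>I. (\<Sum>j\<in>UNIV. v $ j * pd j (f a) x) * (\<Prod>b\<in>I - {a}. f b x))) (at x)"
    by (rule has_derivative_prod[OF has_derivative_pd[OF assms]])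
  from pd_eq[OF this] show ?thesis by (simp add: sum_axis)
qed

lemma differentiable_prod:
  fixes f :: "'k \<Rightarrow> real^'n::finite \<Rightarrow> real"
  assumes "\<And>a. a \<in> I \<Longrightarrow> f a differentiable (at x)"
  shows "(\<lambda>x. \<Prod>a\<in>I. f a x) differentiable (at x)"
  using has_derivative_prod[of I f "\<lambda>a v. \<Sum>j\<in>UNIV. v $ j * pd j (f a) x" x UNIV] has_derivative_pd[OF assms]
  unfolding differentiable_def by blast

text \<open>Jacobi's formula. The derivative of row k is expanded in the rows of A with the help of
  the inverse B; in the determinant with row k replaced, all terms but the k-th repeat a row and
  vanish.\<close>

lemma pd_det:
  fixes A :: "real^'n::finite \<Rightarrow> real^'m::finite^'m"
  assumes d: "\<And>i j. (\<lambda>x. A x $ i $ j) differentiable (at x)" and B: "B ** A x = mat 1"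
  shows "pd m (\<lambda>x. det (A x)) x = det (A x) * (\<Sum>k\<in>UNIV. \<Sum>j\<in>UNIV. pd m (\<lambda>x. A x $ k $ j) x * B $ j $ k)"
    and "(\<lambda>x. det (A x)) differentiable (at x)"
proof -
  let ?P = "{p. p permutes (UNIV :: 'm set)}"
  have dp: "(\<lambda>x. \<Prod>i\<in>UNIV. A x $ i $ p i) differentiable (at x)" for p
    by (rule differentiable_prod) (rule d)
  have ds: "(\<lambda>x. of_int (sign p) * (\<Prod>i\<in>UNIV. A x $ i $ p i)) differentiable (at x)" for p
    by (intro differentiable_mult differentiable_const dp)
  show "(\<lambda>x. det (A x)) differentiable (at x)"
    unfolding det_def by (rule differentiable_sum, simp, intro ballI, rule ds)
  define D where "D k = (\<chi> j. pd m (\<lambda>x. A x $ k $ j) x)" for k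
  define c where "c k l = (\<Sum>j\<in>UNIV. D k $ j * B $ j $ l)" for k l
  have Dk: "D k = (\<Sum>l\<in>UNIV. c k l *s A x $ l)" for k
  proof -
    have "(\<Sum>l\<in>UNIV. c k l *s A x $ l) $ j = D k $ j" for j
    proof -
      have "(\<Sum>l\<in>UNIV. c k l *s A x $ l) $ j = (\<Sum>l\<in>UNIV. \<Sum>i\<in>UNIV. D k $ i * (B $ i $ l * A x $ l $ j))"
        by (simp add: c_def sum_distrib_right mult.assoc)
      also have "\<dots> = (\<Sum>i\<in>UNIV. D k $ i * (\<Sum>l\<in>UNIV. B $ i $ l * A x $ l $ j))"
        unfolding sum_distrib_left by (rule sum.swap)
      also have "\<dots> = (\<Sum>i\<in>UNIV. D k $ i * (B ** A x) $ i $ j)" by (simp add: matrix_matrix_mult_def)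
      also have "\<dots> = D k $ j" unfolding B by (simp add: mat_def sum_delta_mult)
      finally show ?thesis .
    qed
    then show ?thesis by (simp add: vec_eq_iff)
  qed
  have row: "det (\<chi> i. if i = k then D k else A x $ i) = c k k * det (A x)" for k
  proof -
    have z: "det (\<chi> i. if i = k then A x $ l else A x $ i) = (if l = k then det (A x) else 0)" for l
    proof (cases "l = k")
      case True
      then have "(\<chi> i. if i = k then A x $ l else A x $ i) = A x" by (simp add: vec_eq_iff)
      then show ?thesis using True by simp
    next
      case False
      then show ?thesis
        using det_identical_rows[of l k "\<chi> i. if i = k then A x $ l else A x $ i"] by (simp add: row_def)
    qed
    have "det (\<chi> i. if i = k then D k else A x $ i) = (\<Sum>l\<in>UNIV. det (\<chi> i. if i = k then c k l *s A x $ l else A x $ i))"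
      unfolding Dk by (rule det_linear_row_sum) simp
    also have "\<dots> = (\<Sum>l\<in>UNIV. c k l * (if l = k then det (A x) else 0))"
      unfolding det_row_mul z ..
    finally show ?thesis by (simp add: if_distrib cong: if_cong)
  qed
  have rk: "det (\<chi> i. if i = k then D k else A x $ i) =
     (\<Sum>p\<in>?P. of_int (sign p) * (pd m (\<lambda>x. A x $ k $ p k) x * (\<Prod>i\<in>UNIV - {k}. A x $ i $ p i)))" for k
    unfolding det_def
  proof (intro sum.cong refl, goal_cases)
    case (1 p)
    have "(\<Prod>i\<in>UNIV. (\<chi> i. if i = k then D k else A x $ i) $ i $ p i)
       = (\<chi> i. if i = k then D k else A x $ i) $ k $ p k * (\<Prod>i\<in>UNIV - {k}. (\<chi> i. if i = k then D k else A x $ i) $ i $ p i)"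
      by (rule prod.remove) auto
    also have "\<dots> = pd m (\<lambda>x. A x $ k $ p k) x * (\<Prod>i\<in>UNIV - {k}. A x $ i $ p i)"
      by (simp add: D_def)
    finally show ?case by simp
  qed
  have "pd m (\<lambda>x. det (A x)) x = (\<Sum>p\<in>?P. pd m (\<lambda>x. of_int (sign p) * (\<Prod>i\<in>UNIV. A x $ i $ p i)) x)"
    unfolding det_def by (rule pd_sum) (rule ds)
  also have "\<dots> = (\<Sum>p\<in>?P. of_int (sign p) * (\<Sum>k\<in>UNIV. pd m (\<lambda>x. A x $ k $ p k) x * (\<Prod>i\<in>UNIV - {k}. A x $ i $ p i)))"
    by (intro sum.cong refl) (simp add: pd_cmult[OF dp] pd_prod[OF d])
  also have "\<dots> = (\<Sum>k\<in>UNIV. det (\<chi> i. if i = k then D k else A x $ i))"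
    unfolding rk sum_distrib_left by (rule sum.swap)
  also have "\<dots> = det (A x) * (\<Sum>k\<in>UNIV. c k k)" unfolding row by (simp add: sum_distrib_left mult.commute)
  finally show "pd m (\<lambda>x. det (A x)) x = det (A x) * (\<Sum>k\<in>UNIV. \<Sum>j\<in>UNIV. pd m (\<lambda>x. A x $ k $ j) x * B $ j $ k)"
    by (simp add: c_def D_def)
qed

lemma DERIV_inverse_abs:
  assumes "t \<noteq> (0::real)"
  shows "((\<lambda>t. inverse \<bar>t\<bar>) has_real_derivative (- (inverse \<bar>t\<bar> / t))) (at t)"
proof (cases "t > 0")
  case True
  have "(inverse has_real_derivative (- (inverse \<bar>t\<bar> / t))) (at t)"
    using True by (auto intro!: derivative_eq_intros simp: divide_inverse)
  then show ?thesis
    by (rule has_field_derivative_transform_within_open[of _ _ _ "{0<..}"]) (use True in auto)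
next
  case False
  have "((\<lambda>t. - inverse t) has_real_derivative (- (inverse \<bar>t\<bar> / t))) (at t)"
    using False assms by (auto intro!: derivative_eq_intros simp: divide_inverse)
  then show ?thesis
    by (rule has_field_derivative_transform_within_open[of _ _ _ "{..<0}"]) (use False assms in auto)
qed

text \<open>The theorem for functions into \<open>real^1\<close>, read for real functions. The
  equivalence moves integrability and the value of the integral together.\<close>

lemma change_of_variables_real:
  fixes f :: "real^'m::{finite,wellorder} \<Rightarrow> real" and h :: "real^'m::_ \<Rightarrow> real^'m::_"
  assumes "S \<in> sets lebesgue" "\<And>x. x \<in> S \<Longrightarrow> (h has_derivative (\<lambda>v. M x *v v)) (at x within S)" "inj_on h S"
  shows "(\<lambda>x. \<bar>det (M x)\<bar> * f (h x)) absolutely_integrable_on S \<and> integral S (\<lambda>x. \<bar>det (M x)\<bar> * f (h x)) = b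
    \<longleftrightarrow> f absolutely_integrable_on (h ` S) \<and> integral (h ` S) f = b"
  using has_absolute_integral_change_of_variables[OF assms, of "\<lambda>y. \<chi> i::1. f y" "\<chi> i. b"]
  unfolding absolutely_integrable_on_1_iff integral_on_1_eq by (simp add: vec_eq_iff)

lemma rint_cong:
  assumes "open W" "\<And>x. x \<in> W \<Longrightarrow> \<psi> x = \<psi>' x" "x \<in> W"
  shows "rint G r s m n \<psi> x = rint G r s m n \<psi>' x"
  using pd_cong[OF assms(1,3), of \<psi> \<psi>'] assms(2,3) by (simp add: rint_def)

lemma LINT_rint_cong:
  assumes "open W" "\<And>x. x \<in> W \<Longrightarrow> \<psi> x = \<psi>' x"
  shows "(LINT x:W|lebesgue. rint G r s m n \<psi> x) = (LINT x:W|lebesgue. rint G r s m n \<psi>' x)"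
  by (rule set_lebesgue_integral_cong) (use assms rint_cong[OF assms] in auto)

lemma ric_on_cong:
  assumes "open W" "\<And>x. x \<in> W \<Longrightarrow> \<psi> x = \<psi>' x"
  shows "ric_on W G m n \<psi> = ric_on W G m n \<psi>'"
  unfolding ric_on_def by (intro sum.cong refl LINT_rint_cong assms)

lemma scal_on_cong:
  assumes "open W" "\<And>x. x \<in> W \<Longrightarrow> \<psi> x = \<psi>' x"
  shows "scal_on W G \<psi> = scal_on W G \<psi>'"
  unfolding scal_on_def by (intro sum.cong refl ric_on_cong assms(1)) (simp add: assms(2))

lemma ein_on_cong:
  assumes "open W" "\<And>x. x \<in> W \<Longrightarrow> \<psi> x = \<psi>' x"
  shows "ein_on W G m n \<psi> = ein_on W G m n \<psi>'"
proof -
  have "ric_on W G m n \<psi> = ric_on W G m n \<psi>'" by (rule ric_on_cong[OF assms])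
  moreover have "scal_on W G (\<lambda>x. G x $ m $ n * \<psi> x) = scal_on W G (\<lambda>x. G x $ m $ n * \<psi>' x)"
    by (rule scal_on_cong[OF assms(1)]) (simp add: assms(2))
  ultimately show ?thesis by (simp add: ein_on_def)
qed

text \<open>The transition map between the two coordinate images of an overlap. \<open>N_iff\<close>
  expresses that the two exceptional sets come from one hypersurface, so a point is good for both
  metrics or for neither.\<close>

locale coord_change = M: lip_metric W N G + M': lip_metric W' N' G' for W N G W' N' G' +
  fixes H H' :: "real^4 \<Rightarrow> real^4"
  assumes H_in: "x \<in> W \<Longrightarrow> H x \<in> W'" and H'_in: "y \<in> W' \<Longrightarrow> H' y \<in> W"
    and H'H: "x \<in> W \<Longrightarrow> H' (H x) = x" and HH': "y \<in> W' \<Longrightarrow> H (H' y) = y"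
    and smooth_H: "smooth_on W (\<lambda>x. H x $ a)" and smooth_H': "smooth_on W' (\<lambda>y. H' y $ a)"
    and N_iff: "x \<in> W \<Longrightarrow> H x \<in> N' \<longleftrightarrow> x \<in> N"
    and tens: "x \<in> W \<Longrightarrow> G x = transpose (\<chi> a i. pd i (\<lambda>x. H x $ a) x) ** G' (H x) ** (\<chi> a i. pd i (\<lambda>x. H x $ a) x)"
begin

definition J :: "4 \<Rightarrow> 4 \<Rightarrow> real^4 \<Rightarrow> real" where "J a i x = pd i (\<lambda>x. H x $ a) x"
definition K :: "4 \<Rightarrow> 4 \<Rightarrow> real^4 \<Rightarrow> real" where "K i a x = pd a (\<lambda>y. H' y $ i) (H x)"
definition D :: "4 \<Rightarrow> 4 \<Rightarrow> 4 \<Rightarrow> real^4 \<Rightarrow> real" where "D m a n x = pd m (J a n) x"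
definition Jm :: "real^4 \<Rightarrow> real^4^4" where "Jm x = (\<chi> a i. J a i x)"
definition Km :: "real^4 \<Rightarrow> real^4^4" where "Km x = (\<chi> i a. K i a x)"
text \<open>Compensates the determinant of the change of variables: the arguments of the functionals
  transform as densities.\<close>

definition \<Delta> :: "real^4 \<Rightarrow> real" where "\<Delta> x = inverse \<bar>det (Jm x)\<bar>"

section \<open>The Jacobian matrix of the coordinate change and its inverse\<close>

lemma dH: "x \<in> W \<Longrightarrow> (\<lambda>x. H x $ a) differentiable (at x)"
  using smooth_on_differentiable[OF smooth_H] .

lemma dH': "y \<in> W' \<Longrightarrow> (\<lambda>y. H' y $ a) differentiable (at y)"
  using smooth_on_differentiable[OF smooth_H'] .

lemma smooth_J: "smooth_on W (J a i)"
  unfolding J_def[abs_def] by (rule smooth_on_pd[OF smooth_H])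

lemma smooth_D: "smooth_on W (D m a n)"
  unfolding D_def[abs_def] by (rule smooth_on_pd[OF smooth_J])

lemma lip_J: "lipd W N (J a i)" and lip_D: "lipd W N (D m a n)"
  by (rule smooth_on_lipd[OF M.open_W smooth_J], rule smooth_on_lipd[OF M.open_W smooth_D])

lemma dJ: "x \<in> W \<Longrightarrow> J a i differentiable (at x)"
  using smooth_on_differentiable[OF smooth_J] .

lemma D_sym: "x \<in> W \<Longrightarrow> D m b n x = D n b m x"
  unfolding D_def J_def[abs_def] by (rule pd_commute[OF M.open_W _ smooth_on_CkD[OF smooth_H]])

lemma KJ: assumes x: "x \<in> W" shows "(\<Sum>a\<in>UNIV. K i a x * J a j x) = (if i = j then 1 else 0)"
proof -
  have "pd j (\<lambda>x. H' (H x) $ i) x = (\<Sum>a\<in>UNIV. pd j (\<lambda>x. H x $ a) x * pd a (\<lambda>y. H' y $ i) (H x))"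
    by (rule pd_compose[OF dH[OF x] dH'[OF H_in[OF x]]])
  moreover have "pd j (\<lambda>x. H' (H x) $ i) x = pd j (\<lambda>x. x $ i) x"
    by (rule pd_cong[OF M.open_W x]) (simp add: H'H)
  ultimately show ?thesis by (auto simp: J_def K_def pd_coord mult.commute)
qed

lemma KmJm: "x \<in> W \<Longrightarrow> Km x ** Jm x = mat 1"
  by (simp add: Km_def Jm_def matrix_matrix_mult_def mat_def KJ)

lemma JmKm: "x \<in> W \<Longrightarrow> Jm x ** Km x = mat 1"
  using KmJm matrix_left_right_inverse by blast

lemma JK: assumes x: "x \<in> W" shows "(\<Sum>i\<in>UNIV. J a i x * K i b x) = (if a = b then 1 else 0)"
proof -
  have "(Jm x ** Km x) $ a $ b = (if a = b then 1 else 0)" by (simp add: JmKm[OF x] mat_def)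
  then show ?thesis by (simp add: Km_def Jm_def matrix_matrix_mult_def)
qed

lemma det_Jm: assumes x: "x \<in> W" shows "det (Jm x) \<noteq> 0"
proof -
  have "det (Km x) * det (Jm x) = 1" using arg_cong[OF KmJm[OF x], of det] by (simp add: det_mul)
  then show ?thesis by auto
qed

lemma lip_\<Delta>: "lipd W N \<Delta>"
proof -
  have "lipd W N (\<lambda>x. det (Jm x))"
    by (rule lipd_det[OF M.open_W]) (simp add: Jm_def lip_J)
  then show ?thesis unfolding \<Delta>_def[abs_def] by (intro lipd_inverse lipd_abs) (simp_all add: det_Jm)
qed

text \<open>The logarithmic derivative of |det J|, by Jacobi's formula.\<close>

definition \<tau> :: "4 \<Rightarrow> real^4 \<Rightarrow> real" where
  "\<tau> m x = (\<Sum>c\<in>UNIV. \<Sum>l\<in>UNIV. K l c x * D m c l x)"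

lemma pd_\<Delta>: assumes x: "x \<in> W" shows "pd m \<Delta> x = - (\<Delta> x * \<tau> m x)" and "\<Delta> differentiable (at x)"
proof -
  have dJm: "(\<lambda>x. Jm x $ i $ j) differentiable (at x)" for i j using dJ[OF x] by (simp add: Jm_def)
  note jac = pd_det[OF dJm KmJm[OF x]]
  have "pd m (\<lambda>x. det (Jm x)) x = det (Jm x) * \<tau> m x"
    unfolding jac(1) \<tau>_def by (simp add: Jm_def Km_def D_def mult.commute)
  then show "pd m \<Delta> x = - (\<Delta> x * \<tau> m x)"
    unfolding \<Delta>_def[abs_def] pd_compose_real(1)[OF jac(2) DERIV_inverse_abs[OF det_Jm[OF x]]]
    using det_Jm[OF x] by simp
  show "\<Delta> differentiable (at x)"
    unfolding \<Delta>_def[abs_def] by (rule pd_compose_real(2)[OF jac(2) DERIV_inverse_abs[OF det_Jm[OF x]]])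
qed

text \<open>The Piola identity: the push-forward of a coordinate vector field as a vector density is
  divergence free.\<close>

lemma piola:
  assumes x: "x \<in> W" and w: "w differentiable (at x)"
  shows "(\<Sum>d\<in>UNIV. \<Sum>l\<in>UNIV. K l d x * pd l (\<lambda>x. J d n x * \<Delta> x * w x) x) = \<Delta> x * pd n w x"
proof -
  have dJD: "(\<lambda>x. J d n x * \<Delta> x) differentiable (at x)" for d
    by (intro differentiable_mult dJ x pd_\<Delta>)
  have p: "pd l (\<lambda>x. J d n x * \<Delta> x * w x) x = D n d l x * (\<Delta> x * w x) - J d n x * (\<Delta> x * \<tau> l x * w x) + J d n x * (\<Delta> x * pd l w x)" for d l
    unfolding pd_mult[OF dJD w] pd_mult[OF dJ[OF x] pd_\<Delta>(2)[OF x]] pd_\<Delta>(1)[OF x] D_def[symmetric] D_sym[OF x, of l]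
    by (simp add: algebra_simps)
  have s: "(\<Sum>d\<in>UNIV. \<Sum>l\<in>UNIV. K l d x * (J d n x * f l)) = f n" for f
  proof -
    have "(\<Sum>d\<in>UNIV. \<Sum>l\<in>UNIV. K l d x * (J d n x * f l)) = (\<Sum>l\<in>UNIV. (\<Sum>d\<in>UNIV. K l d x * J d n x) * f l)"
      unfolding sum_distrib_right mult.assoc by (rule sum.swap)
    then show ?thesis unfolding KJ[OF x] sum_delta_mult .
  qed
  have t: "(\<Sum>d\<in>UNIV. \<Sum>l\<in>UNIV. K l d x * (D n d l x * (\<Delta> x * w x))) = \<tau> n x * (\<Delta> x * w x)"
    unfolding \<tau>_def sum_distrib_right by (simp add: mult.assoc)
  show ?thesis unfolding p distrib_left right_diff_distrib sum.distrib sum_subtractf s t by (simp add: mult_ac)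
qed

lemma lipc_push:
  assumes f: "lipc W N f" shows "lipc W' N' (\<lambda>y. f (H' y))"
proof -
  have N: "H' y \<notin> N" if "y \<in> W' - N'" for y using N_iff[OF H'_in[of y]] HH'[of y] that by auto
  have l: "lipd W' N' (\<lambda>y. f (H' y))"
    by (rule lipd_compose[OF smooth_on_lipd[OF M'.open_W smooth_H'] lipc_lipd[OF f] H'_in N])
  obtain C where C: "compact C" "C \<subseteq> W" "\<forall>x\<in>W-C. f x = 0" using f unfolding lipc_def by blast
  have "continuous_on W (\<lambda>x. \<chi> a. H x $ a)"
    by (rule continuous_on_vec_lambda) (rule smooth_on_continuous[OF smooth_H])
  then have "continuous_on C H" using C(2) by (simp add: continuous_on_subset)
  then have "compact (H ` C)" using C(1) by (rule compact_continuous_image)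
  moreover have "H ` C \<subseteq> W'" using C(2) H_in by auto
  moreover have "\<forall>y\<in>W' - H ` C. f (H' y) = 0"
  proof
    fix y assume y: "y \<in> W' - H ` C"
    then have "H' y \<notin> C" using HH'[of y] by (metis DiffD1 DiffD2 imageI)
    then show "f (H' y) = 0" using C(3) H'_in y by auto
  qed
  ultimately show ?thesis unfolding lipc_def using l by blast
qed

lemma pd_push:
  assumes x: "x \<in> W" "x \<notin> N" and f: "lipd W N f"
  shows "pd c (\<lambda>y. f (H' y)) (H x) = (\<Sum>l\<in>UNIV. K l c x * pd l f x)"
proof -
  have "f differentiable (at (H' (H x)))" using lipd_differentiable[OF f x] H'H[OF x(1)] by simp
  from pd_compose[OF dH'[OF H_in[OF x(1)]] this] show ?thesis by (simp add: K_def H'H[OF x(1)])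
qed

lemma change_of_variables:
  assumes f: "set_integrable lebesgue W' f"
  shows "set_integrable lebesgue W (\<lambda>x. \<bar>det (Jm x)\<bar> * f (H x))"
    "(LINT y:W'|lebesgue. f y) = (LINT x:W|lebesgue. \<bar>det (Jm x)\<bar> * f (H x))"
proof -
  have im: "H ` W = W'" using H_in H'_in HH' by (force intro: image_eqI)
  have inj: "inj_on H W" using H'H by (metis inj_onI)
  have der: "(H has_derivative (\<lambda>v. Jm x *v v)) (at x within W)" if "x \<in> W" for x
  proof -
    have "(\<lambda>v. \<chi> j. \<Sum>i\<in>UNIV. v $ i * pd i (\<lambda>x. H x $ j) x) = (\<lambda>v. Jm x *v v)"
      by (simp add: fun_eq_iff vec_eq_iff matrix_vector_mult_def Jm_def J_def mult.commute)
    then show ?thesis using differentiable_vec[OF dH[OF that]] has_derivative_at_withinI by metis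
  qed
  have W: "W \<in> sets lebesgue" using M.open_W by simp
  have *: "(\<lambda>x. \<bar>det (Jm x)\<bar> * f (H x)) absolutely_integrable_on W \<and> integral W (\<lambda>x. \<bar>det (Jm x)\<bar> * f (H x)) = integral W' f"
    using change_of_variables_real[OF W der inj, of f "integral W' f"] f im by simp
  then show i: "set_integrable lebesgue W (\<lambda>x. \<bar>det (Jm x)\<bar> * f (H x))" by blast
  have "integral W (\<lambda>x. \<bar>det (Jm x)\<bar> * f (H x)) = integral W' f" using * by blast
  then show "(LINT y:W'|lebesgue. f y) = (LINT x:W|lebesgue. \<bar>det (Jm x)\<bar> * f (H x))"
    using set_lebesgue_integral_eq_integral(2)[OF i] set_lebesgue_integral_eq_integral(2)[OF f] by simp
qed

lemma tens_Jm: "x \<in> W \<Longrightarrow> G x = transpose (Jm x) ** G' (H x) ** Jm x"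
  using tens by (simp add: Jm_def J_def)

lemma tens_sum: assumes "x \<in> W" shows "G x $ m $ n = (\<Sum>a\<in>UNIV. \<Sum>b\<in>UNIV. J a m x * G' (H x) $ a $ b * J b n x)"
proof -
  have "G x $ m $ n = (\<Sum>b\<in>UNIV. \<Sum>a\<in>UNIV. J a m x * G' (H x) $ a $ b * J b n x)"
    unfolding tens_Jm[OF assms] by (simp add: Jm_def matrix_matrix_mult_def transpose_def sum_distrib_right)
  also have "\<dots> = (\<Sum>a\<in>UNIV. \<Sum>b\<in>UNIV. J a m x * G' (H x) $ a $ b * J b n x)" by (rule sum.swap)
  finally show ?thesis .
qed

text \<open>The tensor law of the inverse metric with only one Jacobian moved across, the form in
  which the Christoffel law raises an index.\<close>

lemma inverse_tens:
  assumes x: "x \<in> W"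
  shows "(\<Sum>r\<in>UNIV. J a r x * matrix_inv (G x) $ r $ b) = (\<Sum>e\<in>UNIV. matrix_inv (G' (H x)) $ a $ e * K b e x)"
proof -
  let ?I = "matrix_inv (G x)" and ?I' = "matrix_inv (G' (H x))" and ?J = "Jm x" and ?K = "Km x"
  have GI: "G x ** ?I = mat 1" by (rule matrix_inv_mult(1)[OF M.det_G[OF x]])
  have I'G': "?I' ** G' (H x) = mat 1" by (rule matrix_inv_mult(2)[OF M'.det_G[OF H_in[OF x]]])
  have KtJt: "transpose ?K ** transpose ?J = mat 1"
    using JmKm[OF x] by (metis matrix_transpose_mul transpose_mat)
  have "?I' ** transpose ?K ** G x = ?I' ** (transpose ?K ** transpose ?J) ** G' (H x) ** ?J"
    unfolding tens_Jm[OF x] by (simp add: matrix_mul_assoc)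
  also have "\<dots> = ?J" unfolding KtJt by (simp add: I'G')
  finally have "?J ** ?I = ?I' ** transpose ?K ** G x ** ?I" by simp
  also have "\<dots> = ?I' ** transpose ?K" using GI by (simp add: matrix_mul_assoc[symmetric])
  finally have "(?J ** ?I) $ a $ b = (?I' ** transpose ?K) $ a $ b" by simp
  then show ?thesis by (simp add: matrix_matrix_mult_def Jm_def Km_def transpose_def)
qed

text \<open>Off N the metric is differentiable in both coordinate systems, so its tensor law can be
  differentiated at the point; the rest is algebra.\<close>

lemma christoffel_law:
  assumes x: "x \<in> W" "x \<notin> N"
  shows "(\<Sum>r\<in>UNIV. J b r x * chr G r m n x) = (\<Sum>c\<in>UNIV. \<Sum>d\<in>UNIV. chr G' b c d (H x) * J c m x * J d n x) + D m b n x"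
proof -
  let ?y = "H x"
  have y: "?y \<in> W'" "?y \<notin> N'" using H_in N_iff x by auto
  define dg where "dg l m n = pd l (\<lambda>x. G x $ m $ n) x" for l m n
  define dg' where "dg' p a c = pd p (\<lambda>y. G' y $ a $ c) ?y" for p a c
  have dG': "(\<lambda>y. G' y $ a $ c) differentiable (at ?y)" for a c by (rule lipd_differentiable[OF M'.lip_G y])
  have dGH: "(\<lambda>x. G' (H x) $ a $ c) differentiable (at x)" for a c
    by (rule differentiable_compose_pd[where h = H and f = "\<lambda>y. G' y $ a $ c", OF dH[OF x(1)] dG'])
  have pGH: "pd l (\<lambda>x. G' (H x) $ a $ c) x = (\<Sum>p\<in>UNIV. J p l x * dg' p a c)" for l a c
    using pd_compose[where h = H and f = "\<lambda>y. G' y $ a $ c", OF dH[OF x(1)] dG'] by (simp add: J_def dg'_def)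
  have d1: "(\<lambda>x. J a m x * G' (H x) $ a $ c) differentiable (at x)" for a c m
    by (intro differentiable_mult dJ x(1) dGH)
  have d2: "(\<lambda>x. J a m x * G' (H x) $ a $ c * J c n x) differentiable (at x)" for a c m n
    by (intro differentiable_mult d1 dJ x(1))
  have d3: "(\<lambda>x. \<Sum>c\<in>UNIV. J a m x * G' (H x) $ a $ c * J c n x) differentiable (at x)" for a m n
    by (rule differentiable_sum, simp, intro ballI, rule d2)
  have p1: "pd l (\<lambda>x. J a m x * G' (H x) $ a $ c * J c n x) x = D l a m x * G' ?y $ a $ c * J c n x
        + J a m x * (\<Sum>p\<in>UNIV. J p l x * dg' p a c) * J c n x + J a m x * G' ?y $ a $ c * D l c n x" for l m n a c
    unfolding pd_mult[OF d1 dJ[OF x(1)]] pd_mult[OF dJ[OF x(1)] dGH] pGH D_def by (simp only: distrib_right)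
  have dgf: "dg l m n = (\<Sum>a\<in>UNIV. \<Sum>c\<in>UNIV. D l a m x * G' ?y $ a $ c * J c n x
        + J a m x * (\<Sum>p\<in>UNIV. J p l x * dg' p a c) * J c n x + J a m x * G' ?y $ a $ c * D l c n x)" for l m n
  proof -
    have "dg l m n = pd l (\<lambda>x. \<Sum>a\<in>UNIV. \<Sum>c\<in>UNIV. J a m x * G' (H x) $ a $ c * J c n x) x"
      unfolding dg_def by (rule pd_cong[OF M.open_W x(1)]) (rule tens_sum)
    also have "\<dots> = (\<Sum>a\<in>UNIV. \<Sum>c\<in>UNIV. pd l (\<lambda>x. J a m x * G' (H x) $ a $ c * J c n x) x)"
      by (subst pd_sum[OF d3], intro sum.cong refl, rule pd_sum[OF d2])
    finally show ?thesis unfolding p1 .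
  qed
  have gs: "G' ?y $ a $ b = G' ?y $ b $ a" for a b
  proof -
    have "transpose (G' ?y) $ b $ a = G' ?y $ b $ a" using lorentzian_symmetric[OF M'.lor[OF y(1)]] by simp
    then show ?thesis by (simp add: transpose_def)
  qed
  have inv': "(\<Sum>e\<in>UNIV. matrix_inv (G' ?y) $ a $ e * G' ?y $ e $ c) = (if a = c then 1 else 0)" for a c
  proof -
    have "(matrix_inv (G' ?y) ** G' ?y) $ a $ c = (if a = c then 1 else 0)"
      unfolding matrix_inv_mult(2)[OF M'.det_G[OF y(1)]] by (simp add: mat_def)
    then show ?thesis by (simp add: matrix_matrix_mult_def)
  qed
  have JK': "(\<Sum>b\<in>UNIV. K b e x * J c b x) = (if c = e then 1 else 0)" for e c
    using JK[OF x(1), of c e] by (simp add: mult.commute)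
  from christoffel_algebra[of "\<lambda>m b n. D m b n x" "\<lambda>a b. G' ?y $ a $ b" dg "\<lambda>a m. J a m x" dg' "\<lambda>a e. matrix_inv (G' ?y) $ a $ e"
      "\<lambda>a b. matrix_inv (G x) $ a $ b" "\<lambda>b e. K b e x", OF D_sym[OF x(1)] gs dgf inv' inverse_tens[OF x(1)] JK', of b m n]
  show ?thesis unfolding chr_def dg_def dg'_def .
qed

end

section \<open>Transformation of the curvature functionals\<close>

lemma rint_0: "rint G r s m n (\<lambda>_. 0) = (\<lambda>_. 0)"
  by (simp add: rint_def fun_eq_iff)

context coord_change
begin

definition push :: "(real^4 \<Rightarrow> real) \<Rightarrow> real^4 \<Rightarrow> real" where
  "push f y = f (H' y)"

lemma push_lipc: "lipc W N f \<Longrightarrow> lipc W' N' (push f)"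
  using lipc_push by (simp add: push_def[abs_def])

text \<open>Each lower index contributes a Jacobian to the pushed argument, and \<Delta> cancels
  |det J|. Summed over c or d, the factor J \<Delta> and the derivative with the same index form the
  divergence of a pushed vector density, which the Piola identity turns into a single derivative in
  the old coordinates; no derivative of the determinant survives.\<close>

lemma riemann_law_pointwise:
  assumes x: "x \<in> W" "x \<notin> N" and p: "lipd W N \<psi>"
  shows "(\<Sum>r\<in>UNIV. rint G r s m n (\<lambda>x. J a r x * \<psi> x) x)
    = (\<Sum>b\<in>UNIV. \<Sum>c\<in>UNIV. \<Sum>d\<in>UNIV. \<bar>det (Jm x)\<bar> * rint G' a b c d (push (\<lambda>x. J b s x * J c m x * J d n x * \<Delta> x * \<psi> x)) (H x))
      + (D m a s x * pd n \<psi> x - D n a s x * pd m \<psi> x)"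
proof -
  let ?j = "\<bar>det (Jm x)\<bar>"
  define f where "f b c d = (\<lambda>x. J b s x * J c m x * J d n x * \<Delta> x * \<psi> x)" for b c d
  have jD: "?j * \<Delta> x = 1" using det_Jm[OF x(1)] by (simp add: \<Delta>_def)
  have dp: "\<psi> differentiable (at x)" by (rule lipd_differentiable[OF p x])
  have lf: "lipd W N (f b c d)" for b c d
    unfolding f_def by (intro lipd_mult lip_J lip_\<Delta> p)
  have dw: "(\<lambda>x. J b i x * J c k x * \<psi> x) differentiable (at x)" for b c i k
    by (intro differentiable_mult dJ[OF x(1)] dp)
  have pw: "pd l (\<lambda>x. J b i x * J c k x * \<psi> x) x = D l b i x * J c k x * \<psi> x + J b i x * D l c k x * \<psi> x + J b i x * J c k x * pd l \<psi> x" for l b i c k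
    unfolding pd_mult[OF differentiable_mult[OF dJ[OF x(1)] dJ[OF x(1)]] dp] pd_mult[OF dJ[OF x(1)] dJ[OF x(1)]] D_def
    by (simp only: distrib_right)
  have P1: "(\<Sum>d\<in>UNIV. ?j * pd d (push (f b c d)) (H x)) = D n b s x * J c m x * \<psi> x + J b s x * D n c m x * \<psi> x + J b s x * J c m x * pd n \<psi> x" for b c
  proof -
    have fe: "f b c d = (\<lambda>x. J d n x * \<Delta> x * (J b s x * J c m x * \<psi> x))" for d by (simp add: f_def fun_eq_iff)
    have "(\<Sum>d\<in>UNIV. ?j * pd d (push (f b c d)) (H x)) = ?j * (\<Sum>d\<in>UNIV. \<Sum>l\<in>UNIV. K l d x * pd l (f b c d) x)"
      unfolding push_def[abs_def] pd_push[OF x lf] by (simp only: sum_distrib_left)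
    also have "\<dots> = ?j * (\<Delta> x * pd n (\<lambda>x. J b s x * J c m x * \<psi> x) x)"
      unfolding fe piola[OF x(1) dw] ..
    also have "\<dots> = pd n (\<lambda>x. J b s x * J c m x * \<psi> x) x" by (simp add: mult.assoc[symmetric] jD)
    finally show ?thesis unfolding pw .
  qed
  have P2: "(\<Sum>c\<in>UNIV. ?j * pd c (push (f b c d)) (H x)) = D m b s x * J d n x * \<psi> x + J b s x * D m d n x * \<psi> x + J b s x * J d n x * pd m \<psi> x" for b d
  proof -
    have fe: "f b c d = (\<lambda>x. J c m x * \<Delta> x * (J b s x * J d n x * \<psi> x))" for c by (simp add: f_def fun_eq_iff)
    have "(\<Sum>c\<in>UNIV. ?j * pd c (push (f b c d)) (H x)) = ?j * (\<Sum>c\<in>UNIV. \<Sum>l\<in>UNIV. K l c x * pd l (f b c d) x)"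
      unfolding push_def[abs_def] pd_push[OF x lf] by (simp only: sum_distrib_left)
    also have "\<dots> = ?j * (\<Delta> x * pd m (\<lambda>x. J b s x * J d n x * \<psi> x) x)"
      unfolding fe piola[OF x(1) dw] ..
    also have "\<dots> = pd m (\<lambda>x. J b s x * J d n x * \<psi> x) x" by (simp add: mult.assoc[symmetric] jD)
    finally show ?thesis unfolding pw .
  qed
  have P3: "?j * push (f b c d) (H x) = J b s x * J c m x * J d n x * \<psi> x" for b c d
  proof -
    have "?j * push (f b c d) (H x) = (?j * \<Delta> x) * (J b s x * J c m x * J d n x * \<psi> x)"
      by (simp add: push_def f_def H'H[OF x(1)] mult_ac)
    then show ?thesis unfolding jD by simp
  qed
  have "(\<Sum>b\<in>UNIV. \<Sum>c\<in>UNIV. \<Sum>d\<in>UNIV. ?j * rint G' a b c d (push (f b c d)) (H x))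
    = (\<Sum>b\<in>UNIV. \<Sum>c\<in>UNIV. chr G' a c b (H x) * (\<Sum>d\<in>UNIV. ?j * pd d (push (f b c d)) (H x)))
      - (\<Sum>b\<in>UNIV. \<Sum>c\<in>UNIV. \<Sum>d\<in>UNIV. chr G' a d b (H x) * (?j * pd c (push (f b c d)) (H x)))
      + (\<Sum>b\<in>UNIV. \<Sum>c\<in>UNIV. \<Sum>d\<in>UNIV. (\<Sum>l\<in>UNIV. chr G' a c l (H x) * chr G' l d b (H x) - chr G' a d l (H x) * chr G' l c b (H x)) * (?j * push (f b c d) (H x)))"
    unfolding sum_distrib_left[of "chr _ _ _ _ _"] sum.distrib[symmetric] sum_subtractf[symmetric]
    by (intro sum.cong refl) (simp add: rint_def distrib_left right_diff_distrib mult.left_commute)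
  also have "(\<Sum>b\<in>UNIV. \<Sum>c\<in>UNIV. \<Sum>d\<in>UNIV. chr G' a d b (H x) * (?j * pd c (push (f b c d)) (H x)))
    = (\<Sum>b\<in>UNIV. \<Sum>d\<in>UNIV. chr G' a d b (H x) * (\<Sum>c\<in>UNIV. ?j * pd c (push (f b c d)) (H x)))"
    unfolding sum_distrib_left[of "chr _ _ _ _ _"] by (intro sum.cong refl sum.swap)
  finally have R: "(\<Sum>b\<in>UNIV. \<Sum>c\<in>UNIV. \<Sum>d\<in>UNIV. ?j * rint G' a b c d (push (f b c d)) (H x))
    = (\<Sum>b\<in>UNIV. \<Sum>c\<in>UNIV. chr G' a c b (H x) * (D n b s x * J c m x * \<psi> x + J b s x * D n c m x * \<psi> x + J b s x * J c m x * pd n \<psi> x))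
      - (\<Sum>b\<in>UNIV. \<Sum>c\<in>UNIV. chr G' a c b (H x) * (D m b s x * J c n x * \<psi> x + J b s x * D m c n x * \<psi> x + J b s x * J c n x * pd m \<psi> x))
      + (\<Sum>b\<in>UNIV. \<Sum>c\<in>UNIV. \<Sum>d\<in>UNIV. (\<Sum>l\<in>UNIV. chr G' a c l (H x) * chr G' l d b (H x) - chr G' a d l (H x) * chr G' l c b (H x)) * (J b s x * J c m x * J d n x * \<psi> x))"
    unfolding P1 P2 P3 .
  have pJ: "pd i (\<lambda>x. J a r x * \<psi> x) x = D i a r x * \<psi> x + J a r x * pd i \<psi> x" for i r
    unfolding pd_mult[OF dJ[OF x(1)] dp] D_def ..
  have L: "(\<Sum>r\<in>UNIV. rint G r s m n (\<lambda>x. J a r x * \<psi> x) x) =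
    (\<Sum>r\<in>UNIV. chr G r m s x * (D n a r x * \<psi> x + J a r x * pd n \<psi> x) - chr G r n s x * (D m a r x * \<psi> x + J a r x * pd m \<psi> x)
       + (\<Sum>l\<in>UNIV. chr G r m l x * chr G l n s x - chr G r n l x * chr G l m s x) * (J a r x * \<psi> x))"
    unfolding rint_def pJ ..
  show ?thesis unfolding f_def[symmetric] R L
    by (rule riemann_algebra[of "\<lambda>m b n. D m b n x" "\<lambda>a r. J a r x" "\<lambda>r m n. chr G r m n x" "\<lambda>b c d. chr G' b c d (H x)" m s n a "\<psi> x" "\<lambda>i. pd i \<psi> x",
        OF D_sym[OF x(1)] christoffel_law[OF x]])
qed

text \<open>The upper index is contracted on the left and the lower ones on the right, so that the
  inverse Jacobian does not enter before the trace is taken.\<close>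

lemma riemann_law:
  assumes p: "lipc W N \<psi>"
  shows "(\<Sum>r\<in>UNIV. LINT x:W|lebesgue. rint G r s m n (\<lambda>x. J a r x * \<psi> x) x)
    = (\<Sum>b\<in>UNIV. \<Sum>c\<in>UNIV. \<Sum>d\<in>UNIV. LINT y:W'|lebesgue. rint G' a b c d (push (\<lambda>x. J b s x * J c m x * J d n x * \<Delta> x * \<psi> x)) y)"
proof -
  define q where "q b c d = rint G' a b c d (push (\<lambda>x. J b s x * J c m x * J d n x * \<Delta> x * \<psi> x))" for b c d
  have f: "lipc W N (\<lambda>x. J b s x * J c m x * J d n x * \<Delta> x * \<psi> x)" for b c d
    by (intro lipc_mult lipd_mult lip_J lip_\<Delta> p)
  have qi: "set_integrable lebesgue W' (q b c d)" for b c d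
    unfolding q_def by (rule M'.rint_integrals(1)[OF push_lipc[OF f]])
  note cov = change_of_variables[OF qi]
  have ri: "set_integrable lebesgue W (rint G r s m n (\<lambda>x. J a r x * \<psi> x))" for r
    by (rule M.rint_integrals(1)[OF lipc_mult[OF lip_J p]])
  have pi: "set_integrable lebesgue W (\<lambda>x. D m a s x * pd n \<psi> x)" for m n
    by (rule lipc_pd_integrable[OF M.open_W M.null_N lipd_loc_bdd[OF M.open_W lip_D] p])
  note s1 = set_integral_sum[OF cov(1)]
  note s2 = set_integral_sum[OF s1(1)]
  note s3 = set_integral_sum[OF s2(1)]
  have "(\<Sum>r\<in>UNIV. LINT x:W|lebesgue. rint G r s m n (\<lambda>x. J a r x * \<psi> x) x) = (LINT x:W|lebesgue. \<Sum>r\<in>UNIV. rint G r s m n (\<lambda>x. J a r x * \<psi> x) x)"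
    by (rule set_integral_sum(2)[OF ri, symmetric])
  also have "\<dots> = (LINT x:W|lebesgue. (\<Sum>b\<in>UNIV. \<Sum>c\<in>UNIV. \<Sum>d\<in>UNIV. \<bar>det (Jm x)\<bar> * q b c d (H x))
      + (D m a s x * pd n \<psi> x - D n a s x * pd m \<psi> x))"
    unfolding set_lebesgue_integral_def
  proof (rule integral_cong_AE)
    show "AE x in lebesgue. indicator W x *\<^sub>R (\<Sum>r\<in>UNIV. rint G r s m n (\<lambda>x. J a r x * \<psi> x) x) =
      indicator W x *\<^sub>R ((\<Sum>b\<in>UNIV. \<Sum>c\<in>UNIV. \<Sum>d\<in>UNIV. \<bar>det (Jm x)\<bar> * q b c d (H x)) + (D m a s x * pd n \<psi> x - D n a s x * pd m \<psi> x))"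
      using AE_notin_negligible[OF M.null_N]
    proof eventually_elim
      fix x assume "x \<notin> N"
      then show "indicator W x *\<^sub>R (\<Sum>r\<in>UNIV. rint G r s m n (\<lambda>x. J a r x * \<psi> x) x) =
        indicator W x *\<^sub>R ((\<Sum>b\<in>UNIV. \<Sum>c\<in>UNIV. \<Sum>d\<in>UNIV. \<bar>det (Jm x)\<bar> * q b c d (H x)) + (D m a s x * pd n \<psi> x - D n a s x * pd m \<psi> x))"
        unfolding q_def using riemann_law_pointwise[OF _ _ lipc_lipd[OF p], of x s m n a] by (cases "x \<in> W") auto
    qed
    show "(\<lambda>x. indicator W x *\<^sub>R (\<Sum>r\<in>UNIV. rint G r s m n (\<lambda>x. J a r x * \<psi> x) x)) \<in> borel_measurable lebesgue"
      using set_integral_sum(1)[where I = UNIV, OF ri] unfolding set_integrable_def by (rule borel_measurable_integrable)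
    show "(\<lambda>x. indicator W x *\<^sub>R ((\<Sum>b\<in>UNIV. \<Sum>c\<in>UNIV. \<Sum>d\<in>UNIV. \<bar>det (Jm x)\<bar> * q b c d (H x)) + (D m a s x * pd n \<psi> x - D n a s x * pd m \<psi> x))) \<in> borel_measurable lebesgue"
      using set_integral_add(1)[OF s3(1) set_integral_diff(1)[OF pi pi]] unfolding set_integrable_def by (rule borel_measurable_integrable)
  qed
  also have "\<dots> = (\<Sum>b\<in>UNIV. \<Sum>c\<in>UNIV. \<Sum>d\<in>UNIV. LINT x:W|lebesgue. \<bar>det (Jm x)\<bar> * q b c d (H x))
      + ((LINT x:W|lebesgue. D m a s x * pd n \<psi> x) - (LINT x:W|lebesgue. D n a s x * pd m \<psi> x))"
    unfolding set_integral_add(2)[OF s3(1) set_integral_diff(1)[OF pi pi]] set_integral_diff(2)[OF pi pi] s3(2) s2(2) s1(2) ..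
  \<comment> \<open>Integration by parts reduces the equality to third derivatives of H, which agree
    by symmetry.\<close>
  also have "(LINT x:W|lebesgue. D m a s x * pd n \<psi> x) = (LINT x:W|lebesgue. D n a s x * pd m \<psi> x)"
  proof -
    have "pd n (D m a s) x = pd m (D n a s) x" if "x \<in> W" for x
      unfolding D_def[abs_def] by (rule pd_commute[OF M.open_W that smooth_on_CkD[OF smooth_J]])
    then have "(LINT x:W|lebesgue. pd n (D m a s) x * \<psi> x) = (LINT x:W|lebesgue. pd m (D n a s) x * \<psi> x)"
      by (intro set_lebesgue_integral_cong) (use M.open_W in auto)
    then show ?thesis unfolding lipc_by_parts[OF M.open_W M.null_N lip_D p] by simp
  qed
  finally show ?thesis unfolding cov(2)[symmetric] unfolding q_def by simp
qed

text \<open>The trace is taken inside the functional: the factor K^m_a is put into the argument of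
  the Riemann law, and by linearity the sum over a of J^a_r K^m_a collapses to a Kronecker delta. On
  the other side the sum over m of the same factor with J^c_m sets c = a.\<close>

lemma ricci_law:
  assumes p: "lipc W N \<psi>"
  shows "ric_on W G s n \<psi> = (\<Sum>b\<in>UNIV. \<Sum>d\<in>UNIV. ric_on W' G' b d (push (\<lambda>x. J b s x * J d n x * \<Delta> x * \<psi> x)))"
proof -
  let ?R = "\<lambda>r s m n \<psi>. LINT x:W|lebesgue. rint G r s m n \<psi> x"
  let ?R' = "\<lambda>a b c d \<psi>. LINT y:W'|lebesgue. rint G' a b c d \<psi> y"
  have Kp: "lipc W N (\<lambda>x. K m a x * \<psi> x)" for m a
  proof -
    have "lipd W N (\<lambda>x. pd a (\<lambda>y. H' y $ m) (H x))"
      by (rule lipd_compose[OF smooth_on_lipd[OF M.open_W smooth_H] smooth_on_lipd[OF M'.open_W smooth_on_pd[OF smooth_H']], where N' = N'])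
         (use H_in N_iff in auto)
    then show ?thesis by (intro lipc_mult p) (simp add: K_def[abs_def])
  qed
  have step: "(\<Sum>m\<in>UNIV. \<Sum>a\<in>UNIV. ?R r s m n (\<lambda>x. J a r x * (K m a x * \<psi> x))) = ?R r s r n \<psi>" for r
  proof -
    have "(\<Sum>a\<in>UNIV. ?R r s m n (\<lambda>x. J a r x * (K m a x * \<psi> x))) = (if m = r then ?R r s r n \<psi> else 0)" for m
    proof -
      have "(\<Sum>a\<in>UNIV. ?R r s m n (\<lambda>x. J a r x * (K m a x * \<psi> x))) = ?R r s m n (\<lambda>x. \<Sum>a\<in>UNIV. J a r x * (K m a x * \<psi> x))"
        by (rule first_order_sum_arg[OF M.open_W M.null_N M.first_order_rint lipc_mult[OF lip_J Kp], symmetric])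
      also have "\<dots> = ?R r s m n (\<lambda>x. if m = r then \<psi> x else 0)"
      proof (rule LINT_rint_cong[OF M.open_W])
        fix x assume x: "x \<in> W"
        have "(\<Sum>a\<in>UNIV. J a r x * (K m a x * \<psi> x)) = (\<Sum>a\<in>UNIV. K m a x * J a r x) * \<psi> x"
          unfolding sum_distrib_right by (simp add: mult_ac)
        then show "(\<Sum>a\<in>UNIV. J a r x * (K m a x * \<psi> x)) = (if m = r then \<psi> x else 0)" unfolding KJ[OF x] by simp
      qed
      also have "\<dots> = (if m = r then ?R r s r n \<psi> else 0)" by (cases "m = r") (simp_all add: rint_0)
      finally show ?thesis .
    qed
    then show ?thesis by simp
  qed
  define g where "g b d = (\<lambda>x. J b s x * J d n x * \<Delta> x * \<psi> x)" for b d
  have lg: "lipc W N (g b d)" for b d unfolding g_def by (intro lipc_mult lipd_mult lip_J lip_\<Delta> p)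
  have step': "(\<Sum>m\<in>UNIV. ?R' a b c d (push (\<lambda>x. J b s x * J c m x * J d n x * \<Delta> x * (K m a x * \<psi> x)))) = (if c = a then ?R' a b a d (push (g b d)) else 0)" for a b c d
  proof -
    have l: "lipc W N (\<lambda>x. J b s x * J c m x * J d n x * \<Delta> x * (K m a x * \<psi> x))" for m
      by (intro lipc_mult lipd_mult lip_J lip_\<Delta> Kp)
    have "(\<Sum>m\<in>UNIV. ?R' a b c d (push (\<lambda>x. J b s x * J c m x * J d n x * \<Delta> x * (K m a x * \<psi> x))))
       = ?R' a b c d (\<lambda>y. \<Sum>m\<in>UNIV. push (\<lambda>x. J b s x * J c m x * J d n x * \<Delta> x * (K m a x * \<psi> x)) y)"
      by (rule first_order_sum_arg[OF M'.open_W M'.null_N M'.first_order_rint push_lipc[OF l], symmetric])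
    also have "\<dots> = ?R' a b c d (\<lambda>y. if c = a then push (g b d) y else 0)"
    proof (rule LINT_rint_cong[OF M'.open_W])
      fix y assume y: "y \<in> W'"
      let ?x = "H' y"
      have "(\<Sum>m\<in>UNIV. push (\<lambda>x. J b s x * J c m x * J d n x * \<Delta> x * (K m a x * \<psi> x)) y) = (\<Sum>m\<in>UNIV. J c m ?x * K m a ?x) * g b d ?x"
        unfolding sum_distrib_right by (simp add: push_def g_def mult_ac)
      then show "(\<Sum>m\<in>UNIV. push (\<lambda>x. J b s x * J c m x * J d n x * \<Delta> x * (K m a x * \<psi> x)) y) = (if c = a then push (g b d) y else 0)"
        unfolding JK[OF H'_in[OF y]] by (simp add: push_def)
    qed
    also have "\<dots> = (if c = a then ?R' a b a d (push (g b d)) else 0)" by (cases "c = a") (simp_all add: rint_0)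
    finally show ?thesis .
  qed
  have "ric_on W G s n \<psi> = (\<Sum>r\<in>UNIV. \<Sum>m\<in>UNIV. \<Sum>a\<in>UNIV. ?R r s m n (\<lambda>x. J a r x * (K m a x * \<psi> x)))"
    unfolding step ric_on_def ..
  also have "\<dots> = (\<Sum>a\<in>UNIV. \<Sum>r\<in>UNIV. \<Sum>m\<in>UNIV. ?R r s m n (\<lambda>x. J a r x * (K m a x * \<psi> x)))" by (rule sum_swap3)
  also have "\<dots> = (\<Sum>a\<in>UNIV. \<Sum>m\<in>UNIV. \<Sum>r\<in>UNIV. ?R r s m n (\<lambda>x. J a r x * (K m a x * \<psi> x)))"
    by (intro sum.cong refl sum.swap)
  also have "\<dots> = (\<Sum>a\<in>UNIV. \<Sum>m\<in>UNIV. \<Sum>b\<in>UNIV. \<Sum>c\<in>UNIV. \<Sum>d\<in>UNIV. ?R' a b c d (push (\<lambda>x. J b s x * J c m x * J d n x * \<Delta> x * (K m a x * \<psi> x))))"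
    unfolding riemann_law[OF Kp] ..
  also have "\<dots> = (\<Sum>a\<in>UNIV. \<Sum>b\<in>UNIV. \<Sum>c\<in>UNIV. \<Sum>d\<in>UNIV. \<Sum>m\<in>UNIV. ?R' a b c d (push (\<lambda>x. J b s x * J c m x * J d n x * \<Delta> x * (K m a x * \<psi> x))))"
    by (rule sum.cong[OF refl], rule sum_swap4[symmetric])
  also have "\<dots> = (\<Sum>a\<in>UNIV. \<Sum>b\<in>UNIV. \<Sum>d\<in>UNIV. ?R' a b a d (push (g b d)))"
  proof (rule sum.cong[OF refl], rule sum.cong[OF refl])
    fix a b :: 4
    have "(\<Sum>c\<in>UNIV. \<Sum>d\<in>UNIV. if c = a then ?R' a b a d (push (g b d)) else 0) = (\<Sum>d\<in>UNIV. \<Sum>c\<in>UNIV. if c = a then ?R' a b a d (push (g b d)) else 0)"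
      by (rule sum.swap)
    then show "(\<Sum>c\<in>UNIV. \<Sum>d\<in>UNIV. \<Sum>m\<in>UNIV. ?R' a b c d (push (\<lambda>x. J b s x * J c m x * J d n x * \<Delta> x * (K m a x * \<psi> x)))) = (\<Sum>d\<in>UNIV. ?R' a b a d (push (g b d)))"
      unfolding step' by simp
  qed
  also have "\<dots> = (\<Sum>b\<in>UNIV. \<Sum>d\<in>UNIV. \<Sum>a\<in>UNIV. ?R' a b a d (push (g b d)))" by (rule sum_swap3[symmetric])
  finally show ?thesis unfolding ric_on_def g_def .
qed

text \<open>The Ricci law is applied to the argument multiplied by the inverse metric; once the sums
  are moved into the argument, two Jacobians turn the inverse of G into that of G'.\<close>

lemma scalar_law:
  assumes p: "lipc W N \<psi>"
  shows "scal_on W G \<psi> = scal_on W' G' (push (\<lambda>x. \<Delta> x * \<psi> x))"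
proof -
  define h where "h c d a b = (\<lambda>x. J c a x * J d b x * \<Delta> x * (matrix_inv (G x) $ a $ b * \<psi> x))" for c d a b
  have lh: "lipc W N (h c d a b)" for c d a b unfolding h_def by (intro lipc_mult lipd_mult lip_J lip_\<Delta> M.lip_inv p)
  have inner: "(\<Sum>a\<in>UNIV. \<Sum>b\<in>UNIV. ric_on W' G' c d (push (h c d a b))) = ric_on W' G' c d (\<lambda>y. matrix_inv (G' y) $ c $ d * push (\<lambda>x. \<Delta> x * \<psi> x) y)" for c d
  proof -
    have "(\<Sum>a\<in>UNIV. \<Sum>b\<in>UNIV. ric_on W' G' c d (push (h c d a b))) = (\<Sum>a\<in>UNIV. ric_on W' G' c d (\<lambda>y. \<Sum>b\<in>UNIV. push (h c d a b) y))"
      by (intro sum.cong refl first_order_sum_arg[OF M'.open_W M'.null_N M'.first_order_ric push_lipc[OF lh], symmetric])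
    also have "\<dots> = ric_on W' G' c d (\<lambda>y. \<Sum>a\<in>UNIV. \<Sum>b\<in>UNIV. push (h c d a b) y)"
      by (rule first_order_sum_arg[OF M'.open_W M'.null_N M'.first_order_ric lipc_sum[OF M'.open_W push_lipc[OF lh]], symmetric])
    also have "\<dots> = ric_on W' G' c d (\<lambda>y. matrix_inv (G' y) $ c $ d * push (\<lambda>x. \<Delta> x * \<psi> x) y)"
    proof (rule ric_on_cong[OF M'.open_W])
      fix y assume y: "y \<in> W'"
      let ?x = "H' y"
      have x: "?x \<in> W" by (rule H'_in[OF y])
      have "(\<Sum>a\<in>UNIV. \<Sum>b\<in>UNIV. J c a ?x * J d b ?x * matrix_inv (G ?x) $ a $ b)
        = (\<Sum>b\<in>UNIV. \<Sum>a\<in>UNIV. J c a ?x * J d b ?x * matrix_inv (G ?x) $ a $ b)" by (rule sum.swap)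
      also have "\<dots> = (\<Sum>b\<in>UNIV. (\<Sum>a\<in>UNIV. J c a ?x * matrix_inv (G ?x) $ a $ b) * J d b ?x)"
        unfolding sum_distrib_right by (simp add: mult_ac)
      also have "\<dots> = (\<Sum>b\<in>UNIV. \<Sum>e\<in>UNIV. matrix_inv (G' (H ?x)) $ c $ e * (K b e ?x * J d b ?x))"
        unfolding inverse_tens[OF x] sum_distrib_right by (simp add: mult_ac)
      also have "\<dots> = (\<Sum>e\<in>UNIV. matrix_inv (G' (H ?x)) $ c $ e * (\<Sum>b\<in>UNIV. J d b ?x * K b e ?x))"
        unfolding sum_distrib_left by (subst sum.swap) (simp add: mult_ac)
      also have "\<dots> = matrix_inv (G' y) $ c $ d" unfolding JK[OF x] sum_delta_mult HH'[OF y] ..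
      finally have e: "(\<Sum>a\<in>UNIV. \<Sum>b\<in>UNIV. J c a ?x * J d b ?x * matrix_inv (G ?x) $ a $ b) = matrix_inv (G' y) $ c $ d" .
      have "(\<Sum>a\<in>UNIV. \<Sum>b\<in>UNIV. push (h c d a b) y) = (\<Sum>a\<in>UNIV. \<Sum>b\<in>UNIV. J c a ?x * J d b ?x * matrix_inv (G ?x) $ a $ b) * (\<Delta> ?x * \<psi> ?x)"
        unfolding sum_distrib_right by (simp add: push_def h_def mult_ac)
      then show "(\<Sum>a\<in>UNIV. \<Sum>b\<in>UNIV. push (h c d a b) y) = matrix_inv (G' y) $ c $ d * push (\<lambda>x. \<Delta> x * \<psi> x) y"
        unfolding e by (simp add: push_def)
    qed
    finally show ?thesis .
  qed
  have "scal_on W G \<psi> = (\<Sum>a\<in>UNIV. \<Sum>b\<in>UNIV. \<Sum>c\<in>UNIV. \<Sum>d\<in>UNIV. ric_on W' G' c d (push (h c d a b)))"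
    unfolding scal_on_def ricci_law[OF lipc_mult[OF M.lip_inv p]] h_def ..
  also have "\<dots> = (\<Sum>a\<in>UNIV. \<Sum>c\<in>UNIV. \<Sum>d\<in>UNIV. \<Sum>b\<in>UNIV. ric_on W' G' c d (push (h c d a b)))"
    by (rule sum.cong[OF refl], rule sum_swap3[symmetric])
  also have "\<dots> = (\<Sum>c\<in>UNIV. \<Sum>a\<in>UNIV. \<Sum>d\<in>UNIV. \<Sum>b\<in>UNIV. ric_on W' G' c d (push (h c d a b)))" by (rule sum.swap)
  also have "\<dots> = (\<Sum>c\<in>UNIV. \<Sum>d\<in>UNIV. \<Sum>a\<in>UNIV. \<Sum>b\<in>UNIV. ric_on W' G' c d (push (h c d a b)))"
    by (intro sum.cong refl sum.swap)
  also have "\<dots> = scal_on W' G' (push (\<lambda>x. \<Delta> x * \<psi> x))" unfolding inner scal_on_def ..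
  finally show ?thesis .
qed

text \<open>In the trace part the factor \<open>G x $ m $ n\<close> supplies the two Jacobians which
  the Ricci part already carries, so both parts end with a common argument.\<close>

lemma einstein_law:
  assumes p: "lipc W N \<psi>"
  shows "ein_on W G m n \<psi> = (\<Sum>a\<in>UNIV. \<Sum>b\<in>UNIV. ein_on W' G' a b (push (\<lambda>x. J a m x * J b n x * \<Delta> x * \<psi> x)))"
proof -
  define h where "h a b = (\<lambda>x. J a m x * J b n x * \<Delta> x * \<psi> x)" for a b
  have lh: "lipc W N (h a b)" for a b unfolding h_def by (intro lipc_mult lipd_mult lip_J lip_\<Delta> p)
  have lgh: "lipc W' N' (\<lambda>y. G' y $ a $ b * push (h a b) y)" for a b
    by (rule lipc_mult[OF M'.lip_G push_lipc[OF lh]])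
  have "scal_on W G (\<lambda>x. G x $ m $ n * \<psi> x) = scal_on W' G' (push (\<lambda>x. \<Delta> x * (G x $ m $ n * \<psi> x)))"
    by (rule scalar_law[OF lipc_mult[OF M.lip_G p]])
  also have "\<dots> = scal_on W' G' (\<lambda>y. \<Sum>a\<in>UNIV. \<Sum>b\<in>UNIV. G' y $ a $ b * push (h a b) y)"
  proof (rule scal_on_cong[OF M'.open_W])
    fix y assume y: "y \<in> W'"
    show "push (\<lambda>x. \<Delta> x * (G x $ m $ n * \<psi> x)) y = (\<Sum>a\<in>UNIV. \<Sum>b\<in>UNIV. G' y $ a $ b * push (h a b) y)"
      unfolding push_def h_def tens_sum[OF H'_in[OF y]] HH'[OF y]
      by (simp add: sum_distrib_right sum_distrib_left mult_ac)
  qed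
  also have "\<dots> = (\<Sum>a\<in>UNIV. \<Sum>b\<in>UNIV. scal_on W' G' (\<lambda>y. G' y $ a $ b * push (h a b) y))"
    by (subst first_order_sum_arg[OF M'.open_W M'.null_N M'.first_order_scal lipc_sum[OF M'.open_W lgh]],
        intro sum.cong refl, rule first_order_sum_arg[OF M'.open_W M'.null_N M'.first_order_scal lgh])
  finally have s: "scal_on W G (\<lambda>x. G x $ m $ n * \<psi> x) = (\<Sum>a\<in>UNIV. \<Sum>b\<in>UNIV. scal_on W' G' (\<lambda>y. G' y $ a $ b * push (h a b) y))" .
  show ?thesis
    unfolding ein_on_def s ricci_law[OF p] h_def[symmetric] sum_subtractf sum_distrib_left[symmetric] ..
qed

end

section \<open>Charts and test functions\<close>

lemma is_chartD:
  assumes "is_chart c"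
  shows chart_open_dom: "open (cdom c)" and chart_open_img: "open (cimg c)"
    and chart_inv: "\<And>p. p \<in> cdom c \<Longrightarrow> cinv c (crd c p) = p"
    and chart_inv': "\<And>x. x \<in> cimg c \<Longrightarrow> crd c (cinv c x) = x"
    and chart_in: "\<And>p. p \<in> cdom c \<Longrightarrow> crd c p \<in> cimg c"
    and chart_in': "\<And>x. x \<in> cimg c \<Longrightarrow> cinv c x \<in> cdom c"
    and chart_cont: "continuous_on (cdom c) (crd c)" and chart_cont': "continuous_on (cimg c) (cinv c)"
  using assms unfolding is_chart_def homeomorphism_def by auto

lemma chart_open_image:
  assumes c: "is_chart c" and V: "open V" "V \<subseteq> cdom c"
  shows "open (crd c ` V)"
proof -
  have h: "homeomorphism (cdom c) (cimg c) (crd c) (cinv c)" using c by (simp add: is_chart_def)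
  have "openin (top_of_set (cdom c)) V" using V by (simp add: open_subset)
  from homeomorphism_imp_open_map[OF h this] show ?thesis
    using openin_open_trans chart_open_img[OF c] by blast
qed

lemma chart_open_image':
  assumes c: "is_chart c" and V: "open V" "V \<subseteq> cimg c"
  shows "open (cinv c ` V)"
proof -
  have h: "homeomorphism (cdom c) (cimg c) (crd c) (cinv c)" using c by (simp add: is_chart_def)
  have "openin (top_of_set (cimg c)) V" using V by (simp add: open_subset)
  from homeomorphism_imp_open_map[OF homeomorphism_symD[OF h] this] show ?thesis
    using openin_open_trans chart_open_dom[OF c] by blast
qed

lemma chart_image_iff:
  assumes c: "is_chart c" and x: "x \<in> cimg c" and V: "V \<subseteq> cdom c"
  shows "x \<in> crd c ` V \<longleftrightarrow> cinv c x \<in> V"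
proof
  assume "x \<in> crd c ` V"
  then obtain v where "v \<in> V" "x = crd c v" by blast
  then show "cinv c x \<in> V" using chart_inv[OF c, of v] V by auto
next
  assume "cinv c x \<in> V"
  then have "crd c (cinv c x) \<in> crd c ` V" by (rule imageI)
  then show "x \<in> crd c ` V" using chart_inv'[OF c x] by simp
qed

lemma chart_compact_image:
  assumes c: "is_chart c" and K: "compact K" "K \<subseteq> cdom c"
  shows "compact (crd c ` K)" "crd c ` K \<subseteq> cimg c"
  using compact_continuous_image[OF continuous_on_subset[OF chart_cont[OF c] K(2)] K(1)] K(2) chart_in[OF c] by auto

lemma testsD:
  assumes "\<phi> \<in> tests A U"
  shows "\<And>c. c \<in> A \<Longrightarrow> smooth_on (cimg c) (\<lambda>x. \<phi> (cinv c x))" "compact (supp \<phi>)" "supp \<phi> \<subseteq> U"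
  using assms by (auto simp: tests_def)

lemma tests_mono: "\<phi> \<in> tests A U \<Longrightarrow> U \<subseteq> V \<Longrightarrow> \<phi> \<in> tests A V"
  by (auto simp: tests_def)

lemma supp_mult_subset: "supp (\<lambda>p. f p * \<phi> p) \<subseteq> supp \<phi>"
  unfolding supp_def by (rule closure_mono) auto

lemma compact_supp_mult: "compact (supp \<phi>) \<Longrightarrow> compact (supp (\<lambda>p. f p * \<phi> p))"
  using compact_Int_closed[of "supp \<phi>" "supp (\<lambda>p. f p * \<phi> p)"] supp_mult_subset[of f \<phi>]
  by (simp add: supp_def inf.absorb2)

lemma atlas_chart: "smooth_atlas A \<Longrightarrow> c \<in> A \<Longrightarrow> is_chart c"
  by (simp add: smooth_atlas_def)

lemma atlas_cover: "smooth_atlas A \<Longrightarrow> \<exists>c\<in>A. p \<in> cdom c"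
  unfolding smooth_atlas_def by blast

lemma atlas_smooth:
  "smooth_atlas A \<Longrightarrow> c \<in> A \<Longrightarrow> c' \<in> A \<Longrightarrow> smooth_on (crd c ` (cdom c \<inter> cdom c')) (\<lambda>x. crd c' (cinv c x) $ i)"
  by (simp add: smooth_atlas_def)

text \<open>f is smooth on V only. Off the closed support of \<phi> the product is 0, and V and the
  complement of the support cover the manifold. Jacobian entries, which are arbitrary outside the
  overlap, are multiplied in this way.\<close>

lemma tests_local_mult:
  fixes A :: "('a::t2_space, 'n::finite) chart set"
  assumes A: "smooth_atlas A" and \<phi>: "\<phi> \<in> tests A U" and V: "open V" "U \<subseteq> V"
    and f: "\<And>c. c \<in> A \<Longrightarrow> smooth_on (crd c ` (cdom c \<inter> V)) (\<lambda>x. f (cinv c x))"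
  shows "(\<lambda>p. f p * \<phi> p) \<in> tests A U"
proof -
  have "smooth_on (cimg c) (\<lambda>x. f (cinv c x) * \<phi> (cinv c x))" if c: "c \<in> A" for c
    unfolding smooth_on_def
  proof (intro allI Ck_on_local)
    fix k x assume x: "x \<in> cimg c"
    have ch: "is_chart c" by (rule atlas_chart[OF A c])
    show "\<exists>W. open W \<and> x \<in> W \<and> Ck_on k W (\<lambda>x. f (cinv c x) * \<phi> (cinv c x))"
    proof (cases "cinv c x \<in> V")
      case True
      let ?W = "crd c ` (cdom c \<inter> V)"
      have o: "open ?W" by (rule chart_open_image[OF ch]) (use chart_open_dom[OF ch] V in auto)
      have "?W \<subseteq> cimg c" using chart_in[OF ch] by auto
      then have "Ck_on k ?W (\<lambda>x. \<phi> (cinv c x))"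
        using Ck_on_subset[OF smooth_on_CkD[OF testsD(1)[OF \<phi> c]]] by blast
      then have "Ck_on k ?W (\<lambda>x. f (cinv c x) * \<phi> (cinv c x))"
        by (rule Ck_on_mult[OF o smooth_on_CkD[OF f[OF c]]])
      moreover have "x \<in> ?W" using True x chart_in'[OF ch x] chart_image_iff[OF ch x] by simp
      ultimately show ?thesis using o by blast
    next
      case False
      let ?W = "crd c ` (cdom c - supp \<phi>)"
      have "closed (supp \<phi>)" by (simp add: supp_def)
      then have o: "open ?W" by (intro chart_open_image[OF ch] open_Diff chart_open_dom[OF ch]) auto
      have "Ck_on k ?W (\<lambda>x. f (cinv c x) * \<phi> (cinv c x))"
        by (rule Ck_on_cong[OF o _ Ck_on_const[of _ _ 0]]) (auto simp: chart_inv[OF ch] notin_supp)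
      moreover have "x \<in> ?W" using False x V testsD(3)[OF \<phi>] chart_in'[OF ch x] chart_image_iff[OF ch x] by blast
      ultimately show ?thesis using o by blast
    qed
  qed
  moreover have "supp (\<lambda>p. f p * \<phi> p) \<subseteq> U" using supp_mult_subset testsD(3)[OF \<phi>] by blast
  ultimately show ?thesis using compact_supp_mult[OF testsD(2)[OF \<phi>]] unfolding tests_def by blast
qed

lemma jac_smooth:
  fixes A :: "('a::t2_space, 'n::finite) chart set"
  assumes A: "smooth_atlas A" and c: "c \<in> A" "c' \<in> A" "e \<in> A"
  shows "smooth_on (crd e ` (cdom e \<inter> (cdom c \<inter> cdom c'))) (\<lambda>x. jac c c' (cinv e x) $ a $ i)"
proof -
  have ch: "is_chart c" "is_chart c'" "is_chart e" using atlas_chart[OF A] c by auto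
  let ?W = "crd e ` (cdom e \<inter> (cdom c \<inter> cdom c'))"
  have "open (cdom e \<inter> (cdom c \<inter> cdom c'))" by (intro open_Int chart_open_dom ch)
  then have o: "open ?W" by (rule chart_open_image[OF ch(3) _ Int_lower1])
  have "Ck_on k ?W (\<lambda>x. pd i (\<lambda>x. crd c' (cinv c x) $ a) (crd c (cinv e x)))" for k
  proof (rule Ck_on_compose[OF o])
    show "Ck_on k (crd c ` (cdom c \<inter> cdom c')) (pd i (\<lambda>x. crd c' (cinv c x) $ a))"
      by (rule smooth_on_CkD[OF smooth_on_pd[OF atlas_smooth[OF A c(1,2)]]])
    show "Ck_on k ?W (\<lambda>x. crd c (cinv e x) $ j)" for j
      by (rule Ck_on_subset[OF smooth_on_CkD[OF atlas_smooth[OF A c(3,1)]]]) auto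
    show "(\<lambda>x. crd c (cinv e x)) ` ?W \<subseteq> crd c ` (cdom c \<inter> cdom c')"
      using chart_inv[OF ch(3)] by auto
  qed
  then show ?thesis by (simp add: smooth_on_def jac_def)
qed

lemma tests_jac:
  fixes A :: "('a::t2_space, 'n::finite) chart set"
  assumes A: "smooth_atlas A" and c: "c \<in> A" "c' \<in> A" and U: "U \<subseteq> cdom c \<inter> cdom c'" and \<phi>: "\<phi> \<in> tests A U"
  shows "(\<lambda>p. jac c c' p $ a $ i * jac c c' p $ b $ j * \<phi> p) \<in> tests A U"
proof (rule tests_local_mult[OF A \<phi> _ U])
  show "open (cdom c \<inter> cdom c')" by (intro open_Int chart_open_dom atlas_chart[OF A] c)
  fix e assume e: "e \<in> A"
  have "open (cdom e \<inter> (cdom c \<inter> cdom c'))" by (intro open_Int chart_open_dom atlas_chart[OF A] c e)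
  then have o: "open (crd e ` (cdom e \<inter> (cdom c \<inter> cdom c')))"
    by (rule chart_open_image[OF atlas_chart[OF A e] _ Int_lower1])
  show "smooth_on (crd e ` (cdom e \<inter> (cdom c \<inter> cdom c'))) (\<lambda>x. jac c c' (cinv e x) $ a $ i * jac c c' (cinv e x) $ b $ j)"
    unfolding smooth_on_def by (intro allI Ck_on_mult o smooth_on_CkD[OF jac_smooth[OF A c e]])
qed

section \<open>Seminorms of test functions\<close>

lemma pds_vanish:
  assumes "open S" "\<And>x. x \<in> S \<Longrightarrow> f x = 0" "x \<in> S"
  shows "pds is f x = 0"
  using assms(3)
proof (induction "is" arbitrary: x)
  case (Cons i "is")
  have "pd i (pds is f) x = pd i (\<lambda>_. 0) x" by (rule pd_cong[OF assms(1) Cons.prems]) (rule Cons.IH)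
  then show ?case by simp
qed (simp add: assms(2))

text \<open>A supremum of reals is an upper bound once the set is known to be bounded; compact
  support provides this.\<close>

lemma tests_seminorm_term:
  fixes A :: "('a::t2_space, 'n::finite) chart set" and c :: "('a, 'n) chart"
  assumes A: "smooth_atlas A" and c: "c \<in> A" and \<phi>: "\<phi> \<in> tests A (cdom c)" and x: "x \<in> cimg c"
  shows "\<bar>pds is (\<lambda>x. \<phi> (cinv c x)) x\<bar> \<le> (SUP x\<in>cimg c. \<bar>pds is (\<lambda>x. \<phi> (cinv c x)) x\<bar>)"
proof (rule cSUP_upper[OF x])
  have ch: "is_chart c" by (rule atlas_chart[OF A c])
  let ?f = "\<lambda>x. \<phi> (cinv c x)" and ?K = "crd c ` supp \<phi>"
  have K: "compact ?K" "?K \<subseteq> cimg c" using chart_compact_image[OF ch testsD(2,3)[OF \<phi>]] by auto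
  have "continuous_on (cimg c) (pds is ?f)" by (rule smooth_on_continuous[OF smooth_on_pds[OF testsD(1)[OF \<phi> c]]])
  then have "compact (pds is ?f ` ?K)" using K by (meson compact_continuous_image continuous_on_subset)
  then obtain C where C: "\<And>x. x \<in> ?K \<Longrightarrow> \<bar>pds is ?f x\<bar> \<le> C" by (metis bounded_real compact_imp_bounded imageI)
  have o: "open (cimg c - ?K)" using chart_open_img[OF ch] compact_imp_closed[OF K(1)] by (rule open_Diff)
  have z: "pds is ?f x = 0" if "x \<in> cimg c - ?K" for x
  proof (rule pds_vanish[OF o _ that])
    fix y assume y: "y \<in> cimg c - ?K"
    then have "cinv c y \<notin> supp \<phi>" using chart_inv'[OF ch, of y] by (metis DiffD1 DiffD2 imageI)
    then show "?f y = 0" by (rule notin_supp)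
  qed
  have "\<bar>pds is ?f x\<bar> \<le> max C 0" if "x \<in> cimg c" for x using C[of x] z[of x] that by (cases "x \<in> ?K") auto
  then show "bdd_above ((\<lambda>x. \<bar>pds is ?f x\<bar>) ` cimg c)" by (intro bdd_aboveI[of _ "max C 0"]) auto
qed

lemma tests_seminorm:
  fixes A :: "('a::t2_space, 'n::finite) chart set" and c :: "('a, 'n) chart"
  assumes A: "smooth_atlas A" and c: "c \<in> A" and \<phi>: "\<phi> \<in> tests A (cdom c)" and x: "x \<in> cimg c"
    and l: "length js \<le> n"
  shows "\<bar>pds js (\<lambda>x. \<phi> (cinv c x)) x\<bar> \<le> (\<Sum>is | length is \<le> n. SUP x\<in>cimg c. \<bar>pds is (\<lambda>x. \<phi> (cinv c x)) x\<bar>)"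
proof -
  let ?s = "\<lambda>is. SUP x\<in>cimg c. \<bar>pds is (\<lambda>x. \<phi> (cinv c x)) x\<bar>"
  note up = tests_seminorm_term[OF A c \<phi> x]
  have nn: "0 \<le> ?s is" for "is" using up[of "is"] by linarith
  have fin: "finite {is :: 'n list. length is \<le> n}" using finite_lists_length_le[of "UNIV :: 'n set" n] by simp
  have "?s js \<le> (\<Sum>is | length is \<le> n. ?s is)" by (rule member_le_sum) (use l nn fin in auto)
  then show ?thesis using up[of js] by linarith
qed

lemma tests_empty:
  fixes \<phi> :: "'a::topological_space \<Rightarrow> real" shows "\<phi> \<in> tests A {} \<Longrightarrow> \<phi> = (\<lambda>_. 0)"
  using notin_supp[of _ \<phi>] by (auto simp: tests_def)

lemma zero_test: "(\<lambda>_. 0) \<in> tests A (U :: 'a::topological_space set)"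
  by (simp add: tests_def supp_def smooth_on_def)

text \<open>By covariance the components in c are combinations of those in c', tested against
  Jacobian multiples of the test function, and these are again supported in W.\<close>

lemma weak_equation_transfer:
  fixes A :: "('a::t2_space, 'n::finite) chart set"
  assumes A: "smooth_atlas A" and S: "tensor_distribution A S" and T: "tensor_distribution A T"
    and c: "c \<in> A" "c' \<in> A" and W: "W \<subseteq> cdom c \<inter> cdom c'" and eq: "weak_equation_on A S T c' W"
  shows "weak_equation_on A S T c W"
  unfolding weak_equation_on_def
proof (intro ballI allI)
  fix \<phi> \<mu> \<nu> assume \<phi>: "\<phi> \<in> tests A W"
  have \<phi>': "\<phi> \<in> tests A (cdom c \<inter> cdom c')" by (rule tests_mono[OF \<phi> W])
  let ?t = "\<lambda>\<alpha> \<beta> p. jac c c' p $ \<alpha> $ \<mu> * jac c c' p $ \<beta> $ \<nu> * \<phi> p"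
  have "S c \<mu> \<nu> \<phi> = (\<Sum>\<alpha>\<in>UNIV. \<Sum>\<beta>\<in>UNIV. S c' \<alpha> \<beta> (?t \<alpha> \<beta>))"
    using S c \<phi>' unfolding tensor_distribution_def by blast
  also have "\<dots> = (\<Sum>\<alpha>\<in>UNIV. \<Sum>\<beta>\<in>UNIV. T c' \<alpha> \<beta> (?t \<alpha> \<beta>))"
    using eq tests_jac[OF A c W \<phi>] unfolding weak_equation_on_def by (intro sum.cong refl) blast
  also have "(\<Sum>\<alpha>\<in>UNIV. \<Sum>\<beta>\<in>UNIV. T c' \<alpha> \<beta> (?t \<alpha> \<beta>)) = T c \<mu> \<nu> \<phi>"
  proof -
    have "T c \<mu> \<nu> \<phi> = (\<Sum>\<alpha>\<in>UNIV. \<Sum>\<beta>\<in>UNIV. T c' \<alpha> \<beta> (?t \<alpha> \<beta>))"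
      using T c \<phi>' unfolding tensor_distribution_def by blast
    then show ?thesis by simp
  qed
  finally show "S c \<mu> \<nu> \<phi> = T c \<mu> \<nu> \<phi>" .
qed

section \<open>The Einstein tensor of a metric with a jump along a hypersurface\<close>

text \<open>Off the closed image a small ball misses the hypersurface. At a point of the image the
  immersion gives the cone condition for a small piece, and the embedding keeps all other pieces of
  the hypersurface away from the point.\<close>

lemma hypersurface_local:
  fixes A :: "('a::t2_space, 4) chart set" and B :: "('b::topological_space, 3) chart set"
  assumes A: "smooth_atlas A" and B: "smooth_atlas B" and X: "embedded_hypersurface A B X"
    and c: "c \<in> A" and x: "x \<in> cimg c"
  shows "\<exists>r>0. \<exists>n. norm n = 1 \<and> ball x r \<subseteq> cimg c \<and> negligible (crd c ` (cdom c \<inter> range X) \<inter> ball x r) \<and>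
     (\<forall>s\<in>crd c ` (cdom c \<inter> range X) \<inter> ball x r. \<forall>t\<in>crd c ` (cdom c \<inter> range X) \<inter> ball x r. \<bar>n \<bullet> (s - t)\<bar> \<le> norm (s - t) / 4)"
proof -
  have ch: "is_chart c" by (rule atlas_chart[OF A c])
  let ?N = "crd c ` (cdom c \<inter> range X)"
  show ?thesis
  proof (cases "cinv c x \<in> range X")
    case False
    have "closed (range X)" using X by (simp add: embedded_hypersurface_def)
    then have "open (crd c ` (cdom c - range X))"
      by (intro chart_open_image[OF ch] open_Diff chart_open_dom[OF ch] Diff_subset)
    moreover have "x \<in> crd c ` (cdom c - range X)"
      using chart_image_iff[OF ch x, of "cdom c - range X"] chart_in'[OF ch x] False by simp
    ultimately obtain r where r: "r > 0" "ball x r \<subseteq> crd c ` (cdom c - range X)"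
      using open_contains_ball by blast
    have "?N \<inter> crd c ` (cdom c - range X) = {}" using chart_inv[OF ch] by (auto, metis rangeI)
    then have e: "?N \<inter> ball x r = {}" using r(2) by blast
    have "ball x r \<subseteq> cimg c" using r(2) chart_in[OF ch] by auto
    moreover have "norm (axis 1 1 :: real^4) = 1" by (simp add: norm_axis_1)
    moreover have "negligible (?N \<inter> ball x r)" unfolding e by simp
    moreover have "\<forall>s\<in>?N \<inter> ball x r. \<forall>t\<in>?N \<inter> ball x r. \<bar>axis 1 1 \<bullet> (s - t)\<bar> \<le> norm (s - t) / 4" unfolding e by blast
    ultimately show ?thesis using r(1) by (intro exI[of _ r] exI[of _ "axis 1 1"] conjI)
  next
    case True
    then obtain b where b: "cinv c x = X b" by blast
    have Xb: "X b \<in> cdom c" using chart_in'[OF ch x] b by simp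
    obtain d where d: "d \<in> B" "b \<in> cdom d" using atlas_cover[OF B] by blast
    have dh: "is_chart d" by (rule atlas_chart[OF B d(1)])
    have hX: "homeomorphism UNIV (range X) X (inv X)" using X by (simp add: embedded_hypersurface_def)
    have Xc: "continuous_on UNIV X" using hX by (simp add: homeomorphism_def)
    let ?P = "cdom d \<inter> X -` cdom c"
    have oP: "open ?P" by (intro open_Int chart_open_dom[OF dh] open_vimage[OF chart_open_dom[OF ch] Xc])
    let ?D = "crd d ` ?P"
    have oD: "open ?D" by (rule chart_open_image[OF dh oP Int_lower1])
    have Dimg: "?D \<subseteq> cimg d" using chart_in[OF dh] by auto
    define Y where "Y u = crd c (X (cinv d u))" for u
    have Y: "Ck_on k ?D (\<lambda>u. Y u $ \<mu>)" for k \<mu>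
      using X c d(1) unfolding embedded_hypersurface_def Y_def smooth_on_def by blast
    have "inj (\<lambda>w. dmap X c d b *v w)" using X c d Xb unfolding embedded_hypersurface_def by blast
    then have inj: "inj (\<lambda>w. (\<chi> \<mu> i. pd i (\<lambda>u. Y u $ \<mu>) (crd d b)) *v w)" by (simp add: dmap_def Y_def)
    have bD: "crd d b \<in> ?D" using d(2) Xb by blast
    obtain \<rho> n where \<rho>: "\<rho> > 0" "norm n = 1" "ball (crd d b) \<rho> \<subseteq> ?D"
      "\<forall>y\<in>ball (crd d b) \<rho>. \<forall>z\<in>ball (crd d b) \<rho>. \<bar>n \<bullet> (Y y - Y z)\<bar> \<le> norm (Y y - Y z) / 4"
      using immersion_flat[OF oD bD Y inj] by auto
    let ?U = "cinv d ` ball (crd d b) \<rho>"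
    have oU: "open ?U" by (rule chart_open_image'[OF dh open_ball]) (use \<rho>(3) Dimg in blast)
    \<comment> \<open>The homeomorphism onto the image separates the small piece from the rest:
      within some ambient open set V the image consists of this piece only.\<close>
    have "openin (top_of_set (range X)) (X ` ?U)"
      by (rule homeomorphism_imp_open_map[OF hX]) (simp add: oU)
    then obtain V where V: "open V" "X ` ?U = range X \<inter> V" by (auto simp: openin_open)
    have bU: "b \<in> ?U" using \<rho>(1) chart_inv[OF dh d(2)] by (metis centre_in_ball imageI)
    have oW: "open (crd c ` (cdom c \<inter> V))" by (rule chart_open_image[OF ch _ Int_lower1]) (intro open_Int chart_open_dom[OF ch] V)
    have "X b \<in> V" using V(2) bU by blast
    then have "x \<in> crd c ` (cdom c \<inter> V)" using chart_image_iff[OF ch x Int_lower1] Xb b by simp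
    then obtain r where r: "r > 0" "ball x r \<subseteq> crd c ` (cdom c \<inter> V)" using oW open_contains_ball by blast
    have NY: "?N \<inter> ball x r \<subseteq> Y ` ball (crd d b) \<rho>"
    proof
      fix s assume s: "s \<in> ?N \<inter> ball x r"
      obtain q where q: "q \<in> cdom c" "q \<in> range X" "s = crd c q" using s by blast
      obtain q' where q': "q' \<in> cdom c" "q' \<in> V" "s = crd c q'" using s r(2) by blast
      have "q = q'" using q q' chart_inv[OF ch q(1)] chart_inv[OF ch q'(1)] by metis
      then have "q \<in> X ` ?U" using V(2) q(2) q'(2) by blast
      then obtain u where "u \<in> ball (crd d b) \<rho>" "q = X (cinv d u)" by blast
      then show "s \<in> Y ` ball (crd d b) \<rho>" using q(3) by (auto simp: Y_def)
    qed
    \<comment> \<open>A differentiable image of a set of dimension 3 in dimension 4.\<close>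
    have "negligible (Y ` ball (crd d b) \<rho>)"
    proof (rule negligible_differentiable_image_lowdim)
      show "Y differentiable_on ball (crd d b) \<rho>"
        unfolding differentiable_on_def
      proof
        fix u assume "u \<in> ball (crd d b) \<rho>"
        then have "(\<lambda>u. Y u $ \<mu>) differentiable (at u)" for \<mu> using Y[of 1 \<mu>] \<rho>(3) by auto
        then have "Y differentiable (at u)" using differentiable_vec[of Y u] unfolding differentiable_def by blast
        then show "Y differentiable (at u within ball (crd d b) \<rho>)" by (rule differentiable_at_withinI)
      qed
    qed simp
    then have neg: "negligible (?N \<inter> ball x r)" using NY by (rule negligible_subset)
    have cone: "\<forall>s\<in>?N \<inter> ball x r. \<forall>t\<in>?N \<inter> ball x r. \<bar>n \<bullet> (s - t)\<bar> \<le> norm (s - t) / 4"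
    proof (intro ballI)
      fix s t assume "s \<in> ?N \<inter> ball x r" "t \<in> ?N \<inter> ball x r"
      then have "s \<in> Y ` ball (crd d b) \<rho>" "t \<in> Y ` ball (crd d b) \<rho>" using NY by auto
      then show "\<bar>n \<bullet> (s - t)\<bar> \<le> norm (s - t) / 4" using \<rho>(4) by auto
    qed
    have "ball x r \<subseteq> cimg c" using r(2) chart_in[OF ch] by auto
    then show ?thesis using r(1) \<rho>(2) neg cone by blast
  qed
qed

locale jump_metric =
  fixes A :: "('a::{second_countable_topology, t2_space}, 4) chart set"
    and B :: "('b::{second_countable_topology, t2_space}, 3) chart set"
    and g :: "('a, 4) chart \<Rightarrow> 'a \<Rightarrow> real^4^4" and X :: "'b \<Rightarrow> 'a"
  assumes A: "smooth_atlas A" and B: "smooth_atlas B" and g: "lorentzian_metric A g"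
    and X: "embedded_hypersurface A B X"
    and g_C2: "metric_C0_C2_off A (range X) g"
    and g_bdd: "metric_derivs_locally_bounded_off A (range X) g"
begin

abbreviation N where "N c \<equiv> crd c ` (cdom c \<inter> range X)"

lemma chA: "c \<in> A \<Longrightarrow> is_chart c" by (rule atlas_chart[OF A])

lemma N_iff: "c \<in> A \<Longrightarrow> x \<in> cimg c \<Longrightarrow> x \<in> N c \<longleftrightarrow> cinv c x \<in> range X"
  using chart_image_iff[OF chA, of c x "cdom c \<inter> range X"] chart_in'[OF chA] by simp

lemma flat_N: "c \<in> A \<Longrightarrow> flat_set (cimg c) (N c)"
  unfolding flat_set_def using hypersurface_local[OF A B X] by meson

text \<open>Negligibility is a local property, by second countability of the coordinate
  space.\<close>

lemma negligible_N: assumes c: "c \<in> A" shows "negligible (N c)"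
  unfolding locally_negligible_alt[of "N c"]
proof
  fix x assume x: "x \<in> N c"
  then have "x \<in> cimg c" using chart_in[OF chA[OF c]] by auto
  then obtain r where r: "r > 0" "negligible (N c \<inter> ball x r)" using hypersurface_local[OF A B X c] by meson
  have "openin (top_of_set (N c)) (N c \<inter> ball x r)" by (simp add: openin_open_Int)
  then show "\<exists>U. openin (top_of_set (N c)) U \<and> x \<in> U \<and> negligible U"
    using r x by (intro exI[of _ "N c \<inter> ball x r"]) auto
qed

lemma lor: "c \<in> A \<Longrightarrow> x \<in> cimg c \<Longrightarrow> lorentzian (metric_coords g c x)"
  using g chart_in'[OF chA] unfolding lorentzian_metric_def metric_coords_def by blast

text \<open>The step from regularity on the two sides to a Lipschitz metric across the hypersurface;
  the cone condition in \<open>flat_set\<close> is what makes it possible.\<close>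

lemma lip_metric_coords:
  assumes c: "c \<in> A" shows "lip_metric (cimg c) (N c) (metric_coords g c)"
proof
  note ch = chA[OF c]
  show "open (cimg c)" by (rule chart_open_img[OF ch])
  show "negligible (N c)" by (rule negligible_N[OF c])
  show "lorentzian (metric_coords g c x)" if "x \<in> cimg c" for x by (rule lor[OF c that])
  fix m n
  let ?u = "\<lambda>x. metric_coords g c x $ m $ n"
  show "lipd (cimg c) (N c) ?u"
  proof (rule lipd_flat_set[OF flat_N[OF c]])
    show "continuous_on (cimg c) ?u" using g_C2 c unfolding metric_C0_C2_off_def by simp
    show "?u differentiable (at x)" if x: "x \<in> cimg c - N c" for x
    proof -
      have "cinv c x \<in> cdom c - range X" using x N_iff[OF c, of x] chart_in'[OF ch, of x] by simp
      then have "x \<in> crd c ` (cdom c - range X)" using chart_image_iff[OF ch _ Diff_subset] x by simp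
      moreover have C2: "Ck_on (Suc 1) (crd c ` (cdom c - range X)) ?u"
        using g_C2 c unfolding metric_C0_C2_off_def by (simp only: Suc_1)
      have "\<forall>x\<in>crd c ` (cdom c - range X). ?u differentiable (at x)"
        by (rule conjunct1[OF C2[unfolded Ck_on.simps]])
      ultimately show ?thesis by blast
    qed
    fix p assume p: "p \<in> cimg c"
    obtain V C where V: "open V" "cinv c p \<in> V" "V \<subseteq> cdom c"
      "\<forall>q\<in>V - range X. \<forall>i \<mu> \<nu>. \<bar>pd i (\<lambda>x. metric_coords g c x $ \<mu> $ \<nu>) (crd c q)\<bar> \<le> C"
      using g_bdd c chart_in'[OF ch p] unfolding metric_derivs_locally_bounded_off_def by meson
    have "p \<in> crd c ` V" using chart_image_iff[OF ch p V(3)] V(2) by simp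
    then obtain r where r: "r > 0" "ball p r \<subseteq> crd c ` V"
      using chart_open_image[OF ch V(1,3)] open_contains_ball by blast
    have "\<bar>pd i ?u x\<bar> \<le> C" if x: "x \<in> ball p r - N c" for x i
    proof -
      obtain q where q: "q \<in> V" "x = crd c q" using x r(2) by blast
      then have "q \<notin> range X" using x V(3) by blast
      then show ?thesis using V(4) q by blast
    qed
    then show "\<exists>r>0. \<exists>C. \<forall>x\<in>ball p r - N c. \<forall>i. \<bar>pd i ?u x\<bar> \<le> C" using r(1) by blast
  qed
qed

lemma lip_sqrt_det:
  assumes c: "c \<in> A" shows "lipd (cimg c) (N c) (\<lambda>x. sqrt (- det (metric_coords g c x)))"
proof -
  interpret lip_metric "cimg c" "N c" "metric_coords g c" by (rule lip_metric_coords[OF c])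
  have "lipd (cimg c) (N c) (\<lambda>x. (-1) * det (metric_coords g c x))"
    by (intro lipd_cmult lipd_det open_W lip_G)
  then have "lipd (cimg c) (N c) (\<lambda>x. - det (metric_coords g c x))" by simp
  then show ?thesis by (rule lipd_sqrt) (use lorentzian_det_neg[OF lor] in simp)
qed

section \<open>The Einstein tensor as a tensor-valued distribution\<close>

lemma lipc_test:
  assumes c: "c \<in> A" and \<phi>: "\<phi> \<in> tests A (cdom c)"
  shows "lipc (cimg c) (N c) (\<lambda>x. \<phi> (cinv c x))"
    and "compact (crd c ` supp \<phi>)" "crd c ` supp \<phi> \<subseteq> cimg c" "\<And>x. x \<in> cimg c - crd c ` supp \<phi> \<Longrightarrow> \<phi> (cinv c x) = 0"
proof -
  note ch = chA[OF c]
  show K: "compact (crd c ` supp \<phi>)" "crd c ` supp \<phi> \<subseteq> cimg c"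
    using chart_compact_image[OF ch testsD(2,3)[OF \<phi>]] by auto
  show z: "\<phi> (cinv c x) = 0" if "x \<in> cimg c - crd c ` supp \<phi>" for x
    by (rule notin_supp) (use that chart_image_iff[OF ch _ testsD(3)[OF \<phi>]] in auto)
  have "lipd (cimg c) (N c) (\<lambda>x. \<phi> (cinv c x))"
    by (rule smooth_on_lipd[OF chart_open_img[OF ch] testsD(1)[OF \<phi> c]])
  then show "lipc (cimg c) (N c) (\<lambda>x. \<phi> (cinv c x))" unfolding lipc_def using K z by blast
qed

lemma lipc_density:
  assumes c: "c \<in> A" and \<phi>: "\<phi> \<in> tests A (cdom c)"
  shows "lipc (cimg c) (N c) (density_test g c \<phi>)"
  unfolding density_test_def[abs_def] by (rule lipc_mult[OF lip_sqrt_det[OF c] lipc_test(1)[OF c \<phi>]])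

lemma einstein_tensor_eq:
  assumes c: "c \<in> A" and \<phi>: "\<phi> \<in> tests A (cdom c)"
  shows "einstein_tensor g c m n \<phi> = ein_on (cimg c) (metric_coords g c) m n (density_test g c \<phi>)"
  unfolding einstein_tensor_def
  by (rule lip_metric.einstein_dist_eq[OF lip_metric_coords[OF c] lipc_density[OF c \<phi>]])

lemma einstein_defined_density:
  assumes c: "c \<in> A" and \<phi>: "\<phi> \<in> tests A (cdom c)"
  shows "einstein_defined_on (cimg c) (metric_coords g c) (density_test g c \<phi>)"
  by (rule lip_metric.einstein_defined[OF lip_metric_coords[OF c] lipc_density[OF c \<phi>]])

text \<open>In coordinates the functional is of order one in the test function, as the Lipschitz
  density is absorbed into the coefficients; the estimate involves derivatives of order at most
  one.\<close>

lemma einstein_chart_distribution: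
  assumes c: "c \<in> A" shows "chart_distribution A c (einstein_tensor g c m n)"
proof -
  interpret lip_metric "cimg c" "N c" "metric_coords g c" by (rule lip_metric_coords[OF c])
  note ch = chA[OF c]
  let ?v = "\<lambda>h. ein_on (cimg c) (metric_coords g c) m n (\<lambda>x. sqrt (- det (metric_coords g c x)) * h x)"
  have v: "first_order (cimg c) (N c) ?v"
    by (rule first_order_mult[OF open_W null_N first_order_ein lip_sqrt_det[OF c]])
  have ev: "einstein_tensor g c m n \<phi> = ?v (\<lambda>x. \<phi> (cinv c x))" if "\<phi> \<in> tests A (cdom c)" for \<phi>
    unfolding einstein_tensor_eq[OF c that] density_test_def[abs_def] ..
  show ?thesis unfolding chart_distribution_def
  proof (intro conjI ballI allI impI)
    fix \<phi> \<psi> a b assume p: "\<phi> \<in> tests A (cdom c)" and q: "\<psi> \<in> tests A (cdom c)"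
    have l: "?v (\<lambda>x. a * \<phi> (cinv c x) + b * \<psi> (cinv c x)) = a * ?v (\<lambda>x. \<phi> (cinv c x)) + b * ?v (\<lambda>x. \<psi> (cinv c x))"
      by (rule first_order_linear[OF open_W null_N v lipc_test(1)[OF c p] lipc_test(1)[OF c q]])
    have "lipc (cimg c) (N c) (\<lambda>x. a * \<phi> (cinv c x) + b * \<psi> (cinv c x))"
      by (intro lipc_add lipc_mult lipd_const open_W lipc_test(1)[OF c] p q)
    then have "lipc (cimg c) (N c) (density_test g c (\<lambda>p. a * \<phi> p + b * \<psi> p))"
      unfolding density_test_def[abs_def] by (rule lipc_mult[OF lip_sqrt_det[OF c]])
    then have "einstein_tensor g c m n (\<lambda>p. a * \<phi> p + b * \<psi> p) = ?v (\<lambda>x. a * \<phi> (cinv c x) + b * \<psi> (cinv c x))"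
      unfolding einstein_tensor_def by (subst einstein_dist_eq) (simp_all add: density_test_def[abs_def])
    then show "einstein_tensor g c m n (\<lambda>p. a * \<phi> p + b * \<psi> p) = a * einstein_tensor g c m n \<phi> + b * einstein_tensor g c m n \<psi>"
      unfolding l ev[OF p] ev[OF q] .
  next
    fix L assume L: "compact L \<and> L \<subseteq> cdom c"
    have K: "compact (crd c ` L)" "crd c ` L \<subseteq> cimg c" using chart_compact_image[OF ch] L by auto
    obtain C where C: "C \<ge> 0" "\<forall>\<psi> S. lipc (cimg c) (N c) \<psi> \<longrightarrow> (\<forall>x\<in>cimg c - crd c ` L. \<psi> x = 0) \<longrightarrow>
     (\<forall>x\<in>cimg c - N c. \<bar>\<psi> x\<bar> \<le> S \<and> (\<forall>i. \<bar>pd i \<psi> x\<bar> \<le> S)) \<longrightarrow> S \<ge> 0 \<longrightarrow> \<bar>?v \<psi>\<bar> \<le> C * S"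
      using first_order_bound[OF open_W null_N v K] by (elim exE conjE)
    show "\<exists>C k. \<forall>\<phi>\<in>tests A L. \<bar>einstein_tensor g c m n \<phi>\<bar> \<le> C * (\<Sum>is | length is \<le> k. SUP x\<in>cimg c. \<bar>pds is (\<lambda>x. \<phi> (cinv c x)) x\<bar>)"
    \<comment> \<open>The seminorms of an empty chart are suprema of the empty set, about which
      nothing is known; its only test function is 0.\<close>
    proof (cases "cimg c = {}")
      case True
      then have "cdom c = {}" by (simp add: cimg_def)
      then have Le: "L = {}" using L by simp
      have "einstein_tensor g c m n \<phi> = 0" if "\<phi> \<in> tests A L" for \<phi>
      proof -
        have "\<phi> \<in> tests A {}" using that Le by simp
        then have "\<phi> = (\<lambda>_. 0)" by (rule tests_empty)
        moreover have "?v (\<lambda>x. 0 * 0 + 0 * 0) = 0 * ?v (\<lambda>_. 0) + 0 * ?v (\<lambda>_. 0)"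
          by (rule first_order_linear[OF open_W null_N v lipc_0[OF open_W] lipc_0[OF open_W]])
        ultimately show ?thesis using ev[OF zero_test] by simp
      qed
      then show ?thesis by (intro exI[of _ 0]) simp
    next
      case False
      then obtain x0 where x0: "x0 \<in> cimg c" by blast
      have "\<bar>einstein_tensor g c m n \<phi>\<bar> \<le> C * (\<Sum>is | length is \<le> 1. SUP x\<in>cimg c. \<bar>pds is (\<lambda>x. \<phi> (cinv c x)) x\<bar>)"
        if \<phi>: "\<phi> \<in> tests A L" for \<phi>
      proof -
        let ?S = "\<Sum>is | length is \<le> 1. SUP x\<in>cimg c. \<bar>pds is (\<lambda>x. \<phi> (cinv c x)) x\<bar>"
        have p: "\<phi> \<in> tests A (cdom c)" by (rule tests_mono[OF \<phi>]) (use L in simp)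
        note sem = tests_seminorm[OF A c p, where n = 1]
        have s0: "\<bar>\<phi> (cinv c x)\<bar> \<le> ?S" if "x \<in> cimg c" for x using sem[OF that, of "[]"] by simp
        have s1: "\<bar>pd i (\<lambda>x. \<phi> (cinv c x)) x\<bar> \<le> ?S" if "x \<in> cimg c" for x i using sem[OF that, of "[i]"] by simp
        have z: "\<forall>x\<in>cimg c - crd c ` L. \<phi> (cinv c x) = 0"
          using lipc_test(4)[OF c p] testsD(3)[OF \<phi>] by blast
        have "0 \<le> ?S" using s0[OF x0] by linarith
        then have "\<bar>?v (\<lambda>x. \<phi> (cinv c x))\<bar> \<le> C * ?S"
          using C(2)[rule_format, of "\<lambda>x. \<phi> (cinv c x)" ?S] lipc_test(1)[OF c p] z s0 s1 by auto
        then show ?thesis unfolding ev[OF p] .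
      qed
      then show ?thesis by blast
    qed
  qed
qed

text \<open>Both sides are localized to the overlap, where the transition map is defined and the
  coordinate law applies.\<close>

lemma einstein_transform:
  assumes c: "c \<in> A" "c' \<in> A" and \<phi>: "\<phi> \<in> tests A (cdom c \<inter> cdom c')"
  shows "einstein_tensor g c m n \<phi> = (\<Sum>a\<in>UNIV. \<Sum>b\<in>UNIV.
     einstein_tensor g c' a b (\<lambda>p. jac c c' p $ a $ m * jac c c' p $ b $ n * \<phi> p))"
proof -
  note ch = chA[OF c(1)] and ch' = chA[OF c(2)]
  let ?I = "cdom c \<inter> cdom c'"
  have oI: "open ?I" by (intro open_Int chart_open_dom ch ch')
  define W where "W = crd c ` ?I"
  define W' where "W' = crd c' ` ?I"
  define H where "H x = crd c' (cinv c x)" for x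
  define H' where "H' y = crd c (cinv c' y)" for y
  have oW: "open W" "W \<subseteq> cimg c" unfolding W_def using chart_open_image[OF ch oI] chart_in[OF ch] by auto
  have oW': "open W'" "W' \<subseteq> cimg c'" unfolding W'_def using chart_open_image[OF ch' oI] chart_in[OF ch'] by auto
  have inW: "cinv c x \<in> ?I" if "x \<in> W" for x using that chart_inv[OF ch] unfolding W_def by auto
  have inW': "cinv c' y \<in> ?I" if "y \<in> W'" for y using that chart_inv[OF ch'] unfolding W'_def by auto
  have sI: "cdom c' \<inter> cdom c = ?I" by blast
  interpret coord_change W "N c" "metric_coords g c" W' "N c'" "metric_coords g c'" H H'
  proof (intro coord_change.intro coord_change_axioms.intro)
    show "lip_metric W (N c) (metric_coords g c)" by (rule lip_metric.restrict[OF lip_metric_coords[OF c(1)] oW])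
    show "lip_metric W' (N c') (metric_coords g c')" by (rule lip_metric.restrict[OF lip_metric_coords[OF c(2)] oW'])
    show "H x \<in> W'" if "x \<in> W" for x using inW[OF that] by (simp add: H_def W'_def)
    show "H' y \<in> W" if "y \<in> W'" for y using inW'[OF that] by (simp add: H'_def W_def)
    show "H' (H x) = x" if "x \<in> W" for x
      using inW[OF that] chart_inv[OF ch'] chart_inv'[OF ch] oW(2) that by (auto simp: H_def H'_def)
    show "H (H' y) = y" if "y \<in> W'" for y
      using inW'[OF that] chart_inv[OF ch] chart_inv'[OF ch'] oW'(2) that by (auto simp: H_def H'_def)
    show "smooth_on W (\<lambda>x. H x $ a)" for a unfolding H_def W_def by (rule atlas_smooth[OF A c])
    show "smooth_on W' (\<lambda>y. H' y $ a)" for a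
      using atlas_smooth[OF A c(2,1)] unfolding H'_def W'_def sI .
    show "H x \<in> N c' \<longleftrightarrow> x \<in> N c" if x: "x \<in> W" for x
    proof -
      have 1: "x \<in> N c \<longleftrightarrow> cinv c x \<in> range X" using N_iff[OF c(1)] oW(2) x by blast
      have "H x \<in> cimg c'" unfolding H_def using inW[OF x] chart_in[OF ch'] by simp
      then have "H x \<in> N c' \<longleftrightarrow> cinv c' (H x) \<in> range X" by (rule N_iff[OF c(2)])
      also have "cinv c' (H x) = cinv c x" unfolding H_def using inW[OF x] chart_inv[OF ch'] by simp
      finally show ?thesis using 1 by simp
    qed
    show "metric_coords g c x = transpose (\<chi> a i. pd i (\<lambda>x. H x $ a) x) ** metric_coords g c' (H x) ** (\<chi> a i. pd i (\<lambda>x. H x $ a) x)"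
      if x: "x \<in> W" for x
    proof -
      have e: "crd c (cinv c x) = x" using chart_inv'[OF ch] oW(2) x by blast
      have "g c (cinv c x) = transpose (jac c c' (cinv c x)) ** g c' (cinv c x) ** jac c c' (cinv c x)"
        using g c inW[OF x] unfolding lorentzian_metric_def cov2_tensor_field_def by blast
      moreover have "cinv c' (H x) = cinv c x" unfolding H_def using inW[OF x] chart_inv[OF ch'] by simp
      ultimately show ?thesis unfolding metric_coords_def jac_def e H_def by simp
    qed
  qed
  have p: "\<phi> \<in> tests A (cdom c)" by (rule tests_mono[OF \<phi>]) simp
  let ?\<psi> = "density_test g c \<phi>"
  let ?t = "\<lambda>a b p. jac c c' p $ a $ m * jac c c' p $ b $ n * \<phi> p"
  have t: "?t a b \<in> tests A ?I" for a b by (rule tests_jac[OF A c order_refl \<phi>])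
  have t': "?t a b \<in> tests A (cdom c')" for a b by (rule tests_mono[OF t]) simp
  have KW: "crd c ` supp \<phi> \<subseteq> W" using testsD(3)[OF \<phi>] unfolding W_def by blast
  have KW': "crd c' ` supp (?t a b) \<subseteq> W'" for a b using testsD(3)[OF t] unfolding W'_def by blast
  have z: "?\<psi> x = 0" if "x \<in> cimg c - crd c ` supp \<phi>" for x
    using lipc_test(4)[OF c(1) p that] by (simp add: density_test_def)
  have z': "density_test g c' (?t a b) y = 0" if "y \<in> cimg c' - crd c' ` supp (?t a b)" for a b y
    using lipc_test(4)[OF c(2) t' that] by (simp add: density_test_def)
  have "lipd W (N c) ?\<psi>" by (rule lipd_subset[OF lipc_lipd[OF lipc_density[OF c(1) p]] oW])
  moreover have "\<forall>x\<in>W - crd c ` supp \<phi>. ?\<psi> x = 0" using z oW(2) by blast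
  ultimately have \<psi>: "lipc W (N c) ?\<psi>"
    unfolding lipc_def using lipc_test(2)[OF c(1) p] KW by (intro conjI exI[of _ "crd c ` supp \<phi>"])
  \<comment> \<open>The density sqrt(-det g) picks up |det J|, which cancels \<Delta>. This is why
    the law for the invariant pairing contains no determinant.\<close>
  have dens: "J a m (H' y) * J b n (H' y) * \<Delta> (H' y) * ?\<psi> (H' y) = density_test g c' (?t a b) y" if y: "y \<in> W'" for a b y
  proof -
    let ?x = "H' y"
    have x: "?x \<in> W" by (rule H'_in[OF y])
    have q: "cinv c ?x = cinv c' y" unfolding H'_def using inW'[OF y] chart_inv[OF ch] by simp
    have Jj: "J a i ?x = jac c c' (cinv c' y) $ a $ i" for a i by (simp add: J_def jac_def H'_def H_def)
    have "det (metric_coords g c ?x) = (det (Jm ?x))^2 * det (metric_coords g c' y)"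
      unfolding tens_Jm[OF x] HH'[OF y] by (simp add: det_mul power2_eq_square mult_ac)
    then have "sqrt (- det (metric_coords g c ?x)) = \<bar>det (Jm ?x)\<bar> * sqrt (- det (metric_coords g c' y))"
      by (metis mult_minus_right real_sqrt_abs real_sqrt_mult)
    then have "\<Delta> ?x * ?\<psi> ?x = sqrt (- det (metric_coords g c' y)) * \<phi> (cinv c' y)"
      using det_Jm[OF x] by (simp add: \<Delta>_def density_test_def q)
    then show ?thesis unfolding Jj density_test_def[of g c'] by (simp add: mult_ac)
  qed
  have "einstein_tensor g c m n \<phi> = ein_on (cimg c) (metric_coords g c) m n ?\<psi>" by (rule einstein_tensor_eq[OF c(1) p])
  also have "\<dots> = ein_on W (metric_coords g c) m n ?\<psi>"
    by (rule ein_on_restrict[OF chart_open_img[OF ch] compact_imp_closed[OF lipc_test(2)[OF c(1) p]] z KW oW(2)])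
  also have "\<dots> = (\<Sum>a\<in>UNIV. \<Sum>b\<in>UNIV. ein_on W' (metric_coords g c') a b (push (\<lambda>x. J a m x * J b n x * \<Delta> x * ?\<psi> x)))"
    by (rule einstein_law[OF \<psi>])
  also have "\<dots> = (\<Sum>a\<in>UNIV. \<Sum>b\<in>UNIV. ein_on W' (metric_coords g c') a b (density_test g c' (?t a b)))"
    by (intro sum.cong refl ein_on_cong[OF oW'(1)]) (simp add: push_def dens)
  also have "\<dots> = (\<Sum>a\<in>UNIV. \<Sum>b\<in>UNIV. ein_on (cimg c') (metric_coords g c') a b (density_test g c' (?t a b)))"
    by (intro sum.cong refl ein_on_restrict[OF chart_open_img[OF ch'] compact_imp_closed[OF lipc_test(2)[OF c(2) t']] z' KW' oW'(2), symmetric])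
  also have "\<dots> = (\<Sum>a\<in>UNIV. \<Sum>b\<in>UNIV. einstein_tensor g c' a b (?t a b))"
    by (intro sum.cong refl einstein_tensor_eq[OF c(2) t', symmetric])
  finally show ?thesis .
qed

lemma einstein_tensor_distribution: "tensor_distribution A (einstein_tensor g)"
  unfolding tensor_distribution_def using einstein_chart_distribution einstein_transform by simp

end

section \<open>The induced volume\<close>

text \<open>Translates between nonnegative integrals, which may be infinite, and absolute
  integrability, in terms of which the change of variables is stated. The value is infinite exactly
  when integrability fails.\<close>

lemma nn_integral_set_eq:
  fixes f :: "'a::euclidean_space \<Rightarrow> real"
  assumes m: "(\<lambda>u. indicator U u *\<^sub>R f u) \<in> borel_measurable borel" and nn: "\<And>u. u \<in> U \<Longrightarrow> 0 \<le> f u"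
  shows "(\<integral>\<^sup>+u\<in>U. ennreal (f u) \<partial>lborel) = (if f absolutely_integrable_on U then ennreal (integral U f) else \<infinity>)"
proof -
  let ?F = "\<lambda>u. indicator U u *\<^sub>R f u"
  have e: "(\<integral>\<^sup>+u\<in>U. ennreal (f u) \<partial>lborel) = (\<integral>\<^sup>+u. ennreal (?F u) \<partial>lborel)"
    by (rule nn_integral_cong) (simp add: indicator_def)
  have nF: "0 \<le> ?F u" for u using nn by (simp add: indicator_def)
  have i: "f absolutely_integrable_on U \<longleftrightarrow> integrable lborel ?F"
    unfolding set_integrable_def using m by (subst integrable_completion) auto
  show ?thesis
  proof (cases "f absolutely_integrable_on U")
    case True
    then have "(\<integral>\<^sup>+u. ennreal (?F u) \<partial>lborel) = ennreal (LINT u|lborel. ?F u)"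
      using i nF by (intro nn_integral_eq_integral) auto
    also have "(LINT u|lborel. ?F u) = (LINT u:U|lebesgue. f u)"
      unfolding set_lebesgue_integral_def by (rule integral_completion[symmetric]) (use m in simp)
    also have "\<dots> = integral U f" using set_lebesgue_integral_eq_integral(2)[OF True] .
    finally show ?thesis using True e by simp
  next
    case False
    then have "\<not> integrable lborel ?F" using i by simp
    then have "\<not> (\<integral>\<^sup>+u. ennreal (norm (?F u)) \<partial>lborel) < \<infinity>"
      using m integrableI_bounded[of ?F lborel] by auto
    then have "(\<integral>\<^sup>+u. ennreal (?F u) \<partial>lborel) = \<infinity>" using nF less_top by force
    then show ?thesis using False e by simp
  qed
qed

section \<open>Chain rules for the embedding and the induced metric\<close>

lemma dmap_chain_target:
  fixes A :: "('a::t2_space, 4) chart set" and B :: "('b::topological_space, 3) chart set"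
  assumes A: "smooth_atlas A" and B: "smooth_atlas B" and X: "embedded_hypersurface A B X"
    and c: "c \<in> A" "c' \<in> A" and d: "d \<in> B" "y \<in> cdom d" and y: "X y \<in> cdom c" "X y \<in> cdom c'"
  shows "dmap X c' d y = jac c c' (X y) ** dmap X c d y"
proof -
  have ch: "is_chart c" and dh: "is_chart d"
    by (rule atlas_chart[OF A c(1)], rule atlas_chart[OF B d(1)])
  have Xc: "continuous_on UNIV X" using X by (simp add: embedded_hypersurface_def homeomorphism_def)
  let ?P = "cdom d \<inter> X -` (cdom c \<inter> cdom c')"
  have "open (cdom c \<inter> cdom c')" by (intro open_Int chart_open_dom atlas_chart[OF A] c)
  then have oP: "open ?P" by (intro open_Int[OF chart_open_dom[OF dh]] open_vimage[OF _ Xc])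
  let ?W = "crd d ` ?P"
  have oW: "open ?W" by (rule chart_open_image[OF dh oP Int_lower1])
  let ?u = "crd d y"
  have u: "?u \<in> ?W" using d y by blast
  have cu: "cinv d ?u = y" by (rule chart_inv[OF dh d(2)])
  let ?Y = "\<lambda>u. crd c (X (cinv d u))"
  have sm: "smooth_on (crd d ` (cdom d \<inter> X -` cdom c)) (\<lambda>u. ?Y u $ j)" for j
    using X c(1) d(1) unfolding embedded_hypersurface_def by blast
  have dY: "(\<lambda>u. ?Y u $ j) differentiable (at ?u)" for j
    by (rule smooth_on_differentiable[OF sm]) (use d y in blast)
  have dC: "(\<lambda>x. crd c' (cinv c x) $ m) differentiable (at (?Y ?u))" for m
    by (rule smooth_on_differentiable[OF atlas_smooth[OF A c]]) (use y in \<open>simp add: cu\<close>)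
  have "pd i (\<lambda>u. crd c' (X (cinv d u)) $ m) ?u = (\<Sum>j\<in>UNIV. pd j (\<lambda>x. crd c' (cinv c x) $ m) (crd c (X y)) * pd i (\<lambda>u. ?Y u $ j) ?u)" for m i
  proof -
    have "pd i (\<lambda>u. crd c' (X (cinv d u)) $ m) ?u = pd i (\<lambda>u. crd c' (cinv c (?Y u)) $ m) ?u"
      by (rule pd_cong[OF oW u]) (auto simp: chart_inv[OF ch] chart_inv[OF dh])
    also have "\<dots> = (\<Sum>j\<in>UNIV. pd i (\<lambda>u. ?Y u $ j) ?u * pd j (\<lambda>x. crd c' (cinv c x) $ m) (?Y ?u))"
      by (rule pd_compose[where h = ?Y and f = "\<lambda>x. crd c' (cinv c x) $ m", OF dY dC])
    finally show ?thesis by (simp add: cu mult.commute)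
  qed
  then show ?thesis by (simp add: dmap_def jac_def matrix_matrix_mult_def vec_eq_iff)
qed

lemma dmap_chain_source:
  fixes A :: "('a::t2_space, 4) chart set" and B :: "('b::topological_space, 3) chart set"
  assumes A: "smooth_atlas A" and B: "smooth_atlas B" and X: "embedded_hypersurface A B X"
    and c: "c \<in> A" and d: "d \<in> B" "d' \<in> B" "y \<in> cdom d" "y \<in> cdom d'" and y: "X y \<in> cdom c"
  shows "dmap X c d y = dmap X c d' y ** jac d d' y"
proof -
  have dh: "is_chart d" "is_chart d'" by (rule atlas_chart[OF B d(1)], rule atlas_chart[OF B d(2)])
  let ?P = "cdom d \<inter> cdom d'"
  have "open ?P" by (intro open_Int chart_open_dom dh)
  then have oW: "open (crd d ` ?P)" by (rule chart_open_image[OF dh(1) _ Int_lower1])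
  let ?u = "crd d y"
  have u: "?u \<in> crd d ` ?P" using d by blast
  have cu: "cinv d ?u = y" by (rule chart_inv[OF dh(1) d(3)])
  let ?h = "\<lambda>u. crd d' (cinv d u)"
  have dh': "(\<lambda>u. ?h u $ j) differentiable (at ?u)" for j
    by (rule smooth_on_differentiable[OF atlas_smooth[OF B d(1,2)] u])
  have sm: "smooth_on (crd d' ` (cdom d' \<inter> X -` cdom c)) (\<lambda>u. crd c (X (cinv d' u)) $ m)" for m
    using X c d(2) unfolding embedded_hypersurface_def by blast
  have dY: "(\<lambda>u. crd c (X (cinv d' u)) $ m) differentiable (at (?h ?u))" for m
    by (rule smooth_on_differentiable[OF sm]) (use d y in \<open>simp add: cu\<close>)
  have "pd i (\<lambda>u. crd c (X (cinv d u)) $ m) ?u = (\<Sum>j\<in>UNIV. pd j (\<lambda>u. crd c (X (cinv d' u)) $ m) (crd d' y) * pd i (\<lambda>u. ?h u $ j) ?u)" for m i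
  proof -
    have "pd i (\<lambda>u. crd c (X (cinv d u)) $ m) ?u = pd i (\<lambda>u. crd c (X (cinv d' (?h u))) $ m) ?u"
      by (rule pd_cong[OF oW u]) (auto simp: chart_inv[OF dh(1)] chart_inv[OF dh(2)])
    also have "\<dots> = (\<Sum>j\<in>UNIV. pd i (\<lambda>u. ?h u $ j) ?u * pd j (\<lambda>u. crd c (X (cinv d' u)) $ m) (?h ?u))"
      by (rule pd_compose[where h = ?h and f = "\<lambda>u. crd c (X (cinv d' u)) $ m", OF dh' dY])
    finally show ?thesis by (simp add: cu mult.commute)
  qed
  then show ?thesis by (simp add: dmap_def jac_def matrix_matrix_mult_def vec_eq_iff)
qed

context jump_metric
begin

abbreviation h where "h d y \<equiv> induced_metric A g X d y"

lemma chB: "d \<in> B \<Longrightarrow> is_chart d" by (rule atlas_chart[OF B])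

lemma X_continuous: "continuous_on UNIV X"
  using X by (simp add: embedded_hypersurface_def homeomorphism_def)

text \<open>The chart in the definition is a choice; the Jacobians that arise when it is changed are
  absorbed by the tensor law of g.\<close>

lemma induced_metric_eq:
  assumes c: "c \<in> A" "X y \<in> cdom c" and d: "d \<in> B" "y \<in> cdom d"
  shows "h d y = transpose (dmap X c d y) ** g c (X y) ** dmap X c d y"
proof -
  define e where "e = (SOME c. c \<in> A \<and> X y \<in> cdom c)"
  have e: "e \<in> A" "X y \<in> cdom e" using someI[of "\<lambda>c. c \<in> A \<and> X y \<in> cdom c" c] c unfolding e_def by auto
  have "dmap X e d y = jac c e (X y) ** dmap X c d y"
    by (rule dmap_chain_target[OF A B X c(1) e(1) d c(2) e(2)])
  moreover have "g c (X y) = transpose (jac c e (X y)) ** g e (X y) ** jac c e (X y)"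
    using g c e unfolding lorentzian_metric_def cov2_tensor_field_def by blast
  ultimately show ?thesis unfolding induced_metric_def Let_def e_def[symmetric]
    by (simp add: matrix_transpose_mul matrix_mul_assoc)
qed

lemma induced_metric_transform:
  assumes d: "d \<in> B" "d' \<in> B" "y \<in> cdom d" "y \<in> cdom d'"
  shows "h d y = transpose (jac d d' y) ** h d' y ** jac d d' y"
proof -
  obtain c where c: "c \<in> A" "X y \<in> cdom c" using atlas_cover[OF A] by blast
  show ?thesis unfolding induced_metric_eq[OF c d(1,3)] induced_metric_eq[OF c d(2,4)]
    dmap_chain_source[OF A B X c(1) d c(2)] by (simp add: matrix_transpose_mul matrix_mul_assoc)
qed

text \<open>The part of the coordinate image of d on which X has an expression in the chart
  c.\<close>

definition Q where "Q c d = crd d ` (cdom d \<inter> X -` cdom c)"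

lemma Q_open: assumes c: "c \<in> A" and d: "d \<in> B" shows "open (Q c d)"
proof -
  have "open (cdom d \<inter> X -` cdom c)"
    by (intro open_Int chart_open_dom[OF chB[OF d]] open_vimage[OF chart_open_dom[OF chA[OF c]] X_continuous])
  then show ?thesis unfolding Q_def by (rule chart_open_image[OF chB[OF d] _ Int_lower1])
qed

lemma Q_sub: "d \<in> B \<Longrightarrow> Q c d \<subseteq> cimg d"
  unfolding Q_def by (rule image_subsetI) (elim IntE, rule chart_in[OF chB])

lemma Q_D: assumes "d \<in> B" "u \<in> Q c d" shows "cinv d u \<in> cdom d" "X (cinv d u) \<in> cdom c" "crd d (cinv d u) = u"
  using assms chart_inv[OF chB[OF assms(1)]] unfolding Q_def by auto

lemma dmap_continuous:
  assumes c: "c \<in> A" and d: "d \<in> B" shows "continuous_on (Q c d) (\<lambda>u. dmap X c d (cinv d u) $ m $ i)"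
proof -
  have "smooth_on (Q c d) (\<lambda>u. crd c (X (cinv d u)) $ m)"
    using X c d unfolding embedded_hypersurface_def Q_def by blast
  then have "continuous_on (Q c d) (pd i (\<lambda>u. crd c (X (cinv d u)) $ m))"
    by (rule smooth_on_continuous[OF smooth_on_pd])
  then show ?thesis
    by (rule continuous_on_eq) (simp add: dmap_def Q_D(3)[OF d])
qed

lemma metric_continuous:
  assumes c: "c \<in> A" and d: "d \<in> B" shows "continuous_on (Q c d) (\<lambda>u. g c (X (cinv d u)) $ m $ n)"
proof -
  have "continuous_on (cimg c) (\<lambda>x. metric_coords g c x $ m $ n)"
    using g_C2 c unfolding metric_C0_C2_off_def by simp
  moreover have "continuous_on (Q c d) (\<lambda>u. crd c (X (cinv d u)))"
  proof (rule continuous_on_compose2[OF chart_cont[OF chA[OF c]]])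
    have "continuous_on (Q c d) (cinv d)" by (rule continuous_on_subset[OF chart_cont'[OF chB[OF d]] Q_sub[OF d]])
    then show "continuous_on (Q c d) (\<lambda>u. X (cinv d u))"
      by (rule continuous_on_compose2[OF X_continuous]) simp
  qed (rule image_subsetI, rule Q_D(2)[OF d])
  ultimately have "continuous_on (Q c d) (\<lambda>u. metric_coords g c (crd c (X (cinv d u))) $ m $ n)"
    by (rule continuous_on_compose2) (rule image_subsetI, rule chart_in[OF chA[OF c] Q_D(2)[OF d]])
  then show ?thesis
    by (rule continuous_on_eq) (simp add: metric_coords_def chart_inv[OF chA[OF c] Q_D(2)[OF d]])
qed

lemma h_continuous_Q:
  assumes c: "c \<in> A" and d: "d \<in> B" shows "continuous_on (Q c d) (\<lambda>u. h d (cinv d u) $ i $ j)"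
proof -
  have "continuous_on (Q c d) (\<lambda>u. (transpose (dmap X c d (cinv d u)) ** g c (X (cinv d u)) ** dmap X c d (cinv d u)) $ i $ j)"
    unfolding matrix_matrix_mult_def transpose_def
    by (simp, intro continuous_intros dmap_continuous[OF c d] metric_continuous[OF c d])
  then show ?thesis
    by (rule continuous_on_eq) (simp add: induced_metric_eq[OF c Q_D(2)[OF d] d Q_D(1)[OF d]])
qed

text \<open>Different ambient charts cover different parts of the image, so continuity is checked
  point by point.\<close>

lemma h_continuous:
  assumes d: "d \<in> B" shows "continuous_on (cimg d) (\<lambda>u. h d (cinv d u) $ i $ j)"
proof (rule continuous_at_imp_continuous_on, rule ballI)
  fix u assume u: "u \<in> cimg d"
  obtain c where c: "c \<in> A" "X (cinv d u) \<in> cdom c" using atlas_cover[OF A] by blast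
  have "u = crd d (cinv d u)" "cinv d u \<in> cdom d" using chart_inv'[OF chB[OF d] u] chart_in'[OF chB[OF d] u] by auto
  then have "u \<in> Q c d" unfolding Q_def using c by blast
  then show "isCont (\<lambda>u. h d (cinv d u) $ i $ j) u"
    using h_continuous_Q[OF c(1) d] Q_open[OF c(1) d] continuous_on_eq_continuous_at by blast
qed

text \<open>The truncation does not change the measure, since \<open>ennreal\<close> maps negative numbers to 0, and it
  makes the positivity of the determinant irrelevant.\<close>

definition vol where "vol d u = max 0 (sqrt (det (h d (cinv d u))))"

lemma vol_continuous: assumes d: "d \<in> B" shows "continuous_on (cimg d) (vol d)"
proof -
  have "continuous_on (cimg d) (\<lambda>u. det (h d (cinv d u)))"
    unfolding det_def by (intro continuous_intros h_continuous[OF d])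
  then have "continuous_on (cimg d) (\<lambda>u. sqrt (det (h d (cinv d u))))" by (rule continuous_on_real_sqrt)
  then show ?thesis unfolding vol_def[abs_def] by (intro continuous_on_max continuous_on_const)
qed

definition I where "I d S = (\<integral>\<^sup>+ u \<in> crd d ` S. ennreal (sqrt (det (h d (cinv d u)))) \<partial>lborel)"

section \<open>The measures of the single charts and their gluing\<close>

lemma I_vol: "I d S = (\<integral>\<^sup>+ u \<in> crd d ` S. ennreal (vol d u) \<partial>lborel)"
proof -
  have "ennreal t = ennreal (max 0 t)" for t by (cases "t \<ge> 0") (simp_all add: max_def ennreal_neg)
  then show ?thesis unfolding I_def vol_def by simp
qed

text \<open>The image under a chart is a preimage under its continuous inverse.\<close>

lemma image_borel:
  assumes d: "d \<in> B" and S: "S \<in> sets borel" "S \<subseteq> cdom d"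
  shows "crd d ` S \<in> sets borel"
proof -
  have eq: "crd d ` S = (cinv d -` S) \<inter> cimg d"
    using chart_image_iff[OF chB[OF d] _ S(2)] chart_in[OF chB[OF d]] S(2) by auto
  have "cinv d \<in> borel_measurable (restrict_space borel (cimg d))"
    using chart_cont'[OF chB[OF d]] by (rule borel_measurable_continuous_on_restrict)
  from measurable_sets[OF this S(1)] have "(cinv d -` S) \<inter> cimg d \<in> sets (restrict_space borel (cimg d))"
    by (simp add: space_restrict_space)
  then have "crd d ` S \<in> sets (restrict_space borel (cimg d))" unfolding eq .
  then show ?thesis using chart_open_img[OF chB[OF d]] by (auto simp: sets_restrict_space_iff)
qed

lemma vol_meas:
  assumes d: "d \<in> B" and U: "U \<in> sets borel" "U \<subseteq> cimg d"
  shows "(\<lambda>u. indicator U u *\<^sub>R vol d u) \<in> borel_measurable borel"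
proof -
  have "(\<lambda>u. indicator (cimg d) u *\<^sub>R vol d u) \<in> borel_measurable borel"
    by (rule borel_measurable_continuous_on_indicator[OF _ vol_continuous[OF d]]) (use chart_open_img[OF chB[OF d]] in simp)
  then have "(\<lambda>u. indicator U u *\<^sub>R (indicator (cimg d) u *\<^sub>R vol d u)) \<in> borel_measurable borel"
    by (rule borel_measurable_scaleR[OF borel_measurable_indicator[OF U(1)]])
  moreover have "(\<lambda>u. indicator U u *\<^sub>R (indicator (cimg d) u *\<^sub>R vol d u)) = (\<lambda>u. indicator U u *\<^sub>R vol d u)"
    using U(2) by (intro ext) (auto simp: indicator_def)
  ultimately show ?thesis by simp
qed

text \<open>The square root of det h picks up the absolute determinant of the transition map, for
  which the change of variables compensates. The common value may be infinite.\<close>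

lemma I_invariant:
  assumes d: "d \<in> B" "d' \<in> B" and S: "S \<in> sets borel" "S \<subseteq> cdom d" "S \<subseteq> cdom d'"
  shows "I d S = I d' S"
proof -
  note dh = chB[OF d(1)] and dh' = chB[OF d(2)]
  let ?U = "crd d ` S" and ?U' = "crd d' ` S"
  define k where "k u = crd d' (cinv d u)" for u
  have U: "?U \<in> sets borel" "?U' \<in> sets borel" using image_borel d S by auto
  have Us: "?U \<subseteq> cimg d" "?U' \<subseteq> cimg d'" using S chart_in[OF dh] chart_in[OF dh'] by auto
  have kU: "k ` ?U = ?U'" unfolding k_def image_image using chart_inv[OF dh] S(2) by (intro image_cong) auto
  have Sin: "cinv d u \<in> S" "crd d (cinv d u) = u" if "u \<in> ?U" for u using that chart_inv[OF dh] S(2) by auto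
  have inj: "inj_on k ?U"
  proof (rule inj_onI)
    fix u v assume u: "u \<in> ?U" and v: "v \<in> ?U" and e: "k u = k v"
    have "cinv d u = cinv d v" using e chart_inv[OF dh'] Sin(1)[OF u] Sin(1)[OF v] S(3) unfolding k_def by (metis subsetD)
    then show "u = v" using Sin(2)[OF u] Sin(2)[OF v] by metis
  qed
  have der: "(k has_derivative (\<lambda>v. jac d d' (cinv d u) *v v)) (at u within ?U)" if u: "u \<in> ?U" for u
  proof -
    have "u \<in> crd d ` (cdom d \<inter> cdom d')" using u S by blast
    then have df: "(\<lambda>u. k u $ j) differentiable (at u)" for j
      unfolding k_def by (rule smooth_on_differentiable[OF atlas_smooth[OF B d]])
    have "(\<lambda>v. \<chi> j. \<Sum>i\<in>UNIV. v $ i * pd i (\<lambda>x. k x $ j) u) = (\<lambda>v. jac d d' (cinv d u) *v v)"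
      by (simp add: fun_eq_iff vec_eq_iff matrix_vector_mult_def jac_def k_def Sin(2)[OF u] mult.commute)
    then show ?thesis using has_derivative_at_withinI[OF differentiable_vec[OF df]] by simp
  qed
  have volk: "\<bar>det (jac d d' (cinv d u))\<bar> * vol d' (k u) = vol d u" if u: "u \<in> ?U" for u
  proof -
    have y: "cinv d u \<in> cdom d" "cinv d u \<in> cdom d'" using Sin(1)[OF u] S by auto
    have "det (h d (cinv d u)) = (det (jac d d' (cinv d u)))^2 * det (h d' (cinv d u))"
      unfolding induced_metric_transform[OF d y] by (simp add: det_mul power2_eq_square mult_ac)
    then have "sqrt (det (h d (cinv d u))) = \<bar>det (jac d d' (cinv d u))\<bar> * sqrt (det (h d' (cinv d u)))"
      by (simp add: real_sqrt_mult)
    then show ?thesis unfolding vol_def k_def chart_inv[OF dh' y(2)]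
      by (simp add: max_mult_distrib_left)
  qed
  have L: "?U \<in> sets lebesgue" using U(1) by simp
  note cov = change_of_variables_real[OF L der inj, of "vol d'", unfolded kU]
  have ai: "(\<lambda>u. \<bar>det (jac d d' (cinv d u))\<bar> * vol d' (k u)) absolutely_integrable_on ?U \<longleftrightarrow> vol d absolutely_integrable_on ?U"
    unfolding set_integrable_def by (intro Bochner_Integration.integrable_cong refl) (auto simp: volk indicator_def)
  have ii: "integral ?U (\<lambda>u. \<bar>det (jac d d' (cinv d u))\<bar> * vol d' (k u)) = integral ?U (vol d)"
    by (rule Henstock_Kurzweil_Integration.integral_cong) (rule volk)
  have "I d S = (if vol d absolutely_integrable_on ?U then ennreal (integral ?U (vol d)) else \<infinity>)"
    unfolding I_vol by (rule nn_integral_set_eq[OF vol_meas[OF d(1) U(1) Us(1)]]) (simp add: vol_def)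
  \<comment> \<open>The equivalence is instantiated with the integral of either side in turn, so
    that integrability passes in both directions.\<close>
  also have "\<dots> = (if vol d' absolutely_integrable_on ?U' then ennreal (integral ?U' (vol d')) else \<infinity>)"
    using cov[unfolded ai ii, of "integral ?U (vol d)"] cov[unfolded ai ii, of "integral ?U' (vol d')"] by auto
  also have "\<dots> = I d' S"
    unfolding I_vol by (rule nn_integral_set_eq[OF vol_meas[OF d(2) U(2) Us(2)], symmetric]) (simp add: vol_def)
  finally show ?thesis .
qed

lemma I_countably_additive:
  assumes d: "d \<in> B" and S: "\<And>i::nat. S i \<in> sets borel" "\<And>i. S i \<subseteq> cdom d" and dj: "disjoint_family S"
  shows "I d (\<Union>i. S i) = (\<Sum>i. I d (S i))"
proof -
  note dh = chB[OF d]
  have dj': "disjoint_family (\<lambda>i. crd d ` S i)"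
    unfolding disjoint_family_on_def
  proof (intro ballI impI)
    fix i j :: nat assume "i \<noteq> j"
    then have "S i \<inter> S j = {}" using dj by (simp add: disjoint_family_on_def)
    moreover have "inj_on (crd d) (cdom d)" by (rule inj_on_inverseI[where g = "cinv d"]) (rule chart_inv[OF dh])
    ultimately show "crd d ` S i \<inter> crd d ` S j = {}"
      using inj_on_image_Int[of "crd d" "cdom d" "S i" "S j"] S(2) by simp
  qed
  let ?F = "\<lambda>u. ennreal (indicator (cimg d) u *\<^sub>R vol d u)"
  have Fm: "?F \<in> borel_measurable lborel" using vol_meas[OF d _ order_refl] chart_open_img[OF dh] by simp
  have e: "I d T = emeasure (density lborel ?F) (crd d ` T)" if T: "T \<in> sets borel" "T \<subseteq> cdom d" for T
  proof -
    have "emeasure (density lborel ?F) (crd d ` T) = (\<integral>\<^sup>+u\<in>crd d ` T. ?F u \<partial>lborel)"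
      by (rule emeasure_density[OF Fm]) (use image_borel[OF d T] in simp)
    also have "\<dots> = I d T" unfolding I_vol
      by (rule nn_integral_cong) (use T chart_in[OF dh] in \<open>auto simp: indicator_def\<close>)
    finally show ?thesis by simp
  qed
  have "I d (\<Union>i. S i) = emeasure (density lborel ?F) (\<Union>i. crd d ` S i)"
    by (subst e) (use S in \<open>auto simp: image_UN\<close>)
  also have "\<dots> = (\<Sum>i. emeasure (density lborel ?F) (crd d ` S i))"
    by (rule suminf_emeasure[symmetric]) (use image_borel[OF d S] dj' in auto)
  finally show ?thesis using e S by simp
qed

text \<open>The atlas may be uncountable; a countable subcover exists by second
  countability.\<close>

lemma countable_charts:
  obtains e :: "nat \<Rightarrow> ('b, 3) chart" where "\<And>n. e n \<in> B" "(\<Union>n. cdom (e n)) = UNIV"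
proof -
  have "open U" if "U \<in> cdom ` B" for U using that chart_open_dom[OF chB] by blast
  then obtain F where F: "F \<subseteq> cdom ` B" "countable F" "\<Union>F = \<Union>(cdom ` B)"
    by (rule Lindelof)
  have "y \<in> \<Union>(cdom ` B)" for y
    using atlas_cover[OF B, of y] by (elim bexE) (rule UnionI[OF imageI])
  then have U: "\<Union>F = UNIV" using F(3) by auto
  then have "F \<noteq> {}" by auto
  then have r: "range (from_nat_into F) = F" using F(2) by (rule range_from_nat_into)
  have "\<forall>n. \<exists>d\<in>B. cdom d = from_nat_into F n" using r F(1) by (metis imageE rangeI subsetD)
  then obtain e where e: "\<And>n. e n \<in> B" "\<And>n. cdom (e n) = from_nat_into F n" by metis
  have "(\<Union>n. cdom (e n)) = UNIV" unfolding e(2) r U ..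
  then show ?thesis by (rule that[OF e(1)])
qed

definition is_volume :: "'b measure \<Rightarrow> bool" where
  "is_volume m \<longleftrightarrow> sets m = sets borel \<and> (\<forall>d\<in>B. \<forall>S\<in>sets borel. S \<subseteq> cdom d \<longrightarrow> emeasure m S = I d S)"

text \<open>The measures of the charts agree on overlaps, and are glued along a countable cover.\<close>

lemma is_volume_ex1: "\<exists>!m. is_volume m"
proof -
  obtain e :: "nat \<Rightarrow> ('b, 3) chart" where e: "\<And>n. e n \<in> B" "(\<Union>n. cdom (e n)) = UNIV" using countable_charts by blast
  \<comment> \<open>Disjoint Borel pieces, each inside one chart: the measure is assembled from
    them, and every volume is determined by its values on their subsets.\<close>
  define P where "P = disjointed (\<lambda>n. cdom (e n))"
  have Pd: "P n \<subseteq> cdom (e n)" for n unfolding P_def by (rule disjointed_subset)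
  have Pb: "P n \<in> sets borel" for n
    unfolding P_def disjointed_def using chart_open_dom[OF chB[OF e(1)]] by (intro sets.Diff sets.finite_UN) auto
  have PU: "(\<Union>n. P n) = UNIV" unfolding P_def UN_disjointed_eq by (rule e(2))
  have Pj: "disjoint_family (\<lambda>n. S \<inter> P n)" for S
    using disjoint_family_disjointed[of "\<lambda>n. cdom (e n)"] unfolding P_def disjoint_family_on_def by blast
  have SP: "S = (\<Union>n. S \<inter> P n)" for S using PU by blast
  define \<mu> where "\<mu> S = (\<Sum>n. I (e n) (S \<inter> P n))" for S
  have \<mu>_chart: "\<mu> S = I d S" if d: "d \<in> B" and S: "S \<in> sets borel" "S \<subseteq> cdom d" for d S
  proof -
    have "I (e n) (S \<inter> P n) = I d (S \<inter> P n)" for n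
      by (rule I_invariant[OF e(1) d]) (use S Pb Pd[of n] in auto)
    then have "\<mu> S = (\<Sum>n. I d (S \<inter> P n))" by (simp add: \<mu>_def)
    also have "\<dots> = I d (\<Union>n. S \<inter> P n)"
      by (rule I_countably_additive[OF d _ _ Pj, symmetric]) (use S Pb in auto)
    finally show ?thesis using SP[of S] by simp
  qed
  have I0: "I d {} = 0" for d unfolding I_def by simp
  define m where "m = measure_of UNIV (sets borel) \<mu>"
  have ms: "sets m = sets borel"
    unfolding m_def using sets.sets_measure_of_eq[of borel] by (simp add: sets.sigma_sets_eq[of borel, simplified])
  have em: "emeasure m S = \<mu> S" if "S \<in> sets borel" for S
  proof (rule emeasure_measure_of[OF m_def])
    show "sets borel \<subseteq> Pow UNIV" by simp
    show "positive (sets m) \<mu>" unfolding positive_def \<mu>_def by (simp add: I0)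
    show "countably_additive (sets m) \<mu>" unfolding countably_additive_def ms
    proof (intro allI impI)
      fix F :: "nat \<Rightarrow> 'b set" assume F: "range F \<subseteq> sets borel" "disjoint_family F" "(\<Union>i. F i) \<in> sets borel"
      have "I (e n) ((\<Union>i. F i) \<inter> P n) = (\<Sum>i. I (e n) (F i \<inter> P n))" for n
      proof -
        have "I (e n) (\<Union>i. F i \<inter> P n) = (\<Sum>i. I (e n) (F i \<inter> P n))"
        proof (rule I_countably_additive[OF e(1)])
          show "disjoint_family (\<lambda>i. F i \<inter> P n)" using F(2) unfolding disjoint_family_on_def by blast
        qed (use F(1) Pb Pd[of n] in auto)
        moreover have "(\<Union>i. F i) \<inter> P n = (\<Union>i. F i \<inter> P n)" by blast
        ultimately show ?thesis by (simp only:)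
      qed
      then have "\<mu> (\<Union>i. F i) = (\<Sum>n. \<Sum>i. I (e n) (F i \<inter> P n))" by (simp add: \<mu>_def)
      \<comment> \<open>One series is read as an integral over the counting measure, so that the
        interchange of integral and nonnegative series applies.\<close>
      also have "\<dots> = (\<integral>\<^sup>+n. (\<Sum>i. I (e n) (F i \<inter> P n)) \<partial>count_space UNIV)" by (rule nn_integral_count_space_nat[symmetric])
      also have "\<dots> = (\<Sum>i. \<integral>\<^sup>+n. I (e n) (F i \<inter> P n) \<partial>count_space UNIV)" by (rule nn_integral_suminf) simp
      also have "\<dots> = (\<Sum>i. \<mu> (F i))" unfolding nn_integral_count_space_nat \<mu>_def ..
      finally show "(\<Sum>i. \<mu> (F i)) = \<mu> (\<Union>i. F i)" by simp
    qed
    show "S \<in> sets m" using that ms by simp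
  qed
  have m: "is_volume m" unfolding is_volume_def using ms em \<mu>_chart by simp
  moreover have "m1 = m2" if m1: "is_volume m1" and m2: "is_volume m2" for m1 m2
  proof (rule measure_eqI)
    show s: "sets m1 = sets m2" using m1 m2 by (simp add: is_volume_def)
    have u: "emeasure m S = (\<Sum>n. I (e n) (S \<inter> P n))" if m: "is_volume m" and S: "S \<in> sets borel" for m S
    proof -
      have "(\<Sum>n. emeasure m (S \<inter> P n)) = emeasure m (\<Union>n. S \<inter> P n)"
        by (rule suminf_emeasure[OF _ Pj]) (use S Pb m in \<open>auto simp: is_volume_def\<close>)
      moreover have "emeasure m (S \<inter> P n) = I (e n) (S \<inter> P n)" for n
        using m e(1) S Pb Pd[of n] unfolding is_volume_def by (simp add: le_infI2)
      ultimately show ?thesis using SP[of S] by simp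
    qed
    fix S assume "S \<in> sets m1"
    then have "S \<in> sets borel" using m1 by (simp add: is_volume_def)
    then show "emeasure m1 S = emeasure m2 S" using u[OF m1] u[OF m2] by simp
  qed
  ultimately show ?thesis by blast
qed

section \<open>Local finiteness of the induced volume\<close>

abbreviation V where "V \<equiv> induced_volume A B g X"

lemma is_volume_V: "is_volume V"
proof -
  have "V = (THE m. is_volume m)" unfolding induced_volume_def is_volume_def I_def ..
  then show ?thesis using theI'[OF is_volume_ex1] by simp
qed

lemma sets_V: "sets V = sets borel"
  using is_volume_V by (simp add: is_volume_def)

lemma space_V: "space V = UNIV"
  using sets_eq_imp_space_eq[OF sets_V] by simp

text \<open>On a closed coordinate ball the continuous density is bounded, so the open ball inside
  it has finite volume.\<close>

lemma V_locally_finite: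
  "\<exists>U. open U \<and> y \<in> U \<and> emeasure V U < \<infinity>"
proof -
  obtain d where d: "d \<in> B" "y \<in> cdom d" using atlas_cover[OF B] by blast
  note dh = chB[OF d(1)]
  have "crd d y \<in> cimg d" by (rule chart_in[OF dh d(2)])
  then obtain r where r: "r > 0" "cball (crd d y) r \<subseteq> cimg d" using chart_open_img[OF dh] open_contains_cball by blast
  let ?b = "ball (crd d y) r" and ?c = "cball (crd d y) r"
  let ?U = "cinv d ` ?b"
  have bs: "?b \<subseteq> cimg d" using r(2) ball_subset_cball by blast
  have o: "open ?U" by (rule chart_open_image'[OF dh open_ball bs])
  have sub: "?U \<subseteq> cdom d" using bs chart_in'[OF dh] by auto
  have im: "crd d ` ?U = ?b" unfolding image_image using chart_inv'[OF dh] bs by force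
  have "compact (vol d ` ?c)" by (rule compact_continuous_image[OF continuous_on_subset[OF vol_continuous[OF d(1)] r(2)] compact_cball])
  then obtain C where C: "\<And>u. u \<in> ?c \<Longrightarrow> \<bar>vol d u\<bar> \<le> C" by (metis bounded_real compact_imp_bounded imageI)
  have "emeasure V ?U = I d ?U" using is_volume_V d(1) o sub unfolding is_volume_def by simp
  also have "\<dots> \<le> (\<integral>\<^sup>+u. ennreal C * indicator ?c u \<partial>lborel)"
    unfolding I_vol im
  proof (rule nn_integral_mono)
    fix u
    show "ennreal (vol d u) * indicator ?b u \<le> ennreal C * indicator ?c u"
    proof (cases "u \<in> ?b")
      case True
      then have "u \<in> ?c" by auto
      then show ?thesis using C[of u] True by (simp add: ennreal_leI)
    qed simp
  qed
  also have "\<dots> = ennreal C * emeasure lborel ?c" by (rule nn_integral_cmult_indicator) simp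
  also have "\<dots> < \<infinity>" using emeasure_bounded_finite[of ?c] by (simp add: ennreal_mult_less_top)
  finally have "emeasure V ?U < \<infinity>" .
  moreover have "y \<in> ?U" using r(1) chart_inv[OF dh d(2)] by (metis centre_in_ball imageI)
  ultimately show ?thesis using o by blast
qed

lemma V_compact_finite:
  assumes K: "compact K" shows "emeasure V K < \<infinity>"
proof -
  obtain U where U: "\<And>y. open (U y)" "\<And>y. y \<in> U y" "\<And>y. emeasure V (U y) < \<infinity>"
    using V_locally_finite by metis
  obtain F where F: "F \<subseteq> K" "finite F" "K \<subseteq> (\<Union>y\<in>F. U y)"
    by (rule compactE_image[OF K, of K U]) (use U(1,2) in auto)
  have "emeasure V K \<le> emeasure V (\<Union>y\<in>F. U y)" by (rule emeasure_mono[OF F(3)]) (use U(1) F(2) sets_V in auto)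
  also have "\<dots> \<le> (\<Sum>y\<in>F. emeasure V (U y))" by (rule emeasure_subadditive_finite) (use U(1) F(2) sets_V in auto)
  also have "\<dots> < \<infinity>" using U(3) F(2) by (simp add: less_top[symmetric])
  finally show ?thesis .
qed

end

section \<open>The distribution supported on the hypersurface\<close>

lemma tests_continuous:
  fixes A :: "('a::t2_space, 'n::finite) chart set"
  assumes A: "smooth_atlas A" and \<phi>: "\<phi> \<in> tests A U"
  shows "continuous_on UNIV \<phi>"
proof (rule continuous_at_imp_continuous_on, rule ballI)
  fix p :: 'a
  obtain c where c: "c \<in> A" "p \<in> cdom c" using atlas_cover[OF A] by blast
  have ch: "is_chart c" by (rule atlas_chart[OF A c(1)])
  have "continuous_on (cdom c) (\<lambda>p. \<phi> (cinv c (crd c p)))"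
    by (rule continuous_on_compose2[OF smooth_on_continuous[OF testsD(1)[OF \<phi> c(1)]] chart_cont[OF ch]])
       (rule image_subsetI, rule chart_in[OF ch])
  then have "continuous_on (cdom c) \<phi>"
    by (rule continuous_on_eq) (simp add: chart_inv[OF ch])
  then show "isCont \<phi> p" using chart_open_dom[OF ch] c(2) continuous_on_eq_continuous_at by blast
qed

section \<open>Linear combinations of tensor-valued distributions\<close>

lemma chart_distribution_linear:
  assumes "chart_distribution A c u" "\<phi> \<in> tests A (cdom c)" "\<psi> \<in> tests A (cdom c)"
  shows "u (\<lambda>p. a * \<phi> p + b * \<psi> p) = a * u \<phi> + b * u \<psi>"
  using assms(1)[unfolded chart_distribution_def, THEN conjunct1, rule_format, OF assms(2,3)] .

lemma chart_distribution_zero: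
  assumes "chart_distribution A c u" "(\<lambda>_. 0) \<in> tests A (cdom c)"
  shows "u (\<lambda>_. 0) = 0"
proof -
  have "u (\<lambda>p. 0 * 0 + 0 * 0) = 0 * u (\<lambda>_. 0) + 0 * u (\<lambda>_. 0)"
    by (rule chart_distribution_linear[OF assms(1,2,2)])
  then show ?thesis by simp
qed

lemma chart_distribution_lincomb:
  fixes A :: "('a::t2_space, 'n::finite) chart set"
  assumes A: "smooth_atlas A" and c: "c \<in> A" and u: "chart_distribution A c u" and v: "chart_distribution A c v"
  shows "chart_distribution A c (\<lambda>\<phi>. k * u \<phi> + l * v \<phi>)"
  unfolding chart_distribution_def
proof (intro conjI ballI allI impI)
  fix \<phi> \<psi> a b assume p: "\<phi> \<in> tests A (cdom c)" "\<psi> \<in> tests A (cdom c)"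
  show "k * u (\<lambda>p. a * \<phi> p + b * \<psi> p) + l * v (\<lambda>p. a * \<phi> p + b * \<psi> p) = a * (k * u \<phi> + l * v \<phi>) + b * (k * u \<psi> + l * v \<psi>)"
    unfolding chart_distribution_linear[OF u p] chart_distribution_linear[OF v p] by (simp add: algebra_simps)
next
  fix K assume K: "compact K \<and> K \<subseteq> cdom c"
  let ?s = "\<lambda>n \<phi>. \<Sum>is | length is \<le> n. SUP x\<in>cimg c. \<bar>pds is (\<lambda>x. \<phi> (cinv c x)) x\<bar>"
  obtain C n where C: "\<forall>\<phi>\<in>tests A K. \<bar>u \<phi>\<bar> \<le> C * ?s n \<phi>" using u K unfolding chart_distribution_def by meson
  obtain D m where D: "\<forall>\<phi>\<in>tests A K. \<bar>v \<phi>\<bar> \<le> D * ?s m \<phi>" using v K unfolding chart_distribution_def by meson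
  show "\<exists>C n. \<forall>\<phi>\<in>tests A K. \<bar>k * u \<phi> + l * v \<phi>\<bar> \<le> C * ?s n \<phi>"
  proof (cases "cimg c = {}")
    case True
    then have "K = {}" using K by (simp add: cimg_def)
    then have "\<phi> = (\<lambda>_. 0)" if "\<phi> \<in> tests A K" for \<phi> using that tests_empty by blast
    then have "k * u \<phi> + l * v \<phi> = 0" if "\<phi> \<in> tests A K" for \<phi>
      using that chart_distribution_zero[OF u zero_test] chart_distribution_zero[OF v zero_test] by simp
    then show ?thesis by (intro exI[of _ 0]) simp
  next
    case False
    then obtain x0 where x0: "x0 \<in> cimg c" by blast
    let ?f = "\<lambda>is \<phi>. SUP x\<in>cimg c. \<bar>pds is (\<lambda>x. \<phi> (cinv c x)) x\<bar>"
    \<comment> \<open>The constants of the two estimates may be negative, hence the absolute values;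
      the seminorm sum of the larger order dominates both.\<close>
    have "\<bar>k * u \<phi> + l * v \<phi>\<bar> \<le> (\<bar>k\<bar> * \<bar>C\<bar> + \<bar>l\<bar> * \<bar>D\<bar>) * ?s (max n m) \<phi>" if \<phi>: "\<phi> \<in> tests A K" for \<phi>
    proof -
      have p: "\<phi> \<in> tests A (cdom c)" by (rule tests_mono[OF \<phi>]) (use K in simp)
      have f0: "0 \<le> ?f is \<phi>" for "is"
        using tests_seminorm_term[OF A c p x0, of "is"] by linarith
      have fin: "finite {is :: 'n list. length is \<le> n}" for n using finite_lists_length_le[of "UNIV :: 'n set" n] by simp
      have s0: "0 \<le> ?s n \<phi>" for n by (rule sum_nonneg) (rule f0)
      have mono: "?s i \<phi> \<le> ?s (max n m) \<phi>" if "i \<le> max n m" for i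
        by (rule sum_mono2[OF fin]) (use that f0 in auto)
      have 1: "\<bar>u \<phi>\<bar> \<le> \<bar>C\<bar> * ?s (max n m) \<phi>"
      proof -
        have "\<bar>u \<phi>\<bar> \<le> C * ?s n \<phi>" using C \<phi> by blast
        also have "\<dots> \<le> \<bar>C\<bar> * ?s (max n m) \<phi>" using s0 mono[of n] by (intro mult_mono) auto
        finally show ?thesis .
      qed
      have 2: "\<bar>v \<phi>\<bar> \<le> \<bar>D\<bar> * ?s (max n m) \<phi>"
      proof -
        have "\<bar>v \<phi>\<bar> \<le> D * ?s m \<phi>" using D \<phi> by blast
        also have "\<dots> \<le> \<bar>D\<bar> * ?s (max n m) \<phi>" using s0 mono[of m] by (intro mult_mono) auto
        finally show ?thesis .
      qed
      have "\<bar>k * u \<phi> + l * v \<phi>\<bar> \<le> \<bar>k\<bar> * \<bar>u \<phi>\<bar> + \<bar>l\<bar> * \<bar>v \<phi>\<bar>" by (metis abs_mult abs_triangle_ineq)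
      also have "\<dots> \<le> \<bar>k\<bar> * (\<bar>C\<bar> * ?s (max n m) \<phi>) + \<bar>l\<bar> * (\<bar>D\<bar> * ?s (max n m) \<phi>)"
        by (intro add_mono mult_left_mono 1 2) auto
      finally show ?thesis by (simp add: algebra_simps)
    qed
    then show ?thesis by blast
  qed
qed

lemma tensor_distribution_lincomb:
  fixes A :: "('a::t2_space, 'n::finite) chart set"
  assumes A: "smooth_atlas A" and S: "tensor_distribution A S" and T: "tensor_distribution A T"
  shows "tensor_distribution A (\<lambda>c \<mu> \<nu> \<phi>. k * S c \<mu> \<nu> \<phi> + l * T c \<mu> \<nu> \<phi>)"
  unfolding tensor_distribution_def
proof (rule conjI; intro ballI allI)
  show "chart_distribution A c (\<lambda>\<phi>. k * S c \<mu> \<nu> \<phi> + l * T c \<mu> \<nu> \<phi>)" if c: "c \<in> A" for c \<mu> \<nu>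
    by (rule chart_distribution_lincomb[OF A c]) (use S T c in \<open>simp_all add: tensor_distribution_def\<close>)
  fix c c' \<phi> \<mu> \<nu> assume c: "c \<in> A" "c' \<in> A" and \<phi>: "\<phi> \<in> tests A (cdom c \<inter> cdom c')"
  let ?t = "\<lambda>\<alpha> \<beta> p. jac c c' p $ \<alpha> $ \<mu> * jac c c' p $ \<beta> $ \<nu> * \<phi> p"
  have "S c \<mu> \<nu> \<phi> = (\<Sum>\<alpha>\<in>UNIV. \<Sum>\<beta>\<in>UNIV. S c' \<alpha> \<beta> (?t \<alpha> \<beta>))" using S c \<phi> unfolding tensor_distribution_def by blast
  moreover have "T c \<mu> \<nu> \<phi> = (\<Sum>\<alpha>\<in>UNIV. \<Sum>\<beta>\<in>UNIV. T c' \<alpha> \<beta> (?t \<alpha> \<beta>))" using T c \<phi> unfolding tensor_distribution_def by blast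
  ultimately show "k * S c \<mu> \<nu> \<phi> + l * T c \<mu> \<nu> \<phi> = (\<Sum>\<alpha>\<in>UNIV. \<Sum>\<beta>\<in>UNIV. k * S c' \<alpha> \<beta> (?t \<alpha> \<beta>) + l * T c' \<alpha> \<beta> (?t \<alpha> \<beta>))"
    by (simp add: sum.distrib sum_distrib_left)
qed

section \<open>Bounds on the components of the tangential source\<close>

lemma inner_matrix_transpose:
  fixes M :: "real^'n::finite^'m::finite" shows "(M *v a) \<bullet> b = a \<bullet> (transpose M *v b)"
  by (metis dot_lmul_matrix inner_commute transpose_matrix_vector)

text \<open>A tangential tensor sees only the tangential parts of its arguments, and the tangential part of
  a coordinate vector depends continuously on the point.\<close>

lemma tangential_component:
  fixes E :: "real^3^4" and G T :: "real^4^4" and M :: "real^3^3"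
  assumes M: "M = transpose E ** G ** E" and d: "det M \<noteq> 0" and G: "transpose G = G"
    and tan: "\<And>n. (\<And>w. bform G n (E *v w) = 0) \<Longrightarrow> T *v n = 0 \<and> n v* T = 0"
    and w: "\<And>\<mu>. w \<mu> = matrix_inv M *v (transpose E *v (G *v axis \<mu> 1))"
  shows "T $ \<mu> $ \<nu> = bform T (E *v w \<mu>) (E *v w \<nu>)"
proof -
  \<comment> \<open>The normal part of the coordinate vector: \<open>w \<mu>\<close> solves M w =
    E^T G e_\<mu>, so E w is its G-orthogonal projection to the tangent space.\<close>
  define n where "n \<mu> = axis \<mu> 1 - E *v w \<mu>" for \<mu> :: 4
  have Mt: "transpose M = M" unfolding M using G by (simp add: matrix_transpose_mul matrix_mul_assoc)
  have "bform G (n \<mu>) (E *v v) = 0" for \<mu> v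
  proof -
    have "(E *v w \<mu>) \<bullet> (G *v (E *v v)) = w \<mu> \<bullet> (M *v v)"
      unfolding inner_matrix_transpose M by (simp add: matrix_vector_mul_assoc matrix_mul_assoc)
    also have "\<dots> = (M *v w \<mu>) \<bullet> v" unfolding inner_matrix_transpose Mt ..
    also have "M *v w \<mu> = transpose E *v (G *v axis \<mu> 1)"
      unfolding w by (simp add: matrix_vector_mul_assoc matrix_inv_mult(1)[OF d] matrix_mul_assoc)
    also have "(transpose E *v (G *v axis \<mu> 1)) \<bullet> v = axis \<mu> 1 \<bullet> (G *v (E *v v))"
      unfolding inner_matrix_transpose transpose_transpose G ..
    finally show ?thesis unfolding bform_def n_def by (simp add: inner_diff_left)
  qed
  then have n: "T *v n \<mu> = 0" "n \<mu> v* T = 0" for \<mu> using tan by blast+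
  have e: "axis \<mu> 1 = E *v w \<mu> + n \<mu>" for \<mu> by (simp add: n_def)
  have "T $ \<mu> $ \<nu> = axis \<mu> 1 \<bullet> (T *v axis \<nu> 1)" by (simp add: matrix_vector_mult_basis column_def inner_axis')
  also have "\<dots> = (E *v w \<mu> + n \<mu>) \<bullet> (T *v (E *v w \<nu>))"
    unfolding e[of \<nu>] matrix_vector_right_distrib n(1) e[symmetric, of \<mu>] by simp
  also have "\<dots> = bform T (E *v w \<mu>) (E *v w \<nu>)"
    unfolding inner_add_left dot_lmul_matrix[symmetric, of "n \<mu>"] n(2) bform_def by simp
  finally show ?thesis .
qed

locale jump_metric_source = jump_metric +
  fixes \<tau> :: "('a, 4) chart \<Rightarrow> 'a \<Rightarrow> real^4^4"
  assumes \<tau>: "cov2_tensor_field A (range X) \<tau>" and tan: "tangential A B g X \<tau>"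
    and nondeg: "induced_metric_nondegenerate A B g X" and Linf: "Linfty_tensor A B g X \<tau>"
begin

text \<open>Coordinates in d of the tangential part of the coordinate vector with index \<mu>;
  nondegeneracy of the induced metric makes the inverse a genuine one.\<close>

definition w where
  "w c d \<mu> y = matrix_inv (h d y) *v (transpose (dmap X c d y) *v (g c (X y) *v axis \<mu> 1))"

lemma \<tau>_component:
  assumes c: "c \<in> A" "X y \<in> cdom c" and d: "d \<in> B" "y \<in> cdom d"
  shows "\<tau> c (X y) $ \<mu> $ \<nu> = bform (\<tau> c (X y)) (dmap X c d y *v w c d \<mu> y) (dmap X c d y *v w c d \<nu> y)"
proof (rule tangential_component[OF induced_metric_eq[OF c d]])
  show "det (h d y) \<noteq> 0" using nondeg d unfolding induced_metric_nondegenerate_def by blast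
  have "lorentzian (g c (X y))" using g c unfolding lorentzian_metric_def by blast
  then show "transpose (g c (X y)) = g c (X y)" by (rule lorentzian_symmetric)
  show "\<tau> c (X y) *v n = 0 \<and> n v* \<tau> c (X y) = 0" if "\<And>w. bform (g c (X y)) n (dmap X c d y *v w) = 0" for n
    using tan c d that unfolding tangential_def by blast
qed (simp add: w_def)

lemma w_continuous:
  assumes c: "c \<in> A" and d: "d \<in> B"
  shows "continuous_on (Q c d) (\<lambda>u. sqrt (bform (h d (cinv d u)) (w c d \<mu> (cinv d u)) (w c d \<mu> (cinv d u))))"
proof -
  note hc = h_continuous_Q[OF c d]
  have dt: "continuous_on (Q c d) (\<lambda>u. det (H u))" if "\<And>i j. continuous_on (Q c d) (\<lambda>u. H u $ i $ j)" for H :: "real^3 \<Rightarrow> real^3^3"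
    unfolding det_def by (intro continuous_intros that)
  have nz: "det (h d (cinv d u)) \<noteq> 0" if "u \<in> Q c d" for u
    using nondeg d Q_D(1)[OF d that] unfolding induced_metric_nondegenerate_def by blast
  have inv: "continuous_on (Q c d) (\<lambda>u. matrix_inv (h d (cinv d u)) $ i $ j)" for i j
  proof (rule continuous_on_eq)
    show "continuous_on (Q c d) (\<lambda>u. det (\<chi> k l. if l = i then axis j 1 $ k else h d (cinv d u) $ k $ l) / det (h d (cinv d u)))"
    proof (intro continuous_on_divide dt hc ballI nz)
      show "continuous_on (Q c d) (\<lambda>u. (\<chi> k l. if l = i then axis j 1 $ k else h d (cinv d u) $ k $ l) $ k $ l)" for k l
        by (cases "l = i") (simp_all add: hc)
    qed
  qed (simp add: matrix_inv_cramer[OF nz])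
  have wc: "continuous_on (Q c d) (\<lambda>u. w c d \<mu> (cinv d u) $ i)" for i
    unfolding w_def matrix_vector_mult_def transpose_def
    by (simp, intro continuous_intros inv dmap_continuous[OF c d] metric_continuous[OF c d])
  have "continuous_on (Q c d) (\<lambda>u. bform (h d (cinv d u)) (w c d \<mu> (cinv d u)) (w c d \<mu> (cinv d u)))"
    unfolding bform_def inner_vec_def matrix_vector_mult_def
    by (simp, intro continuous_intros wc hc)
  then show ?thesis by (rule continuous_on_real_sqrt)
qed

text \<open>The essential bound concerns tangent vectors measured by h. Expressing the components
  through tangential parts reduces the claim to the h-lengths of these parts, which are continuous
  and hence bounded on a closed coordinate ball.\<close>

lemma \<tau>_locally_bounded:
  assumes c: "c \<in> A" "X y0 \<in> cdom c"
  shows "\<exists>U C. open U \<and> y0 \<in> U \<and> (AE y in V. y \<in> U \<longrightarrow> (\<forall>\<mu> \<nu>. \<bar>\<tau> c (X y) $ \<mu> $ \<nu>\<bar> \<le> C))"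
proof -
  obtain d where d: "d \<in> B" "y0 \<in> cdom d" using atlas_cover[OF B] by blast
  note dh = chB[OF d(1)]
  have "crd d y0 \<in> Q c d" unfolding Q_def using d c by blast
  then obtain r where r: "r > 0" "cball (crd d y0) r \<subseteq> Q c d" using Q_open[OF c(1) d(1)] open_contains_cball by blast
  let ?b = "ball (crd d y0) r" and ?c = "cball (crd d y0) r"
  let ?q = "\<lambda>\<mu> y. sqrt (bform (h d y) (w c d \<mu> y) (w c d \<mu> y))"
  have "\<forall>\<mu>. \<exists>R. \<forall>u\<in>?c. \<bar>?q \<mu> (cinv d u)\<bar> \<le> R"
  proof
    fix \<mu>
    have "compact ((\<lambda>u. ?q \<mu> (cinv d u)) ` ?c)"
      by (rule compact_continuous_image[OF continuous_on_subset[OF w_continuous[OF c(1) d(1)] r(2)] compact_cball])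
    from compact_imp_bounded[OF this] show "\<exists>R. \<forall>u\<in>?c. \<bar>?q \<mu> (cinv d u)\<bar> \<le> R"
      by (simp only: bounded_real ball_simps)
  qed
  from choice[OF this] obtain R where R0: "\<forall>\<mu>. \<forall>u\<in>?c. \<bar>?q \<mu> (cinv d u)\<bar> \<le> R \<mu>" by (rule exE)
  have R: "\<bar>?q \<mu> (cinv d u)\<bar> \<le> R \<mu>" if "u \<in> ?c" for \<mu> u by (rule R0[rule_format, OF that])
  define S where "S = (\<Sum>\<mu>\<in>UNIV. \<bar>R \<mu>\<bar>)"
  have S: "\<bar>?q \<mu> (cinv d u)\<bar> \<le> S" if "u \<in> ?c" for \<mu> u
    using R[OF that, of \<mu>] member_le_sum[of \<mu> UNIV "\<lambda>\<mu>. \<bar>R \<mu>\<bar>"] by (auto simp: S_def)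
  have bs: "?b \<subseteq> Q c d" using r(2) ball_subset_cball by blast
  have o: "open (cinv d ` ?b)" by (rule chart_open_image'[OF dh open_ball]) (use bs Q_sub[OF d(1)] in blast)
  obtain C where C: "AE y in V. y \<in> cdom d \<inter> X -` cdom c \<longrightarrow>
        (\<forall>u v. \<bar>bform (\<tau> c (X y)) (dmap X c d y *v u) (dmap X c d y *v v)\<bar>
           \<le> C * sqrt (bform (h d y) u u) * sqrt (bform (h d y) v v))"
    using Linf c(1) d(1) unfolding Linfty_tensor_def by blast
  from C have "AE y in V. y \<in> cinv d ` ?b \<longrightarrow> (\<forall>\<mu> \<nu>. \<bar>\<tau> c (X y) $ \<mu> $ \<nu>\<bar> \<le> \<bar>C\<bar> * S * S)"
  proof eventually_elim
    fix y
    assume y: "y \<in> cdom d \<inter> X -` cdom c \<longrightarrow>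
        (\<forall>u v. \<bar>bform (\<tau> c (X y)) (dmap X c d y *v u) (dmap X c d y *v v)\<bar>
           \<le> C * sqrt (bform (h d y) u u) * sqrt (bform (h d y) v v))"
    show "y \<in> cinv d ` ?b \<longrightarrow> (\<forall>\<mu> \<nu>. \<bar>\<tau> c (X y) $ \<mu> $ \<nu>\<bar> \<le> \<bar>C\<bar> * S * S)"
    proof (intro impI allI)
      fix \<mu> \<nu> assume "y \<in> cinv d ` ?b"
      then obtain u where u: "u \<in> ?b" "y = cinv d u" by blast
      have uQ: "u \<in> Q c d" using u(1) bs by blast
      have yd: "y \<in> cdom d" "X y \<in> cdom c" using Q_D[OF d(1) uQ] u(2) by auto
      have q: "\<bar>?q \<mu> y\<bar> \<le> S" for \<mu> using S[of u \<mu>] u by simp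
      have "\<bar>\<tau> c (X y) $ \<mu> $ \<nu>\<bar> \<le> C * ?q \<mu> y * ?q \<nu> y"
        unfolding \<tau>_component[OF c(1) yd(2) d(1) yd(1)] using y yd by blast
      also have "\<dots> \<le> \<bar>C * ?q \<mu> y * ?q \<nu> y\<bar>" by (rule abs_ge_self)
      also have "\<dots> = \<bar>C\<bar> * \<bar>?q \<mu> y\<bar> * \<bar>?q \<nu> y\<bar>" by (simp only: abs_mult)
      also have "\<dots> \<le> \<bar>C\<bar> * S * S" using q[of \<mu>] q[of \<nu>] by (intro mult_mono) auto
      finally show "\<bar>\<tau> c (X y) $ \<mu> $ \<nu>\<bar> \<le> \<bar>C\<bar> * S * S" .
    qed
  qed
  moreover have "y0 \<in> cinv d ` ?b" using r(1) chart_inv[OF dh d(2)] by (metis centre_in_ball imageI)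
  ultimately show ?thesis using o by blast
qed

lemma \<tau>_bounded_compact:
  assumes c: "c \<in> A" and K: "compact K" "K \<subseteq> X -` cdom c"
  shows "\<exists>C\<ge>0. AE y in V. y \<in> K \<longrightarrow> (\<forall>\<mu> \<nu>. \<bar>\<tau> c (X y) $ \<mu> $ \<nu>\<bar> \<le> C)"
proof -
  have "\<forall>y\<in>K. \<exists>U C. open U \<and> y \<in> U \<and> (AE z in V. z \<in> U \<longrightarrow> (\<forall>\<mu> \<nu>. \<bar>\<tau> c (X z) $ \<mu> $ \<nu>\<bar> \<le> C))"
    by (rule ballI, rule \<tau>_locally_bounded[OF c]) (use K(2) in auto)
  from bchoice[OF this] obtain U where "\<forall>y\<in>K. \<exists>C. open (U y) \<and> y \<in> U y \<and> (AE z in V. z \<in> U y \<longrightarrow> (\<forall>\<mu> \<nu>. \<bar>\<tau> c (X z) $ \<mu> $ \<nu>\<bar> \<le> C))" by (rule exE)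
  from bchoice[OF this] obtain C where UC: "\<forall>y\<in>K. open (U y) \<and> y \<in> U y \<and> (AE z in V. z \<in> U y \<longrightarrow> (\<forall>\<mu> \<nu>. \<bar>\<tau> c (X z) $ \<mu> $ \<nu>\<bar> \<le> C y))" by (rule exE)
  note U = UC[THEN bspec, THEN conjunct1] UC[THEN bspec, THEN conjunct2, THEN conjunct1] UC[THEN bspec, THEN conjunct2, THEN conjunct2]
  obtain F where F: "F \<subseteq> K" "finite F" "K \<subseteq> (\<Union>y\<in>F. U y)"
    by (rule compactE_image[OF K(1), of K U]) (use U(1,2) in auto)
  have "AE z in V. \<forall>y\<in>F. z \<in> U y \<longrightarrow> (\<forall>\<mu> \<nu>. \<bar>\<tau> c (X z) $ \<mu> $ \<nu>\<bar> \<le> C y)"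
    by (rule AE_finite_allI[OF F(2)]) (use U(3) F(1) in blast)
  then have "AE z in V. z \<in> K \<longrightarrow> (\<forall>\<mu> \<nu>. \<bar>\<tau> c (X z) $ \<mu> $ \<nu>\<bar> \<le> (\<Sum>y\<in>F. \<bar>C y\<bar>))"
  proof eventually_elim
    fix z assume z: "\<forall>y\<in>F. z \<in> U y \<longrightarrow> (\<forall>\<mu> \<nu>. \<bar>\<tau> c (X z) $ \<mu> $ \<nu>\<bar> \<le> C y)"
    show "z \<in> K \<longrightarrow> (\<forall>\<mu> \<nu>. \<bar>\<tau> c (X z) $ \<mu> $ \<nu>\<bar> \<le> (\<Sum>y\<in>F. \<bar>C y\<bar>))"
    proof (intro impI allI)
      fix \<mu> \<nu> assume "z \<in> K"
      then obtain y where y: "y \<in> F" "z \<in> U y" using F(3) by blast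
      have "\<bar>\<tau> c (X z) $ \<mu> $ \<nu>\<bar> \<le> C y" using z y by blast
      also have "\<dots> \<le> (\<Sum>y\<in>F. \<bar>C y\<bar>)" using member_le_sum[of y F "\<lambda>y. \<bar>C y\<bar>"] y(1) F(2) by auto
      finally show "\<bar>\<tau> c (X z) $ \<mu> $ \<nu>\<bar> \<le> (\<Sum>y\<in>F. \<bar>C y\<bar>)" .
    qed
  qed
  then show ?thesis by (intro exI[of _ "\<Sum>y\<in>F. \<bar>C y\<bar>"]) (simp add: sum_nonneg)
qed

text \<open>The pairing is of order zero: the constant is an essential bound for \<tau> on K times
  the volume of K, which is finite.\<close>

lemma \<tau>_pairing:
  assumes c: "c \<in> A" and K: "compact K" "K \<subseteq> X -` cdom c"
  shows "\<exists>D\<ge>0. \<forall>f S. f \<in> borel_measurable borel \<longrightarrow> (\<forall>y. \<bar>f y\<bar> \<le> S * indicator K y) \<longrightarrow> S \<ge> 0 \<longrightarrow>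
     integrable V (\<lambda>y. \<tau> c (X y) $ \<mu> $ \<nu> * f y) \<and> \<bar>LINT y|V. \<tau> c (X y) $ \<mu> $ \<nu> * f y\<bar> \<le> D * S"
proof -
  obtain C where C: "C \<ge> 0" "AE y in V. y \<in> K \<longrightarrow> (\<forall>\<mu> \<nu>. \<bar>\<tau> c (X y) $ \<mu> $ \<nu>\<bar> \<le> C)"
    using \<tau>_bounded_compact[OF c K] by blast
  have KV: "K \<in> sets V" using K(1) sets_V by (simp add: borel_compact)
  have Ki: "integrable V (\<lambda>y. indicator K y :: real)"
    using KV V_compact_finite[OF K(1)] by simp
  have "integrable V (\<lambda>y. \<tau> c (X y) $ \<mu> $ \<nu> * f y) \<and> \<bar>LINT y|V. \<tau> c (X y) $ \<mu> $ \<nu> * f y\<bar> \<le> (C * measure V K) * S"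
    if f: "f \<in> borel_measurable borel" "\<forall>y. \<bar>f y\<bar> \<le> S * indicator K y" "S \<ge> 0" for f S
  proof -
    have "set_borel_measurable borel (X -` cdom c) (\<lambda>y. \<tau> c (X y) $ \<mu> $ \<nu>)"
      using Linf c unfolding Linfty_tensor_def by blast
    then have "(\<lambda>y. (indicator (X -` cdom c) y *\<^sub>R \<tau> c (X y) $ \<mu> $ \<nu>) * f y) \<in> borel_measurable borel"
      unfolding set_borel_measurable_def using f(1) by (rule borel_measurable_times)
    \<comment> \<open>Measurability of \<tau> is known where X meets the chart; elsewhere the factor
      f vanishes.\<close>
    moreover have "(\<lambda>y. (indicator (X -` cdom c) y *\<^sub>R \<tau> c (X y) $ \<mu> $ \<nu>) * f y) = (\<lambda>y. \<tau> c (X y) $ \<mu> $ \<nu> * f y)"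
    proof
      fix y show "(indicator (X -` cdom c) y *\<^sub>R \<tau> c (X y) $ \<mu> $ \<nu>) * f y = \<tau> c (X y) $ \<mu> $ \<nu> * f y"
      proof (cases "y \<in> K")
        case True
        then have "y \<in> X -` cdom c" using K(2) by blast
        then show ?thesis by simp
      next
        case False
        then have "f y = 0" using f(2)[rule_format, of y] by simp
        then show ?thesis by simp
      qed
    qed
    ultimately have m: "(\<lambda>y. \<tau> c (X y) $ \<mu> $ \<nu> * f y) \<in> borel_measurable V"
      unfolding measurable_cong_sets[OF sets_V refl] by simp
    have b: "AE y in V. norm (\<tau> c (X y) $ \<mu> $ \<nu> * f y) \<le> (C * S) * indicator K y"
      using C(2)
    proof eventually_elim
      fix y assume y: "y \<in> K \<longrightarrow> (\<forall>\<mu> \<nu>. \<bar>\<tau> c (X y) $ \<mu> $ \<nu>\<bar> \<le> C)"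
      show "norm (\<tau> c (X y) $ \<mu> $ \<nu> * f y) \<le> (C * S) * indicator K y"
        using y f(2)[rule_format, of y] f(3) C(1) by (cases "y \<in> K") (auto simp: abs_mult intro!: mult_mono)
    qed
    have i: "integrable V (\<lambda>y. \<tau> c (X y) $ \<mu> $ \<nu> * f y)"
    proof (rule Bochner_Integration.integrable_bound[OF integrable_mult_right[OF Ki, of "C * S"] m])
      show "AE y in V. norm (\<tau> c (X y) $ \<mu> $ \<nu> * f y) \<le> norm (C * S * indicator K y)"
        using b by eventually_elim (use C(1) f(3) in simp)
    qed
    have "\<bar>LINT y|V. \<tau> c (X y) $ \<mu> $ \<nu> * f y\<bar> \<le> (LINT y|V. (C * S) * indicator K y)"
      unfolding real_norm_def[symmetric]
    proof (rule order_trans[OF integral_norm_bound integral_mono_AE'[OF _ b]])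
      show "integrable V (\<lambda>y. C * S * indicator K y)" by (rule integrable_mult_right[OF Ki])
      show "AE y in V. 0 \<le> C * S * indicator K y" using C(1) f(3) by (intro AE_I2 mult_nonneg_nonneg) auto
    qed
    also have "\<dots> = (C * measure V K) * S" using KV by (simp add: space_V mult_ac)
    finally show ?thesis using i by blast
  qed
  then show ?thesis using C(1) by (intro exI[of _ "C * measure V K"]) simp
qed

text \<open>The embedding is proper because its image is closed; compact supports on the manifold
  pull back to compact sets.\<close>

lemma compact_vimage_X:
  assumes L: "compact L" shows "compact (X -` L)"
proof -
  have hX: "homeomorphism UNIV (range X) X (inv X)" and cl: "closed (range X)" using X by (simp_all add: embedded_hypersurface_def)
  have XI: "\<And>y. inv X (X y) = y" and c: "continuous_on (range X) (inv X)" using hX by (simp_all add: homeomorphism_def)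
  have "X -` L = inv X ` (L \<inter> range X)"
  proof (intro subset_antisym subsetI)
    fix y assume "y \<in> X -` L"
    then have "X y \<in> L \<inter> range X" by simp
    then have "inv X (X y) \<in> inv X ` (L \<inter> range X)" by (rule imageI)
    then show "y \<in> inv X ` (L \<inter> range X)" unfolding XI .
  qed (auto simp: XI)
  moreover have "compact (L \<inter> range X)" using L cl by (rule compact_Int_closed)
  ultimately show ?thesis using compact_continuous_image[OF continuous_on_subset[OF c Int_lower2]] by simp
qed

section \<open>The Dirac term as a tensor-valued distribution\<close>

lemma test_on_hypersurface:
  assumes \<phi>: "\<phi> \<in> tests A U"
  shows "(\<lambda>y. \<phi> (X y)) \<in> borel_measurable borel"
    and "(\<And>p. p \<in> U \<Longrightarrow> \<bar>\<phi> p\<bar> \<le> S) \<Longrightarrow> \<bar>\<phi> (X y)\<bar> \<le> S * indicator (X -` supp \<phi>) y"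
proof -
  show "(\<lambda>y. \<phi> (X y)) \<in> borel_measurable borel"
    by (rule borel_measurable_continuous_onI) (rule continuous_on_compose2[OF tests_continuous[OF A \<phi>] X_continuous subset_UNIV])
  show "\<bar>\<phi> (X y)\<bar> \<le> S * indicator (X -` supp \<phi>) y" if "\<And>p. p \<in> U \<Longrightarrow> \<bar>\<phi> p\<bar> \<le> S"
  proof (cases "X y \<in> supp \<phi>")
    case True
    then show ?thesis using that[of "X y"] testsD(3)[OF \<phi>] by auto
  qed (simp add: notin_supp)
qed

lemma test_bounded:
  assumes \<phi>: "\<phi> \<in> tests A U" obtains S where "S \<ge> 0" "\<And>p. \<bar>\<phi> p\<bar> \<le> S"
proof -
  have "compact (\<phi> ` supp \<phi>)"
    by (rule compact_continuous_image[OF continuous_on_subset[OF tests_continuous[OF A \<phi>] subset_UNIV] testsD(2)[OF \<phi>]])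
  then obtain S where S: "\<And>p. p \<in> supp \<phi> \<Longrightarrow> \<bar>\<phi> p\<bar> \<le> S" by (metis bounded_real compact_imp_bounded imageI)
  have "\<bar>\<phi> p\<bar> \<le> max S 0" for p using S[of p] notin_supp[of p \<phi>] by (cases "p \<in> supp \<phi>") auto
  then show ?thesis using that[of "max S 0"] by simp
qed

lemma delta_integrable:
  assumes c: "c \<in> A" and \<phi>: "\<phi> \<in> tests A (cdom c)"
  shows "integrable V (\<lambda>y. \<tau> c (X y) $ \<mu> $ \<nu> * \<phi> (X y))"
proof -
  have K: "compact (X -` supp \<phi>)" "X -` supp \<phi> \<subseteq> X -` cdom c"
    using compact_vimage_X[OF testsD(2)[OF \<phi>]] testsD(3)[OF \<phi>] by auto
  obtain S where S: "S \<ge> 0" "\<And>p. \<bar>\<phi> p\<bar> \<le> S" using test_bounded[OF \<phi>] by blast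
  show ?thesis using \<tau>_pairing[OF c K, of \<mu> \<nu>] test_on_hypersurface[OF \<phi>] S by blast
qed

lemma delta_tensor_eq: "delta_tensor A B g X \<tau> c \<mu> \<nu> \<phi> = (LINT y|V. \<tau> c (X y) $ \<mu> $ \<nu> * \<phi> (X y))"
  by (simp add: delta_tensor_def mult_dist_def delta_dist_def)

text \<open>Integration against a locally finite measure with a locally essentially bounded
  coefficient: the estimate involves the supremum of the test function and no derivatives.\<close>

lemma delta_chart_distribution:
  assumes c: "c \<in> A" shows "chart_distribution A c (delta_tensor A B g X \<tau> c \<mu> \<nu>)"
  unfolding chart_distribution_def
proof (intro conjI ballI allI impI)
  fix \<phi> \<psi> a b assume p: "\<phi> \<in> tests A (cdom c)" "\<psi> \<in> tests A (cdom c)"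
  note i = delta_integrable[OF c p(1), of \<mu> \<nu>] delta_integrable[OF c p(2), of \<mu> \<nu>]
  have "(LINT y|V. \<tau> c (X y) $ \<mu> $ \<nu> * (a * \<phi> (X y) + b * \<psi> (X y)))
    = (LINT y|V. a * (\<tau> c (X y) $ \<mu> $ \<nu> * \<phi> (X y)) + b * (\<tau> c (X y) $ \<mu> $ \<nu> * \<psi> (X y)))"
    by (simp add: algebra_simps)
  also have "\<dots> = a * (LINT y|V. \<tau> c (X y) $ \<mu> $ \<nu> * \<phi> (X y)) + b * (LINT y|V. \<tau> c (X y) $ \<mu> $ \<nu> * \<psi> (X y))"
    using i by simp
  finally show "delta_tensor A B g X \<tau> c \<mu> \<nu> (\<lambda>p. a * \<phi> p + b * \<psi> p) = a * delta_tensor A B g X \<tau> c \<mu> \<nu> \<phi> + b * delta_tensor A B g X \<tau> c \<mu> \<nu> \<psi>"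
    unfolding delta_tensor_eq .
next
  fix L assume L: "compact L \<and> L \<subseteq> cdom c"
  have K: "compact (X -` L)" "X -` L \<subseteq> X -` cdom c" using compact_vimage_X L by auto
  obtain D where D: "D \<ge> 0" "\<forall>f S. f \<in> borel_measurable borel \<longrightarrow> (\<forall>y. \<bar>f y\<bar> \<le> S * indicator (X -` L) y) \<longrightarrow> S \<ge> 0 \<longrightarrow>
     integrable V (\<lambda>y. \<tau> c (X y) $ \<mu> $ \<nu> * f y) \<and> \<bar>LINT y|V. \<tau> c (X y) $ \<mu> $ \<nu> * f y\<bar> \<le> D * S"
    using \<tau>_pairing[OF c K] by blast
  show "\<exists>C n. \<forall>\<phi>\<in>tests A L. \<bar>delta_tensor A B g X \<tau> c \<mu> \<nu> \<phi>\<bar> \<le> C * (\<Sum>is | length is \<le> n. SUP x\<in>cimg c. \<bar>pds is (\<lambda>x. \<phi> (cinv c x)) x\<bar>)"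
  proof (cases "cimg c = {}")
    case True
    then have "L = {}" using L by (simp add: cimg_def)
    then have z: "\<phi> = (\<lambda>_. 0)" if "\<phi> \<in> tests A L" for \<phi> using that tests_empty by blast
    have "delta_tensor A B g X \<tau> c \<mu> \<nu> \<phi> = 0" if "\<phi> \<in> tests A L" for \<phi>
      unfolding delta_tensor_eq by (subst z[OF that]) simp
    then show ?thesis by (intro exI[of _ 0]) simp
  next
    case False
    then obtain x0 where x0: "x0 \<in> cimg c" by blast
    have "\<bar>delta_tensor A B g X \<tau> c \<mu> \<nu> \<phi>\<bar> \<le> D * (\<Sum>is | length is \<le> 0. SUP x\<in>cimg c. \<bar>pds is (\<lambda>x. \<phi> (cinv c x)) x\<bar>)"
      if \<phi>: "\<phi> \<in> tests A L" for \<phi>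
    proof -
      let ?S = "\<Sum>is | length is \<le> 0. SUP x\<in>cimg c. \<bar>pds is (\<lambda>x. \<phi> (cinv c x)) x\<bar>"
      have p: "\<phi> \<in> tests A (cdom c)" by (rule tests_mono[OF \<phi>]) (use L in simp)
      have s: "\<bar>\<phi> (cinv c x)\<bar> \<le> ?S" if "x \<in> cimg c" for x
        using tests_seminorm[OF A c p that, of "[]" 0] by simp
      have b: "\<bar>\<phi> p\<bar> \<le> ?S" if "p \<in> cdom c" for p
        using s[OF chart_in[OF chA[OF c] that]] by (simp add: chart_inv[OF chA[OF c] that])
      have S0: "0 \<le> ?S" using s[OF x0] by linarith
      have "\<bar>\<phi> (X y)\<bar> \<le> ?S * indicator (X -` L) y" for y
      proof -
        have "\<bar>\<phi> (X y)\<bar> \<le> ?S * indicator (X -` supp \<phi>) y" by (rule test_on_hypersurface(2)[OF p b])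
        also have "\<dots> \<le> ?S * indicator (X -` L) y"
          by (rule mult_left_mono[OF _ S0]) (use testsD(3)[OF \<phi>] in \<open>auto simp: indicator_def\<close>)
        finally show ?thesis .
      qed
      then show ?thesis unfolding delta_tensor_eq
        using D(2)[rule_format, of "\<lambda>y. \<phi> (X y)" ?S] test_on_hypersurface(1)[OF \<phi>] S0 by blast
    qed
    then show ?thesis by blast
  qed
qed

text \<open>The measure does not depend on a chart of the ambient manifold, so the law holds
  pointwise under the integral; off the overlap both sides vanish with \<phi>.\<close>

lemma delta_transform:
  assumes c: "c \<in> A" "c' \<in> A" and \<phi>: "\<phi> \<in> tests A (cdom c \<inter> cdom c')"
  shows "delta_tensor A B g X \<tau> c \<mu> \<nu> \<phi> = (\<Sum>\<alpha>\<in>UNIV. \<Sum>\<beta>\<in>UNIV.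
     delta_tensor A B g X \<tau> c' \<alpha> \<beta> (\<lambda>p. jac c c' p $ \<alpha> $ \<mu> * jac c c' p $ \<beta> $ \<nu> * \<phi> p))"
proof -
  let ?t = "\<lambda>\<alpha> \<beta> p. jac c c' p $ \<alpha> $ \<mu> * jac c c' p $ \<beta> $ \<nu> * \<phi> p"
  have t: "?t \<alpha> \<beta> \<in> tests A (cdom c')" for \<alpha> \<beta>
    by (rule tests_mono[OF tests_jac[OF A c order_refl \<phi>]]) simp
  note i = delta_integrable[OF c(2) t]
  have e: "\<tau> c (X y) $ \<mu> $ \<nu> * \<phi> (X y) = (\<Sum>\<alpha>\<in>UNIV. \<Sum>\<beta>\<in>UNIV. \<tau> c' (X y) $ \<alpha> $ \<beta> * ?t \<alpha> \<beta> (X y))" for y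
  proof (cases "X y \<in> cdom c \<inter> cdom c'")
    case True
    have "\<tau> c (X y) = transpose (jac c c' (X y)) ** \<tau> c' (X y) ** jac c c' (X y)"
      using \<tau> c True unfolding cov2_tensor_field_def by blast
    then have "\<tau> c (X y) $ \<mu> $ \<nu> = (\<Sum>\<beta>\<in>UNIV. \<Sum>\<alpha>\<in>UNIV. jac c c' (X y) $ \<alpha> $ \<mu> * \<tau> c' (X y) $ \<alpha> $ \<beta> * jac c c' (X y) $ \<beta> $ \<nu>)"
      by (simp add: matrix_matrix_mult_def transpose_def sum_distrib_right)
    also have "\<dots> = (\<Sum>\<alpha>\<in>UNIV. \<Sum>\<beta>\<in>UNIV. jac c c' (X y) $ \<alpha> $ \<mu> * \<tau> c' (X y) $ \<alpha> $ \<beta> * jac c c' (X y) $ \<beta> $ \<nu>)" by (rule sum.swap)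
    finally have q: "\<tau> c (X y) $ \<mu> $ \<nu> = (\<Sum>\<alpha>\<in>UNIV. \<Sum>\<beta>\<in>UNIV. jac c c' (X y) $ \<alpha> $ \<mu> * \<tau> c' (X y) $ \<alpha> $ \<beta> * jac c c' (X y) $ \<beta> $ \<nu>)" .
    show ?thesis unfolding q sum_distrib_right by (simp add: mult_ac)
  next
    case False
    then have "X y \<notin> supp \<phi>" using testsD(3)[OF \<phi>] by blast
    then have "\<phi> (X y) = 0" by (rule notin_supp)
    then show ?thesis by simp
  qed
  show ?thesis unfolding delta_tensor_eq e
    by (subst Bochner_Integration.integral_sum) (auto intro!: sum.cong Bochner_Integration.integral_sum integrable_sum i simp del: sum_distrib_left)
qed

lemma delta_tensor_distribution: "tensor_distribution A (delta_tensor A B g X \<tau>)"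
  unfolding tensor_distribution_def using delta_chart_distribution delta_transform by simp

end

text \<open>Integrals and weak derivatives are total in HOL, so the opening clauses of the first two
  parts state that those involved really exist. Well-definedness of the equation means that both
  sides are tensor-valued distributions and that its validity on an open set does not depend on the
  chart whose components are tested.\<close>

theorem theorem2:
  fixes A :: "('a::{second_countable_topology, t2_space}, 4) chart set"
    and B :: "('b::{second_countable_topology, t2_space}, 3) chart set"
    and g :: "('a, 4) chart \<Rightarrow> 'a \<Rightarrow> real^4^4"
    and X :: "'b \<Rightarrow> 'a"
    and \<tau> :: "('a, 4) chart \<Rightarrow> 'a \<Rightarrow> real^4^4"
    and lam GN :: real
    and T :: "('a, 4) tensor_functional"
  assumes "smooth_atlas A" and "smooth_atlas B"
    and "lorentzian_metric A g"
    and "embedded_hypersurface A B X" and "spacelike A B g X"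
    and "cov2_tensor_field A (range X) \<tau>"
    and "\<forall>c\<in>A. \<forall>p \<in> range X \<inter> cdom c. transpose (\<tau> c p) = \<tau> c p"
    and "tangential A B g X \<tau>"
    and "tensor_distribution A T"
    and "metric_C0_C2_off A (range X) g"
    and "metric_derivs_locally_bounded_off A (range X) g"
    and "induced_metric_nondegenerate A B g X"
    and "Linfty_tensor A B g X \<tau>"
  shows
    "((\<forall>c\<in>A. \<forall>\<phi>\<in>tests A (cdom c).
        einstein_defined_on (cimg c) (metric_coords g c) (density_test g c \<phi>)) \<and>
      tensor_distribution A (einstein_tensor g)) \<and>
     ((\<forall>c\<in>A. \<forall>\<phi>\<in>tests A (cdom c). \<forall>\<mu> \<nu>.
        integrable (induced_volume A B g X) (\<lambda>y. \<tau> c (X y) $ \<mu> $ \<nu> * \<phi> (X y))) \<and>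
      tensor_distribution A (delta_tensor A B g X \<tau>)) \<and>
     (tensor_distribution A (field_lhs A B g X \<tau> lam) \<and> tensor_distribution A (field_rhs GN T) \<and>
      (\<forall>c\<in>A. \<forall>c'\<in>A. \<forall>W. open W \<and> W \<subseteq> cdom c \<inter> cdom c' \<longrightarrow>
        (weak_equation_on A (field_lhs A B g X \<tau> lam) (field_rhs GN T) c W \<longleftrightarrow>
         weak_equation_on A (field_lhs A B g X \<tau> lam) (field_rhs GN T) c' W)))"
proof -
  interpret jump_metric_source A B g X \<tau>
    by (intro jump_metric_source.intro jump_metric.intro jump_metric_source_axioms.intro assms)
  have L: "tensor_distribution A (field_lhs A B g X \<tau> lam)"
    using tensor_distribution_lincomb[OF assms(1) einstein_tensor_distribution delta_tensor_distribution, of 1 lam]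
    by (simp add: field_lhs_def[abs_def])
  \<comment> \<open>Scaling is a linear combination whose second coefficient is 0.\<close>
  have R: "tensor_distribution A (field_rhs GN T)"
    using tensor_distribution_lincomb[OF assms(1,9,9), of "8 * pi * GN" 0]
    by (simp add: field_rhs_def[abs_def])
  show ?thesis
  proof (intro conjI ballI allI impI iffI)
    fix c c' W assume c: "c \<in> A" "c' \<in> A" and W: "open W \<and> W \<subseteq> cdom c \<inter> cdom c'"
    show "weak_equation_on A (field_lhs A B g X \<tau> lam) (field_rhs GN T) c' W"
      if "weak_equation_on A (field_lhs A B g X \<tau> lam) (field_rhs GN T) c W"
      by (rule weak_equation_transfer[OF assms(1) L R c(2,1) _ that]) (use W in blast)
    show "weak_equation_on A (field_lhs A B g X \<tau> lam) (field_rhs GN T) c W"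
      if "weak_equation_on A (field_lhs A B g X \<tau> lam) (field_rhs GN T) c' W"
      by (rule weak_equation_transfer[OF assms(1) L R c _ that]) (use W in blast)
  qed (rule einstein_defined_density einstein_tensor_distribution delta_integrable delta_tensor_distribution L R; assumption)+
qed

end
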